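(* Let $M$ be $S^3$ or $H^3$. Let $\rho$ be a smooth real-valued function on $M$ (charge density), with average value zero if $M=S^3$ and with compact support if $M=H^3$. Let $V$ be a smooth vector field on $M$ (steady current), with compact support if $M=H^3$. Let $E=E(\rho)$ and $B=BS(V)$ be the associated electric and magnetic fields, and let $\partial E/\partial t$ be the rate of change of the electric field due to the accumulation of charge by $V$. Then Maxwell's equations hold on $M$: $$\nabla\bullet E=\rho,\qquad \nabla\times E=0,\qquad \nabla\bullet B=0,\qquad \nabla\times B=V+\partial E/\partial t .$$
   Context: $S^3$ is the unit 3-sphere (curvature $+1$), regarded as the group of unit quaternions, oriented so that $i,j,k$ is a positively oriented basis of the tangent space at $1$. $H^3$ is oriented hyperbolic 3-space of curvature $-1$. $\bullet$ and $\times$ are the inner and cross products on tangent spaces; $\nabla$, $\nabla\bullet$, $\nabla\times$ are gradient, divergence and curl; a subscript indicates the variable of differentiation. $\alpha=\alpha(x,y)$ is the distance, $\varphi(x,y)$ abbreviates $\varphi(\alpha(x,y))$, and $dx$ is the volume element in $x$. $L_{yx^{-1}}$ is the differential of left translation by $yx^{-1}$ on $S^3$; $P_{yx}$ is parallel transport from $x$ to $y$ along the shortest geodesic segment (on $S^3$ it is defined for $y\ne-x$). Let $\varphi_0$ be the fundamental solution of the scalar Laplacian: $\varphi_0(\alpha)=-\frac{1}{4\pi^2}(\pi-\alpha)\cot\alpha$ on $S^3$, $\varphi_0(\alpha)=-\frac{1}{4\pi}(\coth\alpha-1)$ on $H^3$. Electric field: $E(\rho)(y)=\nabla_y\int_M\rho(x)\,\varphi_0(x,y)\,dx$.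 Magnetic field $BS(V)$: given by any one of the following formulas. On $S^3$ (left translation), $$BS(V)(y)=\int_{S^3}L_{yx^{-1}}V(x)\times\nabla_y\varphi_0(x,y)\,dx-\frac{1}{4\pi^2}\int_{S^3}L_{yx^{-1}}V(x)\,dx+2\nabla_y\int_{S^3}L_{yx^{-1}}V(x)\bullet\nabla_y\varphi_1(x,y)\,dx,$$ with $\varphi_1(\alpha)=-\frac{1}{16\pi^2}\alpha(2\pi-\alpha)$; on $S^3$ (parallel transport), $BS(V)(y)=\int_{S^3}P_{yx}V(x)\times\nabla_y\varphi(x,y)\,dx$ with $\varphi(\alpha)=-\frac{1}{4\pi^2}(\pi-\alpha)\csc\alpha$; on $H^3$, $BS(V)(y)=\int_{H^3}P_{yx}V(x)\times\nabla_y\varphi(x,y)\,dx$ with $\varphi(\alpha)=-\frac{1}{4\pi}\operatorname{csch}\alpha$. Time derivative of $E$: the steady current $V$ accumulates charge at the rate $\partial\rho/\partial t=-\nabla\bullet V$, and accordingly $$\frac{\partial E}{\partial t}(y)=E(-\nabla\bullet V)(y)=-\nabla_y\int_M(\nabla_x\bullet V(x))\,\varphi_0(x,y)\,dx .$$ *)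

theory Defs
  imports "HOL-Analysis.Analysis"
begin

section \<open>The unit 3-sphere and hyperbolic 3-space in \<open>\<real>\<^sup>4\<close>\<close>

text \<open>
  \<open>S3\<close> is the unit sphere of Euclidean \<open>\<real>\<^sup>4\<close>, and \<open>H3\<close> is the upper sheet of the hyperboloid in
  \<open>\<real>\<^sup>4\<close> with the Lorentz form of signature \<open>(-,+,+,+)\<close>.  In both cases the Riemannian metric is the
  restriction of the ambient form to the tangent spaces.  Functions and vector fields on the
  manifold are total functions on \<open>\<real>\<^sup>4\<close> whose values off the manifold are irrelevant.
\<close>

datatype space_form = S3 | H3

text \<open>The sectional curvature, which is also the value of the ambient form on position vectors.\<close>

fun curv :: "space_form \<Rightarrow> real" where
  "curv S3 = 1"
| "curv H3 = -1"

definition form :: "space_form \<Rightarrow> real^4 \<Rightarrow> real^4 \<Rightarrow> real" where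
  "form M u v = curv M * (u $ 1 * v $ 1) + u $ 2 * v $ 2 + u $ 3 * v $ 3 + u $ 4 * v $ 4"

definition points :: "space_form \<Rightarrow> (real^4) set" where
  "points M = {x. form M x x = curv M \<and> (M = H3 \<longrightarrow> x $ 1 > 0)}"

definition tangent :: "space_form \<Rightarrow> real^4 \<Rightarrow> (real^4) set" where
  "tangent M x = {v. form M x v = 0}"

definition tproj :: "space_form \<Rightarrow> real^4 \<Rightarrow> real^4 \<Rightarrow> real^4" where
  "tproj M x v = v - (form M x v / form M x x) *\<^sub>R x"

text \<open>
  The volume form of the tangent space at \<open>y\<close> is \<open>det(y, u, v, w)\<close>, and the cross product is obtained
  from it by duality.  On \<open>S3\<close> this orientation makes \<open>i, j, k\<close> positively oriented at \<open>1\<close>.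
\<close>

definition cross :: "space_form \<Rightarrow> real^4 \<Rightarrow> real^4 \<Rightarrow> real^4 \<Rightarrow> real^4" where
  "cross M y u v =
    (THE w. w \<in> tangent M y \<and>
       (\<forall>z\<in>tangent M y. form M w z = det (vector [y, u, v, z] :: real^4^4)))"


section \<open>Smooth functions and vector fields\<close>

fun Ck_on :: "nat \<Rightarrow> ('a::real_normed_vector \<Rightarrow> 'b::real_normed_vector) \<Rightarrow> 'a set \<Rightarrow> bool" where
  "Ck_on 0 f U \<longleftrightarrow> continuous_on U f"
| "Ck_on (Suc k) f U \<longleftrightarrow>
     f differentiable_on U \<and> (\<forall>v. Ck_on k (\<lambda>x. frechet_derivative f (at x) v) U)"

text \<open>Smoothness on an embedded submanifold: local smooth extendability to the ambient space.\<close>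

definition smooth :: "space_form \<Rightarrow> (real^4 \<Rightarrow> 'b::real_normed_vector) \<Rightarrow> bool" where
  "smooth M f \<longleftrightarrow>
    (\<forall>p\<in>points M. \<exists>U F. open U \<and> p \<in> U \<and> (\<forall>k. Ck_on k F U) \<and>
       (\<forall>x\<in>U \<inter> points M. F x = f x))"

definition smooth_vector_field :: "space_form \<Rightarrow> (real^4 \<Rightarrow> real^4) \<Rightarrow> bool" where
  "smooth_vector_field M V \<longleftrightarrow> smooth M V \<and> (\<forall>x\<in>points M. V x \<in> tangent M x)"

definition compact_support :: "space_form \<Rightarrow> (real^4 \<Rightarrow> 'b::zero) \<Rightarrow> bool" where
  "compact_support M f \<longleftrightarrow> compact (closure {x\<in>points M. f x \<noteq> 0})"


section \<open>Gradient, divergence and curl\<close>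

text \<open>
  A derivative within the submanifold is determined only on tangent vectors; the definitions below
  evaluate \<open>frechet_derivative\<close> on tangent vectors only.  The Levi-Civita connection is the tangential
  part of the ambient directional derivative.
\<close>

definition gradient :: "space_form \<Rightarrow> (real^4 \<Rightarrow> real) \<Rightarrow> real^4 \<Rightarrow> real^4" where
  "gradient M f y =
    (THE g. g \<in> tangent M y \<and>
       (\<forall>v\<in>tangent M y. form M g v = frechet_derivative f (at y within points M) v))"

definition cov_deriv :: "space_form \<Rightarrow> real^4 \<Rightarrow> (real^4 \<Rightarrow> real^4) \<Rightarrow> real^4 \<Rightarrow> real^4" where
  "cov_deriv M v X y = tproj M y (frechet_derivative X (at y within points M) v)"

definition orthonormal_frame :: "space_form \<Rightarrow> real^4 \<Rightarrow> (3 \<Rightarrow> real^4) \<Rightarrow> bool" where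
  "orthonormal_frame M y e \<longleftrightarrow>
    (\<forall>i. e i \<in> tangent M y) \<and> (\<forall>i j. form M (e i) (e j) = (if i = j then 1 else 0))"

text \<open>Divergence and curl do not depend on the orthonormal frame that is selected.\<close>

definition frame :: "space_form \<Rightarrow> real^4 \<Rightarrow> 3 \<Rightarrow> real^4" where
  "frame M y = (SOME e. orthonormal_frame M y e)"

definition divergence :: "space_form \<Rightarrow> (real^4 \<Rightarrow> real^4) \<Rightarrow> real^4 \<Rightarrow> real" where
  "divergence M X y = (\<Sum>i\<in>UNIV. form M (frame M y i) (cov_deriv M (frame M y i) X y))"

definition curl :: "space_form \<Rightarrow> (real^4 \<Rightarrow> real^4) \<Rightarrow> real^4 \<Rightarrow> real^4" where
  "curl M X y = (\<Sum>i\<in>UNIV. cross M y (frame M y i) (cov_deriv M (frame M y i) X y))"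


section \<open>Distance, parallel transport and left translation\<close>

text \<open>\<open>C1_curve M c c'\<close>: the curve \<open>c\<close>, parametrised by \<open>[0,1]\<close>, has continuous velocity \<open>c'\<close>.\<close>

definition C1_curve :: "space_form \<Rightarrow> (real \<Rightarrow> real^4) \<Rightarrow> (real \<Rightarrow> real^4) \<Rightarrow> bool" where
  "C1_curve M c c' \<longleftrightarrow>
    (\<forall>t\<in>{0..1}. c t \<in> points M \<and> (c has_vector_derivative c' t) (at t within {0..1})) \<and>
    continuous_on {0..1} c'"

definition curve_length :: "space_form \<Rightarrow> (real \<Rightarrow> real^4) \<Rightarrow> real" where
  "curve_length M c' = integral {0..1} (\<lambda>t. sqrt (form M (c' t) (c' t)))"

definition rdist :: "space_form \<Rightarrow> real^4 \<Rightarrow> real^4 \<Rightarrow> real" where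
  "rdist M x y = Inf {curve_length M c' | c c'. C1_curve M c c' \<and> c 0 = x \<and> c 1 = y}"

definition parallel_along :: "space_form \<Rightarrow> (real \<Rightarrow> real^4) \<Rightarrow> (real \<Rightarrow> real^4) \<Rightarrow> bool" where
  "parallel_along M c X \<longleftrightarrow>
    (\<forall>t\<in>{0..1}. X t \<in> tangent M (c t) \<and>
       (\<exists>X'. (X has_vector_derivative X') (at t within {0..1}) \<and> tproj M (c t) X' = 0))"

definition shortest_geodesic :: "space_form \<Rightarrow> real^4 \<Rightarrow> real^4 \<Rightarrow> (real \<Rightarrow> real^4) \<Rightarrow> bool" where
  "shortest_geodesic M x y c \<longleftrightarrow> c 0 = x \<and> c 1 = y \<and>
    (\<exists>c'. C1_curve M c c' \<and> parallel_along M c c' \<and> curve_length M c' = rdist M x y)"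

text \<open>Transport from \<open>x\<close> to \<open>y\<close>; on \<open>S3\<close> it is unspecified for \<open>y = - x\<close>.\<close>

definition ptransport :: "space_form \<Rightarrow> real^4 \<Rightarrow> real^4 \<Rightarrow> real^4 \<Rightarrow> real^4" where
  "ptransport M y x v =
    (THE w. \<exists>c X. shortest_geodesic M x y c \<and> parallel_along M c X \<and> X 0 = v \<and> X 1 = w)"

text \<open>Quaternions: \<open>(a, b, c, d)\<close> stands for \<open>a + b i + c j + d k\<close>.\<close>

definition qmult :: "real^4 \<Rightarrow> real^4 \<Rightarrow> real^4" where
  "qmult p q = vector
    [p$1 * q$1 - p$2 * q$2 - p$3 * q$3 - p$4 * q$4,
     p$1 * q$2 + p$2 * q$1 + p$3 * q$4 - p$4 * q$3,
     p$1 * q$3 - p$2 * q$4 + p$3 * q$1 + p$4 * q$2,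
     p$1 * q$4 + p$2 * q$3 - p$3 * q$2 + p$4 * q$1]"

definition qinverse :: "real^4 \<Rightarrow> real^4" where
  "qinverse p = (1 / (norm p)\<^sup>2) *\<^sub>R vector [p$1, - p$2, - p$3, - p$4]"

text \<open>The differential at \<open>x\<close> of left translation by \<open>y x\<^sup>-\<^sup>1\<close>.\<close>

definition ltranslate :: "real^4 \<Rightarrow> real^4 \<Rightarrow> real^4 \<Rightarrow> real^4" where
  "ltranslate y x = frechet_derivative (\<lambda>q. qmult (qmult y (qinverse x)) q) (at x)"


section \<open>The Riemannian volume measure\<close>

text \<open>
  The volume measure is \<open>sqrt (det g)\<close> times Lebesgue measure in a chart: stereographic projection,
  which misses only the null set \<open>{-1}\<close> of \<open>S3\<close>, and the Poincare ball for \<open>H3\<close>.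
\<close>

definition chart_dom :: "space_form \<Rightarrow> (real^3) set" where
  "chart_dom M = {u. 1 + curv M * (u \<bullet> u) > 0}"

definition chart :: "space_form \<Rightarrow> real^3 \<Rightarrow> real^4" where
  "chart M u = (1 / (1 + curv M * (u \<bullet> u))) *\<^sub>R
     vector [1 - curv M * (u \<bullet> u), 2 * u $ 1, 2 * u $ 2, 2 * u $ 3]"

definition gram :: "space_form \<Rightarrow> real^3 \<Rightarrow> real^3^3" where
  "gram M u = (\<chi> i j. form M (frechet_derivative (chart M) (at u) (axis i 1))
                             (frechet_derivative (chart M) (at u) (axis j 1)))"

definition vol :: "space_form \<Rightarrow> (real^4) measure" where
  "vol M = distr (density (restrict_space lborel (chart_dom M)) (\<lambda>u. ennreal (sqrt (det (gram M u)))))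
             (restrict_space borel (points M)) (chart M)"


section \<open>Electric and magnetic fields\<close>

fun phi0 :: "space_form \<Rightarrow> real \<Rightarrow> real" where
  "phi0 S3 a = - (1 / (4 * pi\<^sup>2)) * ((pi - a) * cot a)"
| "phi0 H3 a = - (1 / (4 * pi)) * (cosh a / sinh a - 1)"

definition phi1 :: "real \<Rightarrow> real" where
  "phi1 a = - (1 / (16 * pi\<^sup>2)) * (a * (2 * pi - a))"

fun phi :: "space_form \<Rightarrow> real \<Rightarrow> real" where
  "phi S3 a = - (1 / (4 * pi\<^sup>2)) * ((pi - a) / sin a)"
| "phi H3 a = - (1 / (4 * pi)) * (1 / sinh a)"

definition E_field :: "space_form \<Rightarrow> (real^4 \<Rightarrow> real) \<Rightarrow> real^4 \<Rightarrow> real^4" where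
  "E_field M \<rho> y = gradient M (\<lambda>z. \<integral>x. \<rho> x * phi0 M (rdist M x z) \<partial>vol M) y"

definition dE_dt :: "space_form \<Rightarrow> (real^4 \<Rightarrow> real^4) \<Rightarrow> real^4 \<Rightarrow> real^4" where
  "dE_dt M V = E_field M (\<lambda>x. - divergence M V x)"

definition BS_left :: "(real^4 \<Rightarrow> real^4) \<Rightarrow> real^4 \<Rightarrow> real^4" where
  "BS_left V y =
     (\<integral>x. cross S3 y (ltranslate y x (V x)) (gradient S3 (\<lambda>z. phi0 S3 (rdist S3 x z)) y) \<partial>vol S3)
     - (1 / (4 * pi\<^sup>2)) *\<^sub>R (\<integral>x. ltranslate y x (V x) \<partial>vol S3)
     + 2 *\<^sub>R gradient S3
         (\<lambda>z. \<integral>x. form S3 (ltranslate z x (V x)) (gradient S3 (\<lambda>w. phi1 (rdist S3 x w)) z) \<partial>vol S3) y"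

definition BS_parallel :: "space_form \<Rightarrow> (real^4 \<Rightarrow> real^4) \<Rightarrow> real^4 \<Rightarrow> real^4" where
  "BS_parallel M V y =
     (\<integral>x. cross M y (ptransport M y x (V x)) (gradient M (\<lambda>z. phi M (rdist M x z)) y) \<partial>vol M)"

text \<open>The magnetic field may be given by either formula on \<open>S3\<close>, and by parallel transport on \<open>H3\<close>.\<close>

fun is_BS :: "space_form \<Rightarrow> (real^4 \<Rightarrow> real^4) \<Rightarrow> (real^4 \<Rightarrow> real^4) \<Rightarrow> bool" where
  "is_BS S3 V B \<longleftrightarrow> B = BS_left V \<or> B = BS_parallel S3 V"
| "is_BS H3 V B \<longleftrightarrow> B = BS_parallel H3 V"

end

theory Submission
  imports Defs "HOL-Analysis.Analysis"
begin

text \<open>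
  Everything is expressed through potentials \<open>pot M K F y\<close>, the integral of \<open>K (cc M x y) *\<^sub>R F x\<close> over
  \<open>x\<close>, where \<open>cc M x y\<close> is the cosine or hyperbolic cosine of the distance of \<open>x\<close> and \<open>y\<close>.  The kernels of the
  electric and the magnetic field become functions \<open>ker0\<close> and \<open>ker\<close> of this variable, with the two crucial
  relations \<open>ker0 t = t * ker t + const\<close> and \<open>(1 - t\<^sup>2) * ker' t = t * ker t - bcon\<close>.

  Potentials are differentiated without differentiating the kernel.  A rotation that moves \<open>y\<close> along a
  geodesic preserves volume and distance, so it can be applied to the density instead (\<open>pot_derivative\<close>): the
  derivative of \<open>pot K F\<close> at \<open>y\<close> in direction \<open>w\<close> is, up to the sign of the curvature, the potential of \<open>lie M
  y w F\<close>, the derivative of \<open>F\<close> along the Killing field of the rotation in the plane of \<open>y\<close> and \<open>w\<close>. For a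
  radial kernel, rotations about \<open>y\<close> contribute nothing (\<open>pot_lie_stabiliser\<close>), second derivatives at \<open>y\<close> in
  tangential directions commute (\<open>pot_lie_commute\<close>), and their trace is given by the differential equation of
  the kernel together with a point mass (\<open>laplace_pot\<close>). The point mass is obtained by replacing \<open>K t\<close> with \<open>K
  (s t)\<close>, which is differentiable everywhere if \<open>s < 1\<close> on \<open>S3\<close> and \<open>s > 1\<close> on \<open>H3\<close>, and letting \<open>s\<close> tend to 1
  (\<open>dirac_limit\<close>).

  The electric field is the gradient of \<open>pot (ker0 M) \<rho>\<close>.  Its covariant derivative is the Hessian of
  that potential: the trace is the charge density and the antisymmetric part is zero (\<open>electric_field\<close>).

  Parallel transport changes a vector only by multiples of \<open>x + y\<close>, and these drop out of the cross product
  with the gradient of the kernel.  Hence the magnetic field is a sum of cross products of constant vectors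
  with first derivatives of the potential of \<open>V\<close>.  In an orthonormal frame \<open>e\<close> at \<open>y\<close>, let \<open>W\<close>, \<open>U j\<close> and \<open>Q i
  j\<close> be the potentials at \<open>y\<close> of \<open>V\<close>, of its Killing derivatives \<open>lie M y (e j) V\<close> and of their Killing
  derivatives in direction \<open>e i\<close>. The double cross product formula gives divergence zero, by symmetry of \<open>Q\<close>,
  and the curl as \<open>V y\<close> plus the tangential vector with components \<open>curv M * (e j \<bullet> W) + 2 * (y
  \<bullet> U j) - (\<Sum>i. e i \<bullet> Q i j)\<close> (\<open>BS_parallel_curl\<close>).

  That this vector is the displacement current follows from the divergence theorem: because of \<open>ker0' t = ker
  t + t * ker' t\<close>, the potential of \<open>divergence M V\<close> with kernel \<open>ker0\<close> is a combination of \<open>y \<bullet> W\<close>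
  and of the trace of \<open>U\<close> (\<open>pot_divergence\<close>), and its gradient has the same components
  (\<open>displacement_current\<close>).

  On \<open>S3\<close>, left translation is \<open>tri y (V x) x + (x \<bullet> y) V x - (V x \<bullet> y) x\<close>.  After the
  gradient in the third term of the left translation formula has been moved under the integral, the integrands
  of both formulas agree by the first-order equation of \<open>ker\<close> (\<open>BS_left_eq_parallel\<close>).

  The distance is computed by comparing lengths with the angle (\<open>rdist_eq\<close>), and parallel transport by first
  integrals of the geodesic equation (\<open>ptransport_eq\<close>).
\<close>

section \<open>Linear algebra of the ambient form\<close>

lemma curv_sq [simp]: "curv M * curv M = 1" "curv M * (curv M * a) = a"
  by (cases M; simp)+

lemma curv_cases: "curv M = 1 \<or> curv M = - 1"
  by (cases M) auto

lemma abs_curv [simp]: "\<bar>curv M\<bar> = 1"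
  by (cases M) auto

lemma curv_nz [simp]: "curv M \<noteq> 0"
  by (cases M) auto

lemma form_sym: "form M u v = form M v u"
  by (simp add: form_def algebra_simps)

lemma bounded_bilinear_form: "bounded_bilinear (form M)"
proof -
  have c: "\<bar>u $ i * v $ i\<bar> \<le> norm u * norm v" for u v :: "real^4" and i
    by (metis abs_ge_zero abs_mult component_le_norm_cart mult_mono norm_ge_zero)
  show ?thesis
  proof
    show "\<exists>K. \<forall>a b. norm (form M a b) \<le> norm a * norm b * K"
    proof (intro exI allI)
      fix u v :: "real^4"
      have "\<bar>form M u v\<bar> \<le> \<bar>u $ 1 * v $ 1\<bar> + \<bar>u $ 2 * v $ 2\<bar> + \<bar>u $ 3 * v $ 3\<bar> + \<bar>u $ 4 * v $ 4\<bar>"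
      proof -
        have "\<bar>form M u v\<bar> \<le> \<bar>curv M * (u $ 1 * v $ 1)\<bar> + \<bar>u $ 2 * v $ 2\<bar> + \<bar>u $ 3 * v $ 3\<bar> + \<bar>u $ 4 * v $ 4\<bar>"
          unfolding form_def by linarith
        then show ?thesis by (simp add: abs_mult[of "curv M"])
      qed
      also have "\<dots> \<le> norm u * norm v * 4"
        using c[of u 1 v] c[of u 2 v] c[of u 3 v] c[of u 4 v] by linarith
      finally show "norm (form M u v) \<le> norm u * norm v * 4" by simp
    qed
  qed (simp_all add: form_def algebra_simps)
qed

interpretation form: bounded_bilinear "form M" for M
  by (rule bounded_bilinear_form)

lemmas form_lin = form.add_left form.add_right form.diff_left form.diff_right
  form.scaleR_left form.scaleR_right form.minus_left form.minus_right form.zero_left form.zero_right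

text \<open>The squares of the standard basis vectors with respect to the form.\<close>

definition eps :: "space_form \<Rightarrow> 4 \<Rightarrow> real" where
  "eps M a = (if a = 1 then curv M else 1)"

abbreviation ax :: "4 \<Rightarrow> real^4" where "ax a \<equiv> axis a 1"

lemma eps_sq [simp]: "eps M a * eps M a = 1"
  by (simp add: eps_def)

lemma eps_values [simp]: "eps M 1 = curv M" "eps M 2 = 1" "eps M 3 = 1" "eps M 4 = 1"
  by (simp_all add: eps_def)

lemma form_ax: "form M (ax a) x = eps M a * x $ a" "form M x (ax a) = eps M a * x $ a"
  using exhaust_4[of a] by (auto simp: form_def axis_def eps_def)

lemma sum_ax: "(\<Sum>a\<in>UNIV. (x $ a) *\<^sub>R ax a) = (x :: real^4)"
  using basis_expansion[of x] by (simp add: scalar_mult_eq_scaleR)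

lemma form_expand: "(\<Sum>a\<in>UNIV. eps M a * (form M (ax a) x * form M (ax a) z)) = form M x z"
  unfolding form_ax sum_4 eps_values unfolding form_def by simp

lemma sum_ax_form: "(\<Sum>a\<in>UNIV. (eps M a * form M (ax a) x) *\<^sub>R ax a) = x"
proof -
  have "eps M a * form M (ax a) x = x $ a" for a
    by (simp add: form_ax flip: mult.assoc)
  then show ?thesis by (simp add: sum_ax)
qed

lemma form_nondegenerate:
  assumes "\<And>z. form M w z = form M w' z"
  shows "w = w'"
proof -
  have "eps M a * w $ a = eps M a * w' $ a" for a
    using assms[of "ax a"] by (simp add: form_ax)
  moreover have "eps M a \<noteq> 0" for a by (simp add: eps_def)
  ultimately show ?thesis by (simp add: vec_eq_iff)
qed

lemma vec4 [simp]:
  "(vector [a, b, c, d] :: 'a::zero^4) $ 1 = a" "(vector [a, b, c, d] :: 'a^4) $ 2 = b"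
  "(vector [a, b, c, d] :: 'a^4) $ 3 = c" "(vector [a, b, c, d] :: 'a^4) $ 4 = d"
  by (simp_all add: vector_def)

lemma det_4:
  "det (vector [y, u, v, z] :: real^4^4) =
     z$1 * (y$2 * (u$4 * v$3 - u$3 * v$4) + y$3 * (u$2 * v$4 - u$4 * v$2) + y$4 * (u$3 * v$2 - u$2 * v$3)) +
     z$2 * (y$1 * (u$3 * v$4 - u$4 * v$3) + y$3 * (u$4 * v$1 - u$1 * v$4) + y$4 * (u$1 * v$3 - u$3 * v$1)) +
     z$3 * (y$1 * (u$4 * v$2 - u$2 * v$4) + y$2 * (u$1 * v$4 - u$4 * v$1) + y$4 * (u$2 * v$1 - u$1 * v$2)) +
     z$4 * (y$1 * (u$2 * v$3 - u$3 * v$2) + y$2 * (u$3 * v$1 - u$1 * v$3) + y$3 * (u$1 * v$2 - u$2 * v$1))"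
proof -
  have f1: "finite {2::4, 3, 4}" "1 \<notin> {2::4, 3, 4}" by auto
  have f2: "finite {3::4, 4}" "2 \<notin> {3::4, 4}" by auto
  have f3: "finite {4::4}" "3 \<notin> {4::4}" by auto
  show ?thesis
    unfolding det_def UNIV_4
    unfolding sum_over_permutations_insert[OF f1]
    unfolding sum_over_permutations_insert[OF f2]
    unfolding sum_over_permutations_insert[OF f3]
    unfolding permutes_sing
    by (simp add: sign_swap_id permutation_swap_id permutation_compose sign_compose sign_id swap_id_eq)
       (simp add: algebra_simps)
qed

text \<open>
  The triple product of \<open>\<real>\<^sup>4\<close>, dual to the determinant under the form.  It is trilinear and alternating,
  and for a point \<open>y\<close> it restricts to the cross product of the tangent space at \<open>y\<close>.
\<close>

definition tri :: "space_form \<Rightarrow> real^4 \<Rightarrow> real^4 \<Rightarrow> real^4 \<Rightarrow> real^4" where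
  "tri M y u v = (\<Sum>a\<in>UNIV. (eps M a * det (vector [y, u, v, ax a] :: real^4^4)) *\<^sub>R ax a)"

lemma tri_component: "tri M y u v $ a = eps M a * det (vector [y, u, v, ax a] :: real^4^4)"
  by (simp add: tri_def axis_def if_distrib[of "\<lambda>x. _ * x"] cong: if_cong)

lemma tri_components:
  "tri M y u v $ 1 = curv M * (y$2 * (u$4 * v$3 - u$3 * v$4) + y$3 * (u$2 * v$4 - u$4 * v$2) + y$4 * (u$3 * v$2 - u$2 * v$3))"
  "tri M y u v $ 2 = y$1 * (u$3 * v$4 - u$4 * v$3) + y$3 * (u$4 * v$1 - u$1 * v$4) + y$4 * (u$1 * v$3 - u$3 * v$1)"
  "tri M y u v $ 3 = y$1 * (u$4 * v$2 - u$2 * v$4) + y$2 * (u$1 * v$4 - u$4 * v$1) + y$4 * (u$2 * v$1 - u$1 * v$2)"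
  "tri M y u v $ 4 = y$1 * (u$2 * v$3 - u$3 * v$2) + y$2 * (u$3 * v$1 - u$1 * v$3) + y$3 * (u$1 * v$2 - u$2 * v$1)"
  unfolding tri_component det_4 by (simp_all add: axis_def)

lemma form_tri: "form M (tri M y u v) z = det (vector [y, u, v, z] :: real^4^4)"
  unfolding form_def tri_components det_4 by (simp add: algebra_simps)

lemma tri_ext: "w = w' \<longleftrightarrow> w$1 = w'$1 \<and> w$2 = w'$2 \<and> w$3 = w'$3 \<and> w$4 = (w'::real^4)$4"
  by (simp add: vec_eq_iff forall_4)

lemma tri_lin:
  "tri M (y + y') u v = tri M y u v + tri M y' u v"
  "tri M y (u + u') v = tri M y u v + tri M y u' v"
  "tri M y u (v + v') = tri M y u v + tri M y u v'"
  "tri M y u (v - v') = tri M y u v - tri M y u v'"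
  "tri M (r *\<^sub>R y) u v = r *\<^sub>R tri M y u v"
  "tri M y (r *\<^sub>R u) v = r *\<^sub>R tri M y u v"
  "tri M y u (r *\<^sub>R v) = r *\<^sub>R tri M y u v"
  by (simp_all add: tri_ext tri_components algebra_simps)

lemma tri_alt [simp]:
  "tri M y y v = 0" "tri M y v y = 0" "tri M y v v = 0" "tri M 0 u v = 0" "tri M y 0 v = 0" "tri M y u 0 = 0"
  by (simp_all add: tri_ext tri_components algebra_simps)

lemma tri_skew: "tri M u y v = - tri M y u v" "tri M y v u = - tri M y u v"
  by (simp_all add: tri_ext tri_components algebra_simps)

lemma form_tri_same [simp]: "form M (tri M y u v) y = 0" "form M (tri M y u v) u = 0" "form M (tri M y u v) v = 0"
  "form M y (tri M y u v) = 0"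
  unfolding form_tri form_sym[of M y] by (simp_all add: det_4 algebra_simps)

text \<open>The form of two triple products is a Gram determinant; this gives the double cross product.\<close>

lemma form_tri_tri:
  "form M (tri M y u v) (tri M y u' v') =
    curv M * (form M y y * (form M u u' * form M v v' - form M u v' * form M v u')
      - form M y u' * (form M u y * form M v v' - form M u v' * form M v y)
      + form M y v' * (form M u y * form M v u' - form M u u' * form M v y))"
  unfolding form_def tri_components using curv_cases[of M]
  by (elim disjE; simp add: algebra_simps)

lemma tri_tri:
  "tri M y a (tri M y b d) =
    - (curv M) *\<^sub>R (form M y y *\<^sub>R (form M a b *\<^sub>R d - form M a d *\<^sub>R b)
      - form M y b *\<^sub>R (form M a y *\<^sub>R d - form M a d *\<^sub>R y)
      + form M y d *\<^sub>R (form M a y *\<^sub>R b - form M a b *\<^sub>R y))"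
proof (rule form_nondegenerate[of M])
  fix z
  have "form M (tri M y a (tri M y b d)) z = - form M (tri M y a z) (tri M y b d)"
    unfolding form_tri form_sym[of M "tri M y a z"]
    by (simp add: form_sym[of M _ "tri M y b d"] form_tri det_4 algebra_simps)
  then show "form M (tri M y a (tri M y b d)) z = form M (- (curv M) *\<^sub>R (form M y y *\<^sub>R (form M a b *\<^sub>R d - form M a d *\<^sub>R b)
      - form M y b *\<^sub>R (form M a y *\<^sub>R d - form M a d *\<^sub>R y)
      + form M y d *\<^sub>R (form M a y *\<^sub>R b - form M a b *\<^sub>R y))) z"
    unfolding form_tri_tri form_lin form_sym[of M z] by (simp add: algebra_simps form_sym)
qed

section \<open>Points, tangent vectors and orthonormal frames\<close>

lemma form_point: "x \<in> points M \<Longrightarrow> form M x x = curv M"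
  by (simp add: points_def)

lemma points_H3_pos: "x \<in> points H3 \<Longrightarrow> x $ 1 > 0"
  by (simp add: points_def)

lemma points_S3_norm: "x \<in> points S3 \<longleftrightarrow> norm x = 1"
proof -
  have "norm x = sqrt (form S3 x x)"
    by (simp add: norm_vec_def L2_set_def sum_4 form_def power2_eq_square)
  then show ?thesis by (auto simp: points_def)
qed

lemma tangentD: "v \<in> tangent M x \<Longrightarrow> form M x v = 0" "v \<in> tangent M x \<Longrightarrow> form M v x = 0"
  by (simp_all add: tangent_def form_sym)

lemma tangent_lin:
  "u \<in> tangent M x \<Longrightarrow> v \<in> tangent M x \<Longrightarrow> u + v \<in> tangent M x"
  "u \<in> tangent M x \<Longrightarrow> v \<in> tangent M x \<Longrightarrow> u - v \<in> tangent M x"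
  "u \<in> tangent M x \<Longrightarrow> r *\<^sub>R u \<in> tangent M x"
  "u \<in> tangent M x \<Longrightarrow> - u \<in> tangent M x"
  "0 \<in> tangent M x"
  by (simp_all add: tangent_def form_lin)

text \<open>On \<open>H3\<close> a tangent vector is spacelike: by Cauchy-Schwarz its time component is dominated.\<close>

lemma tangent_pos:
  assumes "x \<in> points M" "v \<in> tangent M x"
  shows "form M v v \<ge> 0" "form M v v = 0 \<longleftrightarrow> v = 0"
proof -
  have "form M v v \<ge> 0 \<and> (form M v v = 0 \<longrightarrow> v = 0)"
  proof (cases M)
    case S3
    then have e: "form M v v = (v$1)\<^sup>2 + (v$2)\<^sup>2 + (v$3)\<^sup>2 + (v$4)\<^sup>2" by (simp add: form_def power2_eq_square)
    have "v = 0" if "form M v v = 0"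
      using that unfolding e tri_ext by (simp add: add_nonneg_eq_0_iff)
    then show ?thesis unfolding e by auto
  next
    case H3
    let ?s = "(x$2)\<^sup>2 + (x$3)\<^sup>2 + (x$4)\<^sup>2" and ?w = "(v$2)\<^sup>2 + (v$3)\<^sup>2 + (v$4)\<^sup>2"
    have x: "(x$1)\<^sup>2 = 1 + ?s" "x$1 > 0" and v: "x$1 * v$1 = x$2 * v$2 + x$3 * v$3 + x$4 * v$4"
      using assms H3 by (auto simp: points_def tangent_def form_def power2_eq_square)
    have "(x$1)\<^sup>2 * (v$1)\<^sup>2 = (x$2 * v$2 + x$3 * v$3 + x$4 * v$4)\<^sup>2"
      using v by (metis power_mult_distrib)
    also have "\<dots> = ?s * ?w - (x$2 * v$3 - x$3 * v$2)\<^sup>2 - (x$2 * v$4 - x$4 * v$2)\<^sup>2 - (x$3 * v$4 - x$4 * v$3)\<^sup>2"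
      by (simp add: power2_eq_square algebra_simps)
    also have "\<dots> \<le> ?s * ?w"
      using zero_le_power2[of "x$2 * v$3 - x$3 * v$2"] zero_le_power2[of "x$2 * v$4 - x$4 * v$2"]
        zero_le_power2[of "x$3 * v$4 - x$4 * v$3"] by linarith
    finally have *: "(x$1)\<^sup>2 * (v$1)\<^sup>2 \<le> ?s * ?w" .
    have f: "form M v v = ?w - (v$1)\<^sup>2" using H3 by (simp add: form_def power2_eq_square)
    have ge: "(x$1)\<^sup>2 * form M v v \<ge> ?w"
      using * unfolding f x(1) by (simp add: algebra_simps)
    have w0: "?w \<ge> 0" by simp
    have "form M v v \<ge> 0"
      using ge w0 x(2) by (smt (verit) mult_pos_neg zero_less_power)
    moreover have "v = 0" if "form M v v = 0"
    proof -
      have "?w \<le> 0" using ge that by simp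
      then have "v$2 = 0" "v$3 = 0" "v$4 = 0" by (smt (verit) power2_eq_iff_nonneg zero_le_power2 power_zero_numeral zero_eq_power2)+
      moreover then have "v$1 = 0" using v x(2) by simp
      ultimately show ?thesis by (simp add: tri_ext)
    qed
    ultimately show ?thesis by simp
  qed
  then show "form M v v \<ge> 0" "form M v v = 0 \<longleftrightarrow> v = 0" by (auto simp: form_lin)
qed

lemma tangent_unique:
  assumes "y \<in> points M" "w \<in> tangent M y" "w' \<in> tangent M y"
    and "\<And>z. z \<in> tangent M y \<Longrightarrow> form M w z = form M w' z"
  shows "w = w'"
proof -
  have d: "w - w' \<in> tangent M y" using assms by (simp add: tangent_lin)
  have "form M (w - w') (w - w') = 0" using assms(4)[OF d] by (simp add: form_lin)
  then show ?thesis using tangent_pos(2)[OF assms(1) d] by simp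
qed

lemma cross_eq_tri:
  assumes "y \<in> points M" shows "cross M y u v = tri M y u v"
  unfolding cross_def
proof (rule the_equality)
  show "tri M y u v \<in> tangent M y \<and> (\<forall>z\<in>tangent M y. form M (tri M y u v) z = det (vector [y, u, v, z] :: real^4^4))"
    by (simp add: form_tri tangent_def)
next
  fix w assume "w \<in> tangent M y \<and> (\<forall>z\<in>tangent M y. form M w z = det (vector [y, u, v, z] :: real^4^4))"
  then show "w = tri M y u v"
    by (intro tangent_unique[OF assms]) (auto simp: form_tri tangent_def)
qed

text \<open>The tangential part of \<open>x\<close> at \<open>y\<close>; its square is \<open>sin\<^sup>2\<close> or \<open>sinh\<^sup>2\<close> of the distance.\<close>

definition tpart :: "space_form \<Rightarrow> real^4 \<Rightarrow> real^4 \<Rightarrow> real^4" where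
  "tpart M y x = x - (curv M * form M x y) *\<^sub>R y"

lemma tpart_tangent: "y \<in> points M \<Longrightarrow> tpart M y x \<in> tangent M y"
  by (simp add: tpart_def tangent_def form_lin form_point form_sym)

lemma tproj_eq: "y \<in> points M \<Longrightarrow> tproj M y x = tpart M y x"
  using curv_cases[of M] by (auto simp: tproj_def tpart_def form_point form_sym)

definition qq :: "space_form \<Rightarrow> real \<Rightarrow> real" where
  "qq M t = curv M * (1 - t\<^sup>2)"

abbreviation cc :: "space_form \<Rightarrow> real^4 \<Rightarrow> real^4 \<Rightarrow> real" where
  "cc M x y \<equiv> curv M * form M x y"

lemma form_tpart: "x \<in> points M \<Longrightarrow> y \<in> points M \<Longrightarrow> form M (tpart M y x) (tpart M y x) = qq M (cc M x y)"
  using curv_cases[of M] by (auto simp: tpart_def form_lin form_point form_sym qq_def power2_eq_square algebra_simps)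

lemma qq_nonneg: "x \<in> points M \<Longrightarrow> y \<in> points M \<Longrightarrow> qq M (cc M x y) \<ge> 0"
  using tangent_pos(1)[OF _ tpart_tangent, of y M x] by (simp add: form_tpart)

lemma cc_sym: "cc M x y = cc M y x"
  by (simp add: form_sym)

lemma cc_self: "x \<in> points M \<Longrightarrow> cc M x x = 1"
  by (simp add: form_point)

lemma cc_H3_ge1: assumes "x \<in> points H3" "y \<in> points H3" shows "cc H3 x y \<ge> 1"
proof -
  let ?c = "cc H3 x y"
  have sx: "(x$1)\<^sup>2 = 1 + ((x$2)\<^sup>2 + (x$3)\<^sup>2 + (x$4)\<^sup>2)" "x$1 > 0"
    and sy: "(y$1)\<^sup>2 = 1 + ((y$2)\<^sup>2 + (y$3)\<^sup>2 + (y$4)\<^sup>2)" "y$1 > 0"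
    using assms by (auto simp: points_def form_def power2_eq_square)
  let ?d = "x$2 * y$2 + x$3 * y$3 + x$4 * y$4"
  have "?d\<^sup>2 \<le> ((x$2)\<^sup>2 + (x$3)\<^sup>2 + (x$4)\<^sup>2) * ((y$2)\<^sup>2 + (y$3)\<^sup>2 + (y$4)\<^sup>2)"
  proof -
    have "((x$2)\<^sup>2 + (x$3)\<^sup>2 + (x$4)\<^sup>2) * ((y$2)\<^sup>2 + (y$3)\<^sup>2 + (y$4)\<^sup>2) - ?d\<^sup>2
      = (x$2 * y$3 - x$3 * y$2)\<^sup>2 + (x$2 * y$4 - x$4 * y$2)\<^sup>2 + (x$3 * y$4 - x$4 * y$3)\<^sup>2"
      by (simp add: power2_eq_square algebra_simps)
    then show ?thesis by (smt (verit) zero_le_power2)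
  qed
  also have "\<dots> < (x$1)\<^sup>2 * (y$1)\<^sup>2" unfolding sx(1) sy(1)
    by (smt (verit, ccfv_SIG) mult_strict_mono zero_le_power2)
  finally have "?d\<^sup>2 < (x$1 * y$1)\<^sup>2" by (simp add: power_mult_distrib)
  then have "?d < x$1 * y$1" using sx(2) sy(2) by (metis less_eq_real_def mult_pos_pos power2_less_imp_less)
  then have c0: "?c > 0" by (simp add: form_def)
  have "?c\<^sup>2 \<ge> 1" using qq_nonneg[OF assms] by (simp add: qq_def)
  then show ?thesis using c0 by (smt (verit) one_power2 power2_le_imp_le)
qed

lemma cc_S3_le1: assumes "x \<in> points S3" "y \<in> points S3" shows "\<bar>cc S3 x y\<bar> \<le> 1"
  using qq_nonneg[OF assms] by (simp add: qq_def abs_square_le_1)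

lemma qq_pos: assumes "x \<in> points M" "y \<in> points M" "x \<noteq> y" "x \<noteq> - y"
  shows "qq M (cc M x y) > 0"
proof (rule ccontr)
  assume "\<not> ?thesis"
  then have q0: "qq M (cc M x y) = 0" using qq_nonneg[OF assms(1,2)] by simp
  then have "tpart M y x = 0" using form_tpart[OF assms(1,2)] tangent_pos(2)[OF assms(2) tpart_tangent] assms(2) by metis
  then have e: "x = cc M x y *\<^sub>R y" by (simp add: tpart_def)
  from q0 have "cc M x y = 1 \<or> cc M x y = -1" by (auto simp: qq_def power2_eq_1_iff)
  then show False using e assms(3,4) by auto
qed

lemma closed_points: "closed (points M)"
proof -
  have c: "continuous_on UNIV (\<lambda>x. form M x x)" "continuous_on UNIV (\<lambda>x::real^4. x $ 1)"
    by (intro continuous_intros form.continuous_on)+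
  have "closed {x. form M x x = curv M}" using c(1) by (intro closed_Collect_eq) (auto)
  moreover have "points M = {x. form M x x = curv M} \<inter> (if M = H3 then {x. x $ 1 \<ge> 0} else UNIV)"
  proof -
    have "x $ 1 \<noteq> 0" if "form H3 x x = -1" for x
    proof
      assume "x $ 1 = 0"
      then have "form H3 x x \<ge> 0" by (simp add: form_def)
      then show False using that by simp
    qed
    then show ?thesis by (cases M) (force simp: points_def)+
  qed
  moreover have "closed {x::real^4. x $ 1 \<ge> 0}" using c(2) by (intro closed_Collect_le) auto
  ultimately show ?thesis by (auto intro: closed_Int)
qed

lemma frame_expand:
  assumes y: "y \<in> points M" and e: "orthonormal_frame M y e"
  shows "x = cc M x y *\<^sub>R y + (\<Sum>i\<in>UNIV. form M (e i) x *\<^sub>R e i)"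
proof -
  define T :: "real^4 \<Rightarrow> real^4" where "T = (\<lambda>v. (v$1) *\<^sub>R y + ((v$2) *\<^sub>R e 1 + (v$3) *\<^sub>R e 2 + (v$4) *\<^sub>R e 3))"
  have yy: "form M y y = curv M" "\<And>i. form M y (e i) = 0" "\<And>i. form M (e i) y = 0"
     "\<And>i j. form M (e i) (e j) = (if i = j then 1 else 0)"
    using y e by (auto simp: form_point orthonormal_frame_def tangentD)
  have lin: "linear T" by (rule linearI) (simp_all add: T_def algebra_simps)
  have co: "form M (T v) y = v$1 * curv M" "form M (e 1) (T v) = v$2" "form M (e 2) (T v) = v$3" "form M (e 3) (T v) = v$4" for v
    by (simp_all add: T_def form_lin yy)
  have "inj T"
  proof (rule injI)
    fix v w assume "T v = T w"
    then have "v$1 * curv M = w$1 * curv M" "v$2 = w$2" "v$3 = w$3" "v$4 = w$4" using co by metis+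
    then show "v = w" by (simp add: tri_ext)
  qed
  then have "surj T" using linear_injective_imp_surjective lin by blast
  then obtain v where v: "x = T v" by (metis surjD)
  have "cc M x y = v$1" unfolding v co(1) by (simp add: mult.commute[of "v$1"])
  then show ?thesis unfolding sum_3 using co[of v] v by (simp add: T_def flip: v)
qed

text \<open>
  The trace with respect to the form may be taken in the standard basis or in a frame completed by the point.
  The standard basis does not depend on the point, so that expressions in it can be differentiated; the frame
  is used to evaluate the result.
\<close>

lemma trace_frame:
  fixes \<beta> :: "real^4 \<Rightarrow> real^4 \<Rightarrow> 'b::real_vector"
  assumes y: "y \<in> points M" and e: "orthonormal_frame M y e"
    and l: "\<And>p. linear (\<beta> p)" and r: "\<And>p. linear (\<lambda>q. \<beta> q p)"
  shows "(\<Sum>a\<in>UNIV. eps M a *\<^sub>R \<beta> (ax a) (ax a)) = curv M *\<^sub>R \<beta> y y + (\<Sum>i\<in>UNIV. \<beta> (e i) (e i))"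
proof -
  have *: "\<beta> p p' = (\<Sum>a\<in>UNIV. \<Sum>b\<in>UNIV. (p$a * p'$b) *\<^sub>R \<beta> (ax a) (ax b))" for p p'
  proof -
    have "\<beta> p p' = \<beta> (\<Sum>a\<in>UNIV. (p $ a) *\<^sub>R ax a) (\<Sum>b\<in>UNIV. (p' $ b) *\<^sub>R ax b)" by (simp add: sum_ax)
    also have "\<dots> = (\<Sum>a\<in>UNIV. (p$a) *\<^sub>R \<beta> (ax a) (\<Sum>b\<in>UNIV. (p' $ b) *\<^sub>R ax b))"
      by (simp add: linear_sum[OF r] linear_cmul[OF r])
    also have "\<dots> = (\<Sum>a\<in>UNIV. (p$a) *\<^sub>R (\<Sum>b\<in>UNIV. (p' $ b) *\<^sub>R \<beta> (ax a) (ax b)))"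
      by (simp add: linear_sum[OF l] linear_cmul[OF l])
    finally show ?thesis by (simp add: scaleR_sum_right)
  qed
  have k: "curv M * (y$a * y$b) + (\<Sum>i\<in>UNIV. e i $ a * e i $ b) = (if a = b then eps M a else 0)" for a b
  proof -
    have "ax b = cc M (ax b) y *\<^sub>R y + (\<Sum>i\<in>UNIV. form M (e i) (ax b) *\<^sub>R e i)"
      by (rule frame_expand[OF y e])
    then have "ax b $ a = (cc M (ax b) y *\<^sub>R y + (\<Sum>i\<in>UNIV. form M (e i) (ax b) *\<^sub>R e i)) $ a"
      by simp
    then have "ax b $ a = curv M * (eps M b * y$b) * y$a + (\<Sum>i\<in>UNIV. eps M b * e i $ b * e i $ a)"
      by (simp add: form_ax)
    then have "eps M b * (ax b $ a) = eps M b * eps M b * (curv M * (y$a * y$b) + (\<Sum>i\<in>UNIV. e i $ a * e i $ b))"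
      by (simp only: sum_3 distrib_left distrib_right mult.assoc mult.left_commute mult.commute)
    then show ?thesis by (simp add: axis_def split: if_splits)
  qed
  have "curv M *\<^sub>R \<beta> y y + (\<Sum>i\<in>UNIV. \<beta> (e i) (e i))
     = (\<Sum>a\<in>UNIV. \<Sum>b\<in>UNIV. (curv M * (y$a * y$b) + (\<Sum>i\<in>UNIV. e i $ a * e i $ b)) *\<^sub>R \<beta> (ax a) (ax b))"
    unfolding *[of y y] *[of "e _" "e _"]
    by (simp add: scaleR_add_left sum.distrib scaleR_sum_right scaleR_sum_left sum_3)
  also have "\<dots> = (\<Sum>a\<in>UNIV. \<Sum>b\<in>UNIV. (if a = b then eps M a *\<^sub>R \<beta> (ax a) (ax b) else 0))"
    unfolding k by (intro sum.cong refl) auto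
  also have "\<dots> = (\<Sum>a\<in>UNIV. eps M a *\<^sub>R \<beta> (ax a) (ax a))" by simp
  finally show ?thesis by simp
qed

lemma tangent_cauchy_schwarz:
  assumes "y \<in> points M" "u \<in> tangent M y" "v \<in> tangent M y"
  shows "\<bar>form M u v\<bar> \<le> sqrt (form M u u) * sqrt (form M v v)"
proof -
  have p: "0 \<le> form M w w" if "w \<in> tangent M y" for w using tangent_pos(1)[OF assms(1) that] .
  have "(form M u v)\<^sup>2 \<le> form M u u * form M v v"
  proof (cases "form M v v = 0")
    case True
    then have "v = 0" using tangent_pos(2)[OF assms(1,3)] by simp
    then show ?thesis by (simp add: form_lin)
  next
    case False
    let ?w = "form M v v *\<^sub>R u - form M u v *\<^sub>R v"
    have "0 \<le> form M ?w ?w" by (rule p) (simp add: tangent_lin assms)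
    also have "\<dots> = form M v v * (form M u u * form M v v - (form M u v)\<^sup>2)"
      by (simp add: form_lin form_sym[of M v u] algebra_simps power2_eq_square)
    finally show ?thesis using False p[OF assms(3)] by (simp add: zero_le_mult_iff)
  qed
  then have "sqrt ((form M u v)\<^sup>2) \<le> sqrt (form M u u * form M v v)" by (rule real_sqrt_le_mono)
  then show ?thesis by (simp add: real_sqrt_mult)
qed

section \<open>Isometries\<close>

text \<open>
  The group of these maps is transitive on points and preserves all data, so that singular integrals need to
  be computed only for the point \<open>e0\<close>, the centre of the chart.
\<close>

definition isom :: "space_form \<Rightarrow> (real^4 \<Rightarrow> real^4) \<Rightarrow> bool" where
  "isom M R \<longleftrightarrow> linear R \<and> (\<forall>u v. form M (R u) (R v) = form M u v) \<and> R ` points M \<subseteq> points M"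

abbreviation e0 :: "real^4" where "e0 \<equiv> ax 1"

lemma e0_point: "e0 \<in> points M"
  by (simp add: points_def form_ax)

lemma H3_sheet:
  assumes z: "form H3 z z = -1" and y: "y \<in> points H3" and s: "form H3 z y < 0"
  shows "z \<in> points H3"
proof (rule ccontr)
  assume n: "z \<notin> points H3"
  have "z $ 1 \<noteq> 0"
  proof
    assume "z $ 1 = 0"
    then have "form H3 z z \<ge> 0" by (simp add: form_def)
    then show False using z by simp
  qed
  then have "- z \<in> points H3" using n z by (simp add: points_def form_lin)
  then have "cc H3 (-z) y \<ge> 1" using cc_H3_ge1 y by blast
  then show False using s by (simp add: form_lin)
qed

lemma isomI:
  assumes "linear R" "\<And>u v. form M (R u) (R v) = form M u v" "p \<in> points M" "R p \<in> points M"
  shows "isom M R"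
proof -
  have "R x \<in> points M" if x: "x \<in> points M" for x
  proof (cases M)
    case S3
    then show ?thesis using x assms(2)[of x x] by (auto simp: points_def)
  next
    case H3
    have "form H3 (R x) (R p) < 0" using cc_H3_ge1[of x p] x assms(2,3) H3 by simp
    then show ?thesis using H3_sheet[of "R x" "R p"] assms x H3 by (simp add: form_point)
  qed
  then show ?thesis using assms by (auto simp: isom_def)
qed

text \<open>
  The symmetry about the midpoint of \<open>e0\<close> and \<open>y\<close>, a linear involution that interchanges the two points.
  The antipode of \<open>e0\<close> has no midpoint with \<open>e0\<close>, and \<open>- id\<close> takes its place.
\<close>

definition swap :: "space_form \<Rightarrow> real^4 \<Rightarrow> real^4 \<Rightarrow> real^4" where
  "swap M y x = (if 1 + y $ 1 = 0 then - x
     else - x + (cc M x (y + e0) / (1 + y $ 1)) *\<^sub>R (y + e0))"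

lemma swap_facts:
  assumes y: "y \<in> points M"
  shows "isom M (swap M y)" "swap M y e0 = y" "swap M y (swap M y x) = x"
proof -
  have ye: "form M y e0 = curv M * y$1" "form M e0 y = curv M * y$1" "form M e0 e0 = curv M" by (simp_all add: form_ax)
  have yy: "form M y y = curv M" using y by (rule form_point)
  have s: "swap M y e0 = y"
  proof (cases "1 + y $ 1 = 0")
    case True
    then have y1: "y $ 1 = -1" by simp
    moreover have "M = S3" using y y1 by (cases M) (auto simp: points_def)
    ultimately have "(y$2)\<^sup>2 + (y$3)\<^sup>2 + (y$4)\<^sup>2 = 0" using y by (simp add: points_def form_def power2_eq_square)
    then have "y$2 = 0 \<and> y$3 = 0 \<and> y$4 = 0" by (simp add: add_nonneg_eq_0_iff)
    then show ?thesis using y1 by (simp add: swap_def tri_ext axis_def)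
  next
    case False
    have "cc M e0 (y + e0) = 1 + y $ 1" by (simp add: form_lin ye distrib_left)
    then show ?thesis using False by (simp add: swap_def)
  qed
  have l: "linear (swap M y)"
    by (rule linearI) (auto simp: swap_def form_lin algebra_simps add_divide_distrib)
  have n: "form M (y + e0) (y + e0) = 2 * curv M * (1 + y$1)"
    by (simp add: form_lin yy ye algebra_simps)
  have f: "form M (swap M y u) (swap M y v) = form M u v" for u v
  proof (cases "1 + y $ 1 = 0")
    case True then show ?thesis by (simp add: swap_def form_lin)
  next
    case False
    define m d where "m = y + e0" and "d = 1 + y $ 1"
    have mm: "form M m m = 2 * curv M * d" using n by (simp add: m_def d_def)
    have w: "swap M y w = (cc M w m / d) *\<^sub>R m - w" for w
      using False by (simp add: swap_def m_def d_def)
    have "form M (swap M y u) (swap M y v) = cc M u m / d * (cc M v m / d) * form M m m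
       - cc M u m / d * form M m v - cc M v m / d * form M u m + form M u v"
      unfolding w by (simp add: form_lin diff_divide_distrib right_diff_distrib)
    also have "\<dots> = form M u v"
      unfolding mm using False by (simp add: form_sym[of M m] flip: d_def)
    finally show ?thesis .
  qed
  show "isom M (swap M y)" using isomI[OF l f e0_point] s y by simp
  show "swap M y e0 = y" by (rule s)
  show "swap M y (swap M y x) = x"
  proof (cases "1 + y $ 1 = 0")
    case True then show ?thesis by (simp add: swap_def)
  next
    case False
    have "form M (swap M y x) (y + e0) = form M x (y + e0)"
    proof -
      have "cc M (y + e0) (y + e0) = 2 * (1 + y $ 1)" unfolding n using curv_cases[of M] by auto
      then have "swap M y (y + e0) = - (y + e0) + 2 *\<^sub>R (y + e0)" using False unfolding swap_def
        by (simp add: nonzero_divide_eq_eq[of "1 + y $ 1" "2 + 2 * y $ 1" 2])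
      also have "\<dots> = y + e0" unfolding scaleR_2 by (simp only: minus_add_cancel)
      finally have "swap M y (y + e0) = y + e0" .
      then show ?thesis using f[of x "y + e0"] by simp
    qed
    then show ?thesis using False by (simp add: swap_def)
  qed
qed

lemma frame_exists: assumes "y \<in> points M" shows "orthonormal_frame M y (frame M y)"
proof -
  let ?e = "\<lambda>i::3. swap M y (if i = 1 then ax 2 else if i = 2 then ax 3 else ax 4)"
  have f: "form M (swap M y u) (swap M y v) = form M u v" for u v
    using swap_facts(1)[OF assms] by (simp add: isom_def)
  have "orthonormal_frame M y ?e"
    unfolding orthonormal_frame_def
  proof (intro conjI allI)
    fix i :: 3
    have "form M (swap M y e0) (?e i) = 0" unfolding f form_ax(1) using exhaust_3[of i] by (auto simp: axis_def)
    then show "?e i \<in> tangent M y" unfolding swap_facts(2)[OF assms] tangent_def by simp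
    fix j :: 3
    show "form M (?e i) (?e j) = (if i = j then 1 else 0)"
      unfolding f using exhaust_3[of i] exhaust_3[of j] by (auto simp: form_ax(1)) (auto simp: axis_def)
  qed
  then show ?thesis unfolding frame_def by (rule someI[where P = "orthonormal_frame M y"])
qed

lemma frameD:
  assumes "y \<in> points M"
  shows "frame M y i \<in> tangent M y" "form M (frame M y i) (frame M y j) = (if i = j then 1 else 0)"
    "form M y (frame M y i) = 0" "form M (frame M y i) y = 0"
  using frame_exists[OF assms] by (auto simp: orthonormal_frame_def tangentD)

text \<open>
  Expansion in an orthonormal frame.  This compares Riemannian lengths with the ambient norm, in which
  derivatives within the manifold are defined.
\<close>

lemma tangent_norm_le:
  assumes "y \<in> points M"
  obtains C where "C > 0" "\<And>v. v \<in> tangent M y \<Longrightarrow> norm v \<le> C * sqrt (form M v v)"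
proof -
  let ?e = "frame M y"
  define C where "C = 1 + (\<Sum>i\<in>UNIV. norm (?e i))"
  have "norm v \<le> C * sqrt (form M v v)" if v: "v \<in> tangent M y" for v
  proof -
    have "v = cc M v y *\<^sub>R y + (\<Sum>i\<in>UNIV. form M (?e i) v *\<^sub>R ?e i)"
      by (rule frame_expand[OF assms frame_exists[OF assms]])
    then have "v = (\<Sum>i\<in>UNIV. form M (?e i) v *\<^sub>R ?e i)" using v by (simp add: tangentD)
    then have "norm v \<le> (\<Sum>i\<in>UNIV. norm (form M (?e i) v *\<^sub>R ?e i))" by (metis norm_sum)
    also have "\<dots> \<le> (\<Sum>i\<in>UNIV. sqrt (form M v v) * norm (?e i))"
    proof (rule sum_mono)
      fix i
      have "\<bar>form M (?e i) v\<bar> \<le> sqrt (form M v v)"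
        using tangent_cauchy_schwarz[OF assms frameD(1)[OF assms] v, of i] frameD(2)[OF assms, of i i] by simp
      then show "norm (form M (?e i) v *\<^sub>R ?e i) \<le> sqrt (form M v v) * norm (?e i)" by (simp add: mult_right_mono)
    qed
    also have "\<dots> \<le> C * sqrt (form M v v)"
      using tangent_pos(1)[OF assms v] by (simp add: C_def sum_distrib_left algebra_simps)
    finally show ?thesis .
  qed
  moreover have "C > 0" unfolding C_def by (smt (verit) norm_ge_zero sum_nonneg)
  ultimately show ?thesis using that by blast
qed

section \<open>The volume measure in the chart and its invariance\<close>

lemma isom_inverse:
  assumes "isom M R"
  obtains R' where "isom M R'" "\<And>x. R' (R x) = x" "\<And>x. R (R' x) = x"
proof -
  have l: "linear R" and f: "\<And>u v. form M (R u) (R v) = form M u v" and p: "\<And>x. x \<in> points M \<Longrightarrow> R x \<in> points M"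
    using assms by (auto simp: isom_def)
  have "inj R"
  proof (rule injI)
    fix x y assume "R x = R y"
    then have "form M x z = form M y z" for z by (metis f)
    then show "x = y" by (rule form_nondegenerate)
  qed
  then obtain R' where R': "linear R'" "\<And>x. R' (R x) = x" "\<And>x. R (R' x) = x"
    using linear_injective_isomorphism[OF l] by auto
  have "isom M R'"
  proof (rule isomI)
    show "form M (R' u) (R' v) = form M u v" for u v by (metis f R'(3))
    show "R e0 \<in> points M" "R' (R e0) \<in> points M" using p e0_point R'(2) by auto
  qed (fact R')
  then show ?thesis using R' that by blast
qed

text \<open>
  The conformal factor of the chart is \<open>2 / pp\<close>.  The chart is the projection from \<open>- e0\<close>: the vector \<open>chart M
  u + e0\<close> is a multiple of \<open>e0 + emb u\<close>.  Its inverse is \<open>stereo\<close>.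
\<close>

definition pp :: "space_form \<Rightarrow> real^3 \<Rightarrow> real" where "pp M u = 1 + curv M * (u \<bullet> u)"

definition emb :: "real^3 \<Rightarrow> real^4" where "emb u = vector [0, u $ 1, u $ 2, u $ 3]"

definition stereo :: "real^4 \<Rightarrow> real^3" where
  "stereo x = (1 / (1 + x $ 1)) *\<^sub>R vector [x $ 2, x $ 3, x $ 4]"

lemma emb_components [simp]: "emb u $ 1 = 0" "emb u $ 2 = u $ 1" "emb u $ 3 = u $ 2" "emb u $ 4 = u $ 3"
  by (simp_all add: emb_def)

lemma bounded_linear_emb: "bounded_linear emb"
  unfolding linear_conv_bounded_linear[symmetric] by (rule linearI) (simp_all add: tri_ext)

lemma form_emb: "form M (emb u) (emb v) = u \<bullet> v" "form M e0 (emb u) = 0" "form M (emb u) e0 = 0" "form M e0 e0 = curv M"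
  by (simp_all add: form_ax) (simp_all add: form_def inner_vec_def sum_3)

lemma chart_dom_pp: "u \<in> chart_dom M \<longleftrightarrow> pp M u > 0"
  by (simp add: chart_dom_def pp_def)

lemma continuous_pp: "continuous_on A (pp M)"
  unfolding pp_def by (intro continuous_intros)

lemma open_chart_dom: "open (chart_dom M)"
proof -
  have "open {u. pp M u > 0}" by (rule open_Collect_less) (auto intro: continuous_pp)
  moreover have "chart_dom M = {u. pp M u > 0}" using chart_dom_pp by blast
  ultimately show ?thesis by simp
qed

lemma chart_eq: "u \<in> chart_dom M \<Longrightarrow> chart M u = (2 / pp M u) *\<^sub>R (e0 + emb u) - e0"
  by (simp add: chart_dom_pp chart_def tri_ext axis_def)
     (simp add: pp_def field_simps)

lemma chart_e0_coord: "u \<in> chart_dom M \<Longrightarrow> chart M u $ 1 = 2 / pp M u - 1"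
  by (simp add: chart_eq)

lemma chart_point: assumes "u \<in> chart_dom M" shows "chart M u \<in> points M"
proof -
  have p: "pp M u > 0" using assms by (simp add: chart_dom_pp)
  have k: "curv M * pp M u = curv M + u \<bullet> u" by (simp add: pp_def distrib_left)
  have "form M (chart M u) (chart M u) = (2 / pp M u)\<^sup>2 * (curv M * pp M u) - 2 * (2 / pp M u) * curv M + curv M"
  proof -
    define m where "m = e0 + emb u"
    have m: "form M m m = curv M * pp M u" "form M m e0 = curv M" "form M e0 m = curv M"
      unfolding m_def k by (simp_all add: form_lin form_emb)
    show ?thesis unfolding chart_eq[OF assms] m_def[symmetric]
      by (simp add: form_lin m form_emb power2_eq_square)
  qed
  also have "\<dots> = curv M" using p by (simp add: field_simps power2_eq_square)
  finally have fm: "form M (chart M u) (chart M u) = curv M" .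
  show ?thesis
  proof (cases M)
    case H3
    have "pp M u \<le> 1" using H3 by (simp add: pp_def)
    then have "2 / pp M u > 1" using p by simp
    then show ?thesis using fm H3 chart_e0_coord[OF assms] by (simp add: points_def)
  qed (use fm in \<open>simp add: points_def\<close>)
qed

definition dchart :: "space_form \<Rightarrow> real^3 \<Rightarrow> real^3 \<Rightarrow> real^4" where
  "dchart M u h = - (4 * curv M * (u \<bullet> h) / (pp M u)\<^sup>2) *\<^sub>R (e0 + emb u) + (2 / pp M u) *\<^sub>R emb h"

lemma chart_derivative:
  assumes "u \<in> chart_dom M"
  shows "(chart M has_derivative dchart M u) (at u)"
proof -
  have p: "pp M u > 0" using assms by (simp add: chart_dom_pp)
  have "((\<lambda>u. (2 / pp M u) *\<^sub>R (e0 + emb u) - e0) has_derivative dchart M u) (at u)"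
  proof -
    have d1: "((\<lambda>u. 2 / pp M u) has_derivative (\<lambda>h. - (4 * curv M * (u \<bullet> h) / (pp M u)\<^sup>2))) (at u)"
      using p unfolding pp_def
      by (auto intro!: derivative_eq_intros simp: fun_eq_iff power2_eq_square inner_commute)
    have d2: "((\<lambda>u. e0 + emb u) has_derivative emb) (at u)"
      using has_derivative_add[OF has_derivative_const bounded_linear_imp_has_derivative[OF bounded_linear_emb]] by simp
    have "((\<lambda>u. (2 / pp M u) *\<^sub>R (e0 + emb u) - e0) has_derivative
       (\<lambda>h. (2 / pp M u) *\<^sub>R emb h + (- (4 * curv M * (u \<bullet> h) / (pp M u)\<^sup>2)) *\<^sub>R (e0 + emb u) - 0)) (at u)"
      by (intro has_derivative_diff has_derivative_const has_derivative_scaleR d1 d2)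
    then show ?thesis unfolding dchart_def[abs_def] by (simp add: add.commute)
  qed
  then show ?thesis
    by (rule has_derivative_transform_within_open[OF _ open_chart_dom assms]) (simp add: chart_eq)
qed

text \<open>
  The terms with the product of \<open>u \<bullet> h\<close> and \<open>u \<bullet> k\<close> cancel, since \<open>e0 + emb u\<close> has square
  \<open>curv M * pp M u\<close>.
\<close>

lemma dchart_conformal:
  assumes "u \<in> chart_dom M"
  shows "form M (dchart M u h) (dchart M u k) = (2 / pp M u)\<^sup>2 * (h \<bullet> k)"
proof -
  have p: "pp M u > 0" using assms by (simp add: chart_dom_pp)
  have k: "form M (e0 + emb u) (e0 + emb u) = curv M * pp M u" by (simp add: form_lin form_emb pp_def distrib_left)
  have k': "form M (e0 + emb u) (emb h) = u \<bullet> h" "form M (emb h) (e0 + emb u) = u \<bullet> h" for h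
    by (simp_all add: form_lin form_emb inner_commute)
  have "form M (dchart M u h) (dchart M u k) =
     (4 * curv M * (u \<bullet> h) / (pp M u)\<^sup>2) * (4 * curv M * (u \<bullet> k) / (pp M u)\<^sup>2) * (curv M * pp M u)
     - (4 * curv M * (u \<bullet> h) / (pp M u)\<^sup>2) * (2 / pp M u) * (u \<bullet> k)
     - (4 * curv M * (u \<bullet> k) / (pp M u)\<^sup>2) * (2 / pp M u) * (u \<bullet> h)
     + (2 / pp M u)\<^sup>2 * (h \<bullet> k)"
  proof -
    define m where "m = e0 + emb u"
    show ?thesis using k k'
      unfolding dchart_def m_def[symmetric] by (simp add: form_lin form_emb power2_eq_square algebra_simps)
  qed
  also have "\<dots> = (2 / pp M u)\<^sup>2 * (h \<bullet> k)"
  proof -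
    have "16 * (x * y) * (curv M * curv M * curv M) / (P * P * P) = 16 * curv M * (x * y) / (P * P * P)" for x y P :: real
      by simp
    then show ?thesis using p by (simp add: field_simps power2_eq_square)
  qed
  finally show ?thesis .
qed

lemma gram_eq:
  assumes "u \<in> chart_dom M"
  shows "sqrt (det (gram M u)) = (2 / pp M u) ^ 3"
proof -
  have p: "pp M u > 0" using assms by (simp add: chart_dom_pp)
  have "frechet_derivative (chart M) (at u) = dchart M u"
    using frechet_derivative_at[OF chart_derivative[OF assms]] by simp
  then have g: "gram M u = (\<chi> i j. if i = j then (2 / pp M u)\<^sup>2 else 0)"
    by (simp add: gram_def dchart_conformal[OF assms] inner_axis_axis vec_eq_iff)
  have "det (gram M u) = ((2 / pp M u) ^ 3)\<^sup>2"
    unfolding g det_3 by (simp add: power2_eq_square power3_eq_cube)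
  then show ?thesis using p by (intro real_sqrt_unique) auto
qed

lemma sets_vol [measurable_cong]: "sets (vol M) = sets (restrict_space borel (points M))"
  by (simp add: vol_def)

lemma space_vol [simp]: "space (vol M) = points M"
  by (simp add: vol_def space_restrict_space)

lemma points_borel [measurable]: "points M \<in> sets borel"
  by (rule borel_closed[OF closed_points])

lemma chart_dom_borel [measurable]: "chart_dom M \<in> sets borel"
  by (rule borel_open[OF open_chart_dom])

lemma pp_measurable [measurable]: "pp M \<in> borel_measurable borel"
  by (rule borel_measurable_continuous_onI) (rule continuous_pp)

lemma chart_continuous: "continuous_on (chart_dom M) (chart M)"
  using chart_derivative by (meson has_derivative_continuous continuous_at_imp_continuous_on)

lemma chart_measurable [measurable]:
  "chart M \<in> restrict_space lborel (chart_dom M) \<rightarrow>\<^sub>M restrict_space borel (points M)"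
proof (rule measurable_restrict_space2)
  show "chart M \<in> space (restrict_space lborel (chart_dom M)) \<rightarrow> points M"
    using chart_point by (auto simp: space_restrict_space)
  have "chart M \<in> borel_measurable (restrict_space borel (chart_dom M))"
    by (rule borel_measurable_continuous_on_restrict[OF chart_continuous])
  then show "chart M \<in> borel_measurable (restrict_space lborel (chart_dom M))"
    using measurable_cong_sets[OF sets_restrict_space_cong[OF sets_lborel] refl] by blast
qed

lemma vol_eq:
  "vol M = distr (density (restrict_space lborel (chart_dom M)) (\<lambda>u. ennreal ((2 / pp M u) ^ 3)))
     (restrict_space borel (points M)) (chart M)"
proof -
  have m: "(\<lambda>u. ennreal ((2 / pp M u) ^ 3)) \<in> borel_measurable (restrict_space lborel (chart_dom M))"
    by (rule measurable_restrict_space1) measurable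
  have e: "sqrt (det (gram M u)) = (2 / pp M u) ^ 3" if "u \<in> space (restrict_space lborel (chart_dom M))" for u
    using that gram_eq by (simp add: space_restrict_space)
  have m': "(\<lambda>u. ennreal (sqrt (det (gram M u)))) \<in> borel_measurable (restrict_space lborel (chart_dom M))"
    using m by (subst measurable_cong[where g = "\<lambda>u. ennreal ((2 / pp M u) ^ 3)"]) (simp_all add: e)
  have "density (restrict_space lborel (chart_dom M)) (\<lambda>u. ennreal (sqrt (det (gram M u))))
     = density (restrict_space lborel (chart_dom M)) (\<lambda>u. ennreal ((2 / pp M u) ^ 3))"
    by (rule density_cong[OF m' m]) (rule AE_I2, simp add: e)
  then show ?thesis by (simp add: vol_def)
qed

lemma nn_integral_vol:
  assumes "g \<in> borel_measurable (vol M)"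
  shows "(\<integral>\<^sup>+x. g x \<partial>vol M) = (\<integral>\<^sup>+u. ennreal (indicator (chart_dom M) u * (2 / pp M u) ^ 3) * g (chart M u) \<partial>lborel)"
proof -
  have g: "g \<in> borel_measurable (restrict_space borel (points M))" using assms measurable_cong_sets[OF sets_vol refl] by blast
  have m: "(\<lambda>u. ennreal ((2 / pp M u) ^ 3)) \<in> borel_measurable (restrict_space lborel (chart_dom M))"
    by (rule measurable_restrict_space1) measurable
  have gc: "(\<lambda>u. g (chart M u)) \<in> borel_measurable (restrict_space lborel (chart_dom M))"
    using measurable_compose[OF chart_measurable g] .
  have "(\<integral>\<^sup>+x. g x \<partial>vol M) = (\<integral>\<^sup>+u. g (chart M u) \<partial>density (restrict_space lborel (chart_dom M)) (\<lambda>u. ennreal ((2 / pp M u) ^ 3)))"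
    unfolding vol_eq using g by (intro nn_integral_distr) (simp_all add: chart_measurable)
  also have "\<dots> = (\<integral>\<^sup>+u. ennreal ((2 / pp M u) ^ 3) * g (chart M u) \<partial>restrict_space lborel (chart_dom M))"
    by (rule nn_integral_density[OF m gc])
  also have "\<dots> = (\<integral>\<^sup>+u. ennreal ((2 / pp M u) ^ 3) * g (chart M u) * indicator (chart_dom M) u \<partial>lborel)"
    by (rule nn_integral_restrict_space) simp
  also have "\<dots> = (\<integral>\<^sup>+u. ennreal (indicator (chart_dom M) u * (2 / pp M u) ^ 3) * g (chart M u) \<partial>lborel)"
    by (rule nn_integral_cong) (simp add: indicator_def)
  finally show ?thesis .
qed

text \<open>
  The change of variables formula for absolutely integrable maps into \<open>real^1\<close>, carried over to nonnegative
  functions: both sides are finite with the same value, or both are infinite.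
\<close>

lemma nn_integral_change_of_variables:
  fixes f :: "real^3 \<Rightarrow> real" and g :: "real^3 \<Rightarrow> real^3"
  assumes S: "S \<in> sets borel" and T: "g ` S \<in> sets borel"
    and der: "\<And>x. x \<in> S \<Longrightarrow> (g has_derivative g' x) (at x)" and inj: "inj_on g S"
    and J: "\<And>x. x \<in> S \<Longrightarrow> \<bar>det (matrix (g' x))\<bar> = J x"
    and f0: "\<And>x. f x \<ge> 0" and fm: "f \<in> borel_measurable borel"
    and m: "(\<lambda>x. indicator S x * (J x * f (g x))) \<in> borel_measurable borel"
  shows "(\<integral>\<^sup>+x. ennreal (indicator S x * (J x * f (g x))) \<partial>lborel) = (\<integral>\<^sup>+x. ennreal (indicator (g ` S) x * f x) \<partial>lborel)"
proof -
  define F :: "real^3 \<Rightarrow> real^1" where "F x = (\<chi> i. f x)" for x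
  define L where "L x = (\<chi> i::1. J x * f (g x))" for x
  have key: "h absolutely_integrable_on U \<and> integral U h = b \<longleftrightarrow>
      (\<integral>\<^sup>+x. ennreal (indicator U x * h x) \<partial>lborel) = ennreal b"
    if U: "U \<in> sets borel" and h: "\<And>x. x \<in> U \<Longrightarrow> h x \<ge> 0" and hm: "(\<lambda>x. indicator U x * h x) \<in> borel_measurable borel" and b: "b \<ge> 0"
    for U :: "(real^3) set" and h :: "real^3 \<Rightarrow> real" and b
  proof -
    have n: "indicator U x * h x \<ge> 0" for x using h by (simp add: indicator_def)
    have a: "h absolutely_integrable_on U \<longleftrightarrow> integrable lborel (\<lambda>x. indicator U x * h x)"
      unfolding set_integrable_def using integrable_completion[of "\<lambda>x. indicator U x * h x" lborel] hm by simp
    have i: "integral U h = (\<integral>x. indicator U x * h x \<partial>lborel)" if "h absolutely_integrable_on U"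
    proof -
      have "integral U h = (\<integral>x. indicator U x * h x \<partial>lebesgue)"
        using set_lebesgue_integral_eq_integral(2)[OF that] by (simp add: set_lebesgue_integral_def)
      also have "\<dots> = (\<integral>x. indicator U x * h x \<partial>lborel)"
        using integral_completion[of "\<lambda>x. indicator U x * h x" lborel] hm by simp
      finally show ?thesis .
    qed
    show ?thesis
    proof
      assume "h absolutely_integrable_on U \<and> integral U h = b"
      then show "(\<integral>\<^sup>+x. ennreal (indicator U x * h x) \<partial>lborel) = ennreal b"
        using a i n by (subst nn_integral_eq_integral) auto
    next
      assume e: "(\<integral>\<^sup>+x. ennreal (indicator U x * h x) \<partial>lborel) = ennreal b"
      then have "integrable lborel (\<lambda>x. indicator U x * h x)"
        using hm n by (intro integrableI_nonneg) auto
      moreover then have "(\<integral>x. indicator U x * h x \<partial>lborel) = b"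
        using e b n by (subst (asm) nn_integral_eq_integral) (auto simp: integral_nonneg_AE)
      ultimately show "h absolutely_integrable_on U \<and> integral U h = b" using a i by auto
    qed
  qed
  have vec: "(\<lambda>x. (\<chi> i::1. h x) :: real^1) absolutely_integrable_on U \<and> integral U (\<lambda>x. (\<chi> i::1. h x)) = (\<chi> i::1. b)
       \<longleftrightarrow> h absolutely_integrable_on U \<and> integral U h = b" for h :: "real^3 \<Rightarrow> real" and U b
  proof -
    have a: "(\<lambda>x. (\<chi> i::1. h x) :: real^1) absolutely_integrable_on U \<longleftrightarrow> h absolutely_integrable_on U"
      by (subst absolutely_integrable_componentwise_iff) (auto simp: Basis_vec_def inner_axis)
    have "integral U (\<lambda>x. (\<chi> i::1. h x)) = (\<chi> i::1. integral U h)" if "h integrable_on U"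
    proof -
      have "(\<lambda>x. (\<chi> i::1. h x) :: real^1) integrable_on U"
        using that by (subst integrable_componentwise_iff) (auto simp: Basis_vec_def inner_axis)
      then show ?thesis
        by (simp add: vec_eq_iff flip: integral_component_eq_cart)
    qed
    then show ?thesis using a set_lebesgue_integral_eq_integral(1)[of U h] by (auto simp: vec_eq_iff)
  qed
  have iff: "(\<integral>\<^sup>+x. ennreal (indicator S x * (J x * f (g x))) \<partial>lborel) = ennreal b \<longleftrightarrow>
      (\<integral>\<^sup>+x. ennreal (indicator (g ` S) x * f x) \<partial>lborel) = ennreal b" if b: "b \<ge> 0" for b
  proof -
    have J0: "J x * f (g x) \<ge> 0" if "x \<in> S" for x using J[OF that] f0 by (metis abs_ge_zero mult_nonneg_nonneg)
    have gm: "(\<lambda>x. indicator (g ` S) x * f x) \<in> borel_measurable borel" using fm T by measurable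
    have "(\<lambda>x. \<bar>det (matrix (g' x))\<bar> *\<^sub>R F (g x)) absolutely_integrable_on S \<and>
           integral S (\<lambda>x. \<bar>det (matrix (g' x))\<bar> *\<^sub>R F (g x)) = (\<chi> i. b)
     \<longleftrightarrow> F absolutely_integrable_on (g ` S) \<and> integral (g ` S) F = (\<chi> i. b)"
      using S inj by (intro has_absolute_integral_change_of_variables) (auto intro: has_derivative_at_withinI der)
    moreover have "\<bar>det (matrix (g' x))\<bar> *\<^sub>R F (g x) = L x" if "x \<in> S" for x
      using J[OF that] by (simp add: L_def F_def vec_eq_iff)
    ultimately have "L absolutely_integrable_on S \<and> integral S L = (\<chi> i. b)
       \<longleftrightarrow> F absolutely_integrable_on (g ` S) \<and> integral (g ` S) F = (\<chi> i. b)"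
      using absolutely_integrable_spike_eq[of "{}" S L "\<lambda>x. \<bar>det (matrix (g' x))\<bar> *\<^sub>R F (g x)"]
        integral_cong[of S "\<lambda>x. \<bar>det (matrix (g' x))\<bar> *\<^sub>R F (g x)" L] by auto
    then show ?thesis
      using vec[where h = f and U = "g ` S" and b = b] vec[where h = "\<lambda>x. J x * f (g x)" and U = S and b = b] key[OF S J0 m b] key[OF T f0 gm b]
      unfolding F_def[abs_def] L_def[abs_def] by blast
  qed
  show ?thesis
  proof (cases "(\<integral>\<^sup>+x. ennreal (indicator S x * (J x * f (g x))) \<partial>lborel)")
    case (real r) then show ?thesis using iff[of r] by simp
  next
    case top
    then show ?thesis
      using iff by (cases "(\<integral>\<^sup>+x. ennreal (indicator (g ` S) x * f x) \<partial>lborel)") auto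
  qed
qed

lemma stereo_chart: "u \<in> chart_dom M \<Longrightarrow> stereo (chart M u) = u"
  by (simp add: chart_eq stereo_def chart_dom_pp vec_eq_iff forall_3)
     (simp add: axis_def)

lemma point_minus_e0:
  assumes "x \<in> points M" "1 + x $ 1 = 0" shows "x = - e0"
proof -
  have x1: "x $ 1 = -1" using assms(2) by simp
  moreover have "M = S3" using assms(1) x1 by (cases M) (auto simp: points_def)
  ultimately have "(x$2)\<^sup>2 + (x$3)\<^sup>2 + (x$4)\<^sup>2 = 0" using assms(1) by (simp add: points_def form_def power2_eq_square)
  then have "x$2 = 0 \<and> x$3 = 0 \<and> x$4 = 0" by (simp add: add_nonneg_eq_0_iff)
  then show ?thesis using x1 by (simp add: tri_ext axis_def)
qed

lemma chart_stereo:
  assumes x: "x \<in> points M" and n: "1 + x $ 1 \<noteq> 0"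
  shows "stereo x \<in> chart_dom M" "chart M (stereo x) = x"
proof -
  have q: "(x$2)\<^sup>2 + (x$3)\<^sup>2 + (x$4)\<^sup>2 = curv M * (1 - (x$1)\<^sup>2)"
    using form_point[OF x] curv_cases[of M] by (auto simp: form_def power2_eq_square)
  have "stereo x \<bullet> stereo x = ((x$2)\<^sup>2 + (x$3)\<^sup>2 + (x$4)\<^sup>2) / (1 + x$1)\<^sup>2"
    by (simp add: stereo_def inner_vec_def sum_3 power2_eq_square add_divide_distrib)
  then have "pp M (stereo x) = 1 + (1 - (x$1)\<^sup>2) / (1 + x$1)\<^sup>2"
    unfolding q pp_def by simp
  also have "\<dots> = 2 / (1 + x$1)" using n by (simp add: divide_simps) (simp add: power2_eq_square algebra_simps)
  finally have p: "pp M (stereo x) = 2 / (1 + x$1)" .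
  have "1 + x $ 1 > 0"
  proof (cases M)
    case H3 then show ?thesis using points_H3_pos x by fastforce
  next
    case S3
    then have "\<bar>x $ 1\<bar> \<le> 1" using x points_S3_norm component_le_norm_cart by metis
    then show ?thesis using n by linarith
  qed
  then have "pp M (stereo x) > 0" unfolding p by simp
  then show d: "stereo x \<in> chart_dom M" by (simp add: chart_dom_pp)
  show "chart M (stereo x) = x"
    unfolding chart_eq[OF d] p using n by (simp add: tri_ext stereo_def axis_def add_divide_distrib)
qed

lemma stereo_differentiable:
  assumes "1 + x $ 1 \<noteq> 0" shows "stereo differentiable (at x)"
proof -
  have "linear (\<lambda>x::real^4. vector [x $ 2, x $ 3, x $ 4] :: real^3)"
    by (rule linearI) (simp_all add: vec_eq_iff forall_3)
  then have "(\<lambda>x::real^4. vector [x $ 2, x $ 3, x $ 4] :: real^3) differentiable (at x)"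
    by (simp add: linear_imp_differentiable)
  moreover have "(\<lambda>x::real^4. 1 / (1 + x $ 1)) differentiable (at x)"
    using assms by (intro differentiable_divide differentiable_add differentiable_const linear_imp_differentiable
       bounded_linear.linear bounded_linear_vec_nth) auto
  ultimately show ?thesis unfolding stereo_def[abs_def] by (rule differentiable_scaleR[rotated])
qed

lemma det_conformal:
  fixes T :: "real^3 \<Rightarrow> real^3"
  assumes l: "linear T" and r: "r > 0" and c: "\<And>h k. T h \<bullet> T k = r\<^sup>2 * (h \<bullet> k)"
  shows "\<bar>det (matrix T)\<bar> = r ^ 3"
proof -
  define O' where "O' h = (1 / r) *\<^sub>R T h" for h
  have lO: "linear O'" unfolding O'_def[abs_def] using l by (rule linear_compose_scale_right)
  have "orthogonal_transformation O'"
    unfolding orthogonal_transformation_def using lO r by (auto simp: O'_def c power2_eq_square)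
  then have "det (matrix O') = 1 \<or> det (matrix O') = -1"
    using orthogonal_transformation_matrix det_orthogonal_matrix by blast
  moreover have "T = ((*\<^sub>R) r) \<circ> O'" using r by (auto simp: O'_def fun_eq_iff)
  then have "matrix T = matrix ((*\<^sub>R) r) ** matrix O'"
    using matrix_compose[OF lO, of "(*\<^sub>R) r"] by (simp add: linear_scaleR)
  then have "det (matrix T) = r ^ 3 * det (matrix O')"
    by (simp add: det_mul del: matrix_scaleR)
  ultimately show ?thesis using r by (auto simp: abs_mult)
qed

lemma isom_measurable:
  assumes "isom M R" shows "R \<in> vol M \<rightarrow>\<^sub>M vol M"
proof -
  have l: "linear R" and p: "R ` points M \<subseteq> points M" using assms by (auto simp: isom_def)
  have "R \<in> borel_measurable borel"
    using l by (intro borel_measurable_continuous_onI linear_continuous_on) (simp add: linear_conv_bounded_linear)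
  then have "R \<in> restrict_space borel (points M) \<rightarrow>\<^sub>M restrict_space borel (points M)"
    using p by (intro measurable_restrict_space2 measurable_restrict_space1) (auto simp: space_restrict_space)
  then show ?thesis using measurable_cong_sets[OF sets_vol sets_vol] by blast
qed

lemma emeasure_vol:
  assumes "A \<in> sets (vol M)"
  shows "emeasure (vol M) A = (\<integral>\<^sup>+u. ennreal ((2 / pp M u) ^ 3 * indicator {u \<in> chart_dom M. chart M u \<in> A} u) \<partial>lborel)"
proof -
  have "emeasure (vol M) A = (\<integral>\<^sup>+x. indicator A x \<partial>vol M)" using assms by simp
  also have "\<dots> = (\<integral>\<^sup>+u. ennreal (indicator (chart_dom M) u * (2 / pp M u) ^ 3) * indicator A (chart M u) \<partial>lborel)"
    by (rule nn_integral_vol) (use assms in simp)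
  also have "\<dots> = (\<integral>\<^sup>+u. ennreal ((2 / pp M u) ^ 3 * indicator {u \<in> chart_dom M. chart M u \<in> A} u) \<partial>lborel)"
    by (rule nn_integral_cong) (simp add: indicator_def)
  finally show ?thesis .
qed

lemma chart_vimage_borel:
  assumes "A \<in> sets (vol M)"
  shows "{u \<in> chart_dom M. chart M u \<in> A} \<in> sets borel"
proof -
  have "chart M -` A \<inter> space (restrict_space lborel (chart_dom M)) \<in> sets (restrict_space lborel (chart_dom M))"
    using chart_measurable by (rule measurable_sets) (use assms in \<open>simp add: sets_vol\<close>)
  then have "chart M -` A \<inter> chart_dom M \<in> sets borel"
    by (auto simp: space_restrict_space sets_restrict_space_iff)
  moreover have "chart M -` A \<inter> chart_dom M = {u \<in> chart_dom M. chart M u \<in> A}" by auto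
  ultimately show ?thesis by simp
qed

text \<open>
  An isometry, read in the chart, is a conformal map whose Jacobian is the cube of the quotient of
  the conformal factors.  It may fail to be defined at one point, the preimage of the centre of projection.
\<close>

lemma vol_isom:
  assumes R: "isom M R"
  shows "distr (vol M) (vol M) R = vol M"
proof (rule measure_eqI)
  show "sets (distr (vol M) (vol M) R) = sets (vol M)" by simp
next
  fix A assume "A \<in> sets (distr (vol M) (vol M) R)"
  then have A: "A \<in> sets (vol M)" by simp
  obtain R' where R': "isom M R'" "\<And>x. R' (R x) = x" "\<And>x. R (R' x) = x" using isom_inverse[OF R] by blast
  have Rp: "R x \<in> points M" "R' x \<in> points M" if "x \<in> points M" for x using R R'(1) that by (auto simp: isom_def)
  have lR: "linear R" "linear R'" using R R'(1) by (auto simp: isom_def)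
  define D where "D Q = {u \<in> chart_dom M. 1 + Q (chart M u) $ 1 \<noteq> 0}" for Q :: "real^4 \<Rightarrow> real^4"
  have opD: "open (D Q)" if "linear Q" for Q
  proof -
    have "continuous_on (chart_dom M) (\<lambda>u. 1 + Q (chart M u) $ 1)"
      using that by (intro continuous_intros linear_continuous_on_compose[OF chart_continuous])
    then have "open ((\<lambda>u. 1 + Q (chart M u) $ 1) -` (- {0}) \<inter> chart_dom M)"
      using continuous_open_preimage[OF _ open_chart_dom, of M _ "- {0}"] by (auto simp: Int_commute open_Compl)
    moreover have "(\<lambda>u. 1 + Q (chart M u) $ 1) -` (- {0}) \<inter> chart_dom M = D Q" by (auto simp: D_def)
    ultimately show ?thesis by simp
  qed
  define \<psi> where "\<psi> u = stereo (R (chart M u))" for u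
  define \<psi>' where "\<psi>' u = stereo (R' (chart M u))" for u
  have \<psi>: "\<psi> u \<in> chart_dom M" "chart M (\<psi> u) = R (chart M u)" "\<psi> u \<in> D R'" "\<psi>' (\<psi> u) = u" if "u \<in> D R" for u
  proof -
    have u: "u \<in> chart_dom M" "1 + R (chart M u) $ 1 \<noteq> 0" using that by (auto simp: D_def)
    note cs = chart_stereo[OF Rp(1)[OF chart_point[OF u(1)]] u(2)]
    show a: "\<psi> u \<in> chart_dom M" "chart M (\<psi> u) = R (chart M u)" using cs by (simp_all add: \<psi>_def)
    have "1 + chart M u $ 1 \<noteq> 0" using u(1) by (simp add: chart_e0_coord chart_dom_pp)
    then show "\<psi> u \<in> D R'" using a by (simp add: D_def R'(2))
    show "\<psi>' (\<psi> u) = u" unfolding \<psi>'_def a(2) R'(2) by (rule stereo_chart[OF u(1)])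
  qed
  have \<psi>': "\<psi>' u \<in> D R" "\<psi> (\<psi>' u) = u" if "u \<in> D R'" for u
  proof -
    have u: "u \<in> chart_dom M" "1 + R' (chart M u) $ 1 \<noteq> 0" using that by (auto simp: D_def)
    note cs = chart_stereo[OF Rp(2)[OF chart_point[OF u(1)]] u(2)]
    have "1 + chart M u $ 1 \<noteq> 0" using u(1) by (simp add: chart_e0_coord chart_dom_pp)
    then show "\<psi>' u \<in> D R" using cs by (simp add: D_def R'(3) \<psi>'_def)
    show "\<psi> (\<psi>' u) = u" using cs stereo_chart[OF u(1)] by (simp add: \<psi>_def \<psi>'_def R'(3))
  qed
  have im: "\<psi> ` D R = D R'" using \<psi> \<psi>' by (metis (no_types, lifting) image_eqI subsetI subset_antisym image_subsetI)
  have inj: "inj_on \<psi> (D R)" using \<psi>(4) by (metis inj_on_inverseI)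
  have der: "(\<psi> has_derivative frechet_derivative \<psi> (at u)) (at u)" if u: "u \<in> D R" for u
  proof -
    have "chart M differentiable (at u)" using chart_derivative u by (auto simp: D_def differentiable_def)
    then have "(\<lambda>u. R (chart M u)) differentiable (at u)"
      by (rule differentiable_compose[OF linear_imp_differentiable[OF lR(1)]])
    moreover have "stereo differentiable (at (R (chart M u)))" using u by (intro stereo_differentiable) (simp add: D_def)
    ultimately have "\<psi> differentiable (at u)"
      unfolding \<psi>_def[abs_def] by (rule differentiable_compose[rotated])
    then show ?thesis by (simp add: frechet_derivative_works)
  qed
  define J where "J u = (pp M (\<psi> u) / pp M u) ^ 3" for u
  have Jac: "\<bar>det (matrix (frechet_derivative \<psi> (at u)))\<bar> = J u" if u: "u \<in> D R" for u
    unfolding J_def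
  proof (rule det_conformal)
    let ?T = "frechet_derivative \<psi> (at u)"
    have ud: "u \<in> chart_dom M" using u by (simp add: D_def)
    have p: "pp M u > 0" "pp M (\<psi> u) > 0" using ud \<psi>(1)[OF u] by (auto simp: chart_dom_pp)
    show "linear ?T" using der[OF u] by (rule has_derivative_linear)
    show "pp M (\<psi> u) / pp M u > 0" using p by simp
    have "((\<lambda>u. chart M (\<psi> u)) has_derivative (\<lambda>h. dchart M (\<psi> u) (?T h))) (at u)"
      using has_derivative_compose[OF der[OF u] chart_derivative[OF \<psi>(1)[OF u]]] .
    moreover have "((\<lambda>u. R (chart M u)) has_derivative (\<lambda>h. R (dchart M u h))) (at u)"
      using bounded_linear.has_derivative[OF _ chart_derivative[OF ud], of R] lR(1) linear_conv_bounded_linear by blast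
    then have "((\<lambda>u. chart M (\<psi> u)) has_derivative (\<lambda>h. R (dchart M u h))) (at u)"
      by (rule has_derivative_transform_within_open[OF _ opD[OF lR(1)] u]) (simp add: \<psi>)
    ultimately have eq: "dchart M (\<psi> u) (?T h) = R (dchart M u h)" for h
      by (metis has_derivative_unique)
    fix h k
    have "(2 / pp M (\<psi> u))\<^sup>2 * (?T h \<bullet> ?T k) = form M (R (dchart M u h)) (R (dchart M u k))"
      using dchart_conformal[OF \<psi>(1)[OF u], of "?T h" "?T k"] by (simp add: eq)
    also have "\<dots> = (2 / pp M u)\<^sup>2 * (h \<bullet> k)"
      using R dchart_conformal[OF ud, of h k] by (simp add: isom_def)
    finally show "?T h \<bullet> ?T k = (pp M (\<psi> u) / pp M u)\<^sup>2 * (h \<bullet> k)"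
      using p by (simp add: field_simps power2_eq_square)
  qed
  define AA where "AA = {u \<in> chart_dom M. chart M u \<in> A}"
  define BB where "BB = {u \<in> chart_dom M. chart M u \<in> R -` A \<inter> points M}"
  have RA: "R -` A \<inter> points M \<in> sets (vol M)" using measurable_sets[OF isom_measurable[OF R] A] by simp
  have mAA: "AA \<in> sets borel" "BB \<in> sets borel" unfolding AA_def BB_def by (intro chart_vimage_borel A RA)+
  define f where "f u = \<bar>2 / pp M u\<bar> ^ 3 * indicator AA u" for u
  have Jf: "indicator (D R) u * (J u * f (\<psi> u)) = \<bar>2 / pp M u\<bar> ^ 3 * indicator (BB \<inter> D R) u" for u
  proof (cases "u \<in> D R")
    case True
    then have "pp M u > 0" "pp M (\<psi> u) > 0" using \<psi>(1) by (auto simp: chart_dom_pp D_def)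
    moreover have "\<psi> u \<in> AA \<longleftrightarrow> u \<in> BB"
      using True \<psi>(1,2)[OF True] chart_point by (auto simp: AA_def BB_def D_def)
    ultimately show ?thesis using True by (auto simp: f_def J_def indicator_def field_simps)
  qed simp
  have "(\<integral>\<^sup>+u. ennreal (\<bar>2 / pp M u\<bar> ^ 3 * indicator (BB \<inter> D R) u) \<partial>lborel) =
     (\<integral>\<^sup>+u. ennreal (indicator (D R) u * (J u * f (\<psi> u))) \<partial>lborel)"
    unfolding Jf ..
  also have "\<dots> = (\<integral>\<^sup>+u. ennreal (indicator (\<psi> ` D R) u * f u) \<partial>lborel)"
  proof (rule nn_integral_change_of_variables[OF _ _ der inj Jac])
    show "D R \<in> sets borel" "\<psi> ` D R \<in> sets borel" unfolding im using opD lR by (auto intro: borel_open)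
    show "f \<in> borel_measurable borel" unfolding f_def using mAA by measurable
    have "D R \<in> sets borel" using opD lR by (auto intro: borel_open)
    then show "(\<lambda>u. indicator (D R) u * (J u * f (\<psi> u))) \<in> borel_measurable borel"
      unfolding Jf using mAA by measurable
  qed (auto simp: f_def)
  finally have eq: "(\<integral>\<^sup>+u. ennreal (\<bar>2 / pp M u\<bar> ^ 3 * indicator (BB \<inter> D R) u) \<partial>lborel) =
     (\<integral>\<^sup>+u. ennreal (indicator (D R') u * f u) \<partial>lborel)" unfolding im .
  have null: "AE u in lborel. u \<in> chart_dom M \<longrightarrow> u \<in> D Q"
    if Q: "isom M Q" "\<And>x. Q' (Q x) = x" for Q Q'
  proof -
    have "u = stereo (Q' (- e0))" if "u \<in> chart_dom M" "u \<notin> D Q" for u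
    proof -
      have "Q (chart M u) = - e0" using that Q(1) chart_point[OF that(1)] by (intro point_minus_e0[of _ M]) (auto simp: D_def isom_def)
      then have "chart M u = Q' (- e0)" by (metis Q(2))
      then show ?thesis using stereo_chart[OF that(1)] by simp
    qed
    then show ?thesis using AE_lborel_singleton[of "stereo (Q' (- e0))"] by (auto elim!: eventually_mono)
  qed
  have "emeasure (distr (vol M) (vol M) R) A = emeasure (vol M) (R -` A \<inter> points M)"
    using emeasure_distr[OF isom_measurable[OF R] A] by simp
  also have "\<dots> = (\<integral>\<^sup>+u. ennreal ((2 / pp M u) ^ 3 * indicator BB u) \<partial>lborel)"
    unfolding emeasure_vol[OF RA] BB_def ..
  also have "\<dots> = (\<integral>\<^sup>+u. ennreal (\<bar>2 / pp M u\<bar> ^ 3 * indicator (BB \<inter> D R) u) \<partial>lborel)"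
    using null[OF R R'(2)] by (intro nn_integral_cong_AE) (auto elim!: eventually_mono simp: indicator_def BB_def chart_dom_pp)
  also have "\<dots> = (\<integral>\<^sup>+u. ennreal (indicator (D R') u * f u) \<partial>lborel)" by (rule eq)
  also have "\<dots> = (\<integral>\<^sup>+u. ennreal ((2 / pp M u) ^ 3 * indicator AA u) \<partial>lborel)"
    using null[OF R'(1,3)] by (intro nn_integral_cong_AE) (auto elim!: eventually_mono simp: indicator_def AA_def f_def chart_dom_pp)
  also have "\<dots> = emeasure (vol M) A" unfolding emeasure_vol[OF A] AA_def ..
  finally show "emeasure (distr (vol M) (vol M) R) A = emeasure (vol M) A" .
qed

lemma integral_isom:
  fixes g :: "real^4 \<Rightarrow> 'b::{banach, second_countable_topology}"
  assumes "isom M R" "g \<in> borel_measurable (vol M)"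
  shows "(\<integral>x. g (R x) \<partial>vol M) = (\<integral>x. g x \<partial>vol M)"
    and "integrable (vol M) (\<lambda>x. g (R x)) \<longleftrightarrow> integrable (vol M) g"
  using integral_distr[OF isom_measurable[OF assms(1)] assms(2)]
    integrable_distr_eq[OF isom_measurable[OF assms(1)] assms(2)] vol_isom[OF assms(1)] by simp_all

section \<open>Integration of radial functions\<close>

text \<open>The norm pushes Lebesgue measure of \<open>\<real>\<^sup>3\<close> forward to the measure with the volume of balls as distribution function.\<close>

lemma distr_norm_lborel:
  "distr (lborel :: (real^3) measure) borel norm = density lborel (\<lambda>r. ennreal (4 * pi * r\<^sup>2 * indicator {0..} r))"
    (is "?L = ?R")
proof (rule measure_eqI_generator_eq[where \<Omega> = UNIV and E = "range (\<lambda>a::real. {..a})" and A = "\<lambda>i. {..real i}"])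
  show "Int_stable (range (\<lambda>a::real. {..a}))"
    by (auto simp: Int_stable_def)
  have b: "sets (borel :: real measure) = sigma_sets UNIV (range (\<lambda>a. {..a}))"
    by (subst borel_eq_atMost) simp
  show "sets ?L = sigma_sets UNIV (range (\<lambda>a::real. {..a}))" "sets ?R = sigma_sets UNIV (range (\<lambda>a::real. {..a}))"
    using b by simp_all
  have L: "emeasure ?L {..a} = ennreal (if a \<ge> 0 then 4 / 3 * pi * a ^ 3 else 0)" for a
  proof -
    have "emeasure ?L {..a} = emeasure (lborel :: (real^3) measure) (norm -` {..a})"
      by (subst emeasure_distr) simp_all
    also have "\<dots> = ennreal (if a \<ge> 0 then 4 / 3 * pi * a ^ 3 else 0)"
    proof (cases "a \<ge> 0")
      case True
      have "norm -` {..a} = cball (0::real^3) a" by auto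
      then show ?thesis using True by (simp add: emeasure_cball unit_ball_vol_3)
    next
      case False
      then have "norm -` {..a} = ({} :: (real^3) set)" by (auto simp: not_le) (meson norm_ge_zero not_le order_less_le_trans)
      then show ?thesis using False by simp
    qed
    finally show ?thesis .
  qed
  show "emeasure ?L X = emeasure ?R X" if "X \<in> range (\<lambda>a::real. {..a})" for X
  proof -
    obtain a where X: "X = {..a}" using \<open>X \<in> _\<close> by auto
    have "emeasure ?R {..a} = (\<integral>\<^sup>+r. ennreal (4 * pi * r\<^sup>2 * indicator {0..} r) * indicator {..a} r \<partial>lborel)"
      by (subst emeasure_density) simp_all
    also have "\<dots> = (\<integral>\<^sup>+r. ennreal (4 * pi * r\<^sup>2) * indicator {0..a} r \<partial>lborel)"
      by (rule nn_integral_cong) (auto simp: indicator_def)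
    also have "\<dots> = ennreal (if a \<ge> 0 then 4 / 3 * pi * a ^ 3 else 0)"
    proof (cases "a \<ge> 0")
      case True
      have "(\<integral>\<^sup>+r. ennreal (4 * pi * r\<^sup>2) * indicator {0..a} r \<partial>lborel) = ennreal (4 / 3 * pi * a ^ 3 - 4 / 3 * pi * 0 ^ 3)"
        using True by (intro nn_integral_FTC_Icc) (auto intro!: derivative_eq_intros)
      then show ?thesis using True by simp
    qed simp
    finally show ?thesis unfolding X L by simp
  qed
  show "(\<Union>i. {..real i}) = UNIV" by (auto intro: real_arch_simple)
  show "emeasure ?L {..real i} \<noteq> \<infinity>" for i unfolding L by simp
qed auto

lemma nn_integral_radial:
  fixes h :: "real \<Rightarrow> ennreal"
  assumes [measurable]: "h \<in> borel_measurable borel"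
  shows "(\<integral>\<^sup>+u. h (norm u) \<partial>(lborel :: (real^3) measure)) = (\<integral>\<^sup>+r. ennreal (4 * pi * r\<^sup>2 * indicator {0..} r) * h r \<partial>lborel)"
proof -
  have "(\<integral>\<^sup>+u. h (norm u) \<partial>(lborel :: (real^3) measure)) = (\<integral>\<^sup>+r. h r \<partial>distr (lborel :: (real^3) measure) borel norm)"
    by (subst nn_integral_distr) simp_all
  also have "\<dots> = (\<integral>\<^sup>+r. ennreal (4 * pi * r\<^sup>2 * indicator {0..} r) * h r \<partial>lborel)"
    unfolding distr_norm_lborel by (subst nn_integral_density) simp_all
  finally show ?thesis .
qed

definition rp :: "space_form \<Rightarrow> real \<Rightarrow> real" where "rp M r = 1 + curv M * r\<^sup>2"

lemma pp_rp: "pp M u = rp M (norm u)"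
  by (simp add: pp_def rp_def dot_square_norm)

lemma rp_measurable [measurable]: "rp M \<in> borel_measurable borel"
  unfolding rp_def by measurable

lemma borel_vol: "g \<in> borel_measurable borel \<Longrightarrow> g \<in> borel_measurable (vol M)"
  using measurable_cong_sets[OF sets_vol refl] measurable_restrict_space1 by blast

lemma continuous_vol:
  "continuous_on (points M) g \<Longrightarrow> g \<in> borel_measurable (vol M)"
  using measurable_cong_sets[OF sets_vol refl] borel_measurable_continuous_on_restrict by blast

lemma nn_integral_vol_radial:
  fixes h :: "real \<Rightarrow> ennreal"
  assumes [measurable]: "h \<in> borel_measurable borel"
  shows "(\<integral>\<^sup>+x. h (x $ 1) \<partial>vol M) =
    (\<integral>\<^sup>+r. ennreal (indicator {r. r \<ge> 0 \<and> rp M r > 0} r * (4 * pi * r\<^sup>2 * (2 / rp M r) ^ 3)) * h (2 / rp M r - 1) \<partial>lborel)"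
proof -
  have "(\<lambda>x::real^4. h (x $ 1)) \<in> borel_measurable (vol M)" by (rule borel_vol) measurable
  then have "(\<integral>\<^sup>+x. h (x $ 1) \<partial>vol M) = (\<integral>\<^sup>+u. ennreal (indicator (chart_dom M) u * (2 / pp M u) ^ 3) * h (chart M u $ 1) \<partial>lborel)"
    by (rule nn_integral_vol)
  also have "\<dots> = (\<integral>\<^sup>+u. ennreal (indicator {r. rp M r > 0} (norm u) * (2 / rp M (norm u)) ^ 3) * h (2 / rp M (norm u) - 1) \<partial>(lborel :: (real^3) measure))"
    by (intro nn_integral_cong) (auto simp: indicator_def chart_e0_coord chart_dom_pp simp flip: pp_rp)
  also have "\<dots> = (\<integral>\<^sup>+r. ennreal (4 * pi * r\<^sup>2 * indicator {0..} r) *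
       (ennreal (indicator {r. rp M r > 0} r * (2 / rp M r) ^ 3) * h (2 / rp M r - 1)) \<partial>lborel)"
    by (rule nn_integral_radial) measurable
  also have "\<dots> = (\<integral>\<^sup>+r. ennreal (indicator {r. r \<ge> 0 \<and> rp M r > 0} r * (4 * pi * r\<^sup>2 * (2 / rp M r) ^ 3)) * h (2 / rp M r - 1) \<partial>lborel)"
    by (intro nn_integral_cong) (auto simp: indicator_def mult.assoc[symmetric] simp flip: ennreal_mult)
  finally show ?thesis .
qed

lemma qq_measurable [measurable]: "qq M \<in> borel_measurable borel"
  unfolding qq_def by measurable

lemma qq_rp: "rp M r > 0 \<Longrightarrow> qq M (2 / rp M r - 1) = 4 * r\<^sup>2 / (rp M r)\<^sup>2"
proof -
  assume p: "rp M r > 0"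
  have "qq M (2 / rp M r - 1) = curv M * (4 * (rp M r - 1)) / (rp M r)\<^sup>2"
    using p by (simp add: qq_def field_simps power2_eq_square)
  then show ?thesis by (simp add: rp_def)
qed

text \<open>
  The kernels below are at most as singular as \<open>1 / qq\<close>, the inverse square of the distance to a point
  and, on \<open>S3\<close>, to its antipode.  In dimension three this is integrable.
\<close>

lemma sing_integrable_e0:
  "(\<integral>\<^sup>+x. ennreal (indicator {..C} (x $ 1) * (1 + 1 / qq M (x $ 1))) \<partial>vol M) < \<infinity>"
proof -
  define C' where "C' = max C 1"
  have C': "C \<le> C'" "C' \<ge> 1" by (auto simp: C'_def)
  define \<delta> where "\<delta> = 2 / (1 + C')"
  have \<delta>: "\<delta> > 0" using C' by (simp add: \<delta>_def)
  let ?B = "32 * pi / \<delta> ^ 3 + 8 * pi / \<delta>"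
  let ?g = "\<lambda>r. case M of S3 \<Rightarrow> ennreal (40 * pi * (1 / (1 + r\<^sup>2))) * indicator {0..} r | H3 \<Rightarrow> ennreal ?B * indicator {0..1} r"
  have "(\<integral>\<^sup>+x. ennreal (indicator {..C} (x $ 1) * (1 + 1 / qq M (x $ 1))) \<partial>vol M)
    = (\<integral>\<^sup>+r. ennreal (indicator {r. r \<ge> 0 \<and> rp M r > 0} r * (4 * pi * r\<^sup>2 * (2 / rp M r) ^ 3)) *
         ennreal (indicator {..C} (2 / rp M r - 1) * (1 + 1 / qq M (2 / rp M r - 1))) \<partial>lborel)"
    by (rule nn_integral_vol_radial) measurable
  also have "\<dots> \<le> (\<integral>\<^sup>+r. ?g r \<partial>lborel)"
  proof (rule nn_integral_mono)
    fix r :: real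
    show "ennreal (indicator {r. r \<ge> 0 \<and> rp M r > 0} r * (4 * pi * r\<^sup>2 * (2 / rp M r) ^ 3)) *
         ennreal (indicator {..C} (2 / rp M r - 1) * (1 + 1 / qq M (2 / rp M r - 1))) \<le> ?g r"
    proof (cases "r \<ge> 0 \<and> rp M r > 0 \<and> 2 / rp M r - 1 \<le> C")
      case True
      define p where "p = rp M r"
      have p: "p > 0" "r \<ge> 0" "2 / p - 1 \<le> C" using True by (auto simp: p_def)
      have e: "4 * pi * r\<^sup>2 * (2 / p) ^ 3 * (1 + 1 / qq M (2 / p - 1)) \<le> 32 * pi * r\<^sup>2 / p ^ 3 + 8 * pi / p"
      proof -
        have qv: "qq M (2 / p - 1) = 4 * r\<^sup>2 / p\<^sup>2" using qq_rp[of M r] True unfolding p_def by simp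
        show ?thesis
        proof (cases "r = 0")
          case False
          have "4 * pi * r\<^sup>2 * (2 / p) ^ 3 * (1 + 1 / (4 * r\<^sup>2 / p\<^sup>2)) = 32 * pi * r\<^sup>2 / p ^ 3 + 8 * pi / p"
            using p(1) False by (simp add: field_simps power2_eq_square power3_eq_cube)
          then show ?thesis unfolding qv by simp
        qed (use p(1) in simp)
      qed
      have l: "ennreal (indicator {r. r \<ge> 0 \<and> rp M r > 0} r * (4 * pi * r\<^sup>2 * (2 / rp M r) ^ 3)) *
         ennreal (indicator {..C} (2 / rp M r - 1) * (1 + 1 / qq M (2 / rp M r - 1)))
         = ennreal (4 * pi * r\<^sup>2 * (2 / p) ^ 3 * (1 + 1 / qq M (2 / p - 1)))"
        using True by (subst ennreal_mult'[symmetric]) (simp_all add: p_def)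
      also have "\<dots> \<le> ennreal (32 * pi * r\<^sup>2 / p ^ 3 + 8 * pi / p)" using e by (rule ennreal_leI)
      also have "\<dots> \<le> ?g r"
      proof (cases M)
        case S3
        then have ps: "p = 1 + r\<^sup>2" by (simp add: p_def rp_def)
        have "1 \<le> p" "r\<^sup>2 \<le> p" unfolding ps by simp_all
        then have "r\<^sup>2 \<le> p ^ 2" using self_le_power[of p 2] by simp
        then have "r\<^sup>2 / p ^ 3 \<le> p\<^sup>2 / p ^ 3" using p by (intro divide_right_mono) auto
        also have "\<dots> = 1 / p" using p by (simp add: power2_eq_square power3_eq_cube)
        finally have "32 * pi * (r\<^sup>2 / p ^ 3) \<le> 32 * pi * (1 / p)" by (rule mult_left_mono) simp
        then have "32 * pi * r\<^sup>2 / p ^ 3 + 8 * pi / p \<le> 32 * pi * (1 / p) + 8 * pi * (1 / p)" by simp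
        also have "\<dots> = 40 * pi * (1 / p)" using p(1) by (simp add: field_simps)
        finally have "32 * pi * r\<^sup>2 / p ^ 3 + 8 * pi / p \<le> 40 * pi * (1 / p)" .
        then have le: "ennreal (32 * pi * r\<^sup>2 / p ^ 3 + 8 * pi / p) \<le> ennreal (40 * pi * (1 / p))" by (rule ennreal_leI)
        have "indicator {0..} r = (1 :: ennreal)" using p(2) by simp
        then show ?thesis using le unfolding S3 by (simp only: space_form.case mult_1_right ps)
      next
        case H3
        then have ph: "p = 1 - r\<^sup>2" by (simp add: p_def rp_def)
        then have r1: "r\<^sup>2 \<le> 1" using p by simp
        then have r1': "r \<le> 1" using p(2) abs_square_le_1[of r] by simp
        have "2 / p \<le> 1 + C'" using p C' by linarith
        then have pd: "\<delta> \<le> p" using p(1) C' by (simp add: \<delta>_def field_simps)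
        have "32 * pi * r\<^sup>2 / p ^ 3 \<le> 32 * pi / \<delta> ^ 3"
          using pd \<delta> r1 p by (intro frac_le power_mono) (auto simp: mult_left_le)
        moreover have "8 * pi / p \<le> 8 * pi / \<delta>" using pd \<delta> by (intro frac_le) auto
        ultimately show ?thesis using H3 p(2) r1' by (simp add: ennreal_leI)
      qed
      finally show ?thesis .
    qed (auto simp: indicator_def)
  qed
  also have "\<dots> < \<infinity>"
  proof (cases M)
    case S3
    have "(\<integral>\<^sup>+r. ennreal (40 * pi * (1 / (1 + r\<^sup>2))) * indicator {0..} r \<partial>lborel) = ennreal (40 * pi * (pi / 2) - 40 * pi * arctan 0)"
    proof (rule nn_integral_FTC_atLeast)
      show "((\<lambda>r. 40 * pi * arctan r) has_real_derivative 40 * pi * (1 / (1 + r\<^sup>2))) (at r)" for r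
        by (auto intro!: derivative_eq_intros simp: divide_inverse)
      show "((\<lambda>r. 40 * pi * arctan r) \<longlongrightarrow> 40 * pi * (pi / 2)) at_top"
        by (intro tendsto_intros tendsto_arctan_at_top)
    qed auto
    then show ?thesis using S3 by simp
  next
    case H3
    then show ?thesis by (simp add: nn_integral_cmult_indicator ennreal_mult_less_top)
  qed
  finally show ?thesis .
qed

text \<open>The integrable majorant of all singular integrands below.\<close>

definition sing :: "space_form \<Rightarrow> real^4 \<Rightarrow> real \<Rightarrow> real^4 \<Rightarrow> real" where
  "sing M y C x = indicator {..C} (cc M x y) * (1 + 1 / qq M (cc M x y))"

lemma continuous_cc: "continuous_on A (\<lambda>x. cc M x y)"
  by (intro continuous_intros form.continuous_on)

lemma cc_borel [measurable]: "(\<lambda>x. cc M x y) \<in> borel_measurable borel"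
  by (rule borel_measurable_continuous_onI) (rule continuous_cc)

lemma sing_integrable:
  assumes y: "y \<in> points M"
  shows "integrable (vol M) (sing M y C)"
proof -
  have m: "sing M z C \<in> borel_measurable (vol M)" for z
    unfolding sing_def[abs_def] by (rule borel_vol) measurable
  have c1: "cc M x e0 = x $ 1" for x by (simp add: form_ax)
  have "integrable (vol M) (sing M e0 C)"
  proof (rule integrableI_bounded)
    have "(\<integral>\<^sup>+x. ennreal (norm (sing M e0 C x)) \<partial>vol M) = (\<integral>\<^sup>+x. ennreal (indicator {..C} (x $ 1) * (1 + 1 / qq M (x $ 1))) \<partial>vol M)"
    proof (rule nn_integral_cong)
      fix x assume "x \<in> space (vol M)"
      then have "qq M (x $ 1) \<ge> 0" using qq_nonneg[OF _ e0_point, of x M] by (simp add: c1)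
      then show "ennreal (norm (sing M e0 C x)) = ennreal (indicator {..C} (x $ 1) * (1 + 1 / qq M (x $ 1)))"
        by (simp add: sing_def c1)
    qed
    then show "(\<integral>\<^sup>+x. ennreal (norm (sing M e0 C x)) \<partial>vol M) < \<infinity>" using sing_integrable_e0 by simp
  qed (rule m)
  moreover have "sing M y C (swap M y x) = sing M e0 C x" for x
  proof -
    have "form M (swap M y x) (swap M y e0) = form M x e0" using swap_facts(1)[OF y] by (simp add: isom_def)
    then show ?thesis by (simp add: sing_def swap_facts(2)[OF y])
  qed
  ultimately have "integrable (vol M) (\<lambda>x. sing M y C (swap M y x))" by simp
  then show ?thesis using integral_isom(2)[OF swap_facts(1)[OF y] m] by simp
qed

lemma sing_nonneg: "x \<in> points M \<Longrightarrow> y \<in> points M \<Longrightarrow> sing M y C x \<ge> 0"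
  using qq_nonneg[of x M y] by (simp add: sing_def)

lemma vol_singleton: "emeasure (vol M) {x} = 0"
proof (cases "{x} \<in> sets (vol M)")
  case True
  have n: "AE u in lborel. u \<noteq> stereo x" by (rule AE_lborel_singleton)
  have "emeasure (vol M) {x} = (\<integral>\<^sup>+u. ennreal ((2 / pp M u) ^ 3 * indicator {u \<in> chart_dom M. chart M u \<in> {x}} u) \<partial>lborel)"
    by (rule emeasure_vol[OF True])
  also have "\<dots> = (\<integral>\<^sup>+u. 0 \<partial>(lborel :: (real^3) measure))"
    using n by (intro nn_integral_cong_AE) (auto elim!: eventually_mono simp: indicator_def dest: stereo_chart)
  finally show ?thesis by simp
qed (simp add: emeasure_notin_sets)

lemma AE_vol_neq: "AE x in vol M. x \<noteq> y"
proof (cases "y \<in> points M")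
  case True
  then have "{y} \<in> sets (vol M)" by (simp add: sets_vol sets_restrict_space_iff)
  then have "{y} \<in> null_sets (vol M)" by (simp add: null_sets_def vol_singleton)
  then show ?thesis by (rule AE_I') auto
next
  case False
  then show ?thesis by (intro AE_I2) auto
qed

section \<open>The mass of the approximate Dirac kernel\<close>

text \<open>
  The second derivative of a fundamental solution, evaluated at \<open>s * t\<close>, times \<open>curv M * (1 - s\<^sup>2)\<close>
  concentrates at the point \<open>t = 1\<close> as \<open>s\<close> tends to 1.  Its leading part is \<open>refk\<close>, up to sign.  Weighted by
  \<open>t\<close> and restricted to \<open>near\<close>, the chart ball of radius 1/2 about the point, \<open>refk\<close> has an elementary
  antiderivative in the chart radius; the total mass is \<open>mass\<close>, which tends to 1.  This replaces an asymptotic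
  analysis of the flux through small spheres.

  The parameter satisfies \<open>s < 1\<close> on \<open>S3\<close> and \<open>s > 1\<close> on \<open>H3\<close>, so that \<open>qq M (s * t)\<close> is positive on the whole
  range of \<open>cc\<close>.
\<close>

definition reg :: "space_form \<Rightarrow> real \<Rightarrow> bool" where "reg M s \<longleftrightarrow> s > 0 \<and> curv M * (1 - s) > 0"

text \<open>The value of \<open>cc\<close> at chart radius 1/2.\<close>

definition t0 :: "space_form \<Rightarrow> real" where "t0 M = (1 - curv M / 4) / (1 + curv M / 4)"

definition near :: "space_form \<Rightarrow> real set" where "near M = {t. curv M * (t - t0 M) \<ge> 0}"

definition refk :: "space_form \<Rightarrow> real \<Rightarrow> real \<Rightarrow> real" where
  "refk M s t = curv M * (1 - s\<^sup>2) * (3 / (4 * pi)) * (1 / (sqrt (qq M (s * t))) ^ 5)"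

definition mass :: "space_form \<Rightarrow> real \<Rightarrow> real" where
  "mass M s = 1 / (sqrt (curv M * ((1 + curv M / 4)\<^sup>2 - s\<^sup>2 * (1 - curv M / 4)\<^sup>2))) ^ 3"

lemma mass_limit: "(mass M \<longlongrightarrow> 1) (at 1)"
proof -
  have "isCont (mass M) 1"
    unfolding mass_def using curv_cases[of M]
    by (intro continuous_intros) (auto simp: power2_eq_square)
  moreover have "mass M 1 = 1" using curv_cases[of M] by (auto simp: mass_def power2_eq_square)
  ultimately show ?thesis by (simp add: isCont_def)
qed

lemma refk_measurable [measurable]: "refk M s \<in> borel_measurable borel"
  unfolding refk_def by measurable

lemma near_borel [measurable]: "near M \<in> sets borel"
  unfolding near_def by measurable

lemma mass_e0:
  assumes s: "reg M s"
  shows "has_bochner_integral (vol M) (\<lambda>x. indicator (near M) (x $ 1) * (x $ 1 * refk M s (x $ 1))) (mass M s)"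
proof (rule has_bochner_integral_nn_integral)
  define p where "p = rp M"
  define m where "m r = curv M * ((p r)\<^sup>2 - s\<^sup>2 * (2 - p r)\<^sup>2)" for r
  have s0: "s > 0" and s1: "curv M * (1 - s) > 0" using s by (auto simp: reg_def)
  have s2: "curv M * (1 - s\<^sup>2) > 0"
  proof -
    have "curv M * (1 - s\<^sup>2) = curv M * (1 - s) * (1 + s)" by (simp add: algebra_simps power2_eq_square)
    also have "\<dots> > 0" by (rule mult_pos_pos) (use s0 s1 in auto)
    finally show ?thesis .
  qed
  have pr: "p r > 0" "2 - p r > 0" "m r > 0" if r: "r \<in> {0..1/2}" for r
  proof -
    have "r * r \<le> 1/2 * (1/2)" using r by (intro mult_mono) auto
    then have r2: "r\<^sup>2 \<le> 1/4" "r\<^sup>2 \<ge> 0" by (auto simp: power2_eq_square)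
    have "p r = 1 + r\<^sup>2 \<or> p r = 1 - r\<^sup>2" using curv_cases[of M] by (auto simp: p_def rp_def)
    then show p: "p r > 0" "2 - p r > 0" using r2 by (elim disjE; linarith)+
    have "curv M * (p r - s * (2 - p r)) = 2 * r\<^sup>2 + curv M * (1 - s) * (2 - p r)"
      using curv_cases[of M] by (auto simp: p_def rp_def algebra_simps)
    then have "curv M * (p r - s * (2 - p r)) > 0" using r2 s1 p by (simp add: add_nonneg_pos)
    moreover have "p r + s * (2 - p r) > 0" using p s0 by (simp add: add_pos_pos)
    moreover have "m r = curv M * (p r - s * (2 - p r)) * (p r + s * (2 - p r))"
      by (simp add: m_def algebra_simps power2_eq_square)
    ultimately show "m r > 0" by simp
  qed
  \<comment> \<open>In polar coordinates of the chart the density is \<open>g\<close> with antiderivative \<open>G\<close>; \<open>m r / (p r)\<^sup>2\<close> is \<open>qq\<close> at \<open>s * t\<close>.\<close>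
  define g where "g r = 24 * r\<^sup>2 * (p r * (2 - p r)) * (curv M * (1 - s\<^sup>2)) / (sqrt (m r)) ^ 5" for r
  define G where "G r = 8 * r ^ 3 / (sqrt (m r)) ^ 3" for r
  have qs: "qq M (s * (2 / p r - 1)) = m r / (p r)\<^sup>2" if "p r > 0" for r
    using that by (simp add: qq_def m_def field_simps power2_eq_square)
  have inear: "2 / p r - 1 \<in> near M \<longleftrightarrow> r \<le> 1/2" if "r \<ge> 0" "p r > 0" for r
  proof -
    have p0: "1 + curv M / 4 > 0" using curv_cases[of M] by auto
    have "curv M * (2 / p r - 1 - t0 M) = curv M * (2 * (1 + curv M / 4 - p r)) / (p r * (1 + curv M / 4))"
      using that(2) p0 by (simp add: t0_def field_simps)
    also have "curv M * (2 * (1 + curv M / 4 - p r)) = 2 * (1/4 - r\<^sup>2)"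
      using curv_cases[of M] by (auto simp: p_def rp_def algebra_simps)
    finally have "curv M * (2 / p r - 1 - t0 M) = 2 * (1/4 - r\<^sup>2) / (p r * (1 + curv M / 4))" .
    moreover have "p r * (1 + curv M / 4) > 0" using that(2) p0 by (rule mult_pos_pos)
    ultimately have "2 / p r - 1 \<in> near M \<longleftrightarrow> 0 \<le> 2 * (1/4 - r\<^sup>2)"
      unfolding near_def mem_Collect_eq by (metis zero_le_divide_iff not_less order_less_imp_le)
    also have "\<dots> \<longleftrightarrow> r\<^sup>2 \<le> 1/4" by auto
    also have "\<dots> \<longleftrightarrow> r\<^sup>2 \<le> (1/2 :: real)\<^sup>2" by (simp add: power2_eq_square)
    also have "\<dots> \<longleftrightarrow> r \<le> 1/2" using that(1) by (simp add: power2_le_iff_abs_le)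
    finally show ?thesis .
  qed
  have "(\<integral>\<^sup>+x. ennreal (indicator (near M) (x $ 1) * (x $ 1 * refk M s (x $ 1))) \<partial>vol M) =
    (\<integral>\<^sup>+r. ennreal (indicator {r. r \<ge> 0 \<and> rp M r > 0} r * (4 * pi * r\<^sup>2 * (2 / rp M r) ^ 3)) *
     ennreal (indicator (near M) (2 / rp M r - 1) * ((2 / rp M r - 1) * refk M s (2 / rp M r - 1))) \<partial>lborel)"
    by (rule nn_integral_vol_radial) measurable
  also have "\<dots> = (\<integral>\<^sup>+r. ennreal (g r) * indicator {0..1/2} r \<partial>lborel)"
  proof (rule nn_integral_cong)
    fix r :: real
    consider "r \<in> {0..1/2}" | "r \<notin> {0..1/2}" "r \<ge> 0" "p r > 0" | "\<not> (r \<ge> 0 \<and> p r > 0)" "r \<notin> {0..1/2}"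
      using pr(1) by blast
    then show "ennreal (indicator {r. r \<ge> 0 \<and> rp M r > 0} r * (4 * pi * r\<^sup>2 * (2 / rp M r) ^ 3)) *
     ennreal (indicator (near M) (2 / rp M r - 1) * ((2 / rp M r - 1) * refk M s (2 / rp M r - 1)))
       = ennreal (g r) * indicator {0..1/2} r"
    proof cases
      case 1
      have sq: "sqrt (m r / (p r)\<^sup>2) = sqrt (m r) / p r" using pr[OF 1] by (simp add: real_sqrt_divide)
      have w: "sqrt (m r) > 0" using pr[OF 1] by simp
      have "4 * pi * r\<^sup>2 * (2 / p r) ^ 3 * ((2 / p r - 1) * refk M s (2 / p r - 1)) = g r"
        unfolding refk_def qs[OF pr(1)[OF 1]] sq g_def using pr[OF 1] w
        by (simp add: field_simps power2_eq_square power3_eq_cube eval_nat_numeral)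
      then show ?thesis using 1 pr[OF 1] inear[of r]
        by (simp add: p_def[symmetric] ennreal_mult'[symmetric])
    next
      case 2
      then show ?thesis using inear[of r] by (simp add: p_def[symmetric])
    qed (auto simp: p_def)
  qed
  also have "\<dots> = ennreal (G (1/2) - G 0)"
  proof (rule nn_integral_FTC_Icc)
    show "g \<in> borel_measurable borel" unfolding g_def m_def p_def by measurable
    fix r :: real assume r: "r \<in> {0..1/2}"
    note P = pr[OF r]
    show "0 \<le> g r" using P s2 by (simp add: g_def)
    define w where "w = sqrt (m r)"
    have w: "w > 0" "w * w = m r" using P by (simp_all add: w_def)
    define m' where "m' = 4 * r * (p r + s\<^sup>2 * (2 - p r))"
    have "(m has_real_derivative m') (at r)"
      unfolding m_def[abs_def] m'_def p_def rp_def[abs_def]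
      using curv_cases[of M]
      by (elim disjE) (auto intro!: derivative_eq_intros simp: algebra_simps power2_eq_square)
    define W where "W r = sqrt (m r)" for r
    have Wr: "W r = w" by (simp add: W_def w_def)
    have dw: "(W has_real_derivative m' / (2 * w)) (at r)"
      unfolding W_def[abs_def] using P \<open>(m has_real_derivative m') (at r)\<close>
      by (auto intro!: derivative_eq_intros simp: w_def divide_simps)
    have "((\<lambda>r. 8 * r ^ 3 / (W r) ^ 3) has_real_derivative
        (24 * r\<^sup>2 * w ^ 3 - 8 * r ^ 3 * (3 * w\<^sup>2 * (m' / (2 * w)))) / (w ^ 3 * w ^ 3)) (at r)"
      using w(1) by (auto intro!: derivative_eq_intros dw simp: Wr power2_eq_square)
    moreover have "(24 * r\<^sup>2 * w ^ 3 - 8 * r ^ 3 * (3 * w\<^sup>2 * (m' / (2 * w)))) / (w ^ 3 * w ^ 3) = g r"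
    proof -
      have k: "2 * m r - r * m' = 2 * (p r * (2 - p r)) * (curv M * (1 - s\<^sup>2))"
      proof -
        have r2: "r * r = curv M * (p r - 1)" by (simp add: p_def rp_def power2_eq_square)
        have "r * m' = 4 * (r * r) * (p r + s\<^sup>2 * (2 - p r))" by (simp add: m'_def)
        then show ?thesis unfolding r2 m_def by (simp add: algebra_simps power2_eq_square)
      qed
      then have k': "2 * (w * w) - r * m' = 2 * (p r * (2 - p r)) * (curv M * (1 - s\<^sup>2))" unfolding w(2) .
      have "(24 * r\<^sup>2 * w ^ 3 - 8 * r ^ 3 * (3 * w\<^sup>2 * (m' / (2 * w)))) / (w ^ 3 * w ^ 3)
        = 12 * r\<^sup>2 * (2 * (w * w) - r * m') / w ^ 5"
        using w(1) by (simp add: field_simps power2_eq_square power3_eq_cube eval_nat_numeral)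
      also have "\<dots> = g r" unfolding k' g_def w_def[symmetric] by simp
      finally show ?thesis .
    qed
    ultimately show "(G has_real_derivative g r) (at r)" unfolding G_def[abs_def] W_def by simp
  qed simp
  also have "G (1/2) - G 0 = mass M s"
    by (simp add: G_def mass_def m_def p_def rp_def power2_eq_square power3_eq_cube)
  finally show "(\<integral>\<^sup>+x. ennreal (indicator (near M) (x $ 1) * (x $ 1 * refk M s (x $ 1))) \<partial>vol M) = ennreal (mass M s)" .
  show "0 \<le> mass M s"
  proof -
    have "m (1/2) > 0" by (rule pr) simp
    then have "curv M * ((1 + curv M / 4)\<^sup>2 - s\<^sup>2 * (1 - curv M / 4)\<^sup>2) > 0" by (simp add: m_def p_def rp_def power2_eq_square)
    then show ?thesis by (simp add: mass_def)
  qed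
  show "(\<lambda>x. indicator (near M) (x $ 1) * (x $ 1 * refk M s (x $ 1))) \<in> borel_measurable (vol M)"
    by (rule borel_vol) measurable
  show "AE x in vol M. 0 \<le> indicator (near M) (x $ 1) * (x $ 1 * refk M s (x $ 1))"
  proof (rule AE_I2)
    fix x :: "real^4" assume "x \<in> space (vol M)"
    then have x: "x \<in> points M" by simp
    show "0 \<le> indicator (near M) (x $ 1) * (x $ 1 * refk M s (x $ 1))"
    proof (cases "x $ 1 \<in> near M")
      case True
      have "x $ 1 \<ge> 0"
      proof (cases M)
        case S3 then show ?thesis using True by (simp add: near_def t0_def)
      next
        case H3 then show ?thesis using x points_H3_pos by fastforce
      qed
      moreover have "qq M (s * x $ 1) \<ge> 0"
      proof -
        have "qq M (s * x $ 1) = qq M (x $ 1) + curv M * (1 - s\<^sup>2) * (x $ 1)\<^sup>2"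
          by (simp add: qq_def algebra_simps power_mult_distrib)
        moreover have "qq M (x $ 1) \<ge> 0" using qq_nonneg[OF x e0_point] by (simp add: form_ax)
        ultimately show ?thesis using s2 by simp
      qed
      ultimately show ?thesis using s2 by (simp add: refk_def)
    qed simp
  qed
qed

lemma mass_integral:
  assumes s: "reg M s" and y: "y \<in> points M"
  shows "has_bochner_integral (vol M) (\<lambda>x. indicator (near M) (cc M x y) * (cc M x y * refk M s (cc M x y))) (mass M s)"
proof -
  let ?f = "\<lambda>y x. indicator (near M) (cc M x y) * (cc M x y * refk M s (cc M x y))"
  have m: "?f y \<in> borel_measurable (vol M)" by (rule borel_vol) measurable
  have e: "cc M (swap M y x) y = x $ 1" for x
  proof -
    have "form M (swap M y x) (swap M y e0) = form M x e0" using swap_facts(1)[OF y] by (simp add: isom_def)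
    then show ?thesis by (simp add: swap_facts(2)[OF y] form_ax)
  qed
  have "has_bochner_integral (vol M) (\<lambda>x. ?f y (swap M y x)) (mass M s)" unfolding e by (rule mass_e0[OF s])
  then show ?thesis using integral_isom[OF swap_facts(1)[OF y] m] by (simp add: has_bochner_integral_iff)
qed

section \<open>Rotations along geodesics\<close>

fun cs :: "space_form \<Rightarrow> real \<Rightarrow> real" where "cs S3 t = cos t" | "cs H3 t = cosh t"
fun sn :: "space_form \<Rightarrow> real \<Rightarrow> real" where "sn S3 t = sin t" | "sn H3 t = sinh t"

lemma cs_sn_sq: "cs M t * cs M t + curv M * (sn M t * sn M t) = 1"
  using cosh_square_eq[of t] by (cases M) (simp_all add: power2_eq_square flip: power2_eq_square)

lemma cs_sn_0 [simp]: "cs M 0 = 1" "sn M 0 = 0" "cs M (- t) = cs M t" "sn M (- t) = - sn M t"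
  by (cases M; simp)+

lemma cs_derivative [derivative_intros]:
  "(cs M has_real_derivative - (curv M * sn M t)) (at t within A)"
  by (cases M) (auto intro!: derivative_eq_intros simp: cs.simps[abs_def])

lemma sn_derivative [derivative_intros]:
  "(sn M has_real_derivative cs M t) (at t within A)"
  by (cases M) (auto intro!: derivative_eq_intros simp: sn.simps[abs_def])

lemma cs_le_2: assumes "\<bar>t\<bar> \<le> 1" shows "\<bar>cs M t\<bar> \<le> 2"
proof (cases M)
  case S3 then show ?thesis by (simp add: order_trans[OF abs_cos_le_one])
next
  case H3
  have e: "exp \<bar>t\<bar> \<le> 3" using assms exp_le order_trans[of "exp \<bar>t\<bar>" "exp 1" 3] by simp
  have "exp (- \<bar>t\<bar>) \<le> exp 0" unfolding exp_le_cancel_iff by simp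
  then have "exp \<bar>t\<bar> + exp (- \<bar>t\<bar>) \<le> 4" using e unfolding exp_zero by linarith
  then have "cosh \<bar>t\<bar> \<le> 2" by (simp add: cosh_def)
  moreover have "cosh \<bar>t\<bar> = cosh t" by (simp add: abs_if)
  ultimately show ?thesis using H3 cosh_real_nonneg[of t] by simp
qed

lemma mean_value_bound:
  fixes g :: "real \<Rightarrow> 'a::real_normed_vector"
  assumes t: "0 \<le> t" and d: "\<And>u. 0 \<le> u \<Longrightarrow> u \<le> t \<Longrightarrow> (g has_vector_derivative g' u) (at u)"
    and B: "\<And>u. 0 \<le> u \<Longrightarrow> u \<le> t \<Longrightarrow> norm (g' u) \<le> B"
  shows "norm (g t - g 0) \<le> B * t"
proof -
  have "norm (g t - g 0) \<le> B * norm (t - 0)"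
  proof (rule differentiable_bound[where f' = "\<lambda>u h. h *\<^sub>R g' u"])
    show "convex {0..t}" by simp
    fix u assume u: "u \<in> {0..t}"
    then show "(g has_derivative (\<lambda>h. h *\<^sub>R g' u)) (at u within {0..t})"
      using d[of u] by (auto simp: has_vector_derivative_def intro: has_derivative_at_withinI)
    show "onorm (\<lambda>h. h *\<^sub>R g' u) \<le> B"
      using B[of u] u by (intro onorm_le) (auto simp: mult.commute[of B] intro!: mult_left_mono)
  qed (use t in auto)
  then show ?thesis using t by simp
qed

lemma small_angle:
  assumes "0 \<le> t" "t \<le> 1"
  shows "\<bar>sn M t\<bar> \<le> 2 * t" "\<bar>cs M t - 1\<bar> \<le> 2 * t\<^sup>2" "\<bar>sn M t - t\<bar> \<le> 2 * t\<^sup>2"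
proof -
  have s: "\<bar>sn M u\<bar> \<le> 2 * u" if "0 \<le> u" "u \<le> 1" for u
    using mean_value_bound[of u "sn M" "cs M" 2] that cs_le_2
    by (auto simp: has_real_derivative_iff_has_vector_derivative[symmetric] intro!: derivative_intros)
  then show "\<bar>sn M t\<bar> \<le> 2 * t" using assms by simp
  have "norm (cs M t - cs M 0) \<le> (2 * t) * t"
  proof (rule mean_value_bound)
    fix u assume u: "0 \<le> u" "u \<le> t"
    show "(cs M has_vector_derivative - (curv M * sn M u)) (at u)"
      by (auto simp: has_real_derivative_iff_has_vector_derivative[symmetric] intro!: derivative_intros)
    show "norm (- (curv M * sn M u)) \<le> 2 * t" using s[of u] u assms by (simp add: abs_mult)
  qed (use assms in auto)
  then show c: "\<bar>cs M t - 1\<bar> \<le> 2 * t\<^sup>2" by (simp add: power2_eq_square)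
  have "norm ((\<lambda>u. sn M u - u) t - (\<lambda>u. sn M u - u) 0) \<le> (2 * t) * t"
  proof (rule mean_value_bound)
    fix u assume u: "0 \<le> u" "u \<le> t"
    show "((\<lambda>u. sn M u - u) has_vector_derivative cs M u - 1) (at u)"
      by (auto simp: has_real_derivative_iff_has_vector_derivative[symmetric] intro!: derivative_eq_intros)
    have "norm (cs M u - cs M 0) \<le> 2 * u"
    proof (rule mean_value_bound)
      fix v assume v: "0 \<le> v" "v \<le> u"
      show "(cs M has_vector_derivative - (curv M * sn M v)) (at v)"
        by (auto simp: has_real_derivative_iff_has_vector_derivative[symmetric] intro!: derivative_intros)
      show "norm (- (curv M * sn M v)) \<le> 2" using s[of v] v u assms by (simp add: abs_mult)
    qed (use u in auto)
    then show "norm (cs M u - 1) \<le> 2 * t" using u by simp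
  qed (use assms in auto)
  then show "\<bar>sn M t - t\<bar> \<le> 2 * t\<^sup>2" by (simp add: power2_eq_square)
qed

definition unit_tangent :: "space_form \<Rightarrow> real^4 \<Rightarrow> real^4 \<Rightarrow> bool" where
  "unit_tangent M y e \<longleftrightarrow> y \<in> points M \<and> e \<in> tangent M y \<and> form M e e = 1"

lemma unit_tangentD:
  assumes "unit_tangent M y e"
  shows "y \<in> points M" "e \<in> tangent M y" "form M e e = 1" "form M y e = 0" "form M e y = 0" "form M y y = curv M"
  using assms by (auto simp: unit_tangent_def tangentD form_point)

lemma unit_tangent_frame: "y \<in> points M \<Longrightarrow> unit_tangent M y (frame M y i)"
  by (simp add: unit_tangent_def frameD)

definition geo :: "space_form \<Rightarrow> real^4 \<Rightarrow> real^4 \<Rightarrow> real \<Rightarrow> real^4" where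
  "geo M y e t = cs M t *\<^sub>R y + sn M t *\<^sub>R e"

text \<open>
  The rotation by \<open>t\<close> in the plane of \<open>y\<close> and \<open>e\<close>, which moves \<open>y\<close> along the geodesic in direction \<open>e\<close>.
\<close>

definition rot :: "space_form \<Rightarrow> real^4 \<Rightarrow> real^4 \<Rightarrow> real \<Rightarrow> real^4 \<Rightarrow> real^4" where
  "rot M y e t x = x + cc M y x *\<^sub>R (geo M y e t - y)
     + form M e x *\<^sub>R (cs M t *\<^sub>R e - (curv M * sn M t) *\<^sub>R y - e)"

definition kil :: "space_form \<Rightarrow> real^4 \<Rightarrow> real^4 \<Rightarrow> real^4 \<Rightarrow> real^4" where
  "kil M a b x = form M a x *\<^sub>R b - form M b x *\<^sub>R a"

lemma kil_tangent: "kil M a b x \<in> tangent M x"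
  by (simp add: kil_def tangent_def form_lin form_sym[of M x])

lemma form_rot:
  assumes "unit_tangent M y e"
  shows "form M y (rot M y e t x) = cs M t * form M y x - sn M t * form M e x"
    "form M e (rot M y e t x) = cs M t * form M e x + curv M * sn M t * form M y x"
  using unit_tangentD[OF assms] by (simp_all add: rot_def geo_def form_lin algebra_simps)

lemma rot_0 [simp]: "rot M y e 0 x = x"
  by (simp add: rot_def geo_def)

lemma linear_rot: "linear (rot M y e t)"
  by (rule linearI) (simp_all add: rot_def form_lin algebra_simps)

lemma rot_form:
  assumes "unit_tangent M y e"
  shows "form M (rot M y e t u) (rot M y e t v) = form M u v"
proof -
  note U = unit_tangentD[OF assms]
  define C S where "C = cs M t" and "S = sn M t"
  have CS: "C * C = 1 - curv M * (S * S)" using cs_sn_sq[of M t] by (simp add: C_def S_def)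
  have "form M (rot M y e t u) (rot M y e t v) = form M u (rot M y e t v)
     + cc M y u * (form M (geo M y e t) (rot M y e t v) - form M y (rot M y e t v))
     + form M e u * (C * form M e (rot M y e t v) - curv M * S * form M y (rot M y e t v) - form M e (rot M y e t v))"
    unfolding rot_def[of M y e t u] C_def S_def by (simp add: form_lin)
  also have "form M (geo M y e t) (rot M y e t v) = C * form M y (rot M y e t v) + S * form M e (rot M y e t v)"
    by (simp add: geo_def form_lin C_def S_def)
  also have "form M u (rot M y e t v) = form M u v + cc M y v * (C * form M y u + S * form M e u - form M y u)
      + form M e v * (C * form M e u - curv M * S * form M y u - form M e u)"
    unfolding rot_def geo_def C_def S_def by (simp add: form_lin form_sym[of M u y] form_sym[of M u e])
  finally show ?thesis unfolding form_rot[OF assms] C_def[symmetric] S_def[symmetric]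
    using curv_cases[of M] CS by (elim disjE) (simp; algebra)+
qed

lemma geo_point: assumes "unit_tangent M y e" shows "geo M y e t \<in> points M"
proof -
  note U = unit_tangentD[OF assms]
  have n: "form M (geo M y e t) (geo M y e t) = curv M * (cs M t * cs M t + curv M * (sn M t * sn M t))"
    by (simp add: geo_def form_lin U algebra_simps)
  show ?thesis
  proof (cases M)
    case S3 then show ?thesis using n cs_sn_sq[of M t] by (simp add: points_def)
  next
    case H3
    have "form H3 (geo H3 y e t) y < 0" using U H3 by (simp add: geo_def form_lin)
    then show ?thesis using H3_sheet[of "geo H3 y e t" y] n cs_sn_sq[of M t] U(1) H3 by simp
  qed
qed

lemma rot_base: assumes "unit_tangent M y e" shows "rot M y e t y = geo M y e t"
  using unit_tangentD[OF assms] by (simp add: rot_def)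

lemma isom_rot: assumes "unit_tangent M y e" shows "isom M (rot M y e t)"
  using isomI[OF linear_rot rot_form[OF assms] unit_tangentD(1)[OF assms]] rot_base[OF assms] geo_point[OF assms] by simp

lemma rot_point: "unit_tangent M y e \<Longrightarrow> x \<in> points M \<Longrightarrow> rot M y e t x \<in> points M"
  using isom_rot[of M y e t] by (auto simp: isom_def)

lemma rot_inverse:
  assumes "unit_tangent M y e" shows "rot M y e (- t) (rot M y e t x) = x"
proof -
  define C S where "C = cs M t" and "S = sn M t"
  have CS: "C * C + curv M * (S * S) = 1" using cs_sn_sq[of M t] by (simp add: C_def S_def)
  let ?a = "cc M y x" and ?b = "form M e x"
  have "rot M y e (- t) (rot M y e t x) = rot M y e t x
     + (C * ?a - curv M * S * ?b) *\<^sub>R (C *\<^sub>R y - S *\<^sub>R e - y)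
     + (C * ?b + S * ?a) *\<^sub>R (C *\<^sub>R e + (curv M * S) *\<^sub>R y - e)"
    unfolding rot_def[of M y e "- t"] form_rot[OF assms]
    by (simp add: geo_def C_def S_def algebra_simps)
  also have "\<dots> = x + (?a * (C * C + curv M * (S * S)) - ?a) *\<^sub>R y + (?b * (C * C + curv M * (S * S)) - ?b) *\<^sub>R e"
    unfolding rot_def geo_def C_def[symmetric] S_def[symmetric]
    by (simp add: tri_ext algebra_simps)
  also have "\<dots> = x" unfolding CS by simp
  finally show ?thesis .
qed

lemma scaleR_const_derivative:
  "(f has_real_derivative f') (at t within A) \<Longrightarrow> ((\<lambda>t. f t *\<^sub>R c) has_vector_derivative f' *\<^sub>R c) (at t within A)"
  using bounded_linear.has_vector_derivative[OF bounded_linear_scaleR_left]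
  by (simp add: has_real_derivative_iff_has_vector_derivative)

lemma rot_derivative:
  assumes "unit_tangent M y e"
  shows "((\<lambda>t. rot M y e t x) has_vector_derivative curv M *\<^sub>R kil M y e (rot M y e t x)) (at t within A)"
proof -
  have "((\<lambda>t. rot M y e t x) has_vector_derivative
      cc M y x *\<^sub>R ((- (curv M * sn M t)) *\<^sub>R y + cs M t *\<^sub>R e) +
      form M e x *\<^sub>R ((- (curv M * sn M t)) *\<^sub>R e - (curv M * cs M t) *\<^sub>R y)) (at t within A)"
    unfolding rot_def geo_def
    by (rule derivative_eq_intros scaleR_const_derivative cs_derivative sn_derivative refl
       bounded_linear.has_vector_derivative[OF bounded_linear_scaleR_right] DERIV_cmult)+ (simp add: algebra_simps)
  also have "cc M y x *\<^sub>R ((- (curv M * sn M t)) *\<^sub>R y + cs M t *\<^sub>R e) +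
      form M e x *\<^sub>R ((- (curv M * sn M t)) *\<^sub>R e - (curv M * cs M t) *\<^sub>R y) = curv M *\<^sub>R kil M y e (rot M y e t x)"
    unfolding kil_def form_rot[OF assms] by (simp add: tri_ext algebra_simps)
  finally show ?thesis .
qed

section \<open>Derivatives within the manifold\<close>

lemma has_derivative_along_curve:
  assumes F: "(F has_derivative D) (at (c t) within points M)"
    and c: "(c has_vector_derivative v) (at t within A)" and A: "c ` A \<subseteq> points M"
  shows "((\<lambda>t. F (c t)) has_vector_derivative D v) (at t within A)"
proof -
  have "(F has_derivative D) (at (c t) within c ` A)" using F A by (rule has_derivative_subset)
  with c have "((\<lambda>t. F (c t)) has_derivative (\<lambda>h. D (h *\<^sub>R v))) (at t within A)"
    unfolding has_vector_derivative_def by (rule has_derivative_in_compose)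
  moreover have "D (h *\<^sub>R v) = h *\<^sub>R D v" for h
    using has_derivative_linear[OF F] by (simp add: linear_cmul)
  ultimately show ?thesis by (simp add: has_vector_derivative_def)
qed

lemma tangent_unit:
  assumes "y \<in> points M" "v \<in> tangent M y" "v \<noteq> 0"
  obtains e where "unit_tangent M y e" "v = sqrt (form M v v) *\<^sub>R e"
proof
  have p: "form M v v > 0" using tangent_pos[OF assms(1,2)] assms(3) by linarith
  let ?e = "(1 / sqrt (form M v v)) *\<^sub>R v"
  show "unit_tangent M y ?e" using assms p by (simp add: unit_tangent_def tangent_lin form_lin)
  show "v = sqrt (form M v v) *\<^sub>R ?e" using p by simp
qed

text \<open>Geodesics realise every tangent vector, so a derivative within the manifold is unique on tangent vectors.\<close>

lemma derivative_unique:
  assumes "(F has_derivative D) (at y within points M)" "(F has_derivative D') (at y within points M)"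
    and y: "y \<in> points M" and v: "v \<in> tangent M y"
  shows "D v = D' v"
proof (cases "v = 0")
  case True
  then show ?thesis using assms(1,2)[THEN has_derivative_linear] by (simp add: linear_0)
next
  case False
  obtain e where e: "unit_tangent M y e" "v = sqrt (form M v v) *\<^sub>R e" using tangent_unit[OF y v False] .
  have c: "((\<lambda>t. rot M y e t y) has_vector_derivative e) (at 0 within UNIV)"
    using rot_derivative[OF e(1), of y 0 UNIV] unit_tangentD[OF e(1)] by (simp add: kil_def)
  have i: "range (\<lambda>t. rot M y e t y) \<subseteq> points M" using rot_point[OF e(1) y] by auto
  have "((\<lambda>t. F (rot M y e t y)) has_vector_derivative D e) (at 0 within UNIV)"
       "((\<lambda>t. F (rot M y e t y)) has_vector_derivative D' e) (at 0 within UNIV)"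
    using assms(1,2) by (intro has_derivative_along_curve[OF _ c i]; simp)+
  then have "D e = D' e" using vector_derivative_unique_at by blast
  then show ?thesis using e(2) assms(1,2)[THEN has_derivative_linear] by (metis linear_cmul)
qed

lemma fd_tangent:
  assumes "(F has_derivative D) (at y within points M)" "y \<in> points M" "v \<in> tangent M y"
  shows "frechet_derivative F (at y within points M) v = D v"
proof -
  have "F differentiable (at y within points M)" using assms(1) by (auto simp: differentiable_def)
  then have "(F has_derivative frechet_derivative F (at y within points M)) (at y within points M)"
    by (simp add: frechet_derivative_works)
  then show ?thesis using derivative_unique[OF _ assms] by blast
qed

lemma gradient_eq:
  assumes "(f has_derivative D) (at y within points M)" "y \<in> points M" "g \<in> tangent M y"
    and "\<And>v. v \<in> tangent M y \<Longrightarrow> form M g v = D v"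
  shows "gradient M f y = g"
  unfolding gradient_def
proof (rule the_equality)
  show "g \<in> tangent M y \<and> (\<forall>v\<in>tangent M y. form M g v = frechet_derivative f (at y within points M) v)"
    using assms fd_tangent[OF assms(1,2)] by simp
next
  fix h assume "h \<in> tangent M y \<and> (\<forall>v\<in>tangent M y. form M h v = frechet_derivative f (at y within points M) v)"
  then show "h = g" using assms fd_tangent[OF assms(1,2)] by (intro tangent_unique[OF assms(2)]) auto
qed

section \<open>Intrinsic differentiability and Killing derivatives\<close>

text \<open>
  \<open>kil M a b\<close> is the Killing field of the infinitesimal rotation in the plane of \<open>a\<close> and \<open>b\<close>, and \<open>lie\<close>
  is differentiation along it.  These fields span all tangent spaces and, unlike a frame, their flows
  preserve the volume and the distance.
\<close>

definition lie :: "space_form \<Rightarrow> real^4 \<Rightarrow> real^4 \<Rightarrow> (real^4 \<Rightarrow> 'b::real_normed_vector) \<Rightarrow> real^4 \<Rightarrow> 'b" where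
  "lie M a b F x = frechet_derivative F (at x within points M) (kil M a b x)"

lemma lie_eq:
  "(F has_derivative D) (at x within points M) \<Longrightarrow> x \<in> points M \<Longrightarrow> lie M a b F x = D (kil M a b x)"
  unfolding lie_def by (rule fd_tangent) (simp_all add: kil_tangent)

text \<open>
  Differentiability of order \<open>n\<close> tested by Killing derivatives, which can be iterated without extending
  functions to the ambient space.
\<close>

primrec Cn :: "space_form \<Rightarrow> nat \<Rightarrow> (real^4 \<Rightarrow> 'b::real_normed_vector) \<Rightarrow> bool" where
  "Cn M 0 F \<longleftrightarrow> continuous_on (points M) F"
| "Cn M (Suc n) F \<longleftrightarrow> (\<forall>y\<in>points M. F differentiable (at y within points M)) \<and> (\<forall>a b. Cn M n (lie M a b F))"

lemma has_derivative_within_cong: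
  assumes "\<And>x. x \<in> A \<Longrightarrow> F x = G x" "y \<in> A"
  shows "(F has_derivative D) (at y within A) \<longleftrightarrow> (G has_derivative D) (at y within A)"
  using assms by (metis (full_types) has_derivative_transform)

lemma lie_cong:
  assumes "\<And>x. x \<in> points M \<Longrightarrow> F x = G x" "y \<in> points M"
  shows "lie M a b F y = lie M a b G y"
  unfolding lie_def frechet_derivative_def
  using has_derivative_within_cong[of "points M" F G, OF assms] by presburger

lemma Cn_cong:
  assumes "\<And>x. x \<in> points M \<Longrightarrow> F x = G x"
  shows "Cn M n F \<longleftrightarrow> Cn M n G"
  using assms
proof (induction n arbitrary: F G)
  case 0
  then show ?case using continuous_on_cong by (metis Cn.simps(1))
next
  case (Suc n)
  have "Cn M n (lie M a b F) = Cn M n (lie M a b G)" for a b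
    using Suc.IH[of "lie M a b F" "lie M a b G"] lie_cong[of M F G] Suc.prems by blast
  moreover have "F differentiable (at y within points M) \<longleftrightarrow> G differentiable (at y within points M)" if "y \<in> points M" for y
    using has_derivative_within_cong[of "points M" F G, OF Suc.prems that] by (simp add: differentiable_def)
  ultimately show ?case by simp
qed

lemma Cn_continuous: "Cn M n F \<Longrightarrow> continuous_on (points M) F"
  by (cases n) (auto simp: continuous_on_eq_continuous_within differentiable_imp_continuous_within)

lemma Cn_mono: "Cn M (Suc n) F \<Longrightarrow> Cn M n F"
proof (induction n arbitrary: F)
  case 0 then show ?case using Cn_continuous[of M "Suc 0" F] by simp
qed simp

lemma Cn_le: "Cn M n F \<Longrightarrow> m \<le> n \<Longrightarrow> Cn M m F"
  by (induction n) (auto simp: le_Suc_eq dest: Cn_mono simp del: Cn.simps(2))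

lemma Cn_derivative:
  "Cn M (Suc n) F \<Longrightarrow> y \<in> points M \<Longrightarrow> (F has_derivative frechet_derivative F (at y within points M)) (at y within points M)"
  by (simp flip: frechet_derivative_works)

lemma Cn_lie: "Cn M (Suc n) F \<Longrightarrow> Cn M n (lie M a b F)"
  by simp

lemma Cn_SucI:
  assumes "\<And>y. y \<in> points M \<Longrightarrow> (F has_derivative D y) (at y within points M)"
    and "\<And>a b. Cn M n (\<lambda>x. D x (kil M a b x))"
  shows "Cn M (Suc n) F"
  using assms(1) assms(2)[THEN Cn_cong[THEN iffD1, rotated]] lie_eq[OF assms(1)]
  by (auto simp: differentiable_def)

lemma Cn_const: "Cn M n (\<lambda>x. c)"
  by (induction n arbitrary: c) (auto intro!: Cn_SucI[where D = "\<lambda>_ _. 0"] simp del: Cn.simps(2))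

lemma Cn_form: "Cn M n (\<lambda>x. form M v x)"
proof (induction n arbitrary: v)
  case 0 show ?case by (auto intro!: continuous_intros form.continuous_on)
next
  case (Suc n)
  show ?case
  proof (rule Cn_SucI[where D = "\<lambda>_ h. form M v h"])
    show "((\<lambda>x. form M v x) has_derivative (\<lambda>h. form M v h)) (at y within points M)" for y
      by (intro bounded_linear_imp_has_derivative form.bounded_linear_right)
    fix a b
    have "form M v (kil M a b x) = form M (form M v b *\<^sub>R a - form M v a *\<^sub>R b) x" for x
      by (simp add: kil_def form_lin)
    then show "Cn M n (\<lambda>x. form M v (kil M a b x))" using Suc.IH by presburger
  qed
qed

lemma Cn_add: "Cn M n F \<Longrightarrow> Cn M n G \<Longrightarrow> Cn M n (\<lambda>x. F x + G x)"
proof (induction n arbitrary: F G)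
  case 0 then show ?case by (simp add: continuous_on_add)
next
  case (Suc n)
  show ?case
  proof (rule Cn_SucI)
    show "((\<lambda>x. F x + G x) has_derivative (\<lambda>h. frechet_derivative F (at y within points M) h
        + frechet_derivative G (at y within points M) h)) (at y within points M)" if "y \<in> points M" for y
      using Suc.prems that by (intro has_derivative_add Cn_derivative)
    show "Cn M n (\<lambda>x. frechet_derivative F (at x within points M) (kil M a b x)
        + frechet_derivative G (at x within points M) (kil M a b x))" for a b
      using Suc.IH Suc.prems[THEN Cn_lie, of a b] by (simp add: lie_def[abs_def])
  qed
qed

lemma Cn_bounded_linear: "bounded_linear L \<Longrightarrow> Cn M n F \<Longrightarrow> Cn M n (\<lambda>x. L (F x))"
proof (induction n arbitrary: F)
  case 0 then show ?case by (auto intro: bounded_linear.continuous_on)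
next
  case (Suc n)
  show ?case
  proof (rule Cn_SucI)
    show "((\<lambda>x. L (F x)) has_derivative (\<lambda>h. L (frechet_derivative F (at y within points M) h))) (at y within points M)"
      if "y \<in> points M" for y
      using Suc.prems that by (intro bounded_linear.has_derivative[OF Suc.prems(1)] Cn_derivative)
    show "Cn M n (\<lambda>x. L (frechet_derivative F (at x within points M) (kil M a b x)))" for a b
      using Suc.IH[OF Suc.prems(1)] Suc.prems(2)[THEN Cn_lie, of a b] by (simp add: lie_def[abs_def])
  qed
qed

lemma Cn_bilinear:
  assumes B: "bounded_bilinear B"
  shows "Cn M n F \<Longrightarrow> Cn M n G \<Longrightarrow> Cn M n (\<lambda>x. B (F x) (G x))"
proof (induction n arbitrary: F G)
  case 0 then show ?case by (auto intro: bounded_bilinear.continuous_on[OF B])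
next
  case (Suc n)
  show ?case
  proof (rule Cn_SucI)
    show "((\<lambda>x. B (F x) (G x)) has_derivative (\<lambda>h. B (F y) (frechet_derivative G (at y within points M) h)
        + B (frechet_derivative F (at y within points M) h) (G y))) (at y within points M)" if "y \<in> points M" for y
      using Suc.prems that by (intro bounded_bilinear.FDERIV[OF B] Cn_derivative)
    show "Cn M n (\<lambda>x. B (F x) (frechet_derivative G (at x within points M) (kil M a b x))
        + B (frechet_derivative F (at x within points M) (kil M a b x)) (G x))" for a b
      using Suc.IH[of F "lie M a b G"] Suc.IH[of "lie M a b F" G] Suc.prems Suc.prems[THEN Cn_lie, of a b] Suc.prems[THEN Cn_mono]
      by (intro Cn_add) (simp_all add: lie_def[abs_def] del: Cn.simps(2))
  qed
qed

lemmas Cn_scaleR = Cn_bilinear[OF bounded_bilinear_scaleR]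
lemmas Cn_mult = Cn_bilinear[OF bounded_bilinear_mult]

lemma Cn_sum: "finite A \<Longrightarrow> (\<And>i. i \<in> A \<Longrightarrow> Cn M n (F i)) \<Longrightarrow> Cn M n (\<lambda>x. \<Sum>i\<in>A. F i x)"
  by (induction A rule: finite_induct) (simp_all add: Cn_const Cn_add)

lemma Cn_nth: "Cn M n (\<lambda>x. x $ a)"
proof -
  have "(\<lambda>x. eps M a * form M (ax a) x) = (\<lambda>x. x $ a)" by (simp add: form_ax fun_eq_iff flip: mult.assoc)
  then show ?thesis using Cn_mult[OF Cn_const Cn_form, of M n "eps M a" "ax a"] by simp
qed

lemma lie_bilinear:
  assumes F: "F differentiable (at x within points M)"
  shows "lie M (a + a') b F x = lie M a b F x + lie M a' b F x"
    "lie M (r *\<^sub>R a) b F x = r *\<^sub>R lie M a b F x"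
    "lie M a (b + b') F x = lie M a b F x + lie M a b' F x"
    "lie M a (r *\<^sub>R b) F x = r *\<^sub>R lie M a b F x"
    "lie M a a F x = 0"
proof -
  have l: "linear (frechet_derivative F (at x within points M))" using F by (rule linear_frechet_derivative)
  have "kil M (a + a') b x = kil M a b x + kil M a' b x" "kil M (r *\<^sub>R a) b x = r *\<^sub>R kil M a b x"
     "kil M a (b + b') x = kil M a b x + kil M a b' x" "kil M a (r *\<^sub>R b) x = r *\<^sub>R kil M a b x" "kil M a a x = 0"
    by (simp_all add: kil_def form_lin algebra_simps)
  then show "lie M (a + a') b F x = lie M a b F x + lie M a' b F x"
    "lie M (r *\<^sub>R a) b F x = r *\<^sub>R lie M a b F x"
    "lie M a (b + b') F x = lie M a b F x + lie M a b' F x"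
    "lie M a (r *\<^sub>R b) F x = r *\<^sub>R lie M a b F x" "lie M a a F x = 0"
    using l by (simp_all add: lie_def linear_add linear_cmul linear_0)
qed

text \<open>Vanishing outside a bounded set, the substitute for compact support; it is automatic on \<open>S3\<close>.\<close>

definition bsupp :: "space_form \<Rightarrow> (real^4 \<Rightarrow> 'b::real_normed_vector) \<Rightarrow> bool" where
  "bsupp M F \<longleftrightarrow> (\<exists>C. \<forall>x\<in>points M. F x \<noteq> 0 \<longrightarrow> norm x \<le> C)"

lemma bsupp_S3: "bsupp S3 F"
  unfolding bsupp_def by (intro exI[of _ 1]) (simp add: points_S3_norm)

lemma supp_lie:
  assumes C: "\<And>x. x \<in> points M \<Longrightarrow> F x \<noteq> 0 \<Longrightarrow> norm x \<le> C"
    and x: "x \<in> points M" "lie M a b F x \<noteq> 0"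
  shows "norm x \<le> C"
proof (rule ccontr)
  assume "\<not> ?thesis"
  then have n: "norm x > C" by simp
  have "open {z::real^4. norm z > C}" by (intro open_Collect_less continuous_intros)
  then obtain d where d: "d > 0" "\<And>z. dist z x < d \<Longrightarrow> norm z > C"
    using n unfolding open_dist by blast
  have "((\<lambda>_. 0) has_derivative (\<lambda>_. 0)) (at x within points M)" by simp
  then have "(F has_derivative (\<lambda>_. 0)) (at x within points M)"
    by (rule has_derivative_transform_within[OF _ d(1) x(1)]) (use C d in force)
  then show False using x(2) by (simp add: lie_eq[OF _ x(1)])
qed

lemma bsupp_lie: assumes "bsupp M F" shows "bsupp M (lie M a b F)"
  using assms supp_lie[of M F _ _ a b] unfolding bsupp_def by metis

lemma bsupp_image: "bsupp M F \<Longrightarrow> (\<And>x. x \<in> points M \<Longrightarrow> F x = 0 \<Longrightarrow> G x = 0) \<Longrightarrow> bsupp M G"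
  unfolding bsupp_def by metis

lemma bsupp_bounded:
  assumes c: "continuous_on (points M) F" and b: "bsupp M F"
  obtains B where "B > 0" "\<And>x. x \<in> points M \<Longrightarrow> norm (F x) \<le> B"
proof -
  obtain C where C: "\<And>x. x \<in> points M \<Longrightarrow> F x \<noteq> 0 \<Longrightarrow> norm x \<le> C" using b by (auto simp: bsupp_def)
  have "compact (points M \<inter> cball 0 C)" using closed_points by (intro closed_Int_compact) auto
  then have "compact (F ` (points M \<inter> cball 0 C))"
    using c by (intro compact_continuous_image) (auto intro: continuous_on_subset)
  then obtain B where B: "\<And>x. x \<in> points M \<inter> cball 0 C \<Longrightarrow> norm (F x) \<le> B"
    using compact_imp_bounded bounded_iff by (metis (no_types, lifting) imageI)
  have "norm (F x) \<le> max B 1" if "x \<in> points M" for x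
    using B[of x] C[of x] that by (cases "F x = 0") auto
  then show ?thesis using that[of "max B 1"] by simp
qed

lemma flow_derivative:
  assumes "unit_tangent M y e" "x \<in> points M" "Cn M (Suc n) F"
  shows "((\<lambda>t. F (rot M y e t x)) has_vector_derivative curv M *\<^sub>R lie M y e F (rot M y e t x)) (at t)"
proof -
  let ?D = "frechet_derivative F (at (rot M y e t x) within points M)"
  have D: "(F has_derivative ?D) (at (rot M y e t x) within points M)"
    using assms rot_point by (intro Cn_derivative)
  have "((\<lambda>t. F (rot M y e t x)) has_vector_derivative ?D (curv M *\<^sub>R kil M y e (rot M y e t x))) (at t within UNIV)"
    by (rule has_derivative_along_curve[OF D rot_derivative[OF assms(1)]]) (use rot_point assms in auto)
  then show ?thesis using has_derivative_linear[OF D] by (simp add: lie_def linear_cmul)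
qed

section \<open>Smooth functions are intrinsically smooth\<close>

lemma frechet_derivative_cong_open:
  assumes "open U" "x \<in> U" "\<And>x. x \<in> U \<Longrightarrow> f x = g x"
  shows "frechet_derivative f (at x) = frechet_derivative g (at x)"
proof -
  have "(f has_derivative D) (at x) \<longleftrightarrow> (g has_derivative D) (at x)" for D
    using has_derivative_transform_within_open[OF _ assms(1,2), of f D UNIV g]
      has_derivative_transform_within_open[OF _ assms(1,2), of g D UNIV f] assms(3) by auto
  then show ?thesis by (simp add: frechet_derivative_def)
qed

lemma Ck_on_cong:
  assumes U: "open U" and "\<And>x. x \<in> U \<Longrightarrow> f x = g x"
  shows "Ck_on k f U \<Longrightarrow> Ck_on k g U"
  using assms(2)
proof (induction k arbitrary: f g)
  case 0 then show ?case using continuous_on_cong by (metis Ck_on.simps(1))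
next
  case (Suc k)
  have "Ck_on k (\<lambda>x. frechet_derivative g (at x) v) U" for v
    using Suc.IH[of "\<lambda>x. frechet_derivative f (at x) v" "\<lambda>x. frechet_derivative g (at x) v"]
      Suc.prems frechet_derivative_cong_open[OF U, of _ f g] by fastforce
  moreover have "g differentiable_on U"
    using Suc.prems has_derivative_within_cong[of U f g] unfolding differentiable_on_def differentiable_def
    by (metis Ck_on.simps(2) differentiable_def differentiable_on_def)
  ultimately show ?case by simp
qed

lemma Ck_on_mono: "open U \<Longrightarrow> Ck_on (Suc k) f U \<Longrightarrow> Ck_on k f U"
proof (induction k arbitrary: f)
  case 0
  then show ?case by (simp add: differentiable_imp_continuous_on)
next
  case (Suc k)
  have "f differentiable_on U \<and> (\<forall>v. Ck_on (Suc k) (\<lambda>x. frechet_derivative f (at x) v) U)"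
    by (rule iffD1[OF Ck_on.simps(2) Suc.prems(2)])
  then show ?case using Suc.IH[OF Suc.prems(1)] by (intro iffD2[OF Ck_on.simps(2)]) blast
qed

lemma Ck_on_has_derivative:
  "open U \<Longrightarrow> Ck_on (Suc k) f U \<Longrightarrow> x \<in> U \<Longrightarrow> (f has_derivative frechet_derivative f (at x)) (at x)"
  unfolding Ck_on.simps(2) frechet_derivative_works[symmetric]
  using differentiable_on_eq_differentiable_at[of U f] by blast

lemma Ck_on_SucI:
  assumes U: "open U" and "\<And>x. x \<in> U \<Longrightarrow> (f has_derivative D x) (at x)" "\<And>v. Ck_on k (\<lambda>x. D x v) U"
  shows "Ck_on (Suc k) f U"
proof -
  have "Ck_on k (\<lambda>x. frechet_derivative f (at x) v) U" for v
    by (rule Ck_on_cong[OF U _ assms(3)]) (use frechet_derivative_at[OF assms(2)] in auto)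
  moreover have "f differentiable_on U"
    using assms(2) by (auto simp: differentiable_on_def differentiable_def intro: has_derivative_at_withinI)
  ultimately show ?thesis by simp
qed

lemma Ck_on_add: "open U \<Longrightarrow> Ck_on k f U \<Longrightarrow> Ck_on k g U \<Longrightarrow> Ck_on k (\<lambda>x. f x + g x) U"
proof (induction k arbitrary: f g)
  case 0 then show ?case by (simp add: continuous_on_add)
next
  case (Suc k)
  show ?case
  proof (rule Ck_on_SucI[OF Suc.prems(1)])
    show "((\<lambda>x. f x + g x) has_derivative (\<lambda>h. frechet_derivative f (at x) h + frechet_derivative g (at x) h)) (at x)"
      if "x \<in> U" for x
      by (intro has_derivative_add Ck_on_has_derivative[OF Suc.prems(1,2) that] Ck_on_has_derivative[OF Suc.prems(1,3) that])
    show "Ck_on k (\<lambda>x. frechet_derivative f (at x) v + frechet_derivative g (at x) v) U" for v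
      by (rule Suc.IH[OF Suc.prems(1)]) (use Suc.prems(2,3) in simp_all)
  qed
qed

lemma Ck_on_zero: "open U \<Longrightarrow> Ck_on k (\<lambda>x. 0) U"
  by (induction k) (auto intro!: Ck_on_SucI[where D = "\<lambda>_ _. 0"] simp del: Ck_on.simps(2))

lemma Ck_on_sum: "open U \<Longrightarrow> finite A \<Longrightarrow> (\<And>i. i \<in> A \<Longrightarrow> Ck_on k (f i) U) \<Longrightarrow> Ck_on k (\<lambda>x. \<Sum>i\<in>A. f i x) U"
  by (rotate_tac 1, induction A rule: finite_induct) (auto simp: Ck_on_zero Ck_on_add)

lemma Ck_on_bounded_linear: "open U \<Longrightarrow> bounded_linear L \<Longrightarrow> Ck_on k f U \<Longrightarrow> Ck_on k (\<lambda>x. L (f x)) U"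
proof (induction k arbitrary: f)
  case 0 then show ?case by (auto intro: bounded_linear.continuous_on)
next
  case (Suc k)
  show ?case
  proof (rule Ck_on_SucI[OF Suc.prems(1)])
    show "((\<lambda>x. L (f x)) has_derivative (\<lambda>h. L (frechet_derivative f (at x) h))) (at x)" if "x \<in> U" for x
      by (intro bounded_linear.has_derivative[OF Suc.prems(2)] Ck_on_has_derivative[OF Suc.prems(1,3) that])
    show "Ck_on k (\<lambda>x. L (frechet_derivative f (at x) v)) U" for v
      by (rule Suc.IH[OF Suc.prems(1,2)]) (use Suc.prems(3) in simp)
  qed
qed

lemma Ck_on_linear_scaleR:
  fixes l :: "'a::real_normed_vector \<Rightarrow> real"
  assumes U: "open U" and l: "bounded_linear l"
  shows "Ck_on k f U \<Longrightarrow> Ck_on k (\<lambda>x. l x *\<^sub>R f x) U"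
proof (induction k arbitrary: f)
  case 0
  then show ?case using linear_continuous_on[OF l] by (auto intro: continuous_on_scaleR)
next
  case (Suc k)
  show ?case
  proof (rule Ck_on_SucI[OF U])
    show "((\<lambda>x. l x *\<^sub>R f x) has_derivative (\<lambda>h. l x *\<^sub>R frechet_derivative f (at x) h + l h *\<^sub>R f x)) (at x)"
      if "x \<in> U" for x
      using bounded_linear_imp_has_derivative[OF l] Ck_on_has_derivative[OF U Suc.prems that]
      by (intro has_derivative_scaleR)
    show "Ck_on k (\<lambda>x. l x *\<^sub>R frechet_derivative f (at x) v + l v *\<^sub>R f x) U" for v
      using Suc.IH Suc.prems Ck_on_mono[OF U Suc.prems]
      by (intro Ck_on_add[OF U] Ck_on_bounded_linear[OF U bounded_linear_scaleR_right]) auto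
  qed
qed

lemma smooth_differentiable:
  assumes "smooth M F" "y \<in> points M"
  shows "F differentiable (at y within points M)"
proof -
  obtain U G where U: "open U" "y \<in> U" "\<And>k. Ck_on k G U" "\<And>x. x \<in> U \<inter> points M \<Longrightarrow> G x = F x"
    using assms by (metis smooth_def)
  have "(G has_derivative frechet_derivative G (at y)) (at y)" using Ck_on_has_derivative[OF U(1) U(3)[of "Suc 0"] U(2)] .
  then have G: "(G has_derivative frechet_derivative G (at y)) (at y within points M)" by (rule has_derivative_at_withinI)
  obtain d where d: "d > 0" "ball y d \<subseteq> U" by (rule openE[OF U(1,2)])
  have eq: "G z = F z" if "z \<in> points M" "dist z y < d" for z
    using that U(4) d(2) by (metis IntI dist_commute mem_ball subsetD)
  have "(F has_derivative frechet_derivative G (at y)) (at y within points M)"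
    by (rule has_derivative_transform_within[OF G d(1) assms(2) eq])
  then show ?thesis by (auto simp: differentiable_def)
qed

text \<open>
  Killing fields are linear, so the Killing derivative of a local extension is a smooth local extension of the
  Killing derivative.
\<close>

lemma smooth_lie:
  assumes "smooth M F" shows "smooth M (lie M a b F)"
  unfolding smooth_def
proof
  fix p assume p: "p \<in> points M"
  obtain U G where U: "open U" "p \<in> U" "\<And>k. Ck_on k G U" "\<And>x. x \<in> U \<inter> points M \<Longrightarrow> G x = F x"
    using assms p by (metis smooth_def)
  define H where "H x = (\<Sum>j\<in>UNIV. (kil M a b x $ j) *\<^sub>R frechet_derivative G (at x) (ax j))" for x
  have "bounded_linear (\<lambda>x. kil M a b x $ j)" for j
    unfolding linear_conv_bounded_linear[symmetric] by (rule linearI) (simp_all add: kil_def form_lin algebra_simps)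
  moreover have "Ck_on k (\<lambda>x. frechet_derivative G (at x) (ax j)) U" for k j
    using U(3)[of "Suc k"] by simp
  ultimately have "Ck_on k H U" for k
    unfolding H_def[abs_def] using U(1) by (intro Ck_on_sum Ck_on_linear_scaleR) auto
  moreover have "H x = lie M a b F x" if x: "x \<in> U \<inter> points M" for x
  proof -
    have D: "(G has_derivative frechet_derivative G (at x)) (at x)" using Ck_on_has_derivative[OF U(1) U(3)[of "Suc 0"]] x by simp
    then have G: "(G has_derivative frechet_derivative G (at x)) (at x within points M)" by (rule has_derivative_at_withinI)
    have xU: "x \<in> U" "x \<in> points M" using x by simp_all
    have "x \<in> U" using x by simp
    then obtain d where d: "d > 0" "ball x d \<subseteq> U" by (rule openE[OF U(1)])
    have eq: "G z = F z" if "z \<in> points M" "dist z x < d" for z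
      using that U(4) d(2) by (metis IntI dist_commute mem_ball subsetD)
    have "(F has_derivative frechet_derivative G (at x)) (at x within points M)"
      by (rule has_derivative_transform_within[OF G d(1) xU(2) eq])
    then have "lie M a b F x = frechet_derivative G (at x) (kil M a b x)" using lie_eq x by blast
    also have "\<dots> = frechet_derivative G (at x) (\<Sum>j\<in>UNIV. (kil M a b x $ j) *\<^sub>R ax j)" by (simp add: sum_ax)
    also have "\<dots> = H x" using has_derivative_linear[OF D] by (simp add: H_def linear_sum linear_cmul)
    finally show ?thesis by simp
  qed
  ultimately show "\<exists>U H. open U \<and> p \<in> U \<and> (\<forall>k. Ck_on k H U) \<and> (\<forall>x\<in>U \<inter> points M. H x = lie M a b F x)"
    using U(1,2) by blast
qed

lemma smooth_Cn: "smooth M F \<Longrightarrow> Cn M n F"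
proof (induction n arbitrary: F)
  case 0
  then show ?case
    by (auto simp: continuous_on_eq_continuous_within intro!: differentiable_imp_continuous_within smooth_differentiable)
qed (simp add: smooth_differentiable smooth_lie)

section \<open>Differentiability along geodesics\<close>

lemma sinh_ge: "0 \<le> x \<Longrightarrow> x \<le> sinh (x::real)"
proof -
  assume x: "0 \<le> x"
  have "(\<lambda>x. sinh x - x) 0 \<le> (\<lambda>x. sinh x - x) x"
  proof (rule DERIV_nonneg_imp_nondecreasing[OF x])
    fix u :: real
    have "((\<lambda>x. sinh x - x) has_real_derivative cosh u - 1) (at u)" by (auto intro!: derivative_eq_intros)
    moreover have "0 \<le> cosh u - 1" using cosh_real_ge_1[of u] by simp
    ultimately show "\<exists>y. ((\<lambda>x. sinh x - x) has_real_derivative y) (at u) \<and> 0 \<le> y" by blast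
  qed
  then show ?thesis by simp
qed

lemma sin_ge_half: assumes "0 \<le> x" "x \<le> pi / 2" shows "x / 2 \<le> sin x"
proof (cases "x \<le> pi / 3")
  case True
  have "(\<lambda>x. sin x - x / 2) 0 \<le> (\<lambda>x. sin x - x / 2) x"
  proof (rule DERIV_nonneg_imp_nondecreasing[OF assms(1)])
    fix u assume u: "0 \<le> u" "u \<le> x"
    have "cos (pi / 3) \<le> cos u" using u True by (intro cos_monotone_0_pi_le) auto
    then have "0 \<le> cos u - 1 / 2" by (simp add: cos_60)
    moreover have "((\<lambda>x. sin x - x / 2) has_real_derivative cos u - 1 / 2) (at u)"
      by (auto intro!: derivative_eq_intros)
    ultimately show "\<exists>y. ((\<lambda>x. sin x - x / 2) has_real_derivative y) (at u) \<and> 0 \<le> y" by blast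
  qed
  then show ?thesis by simp
next
  case False
  have "(\<lambda>x. sin x - x / 2) x \<ge> (\<lambda>x. sin x - x / 2) (pi / 2)"
  proof (rule DERIV_nonpos_imp_nonincreasing[OF assms(2)])
    fix u assume u: "x \<le> u" "u \<le> pi / 2"
    have "cos u \<le> cos (pi / 3)" using u False by (intro cos_monotone_0_pi_le) auto
    then have "cos u - 1 / 2 \<le> 0" by (simp add: cos_60)
    moreover have "((\<lambda>x. sin x - x / 2) has_real_derivative cos u - 1 / 2) (at u)"
      by (auto intro!: derivative_eq_intros)
    ultimately show "\<exists>y. ((\<lambda>x. sin x - x / 2) has_real_derivative y) (at u) \<and> y \<le> 0" by blast
  qed
  then show ?thesis using pi_less_4 by simp
qed

text \<open>The distance of two points as a function of \<open>cc\<close>.\<close>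

definition angle :: "space_form \<Rightarrow> real \<Rightarrow> real" where
  "angle M t = (case M of S3 \<Rightarrow> arccos t | H3 \<Rightarrow> arcosh t)"

lemma angle_facts:
  assumes "y \<in> points M" "z \<in> points M"
  shows "cs M (angle M (cc M y z)) = cc M y z" "sn M (angle M (cc M y z)) = sqrt (qq M (cc M y z))"
    "angle M (cc M y z) \<ge> 0" "M = S3 \<Longrightarrow> angle M (cc M y z) \<le> pi"
proof -
  let ?c = "cc M y z"
  have "cs M (angle M ?c) = ?c \<and> sn M (angle M ?c) = sqrt (qq M ?c) \<and> angle M ?c \<ge> 0 \<and> (M = S3 \<longrightarrow> angle M ?c \<le> pi)"
  proof (cases M)
    case S3
    then have "\<bar>?c\<bar> \<le> 1" using cc_S3_le1 assms by metis
    then show ?thesis using S3 by (simp add: angle_def qq_def sin_arccos abs_le_iff arccos_lbound arccos_ubound)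
  next
    case H3
    then have c: "?c \<ge> 1" using cc_H3_ge1 assms by metis
    have q: "qq M ?c = ?c\<^sup>2 - 1" using H3 by (simp add: qq_def)
    obtain u where u: "u \<ge> 0" "cosh u = ?c" using c
      by (metis arcosh_nonneg_real cosh_arcosh_real)
    then have a: "angle M ?c = u" using H3 arcosh_cosh_real[OF u(1)] by (simp add: angle_def flip: u(2))
    have "(sinh u)\<^sup>2 = (cosh u)\<^sup>2 - 1" by (simp add: cosh_square_eq)
    moreover have "sinh u \<ge> 0" using u by simp
    ultimately have "sinh u = sqrt ((cosh u)\<^sup>2 - 1)" by (metis real_sqrt_unique)
    then show ?thesis using H3 u a q by simp
  qed
  then show "cs M (angle M (cc M y z)) = cc M y z" "sn M (angle M (cc M y z)) = sqrt (qq M (cc M y z))"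
    "angle M (cc M y z) \<ge> 0" "M = S3 \<Longrightarrow> angle M (cc M y z) \<le> pi" by auto
qed

lemma polar:
  assumes y: "y \<in> points M" and z: "z \<in> points M"
  obtains e where "unit_tangent M y e" "z = geo M y e (angle M (cc M y z))"
proof -
  let ?c = "cc M y z" and ?v = "tpart M y z"
  note A = angle_facts[OF y z]
  have t: "?v \<in> tangent M y" and n: "form M ?v ?v = qq M ?c" and zd: "z = ?c *\<^sub>R y + ?v"
    using tpart_tangent[OF y] form_tpart[OF z y] by (simp_all add: form_sym[of M y z] tpart_def)
  show ?thesis
  proof (cases "?v = 0")
    case True
    then have "qq M ?c = 0" using n by (simp add: form_lin)
    then have "z = geo M y (frame M y 1) (angle M ?c)" using zd True A by (simp add: geo_def)
    then show ?thesis using that unit_tangent_frame[OF y] by blast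
  next
    case False
    obtain e where e: "unit_tangent M y e" "?v = sqrt (form M ?v ?v) *\<^sub>R e" using tangent_unit[OF y t False] .
    then have "z = geo M y e (angle M ?c)" using zd A n by (simp add: geo_def)
    then show ?thesis using that e(1) by blast
  qed
qed

lemma form_le_norm: "y \<in> points M \<Longrightarrow> z \<in> points M \<Longrightarrow> 2 * (curv M * (1 - cc M y z)) \<le> (norm (z - y))\<^sup>2"
proof -
  assume y: "y \<in> points M" and z: "z \<in> points M"
  have "form M (z - y) (z - y) = 2 * (curv M * (1 - cc M y z))"
    by (simp add: form_lin form_point[OF y] form_point[OF z] form_sym[of M z y] algebra_simps)
  moreover have "form M w w \<le> (norm w)\<^sup>2" for w
  proof -
    have "(norm w)\<^sup>2 = (w$1)\<^sup>2 + (w$2)\<^sup>2 + (w$3)\<^sup>2 + (w$4)\<^sup>2"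
      by (simp add: norm_vec_def L2_set_def sum_4 add_nonneg_nonneg)
    moreover have "curv M * (w$1 * w$1) \<le> (w$1)\<^sup>2" using curv_cases[of M] by (auto simp: power2_eq_square)
    ultimately show ?thesis by (simp add: form_def power2_eq_square)
  qed
  ultimately show ?thesis by metis
qed

lemma angle_le:
  assumes y: "y \<in> points M" and z: "z \<in> points M"
  shows "angle M (cc M y z) \<le> 2 * norm (z - y)"
proof -
  let ?t = "angle M (cc M y z)"
  note A = angle_facts[OF y z]
  have s: "?t / 4 \<le> sn M (?t / 2)"
  proof (cases M)
    case S3 then show ?thesis using sin_ge_half[of "?t / 2"] A(3,4) by simp
  next
    case H3
    have "?t / 4 \<le> ?t / 2" using A(3) by simp
    then show ?thesis using sinh_ge[of "?t / 2"] A(3) H3 by simp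
  qed
  have "curv M * (1 - cs M ?t) = 2 * (sn M (?t / 2))\<^sup>2"
  proof (cases M)
    case S3 then show ?thesis using cos_double_sin[of "?t / 2"] by simp
  next
    case H3 then show ?thesis using cosh_double_cosh[of "?t / 2"] cosh_square_eq[of "?t / 2"] by simp
  qed
  then have "4 * (sn M (?t / 2))\<^sup>2 \<le> (norm (z - y))\<^sup>2" using form_le_norm[OF y z] A(1) by simp
  then have "(2 * sn M (?t / 2))\<^sup>2 \<le> (norm (z - y))\<^sup>2" by (simp add: power_mult_distrib)
  then have "2 * sn M (?t / 2) \<le> norm (z - y)" by (rule power2_le_imp_le) simp
  then show ?thesis using s by linarith
qed

lemma unit_tangent_norm:
  assumes "y \<in> points M"
  obtains C where "C > 0" "\<And>e. unit_tangent M y e \<Longrightarrow> norm e \<le> C"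
proof -
  obtain C where C: "C > 0" "\<And>v. v \<in> tangent M y \<Longrightarrow> norm v \<le> C * sqrt (form M v v)" using tangent_norm_le[OF assms] by blast
  show ?thesis by (rule that[OF C(1)]) (use C(2) in \<open>force simp: unit_tangent_def\<close>)
qed

lemma geo_near:
  assumes y: "y \<in> points M"
  obtains C where "C > 0" "\<And>e t. unit_tangent M y e \<Longrightarrow> 0 \<le> t \<Longrightarrow> t \<le> 1 \<Longrightarrow> norm (geo M y e t - y - t *\<^sub>R e) \<le> C * t\<^sup>2"
proof -
  obtain C where C: "C > 0" "\<And>e. unit_tangent M y e \<Longrightarrow> norm e \<le> C" using unit_tangent_norm[OF y] by blast
  have "norm (geo M y e t - y - t *\<^sub>R e) \<le> (2 * norm y + 2 * C) * t\<^sup>2" if e: "unit_tangent M y e" and t: "0 \<le> t" "t \<le> 1" for e t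
  proof -
    have "geo M y e t - y - t *\<^sub>R e = (cs M t - 1) *\<^sub>R y + (sn M t - t) *\<^sub>R e" by (simp add: geo_def algebra_simps)
    then have "norm (geo M y e t - y - t *\<^sub>R e) \<le> \<bar>cs M t - 1\<bar> * norm y + \<bar>sn M t - t\<bar> * norm e"
      by (metis norm_scaleR norm_triangle_ineq)
    also have "\<dots> \<le> (2 * t\<^sup>2) * norm y + (2 * t\<^sup>2) * C"
      using small_angle[OF t, of M] C(2)[OF e] by (intro add_mono mult_mono) auto
    finally show ?thesis by (simp add: algebra_simps)
  qed
  then show ?thesis using that[of "2 * norm y + 2 * C"] C(1) by (simp add: add_nonneg_pos)
qed

text \<open>A second-order estimate along all geodesics from \<open>y\<close> gives a derivative within the manifold.\<close>

lemma derivative_from_geodesics: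
  fixes U :: "real^4 \<Rightarrow> 'b::real_normed_vector"
  assumes y: "y \<in> points M" and D: "bounded_linear D"
    and A: "\<And>e t. unit_tangent M y e \<Longrightarrow> 0 \<le> t \<Longrightarrow> t \<le> 1 \<Longrightarrow> norm (U (geo M y e t) - U y - t *\<^sub>R D e) \<le> A * t\<^sup>2"
  shows "(U has_derivative D) (at y within points M)"
proof -
  obtain C where C: "C > 0" "\<And>e t. unit_tangent M y e \<Longrightarrow> 0 \<le> t \<Longrightarrow> t \<le> 1 \<Longrightarrow> norm (geo M y e t - y - t *\<^sub>R e) \<le> C * t\<^sup>2"
    using geo_near[OF y] by blast
  obtain K where K: "K > 0" "\<And>x. norm (D x) \<le> norm x * K" using bounded_linear.pos_bounded[OF D] by blast
  define B where "B = 4 * (\<bar>A\<bar> + C * K)"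
  have B: "B \<ge> 0" using C(1) K(1) by (simp add: B_def)
  have key: "norm (U z - U y - D (z - y)) \<le> B * (norm (z - y))\<^sup>2" if z: "z \<in> points M" "norm (z - y) \<le> 1/2" for z
  proof -
    define t where "t = angle M (cc M y z)"
    obtain e where e: "unit_tangent M y e" "z = geo M y e t" using polar[OF y z(1)] unfolding t_def .
    have t: "0 \<le> t" "t \<le> 2 * norm (z - y)" "t \<le> 1"
      using angle_facts(3)[OF y z(1)] angle_le[OF y z(1)] z(2) by (simp_all add: t_def)
    have "U z - U y - D (z - y) = (U z - U y - t *\<^sub>R D e) - D (z - y - t *\<^sub>R e)"
      using D by (simp add: bounded_linear.linear linear_diff linear_cmul)
    then have "norm (U z - U y - D (z - y)) \<le> norm (U z - U y - t *\<^sub>R D e) + norm (D (z - y - t *\<^sub>R e))"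
      by (metis norm_triangle_ineq4)
    also have "\<dots> \<le> A * t\<^sup>2 + (C * t\<^sup>2) * K"
      using A[OF e(1) t(1,3)] C(2)[OF e(1) t(1,3)] K e(2)
      by (intro add_mono order_trans[OF K(2)] mult_right_mono) auto
    also have "\<dots> \<le> (\<bar>A\<bar> + C * K) * t\<^sup>2" by (simp add: algebra_simps mult_right_mono)
    also have "\<dots> \<le> (\<bar>A\<bar> + C * K) * (2 * norm (z - y))\<^sup>2"
      using t C(1) K(1) by (intro mult_left_mono power_mono) auto
    finally show ?thesis by (simp add: B_def power_mult_distrib algebra_simps)
  qed
  show ?thesis
    unfolding has_derivative_within_alt
  proof (intro conjI D allI impI)
    fix r :: real assume r: "r > 0"
    show "\<exists>d>0. \<forall>z\<in>points M. norm (z - y) < d \<longrightarrow> norm (U z - U y - D (z - y)) \<le> r * norm (z - y)"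
    proof (intro exI conjI ballI impI)
      show "min (1/2) (r / (B + 1)) > 0" using r B by simp
      fix z assume z: "z \<in> points M" "norm (z - y) < min (1/2) (r / (B + 1))"
      have "norm (U z - U y - D (z - y)) \<le> B * norm (z - y) * norm (z - y)"
        using key[OF z(1)] z(2) by (simp add: power2_eq_square mult.assoc)
      also have "\<dots> \<le> r * norm (z - y)"
      proof (rule mult_right_mono)
        have "B * norm (z - y) \<le> (B + 1) * (r / (B + 1))" using z(2) B by (intro mult_mono) auto
        then show "B * norm (z - y) \<le> r" using B by simp
      qed simp
      finally show "norm (U z - U y - D (z - y)) \<le> r * norm (z - y)" .
    qed
  qed
qed

section \<open>Potentials\<close>

definition pot :: "space_form \<Rightarrow> (real \<Rightarrow> real) \<Rightarrow> (real^4 \<Rightarrow> 'b::euclidean_space) \<Rightarrow> real^4 \<Rightarrow> 'b" where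
  "pot M K F y = (\<integral>x. K (cc M x y) *\<^sub>R F x \<partial>vol M)"

text \<open>The bound is locally uniform in both points, so that \<open>pot_derivative\<close> can move the parameter.\<close>

definition kernel :: "space_form \<Rightarrow> (real \<Rightarrow> real) \<Rightarrow> bool" where
  "kernel M K \<longleftrightarrow> (\<forall>y\<in>points M. (\<lambda>x. K (cc M x y)) \<in> borel_measurable (vol M)) \<and>
     (\<forall>T. \<exists>B\<ge>0. \<forall>x\<in>points M. \<forall>y\<in>points M. cc M x y \<le> T \<longrightarrow> \<bar>K (cc M x y)\<bar> \<le> B * (1 + 1 / qq M (cc M x y)))"

lemma kernel_const: "kernel M (\<lambda>_. c)"
  unfolding kernel_def
proof (intro conjI ballI allI exI[of _ "\<bar>c\<bar>"] impI)
  fix x y assume "x \<in> points M" "y \<in> points M"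
  then have "qq M (cc M x y) \<ge> 0" by (rule qq_nonneg)
  then have "1 \<le> 1 + 1 / qq M (cc M x y)" by simp
  then show "\<bar>c\<bar> \<le> \<bar>c\<bar> * (1 + 1 / qq M (cc M x y))" by (simp add: mult_le_cancel_left1)
qed auto

lemma cc_bound:
  assumes "y \<in> points M"
  obtains T where "\<And>x. norm x \<le> C \<Longrightarrow> \<bar>cc M x y\<bar> \<le> T"
proof -
  obtain K where K: "K > 0" "\<And>a b. norm (form M a b) \<le> norm a * norm b * K" using form.pos_bounded[of M] by blast
  have "\<bar>cc M x y\<bar> \<le> \<bar>C\<bar> * norm y * K" if "norm x \<le> C" for x
  proof -
    have "\<bar>cc M x y\<bar> \<le> norm x * norm y * K" using K(2)[of x y] by (simp add: abs_mult)
    also have "\<dots> \<le> \<bar>C\<bar> * norm y * K" using that K(1) by (intro mult_right_mono) auto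
    finally show ?thesis .
  qed
  then show ?thesis using that by blast
qed

lemma sing_dominated:
  fixes g :: "real^4 \<Rightarrow> 'b::euclidean_space"
  assumes "y \<in> points M" "g \<in> borel_measurable (vol M)" "AE x in vol M. norm (g x) \<le> B * sing M y T x"
  shows "integrable (vol M) g"
proof (rule Bochner_Integration.integrable_bound[OF _ assms(2)])
  show "integrable (vol M) (\<lambda>x. B * sing M y T x)" using sing_integrable[OF assms(1)] by simp
  show "AE x in vol M. norm (g x) \<le> norm (B * sing M y T x)" using assms(3) by (auto elim!: eventually_mono)
qed

lemma pot_measurable:
  "kernel M K \<Longrightarrow> continuous_on (points M) F \<Longrightarrow> y \<in> points M \<Longrightarrow> (\<lambda>x. K (cc M x y) *\<^sub>R (F x :: 'b::euclidean_space)) \<in> borel_measurable (vol M)"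
  using continuous_vol[of M F] by (auto simp: kernel_def)

lemma kernel_bound:
  assumes K: "kernel M K" and y: "y \<in> points M"
    and C: "\<And>x. x \<in> points M \<Longrightarrow> F x \<noteq> 0 \<Longrightarrow> cc M x y \<le> T" and A: "\<And>x. x \<in> points M \<Longrightarrow> norm (F x) \<le> A"
  obtains B where "B \<ge> 0" "\<And>x. x \<in> points M \<Longrightarrow> norm (K (cc M x y) *\<^sub>R F x) \<le> B * A * sing M y T x"
proof -
  obtain B where B: "B \<ge> 0" "\<And>x. x \<in> points M \<Longrightarrow> cc M x y \<le> T \<Longrightarrow> \<bar>K (cc M x y)\<bar> \<le> B * (1 + 1 / qq M (cc M x y))"
    using K y unfolding kernel_def by metis
  have "norm (K (cc M x y) *\<^sub>R F x) \<le> B * A * sing M y T x" if x: "x \<in> points M" for x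
  proof (cases "F x = 0")
    case True
    have "A \<ge> 0" using A[OF x] norm_ge_zero order_trans by blast
    then show ?thesis using True B(1) sing_nonneg[OF x y] by simp
  next
    case False
    have "\<bar>K (cc M x y)\<bar> * norm (F x) \<le> (B * (1 + 1 / qq M (cc M x y))) * A"
      using B(2)[OF x C[OF x False]] A[OF x] qq_nonneg[OF x y] B(1) by (intro mult_mono) auto
    then show ?thesis using C[OF x False] by (simp add: sing_def algebra_simps)
  qed
  then show ?thesis using that B(1) by blast
qed

lemma pot_integrable:
  fixes F :: "real^4 \<Rightarrow> 'b::euclidean_space"
  assumes K: "kernel M K" and c: "continuous_on (points M) F" and b: "bsupp M F" and y: "y \<in> points M"
  shows "integrable (vol M) (\<lambda>x. K (cc M x y) *\<^sub>R F x)"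
proof -
  obtain C where C: "\<And>x. x \<in> points M \<Longrightarrow> F x \<noteq> 0 \<Longrightarrow> norm x \<le> C" using b by (auto simp: bsupp_def)
  obtain T where T: "\<And>x. norm x \<le> C \<Longrightarrow> \<bar>cc M x y\<bar> \<le> T" using cc_bound[OF y] by blast
  obtain A where A: "A > 0" "\<And>x. x \<in> points M \<Longrightarrow> norm (F x) \<le> A" using bsupp_bounded[OF c b] by blast
  have CT: "cc M x y \<le> T" if "x \<in> points M" "F x \<noteq> 0" for x using T[OF C[OF that]] by simp
  obtain B where "\<And>x. x \<in> points M \<Longrightarrow> norm (K (cc M x y) *\<^sub>R F x) \<le> B * A * sing M y T x"
    using kernel_bound[where F = F and T = T and A = A, OF K y CT A(2)] by blast
  then show ?thesis
    by (intro sing_dominated[OF y pot_measurable[OF K c y], of "B * A" T] AE_I2) simp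
qed

lemma pot_rot:
  fixes F :: "real^4 \<Rightarrow> 'b::euclidean_space"
  assumes K: "kernel M K" and c: "continuous_on (points M) F" and e: "unit_tangent M y e"
  shows "pot M K F (geo M y e t) = (\<integral>x. K (cc M x y) *\<^sub>R F (rot M y e t x) \<partial>vol M)"
proof -
  have y: "y \<in> points M" using e by (simp add: unit_tangent_def)
  have "pot M K F (geo M y e t) = (\<integral>x. K (cc M (rot M y e t x) (geo M y e t)) *\<^sub>R F (rot M y e t x) \<partial>vol M)"
    unfolding pot_def using pot_measurable[OF K c geo_point[OF e]] by (intro integral_isom(1)[OF isom_rot[OF e], symmetric])
  also have "\<dots> = (\<integral>x. K (cc M x y) *\<^sub>R F (rot M y e t x) \<partial>vol M)"
    unfolding rot_base[OF e, symmetric] rot_form[OF e] ..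
  finally show ?thesis .
qed

lemma integral_diff_diff:
  fixes f g h :: "'a \<Rightarrow> 'b::euclidean_space"
  assumes "integrable N f" "integrable N g" "integrable N h"
  shows "(\<integral>x. f x - g x - r *\<^sub>R h x \<partial>N) = (\<integral>x. f x \<partial>N) - (\<integral>x. g x \<partial>N) - r *\<^sub>R (\<integral>x. h x \<partial>N)"
  using assms by simp

lemma continuous_rot: "continuous_on A (rot M y e t)"
  using linear_rot by (simp add: linear_continuous_on linear_conv_bounded_linear)

lemma lie_linear_sum:
  assumes "finite I" "\<And>i. i \<in> I \<Longrightarrow> F i differentiable (at x within points M)" "x \<in> points M"
  shows "lie M a b (\<lambda>z. \<Sum>i\<in>I. c i *\<^sub>R F i z) x = (\<Sum>i\<in>I. c i *\<^sub>R lie M a b (F i) x)"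
proof -
  have "((\<lambda>z. \<Sum>i\<in>I. c i *\<^sub>R F i z) has_derivative (\<lambda>h. \<Sum>i\<in>I. c i *\<^sub>R frechet_derivative (F i) (at x within points M) h)) (at x within points M)"
    using assms(2) by (intro has_derivative_sum has_derivative_scaleR_right) (simp flip: frechet_derivative_works)
  then show ?thesis unfolding lie_def[of M a b "F _"] by (subst lie_eq) (use assms in auto)
qed

lemma lie_sum_right:
  assumes "finite I" "F differentiable (at x within points M)"
  shows "lie M a (\<Sum>i\<in>I. c i *\<^sub>R b i) F x = (\<Sum>i\<in>I. c i *\<^sub>R lie M a (b i) F x)"
  using assms(1)
proof (induction I rule: finite_induct)
  case empty
  show ?case using lie_bilinear(4)[OF assms(2), of a 0 0] by simp
qed (simp add: lie_bilinear[OF assms(2)])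

lemma lie_tangent_right:
  assumes y: "y \<in> points M" and F: "F differentiable (at x within points M)"
  shows "lie M y w F x = (\<Sum>i\<in>UNIV. form M (frame M y i) w *\<^sub>R lie M y (frame M y i) F x)"
proof -
  have "lie M y w F x = lie M y (cc M w y *\<^sub>R y + (\<Sum>i\<in>UNIV. form M (frame M y i) w *\<^sub>R frame M y i)) F x"
    using frame_expand[OF y frame_exists[OF y], of w] by simp
  then show ?thesis by (simp add: lie_bilinear[OF F] lie_sum_right[OF _ F])
qed

text \<open>Uniformity in the direction \<open>e\<close> comes from expanding it in a frame with bounded coefficients.\<close>

lemma second_lie_bounded:
  fixes F :: "real^4 \<Rightarrow> 'b::euclidean_space"
  assumes F: "Cn M 2 F" and b: "bsupp M F" and y: "y \<in> points M"
  obtains A where "A \<ge> 0" "\<And>e x. unit_tangent M y e \<Longrightarrow> x \<in> points M \<Longrightarrow> norm (lie M y e (lie M y e F) x) \<le> A"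
proof -
  let ?f = "frame M y"
  have F': "Cn M (Suc (Suc 0)) F" using F by (simp add: numeral_2_eq_2)
  have "\<exists>B. B > 0 \<and> (\<forall>x\<in>points M. norm (lie M y (?f i) (lie M y (?f j) F) x) \<le> B)" for i j
    using bsupp_bounded[of M "lie M y (?f i) (lie M y (?f j) F)"] F' b Cn_continuous[of M 0] bsupp_lie by (metis Cn_lie)
  then obtain B where B: "\<And>i j. B i j > 0" "\<And>i j x. x \<in> points M \<Longrightarrow> norm (lie M y (?f i) (lie M y (?f j) F) x) \<le> B i j"
    by metis
  have d0: "F differentiable (at x within points M)" if "x \<in> points M" for x using F' that by simp
  have d1: "lie M y (?f j) F differentiable (at x within points M)" if "x \<in> points M" for x j using F' that by simp
  have d1': "lie M y e F differentiable (at x within points M)" if "x \<in> points M" for x e using F' that by simp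
  have "norm (lie M y e (lie M y e F) x) \<le> (\<Sum>i\<in>UNIV. \<Sum>j\<in>UNIV. B i j)" if e: "unit_tangent M y e" and x: "x \<in> points M" for e x
  proof -
    have ce: "\<bar>form M (?f i) e\<bar> \<le> 1" for i
      using tangent_cauchy_schwarz[OF y frameD(1)[OF y, of i] unit_tangentD(2)[OF e]] frameD(2)[OF y, of i i] unit_tangentD(3)[OF e] by simp
    have "lie M y e (lie M y e F) x = (\<Sum>i\<in>UNIV. form M (?f i) e *\<^sub>R lie M y (?f i) (lie M y e F) x)"
      by (rule lie_tangent_right[OF y d1'[OF x]])
    also have "\<dots> = (\<Sum>i\<in>UNIV. form M (?f i) e *\<^sub>R lie M y (?f i) (\<lambda>z. \<Sum>j\<in>UNIV. form M (?f j) e *\<^sub>R lie M y (?f j) F z) x)"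
      using lie_tangent_right[OF y d0] by (intro sum.cong refl arg_cong2[where f = scaleR] lie_cong[OF _ x]) auto
    also have "\<dots> = (\<Sum>i\<in>UNIV. form M (?f i) e *\<^sub>R (\<Sum>j\<in>UNIV. form M (?f j) e *\<^sub>R lie M y (?f i) (lie M y (?f j) F) x))"
      using d1[OF x] x by (subst lie_linear_sum) auto
    finally have eq: "lie M y e (lie M y e F) x = (\<Sum>i\<in>UNIV. form M (?f i) e *\<^sub>R (\<Sum>j\<in>UNIV. form M (?f j) e *\<^sub>R lie M y (?f i) (lie M y (?f j) F) x))" .
    have "norm (lie M y e (lie M y e F) x) \<le> (\<Sum>i\<in>UNIV. norm (form M (?f i) e *\<^sub>R (\<Sum>j\<in>UNIV. form M (?f j) e *\<^sub>R lie M y (?f i) (lie M y (?f j) F) x)))"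
      unfolding eq by (rule norm_sum)
    also have "\<dots> \<le> (\<Sum>i\<in>UNIV. \<Sum>j\<in>UNIV. B i j)"
    proof (rule sum_mono)
      fix i
      have "norm (\<Sum>j\<in>UNIV. form M (?f j) e *\<^sub>R lie M y (?f i) (lie M y (?f j) F) x) \<le> (\<Sum>j\<in>UNIV. B i j)"
      proof (rule sum_norm_le)
        fix j
        have "\<bar>form M (?f j) e\<bar> * norm (lie M y (?f i) (lie M y (?f j) F) x) \<le> 1 * B i j"
          using ce B(2)[OF x] by (intro mult_mono) auto
        then show "norm (form M (?f j) e *\<^sub>R lie M y (?f i) (lie M y (?f j) F) x) \<le> B i j" by simp
      qed
      then have "\<bar>form M (?f i) e\<bar> * norm (\<Sum>j\<in>UNIV. form M (?f j) e *\<^sub>R lie M y (?f i) (lie M y (?f j) F) x) \<le> 1 * (\<Sum>j\<in>UNIV. B i j)"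
        using ce by (intro mult_mono) auto
      then show "norm (form M (?f i) e *\<^sub>R (\<Sum>j\<in>UNIV. form M (?f j) e *\<^sub>R lie M y (?f i) (lie M y (?f j) F) x)) \<le> (\<Sum>j\<in>UNIV. B i j)"
        by simp
    qed
    finally show ?thesis .
  qed
  moreover have "(\<Sum>i\<in>UNIV. \<Sum>j\<in>UNIV. B i j) \<ge> 0" using B(1) by (intro sum_nonneg) (simp add: less_imp_le)
  ultimately show ?thesis using that by blast
qed

lemma flow_taylor:
  fixes F :: "real^4 \<Rightarrow> 'b::euclidean_space"
  assumes F: "Cn M 2 F" and e: "unit_tangent M y e" and x: "x \<in> points M" and t: "0 \<le> t" "t \<le> 1"
    and A: "A \<ge> 0" "\<And>x. x \<in> points M \<Longrightarrow> norm (lie M y e (lie M y e F) x) \<le> A"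
  shows "norm (F (rot M y e t x) - F x - t *\<^sub>R (curv M *\<^sub>R lie M y e F x)) \<le> A * t\<^sup>2"
proof -
  have F': "Cn M (Suc (Suc 0)) F" using F by (simp add: numeral_2_eq_2)
  let ?L = "lie M y e F"
  have 1: "norm (?L (rot M y e u x) - ?L x) \<le> A * u" if u: "0 \<le> u" "u \<le> t" for u
  proof -
    have "norm ((\<lambda>u. ?L (rot M y e u x)) u - (\<lambda>u. ?L (rot M y e u x)) 0) \<le> A * u"
      by (rule mean_value_bound[OF u(1) flow_derivative[OF e x Cn_lie[OF F']]])
        (use A rot_point[OF e x] in simp)
    then show ?thesis by simp
  qed
  let ?g = "\<lambda>u. F (rot M y e u x) - u *\<^sub>R (curv M *\<^sub>R ?L x)"
  have "norm (?g t - ?g 0) \<le> (A * t) * t"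
  proof (rule mean_value_bound[OF t(1)])
    fix u assume u: "0 \<le> u" "u \<le> t"
    have "((\<lambda>u. F (rot M y e u x) - u *\<^sub>R (curv M *\<^sub>R ?L x)) has_vector_derivative
       curv M *\<^sub>R ?L (rot M y e u x) - 1 *\<^sub>R (curv M *\<^sub>R ?L x)) (at u)"
      by (intro has_vector_derivative_diff flow_derivative[OF e x F'] scaleR_const_derivative) auto
    then show "(?g has_vector_derivative curv M *\<^sub>R (?L (rot M y e u x) - ?L x)) (at u)"
      by (simp add: scaleR_diff_right)
    have "A * u \<le> A * t" using u A(1) by (intro mult_left_mono)
    then show "norm (curv M *\<^sub>R (?L (rot M y e u x) - ?L x)) \<le> A * t" using 1[OF u] by simp
  qed
  then show ?thesis by (simp add: power2_eq_square algebra_simps)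
qed

text \<open>
  The key fact about potentials: a rotation moves the derivative in the parameter from the singular
  kernel to the density, so that no derivative of the kernel is needed.
\<close>

theorem pot_derivative:
  fixes F :: "real^4 \<Rightarrow> 'b::euclidean_space"
  assumes K: "kernel M K" and F: "Cn M 2 F" and b: "bsupp M F" and y: "y \<in> points M"
  shows "(pot M K F has_derivative (\<lambda>w. curv M *\<^sub>R pot M K (lie M y w F) y)) (at y within points M)"
proof -
  have F': "Cn M (Suc (Suc 0)) F" using F by (simp add: numeral_2_eq_2)
  have dF: "F differentiable (at x within points M)" if "x \<in> points M" for x using F' that by simp
  have cF: "continuous_on (points M) F" using F by (rule Cn_continuous)
  have cL: "continuous_on (points M) (lie M y w F)" for w using F' by (intro Cn_continuous[of M "Suc 0"] Cn_lie)
  have iL: "integrable (vol M) (\<lambda>x. K (cc M x y) *\<^sub>R lie M y w F x)" for w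
    by (rule pot_integrable[OF K cL bsupp_lie[OF b] y])
  obtain A where A: "A \<ge> 0" "\<And>e x. unit_tangent M y e \<Longrightarrow> x \<in> points M \<Longrightarrow> norm (lie M y e (lie M y e F) x) \<le> A"
    using second_lie_bounded[OF F b y] by blast
  obtain C where C: "\<And>x. x \<in> points M \<Longrightarrow> F x \<noteq> 0 \<Longrightarrow> norm x \<le> C" using b by (auto simp: bsupp_def)
  obtain N where N: "N > 0" "\<And>e. unit_tangent M y e \<Longrightarrow> norm e \<le> N" using unit_tangent_norm[OF y] by blast
  obtain T where T: "\<And>x. norm x \<le> C \<Longrightarrow> \<bar>cc M x y\<bar> \<le> T" using cc_bound[OF y] by blast
  obtain Kf where Kf: "Kf > 0" "\<And>a b. norm (form M a b) \<le> norm a * norm b * Kf" using form.pos_bounded[of M] by blast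
  define T' where "T' = max T (2 * T + 2 * (N * C * Kf))"
  \<comment> \<open>Rotations by an angle of at most one move the support within a fixed ball about \<open>y\<close>.\<close>
  have supp: "cc M x y \<le> T'" if e: "unit_tangent M y e" and x: "x \<in> points M" and t: "0 \<le> t" "t \<le> 1"
    and n: "norm (rot M y e t x) \<le> C" for e x t
  proof -
    let ?z = "rot M y e t x"
    have "form M y x = cs M t * form M y ?z + sn M t * form M e ?z"
      using form_rot(1)[OF e, of "- t" ?z] rot_inverse[OF e, of t x] by simp
    then have "\<bar>form M y x\<bar> \<le> \<bar>cs M t\<bar> * \<bar>form M y ?z\<bar> + \<bar>sn M t\<bar> * \<bar>form M e ?z\<bar>"
      by (metis abs_mult abs_triangle_ineq)
    also have "\<dots> \<le> 2 * T + 2 * (N * C * Kf)"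
    proof (intro add_mono mult_mono)
      show "\<bar>cs M t\<bar> \<le> 2" "\<bar>sn M t\<bar> \<le> 2" using cs_le_2[of t M] small_angle(1)[OF t, of M] t by auto
      show "\<bar>form M y ?z\<bar> \<le> T" using T[OF n] by (simp add: abs_mult form_sym[of M y])
      have "\<bar>form M e ?z\<bar> \<le> norm e * norm ?z * Kf" using Kf(2)[of e ?z] by simp
      also have "\<dots> \<le> N * C * Kf" using N(2)[OF e] n Kf(1) N(1) by (intro mult_right_mono mult_mono) auto
      finally show "\<bar>form M e ?z\<bar> \<le> N * C * Kf" .
    qed auto
    finally have "\<bar>cc M x y\<bar> \<le> T'" by (simp add: T'_def abs_mult form_sym[of M x y])
    then show ?thesis by simp
  qed
  define S where "S = integral\<^sup>L (vol M) (sing M y T')"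
  obtain B where B: "B \<ge> 0" "\<And>x. x \<in> points M \<Longrightarrow> cc M x y \<le> T' \<Longrightarrow> \<bar>K (cc M x y)\<bar> \<le> B * (1 + 1 / qq M (cc M x y))"
    using K y unfolding kernel_def by metis
  have est: "norm (pot M K F (geo M y e t) - pot M K F y - t *\<^sub>R (curv M *\<^sub>R pot M K (lie M y e F) y)) \<le> (A * (B * S)) * t\<^sup>2"
    if e: "unit_tangent M y e" and t: "0 \<le> t" "t \<le> 1" for e t
  proof -
    let ?G = "\<lambda>x. F (rot M y e t x) - F x - t *\<^sub>R (curv M *\<^sub>R lie M y e F x)"
    have z: "cc M x y \<le> T'" if x: "x \<in> points M" "?G x \<noteq> 0" for x
    proof -
      have "F (rot M y e t x) \<noteq> 0 \<or> F x \<noteq> 0 \<or> lie M y e F x \<noteq> 0" using x(2) by auto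
      then consider "norm (rot M y e t x) \<le> C" | "norm x \<le> C"
        using C rot_point[OF e x(1)] x(1) supp_lie[of M F C x, OF C] by blast
      then show ?thesis
      proof cases
        case 2 then show ?thesis using T[of x] by (simp add: T'_def)
      qed (rule supp[OF e x(1) t])
    qed
    have cR: "continuous_on (points M) (\<lambda>x. F (rot M y e t x))"
      using rot_point[OF e] by (intro continuous_on_compose2[OF cF continuous_rot]) auto
    have "bsupp M (\<lambda>x. F (rot M y e t x))"
    proof -
      have "linear (rot M y e (- t))" by (rule linear_rot)
      then obtain L where L: "\<And>z. norm (rot M y e (- t) z) \<le> L * norm z" "L > 0" using linear_bounded_pos by metis
      have "norm x \<le> L * \<bar>C\<bar>" if "x \<in> points M" "F (rot M y e t x) \<noteq> 0" for x
      proof -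
        have "norm x \<le> L * norm (rot M y e t x)" using L(1)[of "rot M y e t x"] rot_inverse[OF e] by simp
        also have "\<dots> \<le> L * \<bar>C\<bar>" using C[OF rot_point[OF e that(1)] that(2)] L(2) by (intro mult_left_mono) auto
        finally show ?thesis .
      qed
      then show ?thesis unfolding bsupp_def by blast
    qed
    then have iR: "integrable (vol M) (\<lambda>x. K (cc M x y) *\<^sub>R F (rot M y e t x))" by (intro pot_integrable K cR y)
    have iF: "integrable (vol M) (\<lambda>x. K (cc M x y) *\<^sub>R F x)" by (rule pot_integrable[OF K cF b y])
    have iS: "integrable (vol M) (\<lambda>x. (A * t\<^sup>2) * (B * sing M y T' x))" using sing_integrable[OF y] by simp
    have eq: "pot M K F (geo M y e t) - pot M K F y - t *\<^sub>R (curv M *\<^sub>R pot M K (lie M y e F) y) = (\<integral>x. K (cc M x y) *\<^sub>R ?G x \<partial>vol M)"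
    proof -
      have "(\<integral>x. K (cc M x y) *\<^sub>R ?G x \<partial>vol M) = (\<integral>x. K (cc M x y) *\<^sub>R F (rot M y e t x) - K (cc M x y) *\<^sub>R F x
           - (t * curv M) *\<^sub>R (K (cc M x y) *\<^sub>R lie M y e F x) \<partial>vol M)"
        by (rule Bochner_Integration.integral_cong) (simp_all add: algebra_simps)
      also have "\<dots> = (\<integral>x. K (cc M x y) *\<^sub>R F (rot M y e t x) \<partial>vol M) - (\<integral>x. K (cc M x y) *\<^sub>R F x \<partial>vol M)
           - (t * curv M) *\<^sub>R (\<integral>x. K (cc M x y) *\<^sub>R lie M y e F x \<partial>vol M)"
        by (rule integral_diff_diff[OF iR iF iL])
      finally show ?thesis unfolding pot_rot[OF K cF e] unfolding pot_def by simp
    qed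
    have "norm (\<integral>x. K (cc M x y) *\<^sub>R ?G x \<partial>vol M) \<le> (\<integral>x. (A * t\<^sup>2) * (B * sing M y T' x) \<partial>vol M)"
    proof (rule order_trans[OF integral_norm_bound integral_mono[OF integrable_norm iS]])
      have "integrable (vol M) (\<lambda>x. K (cc M x y) *\<^sub>R F (rot M y e t x) - K (cc M x y) *\<^sub>R F x
           - (t * curv M) *\<^sub>R (K (cc M x y) *\<^sub>R lie M y e F x))"
        by (intro Bochner_Integration.integrable_diff integrable_scaleR_right iR iF iL)
      then show "integrable (vol M) (\<lambda>x. K (cc M x y) *\<^sub>R ?G x)" by (simp add: algebra_simps)
      fix x assume "x \<in> space (vol M)"
      then have x: "x \<in> points M" by simp
      have G: "norm (?G x) \<le> A * t\<^sup>2" using flow_taylor[OF F e x t A(1)] A(2)[OF e] by blast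
      show "norm (K (cc M x y) *\<^sub>R ?G x) \<le> (A * t\<^sup>2) * (B * sing M y T' x)"
      proof (cases "?G x = 0")
        case True
        then show ?thesis using A(1) B(1) sing_nonneg[OF x y] by simp
      next
        case False
        note zT = z[OF x False]
        have "\<bar>K (cc M x y)\<bar> * norm (?G x) \<le> (B * (1 + 1 / qq M (cc M x y))) * (A * t\<^sup>2)"
          using B(2)[OF x zT] G qq_nonneg[OF x y] B(1) by (intro mult_mono) auto
        then show ?thesis using zT by (simp add: sing_def mult.commute)
      qed
    qed
    also have "\<dots> = (A * (B * S)) * t\<^sup>2" by (simp add: S_def)
    finally show ?thesis unfolding eq .
  qed
  have "linear (\<lambda>w. curv M *\<^sub>R pot M K (lie M y w F) y)"
  proof (rule linearI)
    fix w w' r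
    have "pot M K (lie M y (w + w') F) y = (\<integral>x. K (cc M x y) *\<^sub>R lie M y w F x + K (cc M x y) *\<^sub>R lie M y w' F x \<partial>vol M)"
      unfolding pot_def by (rule Bochner_Integration.integral_cong) (simp_all add: lie_bilinear[OF dF] algebra_simps)
    then show "curv M *\<^sub>R pot M K (lie M y (w + w') F) y = curv M *\<^sub>R pot M K (lie M y w F) y + curv M *\<^sub>R pot M K (lie M y w' F) y"
      using iL by (simp add: pot_def scaleR_add_right)
    have "pot M K (lie M y (r *\<^sub>R w) F) y = (\<integral>x. r *\<^sub>R (K (cc M x y) *\<^sub>R lie M y w F x) \<partial>vol M)"
      unfolding pot_def by (rule Bochner_Integration.integral_cong) (simp_all add: lie_bilinear[OF dF] algebra_simps)
    also have "\<dots> = r *\<^sub>R pot M K (lie M y w F) y" unfolding pot_def by (rule integral_scaleR_right)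
    finally show "curv M *\<^sub>R pot M K (lie M y (r *\<^sub>R w) F) y = r *\<^sub>R (curv M *\<^sub>R pot M K (lie M y w F) y)"
      by (simp add: mult.commute)
  qed
  then show ?thesis
    by (intro derivative_from_geodesics[OF y _ est]) (simp_all add: linear_conv_bounded_linear)
qed

lemma pot_1: "pot M (\<lambda>_. 1) F y = (\<integral>x. F x \<partial>vol M)"
  by (simp add: pot_def)

text \<open>
  Invariance of the volume in infinitesimal form: the potential with a constant kernel does not depend on the
  point.
\<close>

lemma integral_lie_point:
  fixes F :: "real^4 \<Rightarrow> 'b::euclidean_space"
  assumes F: "Cn M 2 F" and b: "bsupp M F" and y: "y \<in> points M"
  shows "(\<integral>x. lie M y w F x \<partial>vol M) = 0"
proof -
  have "(pot M (\<lambda>_. 1) F has_derivative (\<lambda>w. curv M *\<^sub>R pot M (\<lambda>_. 1) (lie M y w F) y)) (at y within points M)"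
    by (rule pot_derivative[OF kernel_const F b y])
  moreover have "(pot M (\<lambda>_. 1) F has_derivative (\<lambda>_. 0)) (at y within points M)" unfolding pot_1[abs_def] by simp
  ultimately have "curv M *\<^sub>R pot M (\<lambda>_. 1) (lie M y v F) y = 0" if "v \<in> tangent M y" for v
    by (rule derivative_unique[OF _ _ y that])
  then have t: "(\<integral>x. lie M y v F x \<partial>vol M) = 0" if "v \<in> tangent M y" for v
    using that by (simp add: pot_1)
  have F': "Cn M (Suc (Suc 0)) F" using F by (simp add: numeral_2_eq_2)
  have "(\<integral>x. lie M y w F x \<partial>vol M) = (\<integral>x. lie M y (tpart M y w) F x \<partial>vol M)"
  proof (rule Bochner_Integration.integral_cong[OF refl])
    fix x assume "x \<in> space (vol M)"
    then have d: "F differentiable (at x within points M)" using F' by simp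
    have "w = tpart M y w + cc M w y *\<^sub>R y" by (simp add: tpart_def)
    then have "lie M y w F x = lie M y (tpart M y w + cc M w y *\<^sub>R y) F x" by simp
    also have "\<dots> = lie M y (tpart M y w) F x" by (simp add: lie_bilinear[OF d])
    finally show "lie M y w F x = lie M y (tpart M y w) F x" .
  qed
  then show ?thesis using t[OF tpart_tangent[OF y]] by simp
qed

lemma lie_integrable:
  fixes F :: "real^4 \<Rightarrow> 'b::euclidean_space"
  assumes F: "Cn M (Suc n) F" and b: "bsupp M F"
  shows "integrable (vol M) (lie M a c F)"
  using pot_integrable[OF kernel_const[of M 1] Cn_continuous[OF Cn_lie[OF F]] bsupp_lie[OF b] e0_point] by simp

lemma integral_lie:
  fixes F :: "real^4 \<Rightarrow> 'b::euclidean_space"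
  assumes F: "Cn M 2 F" and b: "bsupp M F"
  shows "(\<integral>x. lie M a c F x \<partial>vol M) = 0"
proof -
  have F': "Cn M (Suc (Suc 0)) F" using F by (simp add: numeral_2_eq_2)
  have d: "F differentiable (at x within points M)" if "x \<in> points M" for x using F' that by simp
  note i = lie_integrable[OF F' b]
  define I where "I a = (\<integral>x. lie M a c F x \<partial>vol M)" for a
  have l: "linear I"
  proof (rule linearI)
    fix a a' r
    have "I (a + a') = (\<integral>x. lie M a c F x + lie M a' c F x \<partial>vol M)"
      unfolding I_def by (rule Bochner_Integration.integral_cong) (simp_all add: lie_bilinear[OF d])
    then show "I (a + a') = I a + I a'" using i by (simp add: I_def)
    have "I (r *\<^sub>R a) = (\<integral>x. r *\<^sub>R lie M a c F x \<partial>vol M)"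
      unfolding I_def by (rule Bochner_Integration.integral_cong) (simp_all add: lie_bilinear[OF d])
    then show "I (r *\<^sub>R a) = r *\<^sub>R I a" by (simp add: I_def)
  qed
  have p: "I y = 0" if "y \<in> points M" for y unfolding I_def by (rule integral_lie_point[OF F b that])
  have t: "I (frame M e0 i) = 0" for i
  proof -
    let ?e = "frame M e0 i"
    have u: "unit_tangent M e0 ?e" by (rule unit_tangent_frame[OF e0_point])
    have "I (geo M e0 ?e 1) = cs M 1 *\<^sub>R I e0 + sn M 1 *\<^sub>R I ?e" unfolding geo_def by (simp add: linear_add[OF l] linear_cmul[OF l])
    then have "sn M 1 *\<^sub>R I ?e = 0" using p[OF geo_point[OF u]] p[OF e0_point] by simp
    moreover have "sn M 1 \<noteq> 0"
    proof (cases M)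
      case S3
      have "sin (1::real) > 0" using pi_gt3 by (intro sin_gt_zero) auto
      then show ?thesis using S3 by simp
    next
      case H3 then show ?thesis by simp
    qed
    ultimately show ?thesis by simp
  qed
  have "I a = I (cc M a e0 *\<^sub>R e0 + (\<Sum>i\<in>UNIV. form M (frame M e0 i) a *\<^sub>R frame M e0 i))"
    using frame_expand[OF e0_point frame_exists[OF e0_point]] by metis
  also have "\<dots> = 0" by (simp add: linear_add[OF l] linear_cmul[OF l] linear_sum[OF l] p[OF e0_point] t)
  finally show ?thesis by (simp add: I_def)
qed

section \<open>Integration by parts against radial kernels\<close>

lemma lie_scaleR:
  assumes "h differentiable (at x within points M)" "F differentiable (at x within points M)" "x \<in> points M"
  shows "lie M a b (\<lambda>x. h x *\<^sub>R F x) x = h x *\<^sub>R lie M a b F x + lie M a b h x *\<^sub>R F x"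
proof -
  have "((\<lambda>x. h x *\<^sub>R F x) has_derivative (\<lambda>v. h x *\<^sub>R frechet_derivative F (at x within points M) v
     + frechet_derivative h (at x within points M) v *\<^sub>R F x)) (at x within points M)"
    using assms(1,2) by (intro has_derivative_scaleR) (simp_all flip: frechet_derivative_works)
  from lie_eq[OF this assms(3)] show ?thesis by (simp add: lie_def)
qed

lemma lie_form: "x \<in> points M \<Longrightarrow> lie M a b (\<lambda>x. form M u x) x = form M u (kil M a b x)"
  by (rule lie_eq) (intro bounded_linear_imp_has_derivative form.bounded_linear_right)

lemma bsupp_integrable:
  fixes F :: "real^4 \<Rightarrow> 'b::euclidean_space"
  shows "continuous_on (points M) F \<Longrightarrow> bsupp M F \<Longrightarrow> integrable (vol M) F"
  using pot_integrable[OF kernel_const[of M 1] _ _ e0_point, of F] by simp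

lemma integral_by_parts:
  fixes F :: "real^4 \<Rightarrow> 'b::euclidean_space"
  assumes h: "Cn M 2 h" and F: "Cn M 2 F" and b: "bsupp M F"
  shows "(\<integral>x. h x *\<^sub>R lie M a c F x \<partial>vol M) = - (\<integral>x. lie M a c h x *\<^sub>R F x \<partial>vol M)"
proof -
  have h': "Cn M (Suc (Suc 0)) h" and F': "Cn M (Suc (Suc 0)) F" using h F by (simp_all add: numeral_2_eq_2)
  have d: "h differentiable (at x within points M)" "F differentiable (at x within points M)" if "x \<in> points M" for x
    using h' F' that by simp_all
  have i1: "integrable (vol M) (\<lambda>x. h x *\<^sub>R lie M a c F x)"
    by (rule bsupp_integrable[OF continuous_on_scaleR[OF Cn_continuous[OF h] Cn_continuous[OF Cn_lie[OF F']]]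
          bsupp_image[OF bsupp_lie[OF b, of a c]]]) simp
  have i2: "integrable (vol M) (\<lambda>x. lie M a c h x *\<^sub>R F x)"
    by (rule bsupp_integrable[OF continuous_on_scaleR[OF Cn_continuous[OF Cn_lie[OF h']] Cn_continuous[OF F]]
          bsupp_image[OF b]]) simp
  have "0 = (\<integral>x. lie M a c (\<lambda>x. h x *\<^sub>R F x) x \<partial>vol M)"
    by (rule integral_lie[OF Cn_scaleR[OF h F] bsupp_image[OF b], symmetric]) simp
  also have "\<dots> = (\<integral>x. h x *\<^sub>R lie M a c F x + lie M a c h x *\<^sub>R F x \<partial>vol M)"
    using d by (intro Bochner_Integration.integral_cong refl lie_scaleR) auto
  finally show ?thesis using i1 i2 by (simp add: eq_neg_iff_add_eq_0)
qed

lemma kil_form: "curv M * form M (kil M a b x) y = curv M * (form M a x * form M b y - form M b x * form M a y)"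
  by (simp add: kil_def form_lin)

lemma radial_derivative:
  assumes "(k has_real_derivative k') (at (cc M x y))"
  shows "((\<lambda>x. k (cc M x y)) has_derivative (\<lambda>h. k' * (curv M * form M h y))) (at x within A)"
proof -
  have "((\<lambda>x. cc M x y) has_derivative (\<lambda>h. cc M h y)) (at x within A)"
    by (intro has_derivative_mult_right bounded_linear_imp_has_derivative form.bounded_linear_left)
  moreover have "(k has_derivative (\<lambda>h. k' * h)) (at (cc M x y) within (\<lambda>x. cc M x y) ` A)"
    using assms by (simp add: has_field_derivative_def has_derivative_at_withinI)
  ultimately show ?thesis by (rule has_derivative_in_compose)
qed

lemma lie_radial:
  assumes "(k has_real_derivative k') (at (cc M x y))" "x \<in> points M"
  shows "lie M a b (\<lambda>x. k (cc M x y)) x = k' * (curv M * (form M a x * form M b y - form M b x * form M a y))"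
  using lie_eq[OF radial_derivative[OF assms(1)] assms(2)] by (simp add: kil_form)

lemma Cn_radial_0:
  fixes k :: "real \<Rightarrow> real"
  assumes "\<And>x. x \<in> points M \<Longrightarrow> isCont k (cc M x y)"
  shows "Cn M 0 (\<lambda>x. k (cc M x y))"
  unfolding Cn.simps continuous_on_eq_continuous_within
proof
  fix x assume x: "x \<in> points M"
  have "isCont (\<lambda>x. cc M x y) x" using continuous_cc[of UNIV] by (simp add: continuous_on_eq_continuous_at)
  from isCont_o2[OF this assms[OF x]] show "continuous (at x within points M) (\<lambda>x. k (cc M x y))"
    by (rule continuous_at_imp_continuous_at_within)
qed

lemma Cn_radial_Suc:
  assumes "\<And>x. x \<in> points M \<Longrightarrow> (k has_real_derivative k' (cc M x y)) (at (cc M x y))"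
    and "Cn M n (\<lambda>x. k' (cc M x y))"
  shows "Cn M (Suc n) (\<lambda>x. k (cc M x y))"
proof (rule Cn_SucI[OF radial_derivative[OF assms(1)]])
  fix a b
  have "curv M * form M (kil M a b x) y = form M (curv M *\<^sub>R (form M b y *\<^sub>R a - form M a y *\<^sub>R b)) x" for x
    by (simp add: kil_form form_lin algebra_simps)
  then show "Cn M n (\<lambda>x. k' (cc M x y) * (curv M * form M (kil M a b x) y))"
    using Cn_mult[OF assms(2) Cn_form] by presburger
qed

lemma qq_zero: "x \<in> points M \<Longrightarrow> y \<in> points M \<Longrightarrow> \<not> qq M (cc M x y) > 0 \<Longrightarrow> cc M x y = 1 \<or> cc M x y = - 1"
  using qq_nonneg[of x M y] by (auto simp: qq_def power2_eq_1_iff)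

text \<open>
  Discontinuities can occur only at \<open>t = 1\<close> and \<open>t = - 1\<close>, where the value of the kernel is irrelevant for
  measurability.
\<close>

lemma radial_measurable:
  fixes k :: "real \<Rightarrow> real"
  assumes k: "\<And>t. qq M t > 0 \<Longrightarrow> isCont k t" and y: "y \<in> points M"
  shows "(\<lambda>x. k (cc M x y)) \<in> borel_measurable (vol M)"
proof -
  let ?U = "{t. qq M t > 0}"
  have "open ?U" unfolding qq_def by (intro open_Collect_less continuous_intros)
  moreover have "continuous_on ?U k" using k by (auto intro!: continuous_at_imp_continuous_on)
  ultimately have "(\<lambda>t. indicator ?U t *\<^sub>R k t) \<in> borel_measurable borel"
    by (intro borel_measurable_continuous_on_indicator) (auto intro: borel_open)
  then have [measurable]: "(\<lambda>t. indicator ?U t * k t) \<in> borel_measurable borel" by simp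
  let ?k = "\<lambda>t. indicator ?U t * k t + indicator {1} t * k 1 + indicator {-1} t * k (-1)"
  have "(\<lambda>x. ?k (cc M x y)) \<in> borel_measurable (vol M)"
    by (rule borel_vol) measurable
  moreover have "?k (cc M x y) = k (cc M x y)" if "x \<in> space (vol M)" for x
  proof (cases "qq M (cc M x y) > 0")
    case True
    then have "cc M x y \<noteq> 1" "cc M x y \<noteq> -1" by (auto simp: qq_def)
    then show ?thesis using True by simp
  next
    case False
    then show ?thesis using qq_zero[OF _ y False] that by (auto simp: qq_def)
  qed
  ultimately show ?thesis by (subst measurable_cong[where g = "\<lambda>x. ?k (cc M x y)"]) auto
qed

section \<open>Regularised kernels\<close>

text \<open>
  The regularisation replaces the kernel \<open>k t\<close> by \<open>k (s t)\<close>, where \<open>s\<close> tends to \<open>1\<close> from below on \<open>S3\<close> and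
  from above on \<open>H3\<close>.  Then \<open>s t\<close> stays away from the singularities \<open>t = 1\<close> and \<open>t = - 1\<close>, and \<open>qq\<close> only increases.
\<close>

definition sreg :: "space_form \<Rightarrow> nat \<Rightarrow> real" where "sreg M n = 1 - curv M / (real n + 2)"

lemma sreg: "reg M (sreg M n)" "1/2 \<le> sreg M n" "sreg M n \<le> 3/2"
  using curv_cases[of M] by (auto simp: reg_def sreg_def field_simps)

lemma sreg_limit: "sreg M \<longlonglongrightarrow> 1"
proof -
  have "(\<lambda>n. 1 - curv M * inverse (real (Suc (Suc n)))) \<longlonglongrightarrow> 1 - curv M * 0"
    by (intro tendsto_diff tendsto_mult tendsto_const LIMSEQ_Suc[OF LIMSEQ_inverse_real_of_nat])
  moreover have "sreg M n = 1 - curv M * inverse (real (Suc (Suc n)))" for n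
    by (simp add: sreg_def divide_inverse)
  ultimately show ?thesis by (simp add: sreg_def[abs_def])
qed

lemma reg_sq: "reg M s \<Longrightarrow> curv M * (1 - s\<^sup>2) > 0"
proof -
  assume s: "reg M s"
  have "curv M * (1 - s\<^sup>2) = curv M * (1 - s) * (1 + s)" by (simp add: algebra_simps power2_eq_square)
  also have "\<dots> > 0" by (rule mult_pos_pos) (use s in \<open>auto simp: reg_def\<close>)
  finally show ?thesis .
qed

lemma qq_reg:
  assumes s: "reg M s" and x: "x \<in> points M" and y: "y \<in> points M"
  shows "qq M (s * cc M x y) > 0" "qq M (cc M x y) \<le> qq M (s * cc M x y)" "curv M * (1 - s\<^sup>2) \<le> qq M (s * cc M x y)"
proof -
  let ?c = "cc M x y"
  have e: "qq M (s * ?c) = qq M ?c + curv M * (1 - s\<^sup>2) * ?c\<^sup>2" by (simp add: qq_def algebra_simps power_mult_distrib)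
  show 1: "qq M ?c \<le> qq M (s * ?c)" unfolding e using reg_sq[OF s] by simp
  show 2: "qq M (s * ?c) > 0"
  proof (cases "?c = 0")
    case True
    have "M = S3" using True cc_H3_ge1[of x y] x y by (cases M) auto
    then show ?thesis using True by (simp add: qq_def)
  next
    case False
    then have "curv M * (1 - s\<^sup>2) * ?c\<^sup>2 > 0" using reg_sq[OF s] by simp
    then show ?thesis unfolding e using qq_nonneg[OF x y] by simp
  qed
  have "qq M (s * ?c) = curv M * (1 - s\<^sup>2) + s\<^sup>2 * qq M ?c" by (simp add: qq_def algebra_simps power_mult_distrib)
  then show "curv M * (1 - s\<^sup>2) \<le> qq M (s * ?c)" using qq_nonneg[OF x y] by simp
qed

lemma AE_qq_pos: assumes y: "y \<in> points M" shows "AE x in vol M. qq M (cc M x y) > 0"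
proof -
  have "AE x in vol M. x \<noteq> y" "AE x in vol M. x \<noteq> - y" "AE x in vol M. x \<in> points M"
    by (rule AE_vol_neq AE_I2; simp)+
  then show ?thesis
  proof eventually_elim
    case (elim x)
    then show ?case using qq_pos[OF _ y] by blast
  qed
qed

lemma AE_points: "AE x in vol M. x \<in> points M"
  by (rule AE_I2) simp

lemma abs_cc_le: assumes "x \<in> points M" "y \<in> points M" "cc M x y \<le> T" "T \<ge> 1" shows "\<bar>cc M x y\<bar> \<le> T"
proof (cases M)
  case S3 then show ?thesis using cc_S3_le1[of x y] assms by simp
next
  case H3 then show ?thesis using cc_H3_ge1[of x y] assms by simp
qed

lemma bsupp_cc:
  assumes b: "bsupp M F" and y: "y \<in> points M"
  obtains T where "T \<ge> 1" "\<And>x. x \<in> points M \<Longrightarrow> F x \<noteq> 0 \<Longrightarrow> cc M x y \<le> T"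
proof -
  obtain C where C: "\<And>x. x \<in> points M \<Longrightarrow> F x \<noteq> 0 \<Longrightarrow> norm x \<le> C" using b by (auto simp: bsupp_def)
  obtain T where T: "\<And>x. norm x \<le> C \<Longrightarrow> \<bar>cc M x y\<bar> \<le> T" using cc_bound[OF y] by blast
  show ?thesis
  proof (rule that[of "max T 1"])
    fix x assume "x \<in> points M" "F x \<noteq> 0"
    then show "cc M x y \<le> max T 1" using T[OF C] abs_le_D1 by fastforce
  qed simp
qed

lemma form_tpart_bound:
  assumes y: "y \<in> points M"
  obtains C where "C \<ge> 0" "\<And>x. x \<in> points M \<Longrightarrow> \<bar>form M w (tpart M y x)\<bar> \<le> C * sqrt (qq M (cc M x y))"
proof (rule that[of "sqrt (form M (tpart M y w) (tpart M y w))"])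
  show "sqrt (form M (tpart M y w) (tpart M y w)) \<ge> 0" using tangent_pos(1)[OF y tpart_tangent[OF y]] by simp
  fix x assume x: "x \<in> points M"
  have "form M w (tpart M y x) = form M (tpart M y w) (tpart M y x)"
    using tangentD[OF tpart_tangent[OF y, of x]] by (simp add: tpart_def[of M y w] form_lin)
  then show "\<bar>form M w (tpart M y x)\<bar> \<le> sqrt (form M (tpart M y w) (tpart M y w)) * sqrt (qq M (cc M x y))"
    using tangent_cauchy_schwarz[OF y tpart_tangent[OF y] tpart_tangent[OF y], of w x] form_tpart[OF x y] by simp
qed

text \<open>
  A radial solution of the equation \<open>Laplacian k = curv M * (al * k + be) + Dirac\<close>.  In terms of the variable
  \<open>t = cc x y\<close> the radial Laplacian is \<open>curv M * ((1 - t\<^sup>2) k'' - 3 t k')\<close>; the bounds express that \<open>k\<close> has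
  the singularity of the Newton kernel at \<open>t = 1\<close> and that it is less singular at \<open>t = - 1\<close>.
\<close>

locale fundamental_solution =
  fixes M :: space_form and k0 k1 k2 k3 :: "real \<Rightarrow> real" and al be :: real
  assumes k0: "\<And>t. qq M t > 0 \<Longrightarrow> (k0 has_real_derivative k1 t) (at t)"
    and k1: "\<And>t. qq M t > 0 \<Longrightarrow> (k1 has_real_derivative k2 t) (at t)"
    and k2: "\<And>t. qq M t > 0 \<Longrightarrow> (k2 has_real_derivative k3 t) (at t)"
    and k3: "\<And>t. qq M t > 0 \<Longrightarrow> isCont k3 t"
    and ode: "\<And>t. qq M t > 0 \<Longrightarrow> (1 - t\<^sup>2) * k2 t - 3 * t * k1 t = al * k0 t + be"
    and b0: "\<And>T. \<exists>B\<ge>0. \<forall>t. qq M t > 0 \<longrightarrow> \<bar>t\<bar> \<le> T \<longrightarrow> \<bar>k0 t\<bar> \<le> B / sqrt (qq M t)"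
    and b1: "\<And>T. \<exists>B\<ge>0. \<forall>t. qq M t > 0 \<longrightarrow> \<bar>t\<bar> \<le> T \<longrightarrow> \<bar>k1 t\<bar> \<le> B / sqrt (qq M t) ^ 3"
    and b2: "\<And>T. \<exists>B\<ge>0. \<forall>t. qq M t > 0 \<longrightarrow> \<bar>t\<bar> \<le> T \<longrightarrow> t > 0 \<longrightarrow>
        \<bar>k2 t + 3 / (4 * pi) * (1 / sqrt (qq M t) ^ 5)\<bar> \<le> B / sqrt (qq M t) ^ 4"
    and b2': "\<And>T. \<exists>B\<ge>0. \<forall>t. qq M t > 0 \<longrightarrow> \<bar>t\<bar> \<le> T \<longrightarrow> t \<le> 0 \<longrightarrow> M = S3 \<longrightarrow> \<bar>k2 t\<bar> \<le> B / sqrt (qq M t) ^ 4"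
begin

lemma isCont_k: "qq M t > 0 \<Longrightarrow> isCont k0 t" "qq M t > 0 \<Longrightarrow> isCont k1 t" "qq M t > 0 \<Longrightarrow> isCont k2 t"
  using k0 k1 k2 DERIV_isCont by blast+

lemma inverse_sqrt_le: "q > 0 \<Longrightarrow> 1 / sqrt q \<le> 1 + 1 / q"
proof -
  assume q: "q > 0"
  have "0 \<le> (sqrt q - 1)\<^sup>2 + sqrt q" using q by simp
  then have "sqrt q \<le> sqrt q * sqrt q + 1" by (simp add: power2_eq_square algebra_simps)
  then have "sqrt q \<le> q + 1" using q by simp
  then have "sqrt q / q \<le> (q + 1) / q" using q by (intro divide_right_mono) auto
  moreover have "sqrt q / q = 1 / sqrt q" using q by (simp add: field_simps)
  ultimately show ?thesis using q by (simp add: add_divide_distrib)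
qed

lemma kernel_k0: "kernel M k0"
  unfolding kernel_def
proof (intro conjI ballI allI)
  show "(\<lambda>x. k0 (cc M x y)) \<in> borel_measurable (vol M)" if "y \<in> points M" for y
    using radial_measurable[OF isCont_k(1) that] .
  fix T
  obtain B where B: "B \<ge> 0" "\<And>t. qq M t > 0 \<Longrightarrow> \<bar>t\<bar> \<le> max T 1 \<Longrightarrow> \<bar>k0 t\<bar> \<le> B / sqrt (qq M t)" using b0 by metis
  show "\<exists>B\<ge>0. \<forall>x\<in>points M. \<forall>y\<in>points M. cc M x y \<le> T \<longrightarrow> \<bar>k0 (cc M x y)\<bar> \<le> B * (1 + 1 / qq M (cc M x y))"
  proof (intro exI[of _ "B + \<bar>k0 1\<bar> + \<bar>k0 (-1)\<bar>"] conjI ballI impI)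
    fix x y assume x: "x \<in> points M" and y: "y \<in> points M" and T: "cc M x y \<le> T"
    let ?c = "cc M x y"
    show "\<bar>k0 ?c\<bar> \<le> (B + \<bar>k0 1\<bar> + \<bar>k0 (-1)\<bar>) * (1 + 1 / qq M ?c)"
    proof (cases "qq M ?c > 0")
      case True
      have "\<bar>k0 ?c\<bar> \<le> B / sqrt (qq M ?c)" using T by (intro B(2) True abs_cc_le x y) auto
      also have "\<dots> = B * (1 / sqrt (qq M ?c))" by simp
      also have "\<dots> \<le> (B + \<bar>k0 1\<bar> + \<bar>k0 (-1)\<bar>) * (1 + 1 / qq M ?c)"
        using inverse_sqrt_le[OF True] B(1) True by (intro mult_mono) auto
      finally show ?thesis .
    next
      case False
      then show ?thesis using qq_zero[OF x y False] B(1) by (auto simp: qq_def)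
    qed
  qed (use B in simp)
qed

lemma Cn_k:
  assumes s: "reg M s" and y: "y \<in> points M"
  shows "Cn M 3 (\<lambda>x. k0 (s * cc M x y))" "Cn M 2 (\<lambda>x. k1 (s * cc M x y))" "Cn M 1 (\<lambda>x. k2 (s * cc M x y))"
proof -
  have d: "((\<lambda>t. k (s * t)) has_real_derivative s * k' (s * cc M x y)) (at (cc M x y))"
    if "\<And>t. qq M t > 0 \<Longrightarrow> (k has_real_derivative k' t) (at t)" "x \<in> points M" for k k' x
    using DERIV_chain2[OF that(1)[OF qq_reg(1)[OF s that(2) y]] DERIV_cmult[OF DERIV_ident, of s]] by (simp add: mult.commute)
  have c3: "Cn M 0 (\<lambda>x. k3 (s * cc M x y))"
  proof (rule Cn_radial_0[where k = "\<lambda>t. k3 (s * t)"])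
    fix x assume x: "x \<in> points M"
    have "isCont (\<lambda>t. s * t) (cc M x y)" by (intro continuous_intros)
    from isCont_o2[OF this k3[OF qq_reg(1)[OF s x y]]] show "isCont (\<lambda>t. k3 (s * t)) (cc M x y)" .
  qed
  show c2: "Cn M 1 (\<lambda>x. k2 (s * cc M x y))"
    using Cn_radial_Suc[where k = "\<lambda>t. k2 (s * t)" and k' = "\<lambda>t. s * k3 (s * t)" and n = 0, OF d[OF k2]] Cn_mult[OF Cn_const c3, of s] by simp
  show c1: "Cn M 2 (\<lambda>x. k1 (s * cc M x y))"
    using Cn_radial_Suc[where k = "\<lambda>t. k1 (s * t)" and k' = "\<lambda>t. s * k2 (s * t)" and n = 1, OF d[OF k1]] Cn_mult[OF Cn_const c2, of s] by (simp add: numeral_2_eq_2)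
  show "Cn M 3 (\<lambda>x. k0 (s * cc M x y))"
    using Cn_radial_Suc[where k = "\<lambda>t. k0 (s * t)" and k' = "\<lambda>t. s * k1 (s * t)" and n = 2, OF d[OF k0]] Cn_mult[OF Cn_const c1, of s] by (simp add: numeral_3_eq_3 numeral_2_eq_2)
qed

lemma lie_k:
  assumes s: "reg M s" and y: "y \<in> points M" and x: "x \<in> points M"
  shows "lie M a b (\<lambda>x. k0 (s * cc M x y)) x = s * k1 (s * cc M x y) * (curv M * (form M a x * form M b y - form M b x * form M a y))"
    "lie M a b (\<lambda>x. k1 (s * cc M x y)) x = s * k2 (s * cc M x y) * (curv M * (form M a x * form M b y - form M b x * form M a y))"
proof -
  have d: "((\<lambda>t. k (s * t)) has_real_derivative s * k' (s * cc M x y)) (at (cc M x y))"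
    if "\<And>t. qq M t > 0 \<Longrightarrow> (k has_real_derivative k' t) (at t)" for k k'
    using DERIV_chain2[OF that(1)[OF qq_reg(1)[OF s x y]] DERIV_cmult[OF DERIV_ident, of s]] by (simp add: mult.commute)
  show "lie M a b (\<lambda>x. k0 (s * cc M x y)) x = s * k1 (s * cc M x y) * (curv M * (form M a x * form M b y - form M b x * form M a y))"
    using lie_radial[where k = "\<lambda>t. k0 (s * t)", OF d[OF k0] x] by simp
  show "lie M a b (\<lambda>x. k1 (s * cc M x y)) x = s * k2 (s * cc M x y) * (curv M * (form M a x * form M b y - form M b x * form M a y))"
    using lie_radial[where k = "\<lambda>t. k1 (s * t)", OF d[OF k1] x] by simp
qed

lemma kil_coefficient:
  assumes y: "y \<in> points M"
  shows "curv M * (form M y x * form M w y - form M w x * form M y y) = - form M w (tpart M y x)"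
  using form_point[OF y] by (simp add: tpart_def form_lin form_sym[of M x] algebra_simps)

lemma regularised_by_parts:
  fixes F :: "real^4 \<Rightarrow> 'b::euclidean_space"
  assumes s: "reg M s" and y: "y \<in> points M" and F: "Cn M 2 F" and b: "bsupp M F"
  shows "(\<integral>x. k0 (s * cc M x y) *\<^sub>R lie M a c F x \<partial>vol M) =
     - (\<integral>x. (s * k1 (s * cc M x y) * (curv M * (form M a x * form M c y - form M c x * form M a y))) *\<^sub>R F x \<partial>vol M)"
  unfolding integral_by_parts[OF Cn_le[OF Cn_k(1)[OF s y], of 2] F b, simplified]
  using lie_k[OF s y] by (intro arg_cong[where f = uminus] Bochner_Integration.integral_cong) auto

text \<open>Dominated convergence as the regularisation is removed.\<close>

lemma regularised_limit:
  fixes F :: "real^4 \<Rightarrow> 'b::euclidean_space"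
  assumes y: "y \<in> points M" and c: "continuous_on (points M) F" and b: "bsupp M F"
    and g: "\<And>t. qq M t > 0 \<Longrightarrow> isCont g t" and h: "continuous_on (points M) h"
    and dom: "\<And>T. \<exists>B. \<forall>x\<in>points M. \<forall>s. reg M s \<longrightarrow> s \<le> 3/2 \<longrightarrow> cc M x y \<le> T \<longrightarrow> qq M (cc M x y) > 0 \<longrightarrow>
         \<bar>g (s * cc M x y) * h x\<bar> \<le> B * (1 + 1 / qq M (cc M x y))"
  shows "(\<lambda>n. \<integral>x. (g (sreg M n * cc M x y) * h x) *\<^sub>R F x \<partial>vol M) \<longlonglongrightarrow> (\<integral>x. (g (cc M x y) * h x) *\<^sub>R F x \<partial>vol M)"
    "integrable (vol M) (\<lambda>x. (g (cc M x y) * h x) *\<^sub>R F x)"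
proof -
  obtain T where T: "T \<ge> 1" "\<And>x. x \<in> points M \<Longrightarrow> F x \<noteq> 0 \<Longrightarrow> cc M x y \<le> T" using bsupp_cc[OF b y] by blast
  obtain A where A: "A > 0" "\<And>x. x \<in> points M \<Longrightarrow> norm (F x) \<le> A" using bsupp_bounded[OF c b] by blast
  obtain B where B: "\<And>x s. x \<in> points M \<Longrightarrow> reg M s \<Longrightarrow> s \<le> 3/2 \<Longrightarrow> cc M x y \<le> T \<Longrightarrow> qq M (cc M x y) > 0 \<Longrightarrow>
         \<bar>g (s * cc M x y) * h x\<bar> \<le> B * (1 + 1 / qq M (cc M x y))" using dom[of T] by metis
  have m: "(\<lambda>x. (g (cc M x y) * h x) *\<^sub>R F x) \<in> borel_measurable (vol M)"
    using radial_measurable[OF g y] continuous_vol[OF h] continuous_vol[OF c] by simp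
  have mn: "(\<lambda>x. (g (s * cc M x y) * h x) *\<^sub>R F x) \<in> borel_measurable (vol M)" if s: "reg M s" for s
  proof -
    have "continuous_on (points M) (\<lambda>x. g (s * cc M x y))"
    proof (rule Cn_radial_0[where k = "\<lambda>t. g (s * t)", simplified])
      fix x assume x: "x \<in> points M"
      have "isCont (\<lambda>t. s * t) (cc M x y)" by (intro continuous_intros)
      from isCont_o2[OF this g[OF qq_reg(1)[OF s x y]]] show "isCont (\<lambda>t. g (s * t)) (cc M x y)" .
    qed
    then show ?thesis using continuous_vol[of M "\<lambda>x. g (s * cc M x y)"] continuous_vol[OF h] continuous_vol[OF c] by simp
  qed
  have lim: "(\<lambda>n. (g (sreg M n * cc M x y) * h x) *\<^sub>R F x) \<longlonglongrightarrow> (g (cc M x y) * h x) *\<^sub>R F x"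
    if q: "qq M (cc M x y) > 0" for x
  proof -
    have "(\<lambda>n. sreg M n * cc M x y) \<longlonglongrightarrow> 1 * cc M x y" by (rule tendsto_mult[OF sreg_limit tendsto_const])
    then have "(\<lambda>n. g (sreg M n * cc M x y)) \<longlonglongrightarrow> g (cc M x y)" using isCont_tendsto_compose[OF g[OF q]] by simp
    then show ?thesis by (intro tendsto_intros)
  qed
  have le: "norm ((g (sreg M n * cc M x y) * h x) *\<^sub>R F x) \<le> B * A * sing M y T x" if x: "x \<in> points M" and q: "qq M (cc M x y) > 0" for n x
  proof (cases "F x = 0")
    case True
    have "0 \<le> B * A * sing M y T x"
    proof (cases "cc M x y \<le> T")
      case cT: True
      have "0 \<le> \<bar>g (sreg M n * cc M x y) * h x\<bar>" by simp
      also have "\<dots> \<le> B * (1 + 1 / qq M (cc M x y))" using B[OF x sreg(1,3) cT q] .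
      finally have "0 \<le> A * (B * (1 + 1 / qq M (cc M x y)))" by (rule mult_nonneg_nonneg[OF less_imp_le[OF A(1)]])
      then show ?thesis using cT by (simp add: sing_def mult_ac)
    qed (simp add: sing_def)
    then show ?thesis using True by simp
  next
    case False
    note cT = T(2)[OF x False]
    have "\<bar>g (sreg M n * cc M x y) * h x\<bar> * norm (F x) \<le> (B * (1 + 1 / qq M (cc M x y))) * A"
      using B[OF x sreg(1,3) cT q, of n] A(2)[OF x] by (intro mult_mono) auto
    then show ?thesis using cT by (simp add: sing_def mult.commute mult.left_commute)
  qed
  note ae = AE_conjI[OF AE_qq_pos[OF y] AE_points]
  have iw: "integrable (vol M) (\<lambda>x. B * A * sing M y T x)" using sing_integrable[OF y] by simp
  have L: "AE x in vol M. (\<lambda>n. (g (sreg M n * cc M x y) * h x) *\<^sub>R F x) \<longlonglongrightarrow> (g (cc M x y) * h x) *\<^sub>R F x"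
    using ae lim by (auto elim!: eventually_mono)
  have D: "AE x in vol M. norm ((g (sreg M n * cc M x y) * h x) *\<^sub>R F x) \<le> B * A * sing M y T x" for n
    using ae
  proof eventually_elim
    case (elim x)
    then show ?case by (intro le) auto
  qed
  show "(\<lambda>n. \<integral>x. (g (sreg M n * cc M x y) * h x) *\<^sub>R F x \<partial>vol M) \<longlonglongrightarrow> (\<integral>x. (g (cc M x y) * h x) *\<^sub>R F x \<partial>vol M)"
    by (rule integral_dominated_convergence[OF m mn[OF sreg(1)] iw L D])
  show "integrable (vol M) (\<lambda>x. (g (cc M x y) * h x) *\<^sub>R F x)"
    by (rule integrable_dominated_convergence[OF m mn[OF sreg(1)] iw L D])
qed

lemma dom_k0:
  assumes y: "y \<in> points M"
  shows "\<exists>B. \<forall>x\<in>points M. \<forall>s. reg M s \<longrightarrow> s \<le> 3/2 \<longrightarrow> cc M x y \<le> T \<longrightarrow> qq M (cc M x y) > 0 \<longrightarrow>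
         \<bar>k0 (s * cc M x y) * 1\<bar> \<le> B * (1 + 1 / qq M (cc M x y))"
proof -
  obtain B where B: "B \<ge> 0" "\<And>t. qq M t > 0 \<Longrightarrow> \<bar>t\<bar> \<le> 3/2 * max T 1 \<Longrightarrow> \<bar>k0 t\<bar> \<le> B / sqrt (qq M t)" using b0 by metis
  show ?thesis
  proof (intro exI[of _ B] ballI allI impI)
    fix x s assume x: "x \<in> points M" and s: "reg M s" "s \<le> 3/2" and T: "cc M x y \<le> T" and q: "qq M (cc M x y) > 0"
    have ac: "\<bar>cc M x y\<bar> \<le> max T 1" using abs_cc_le[OF x y, of "max T 1"] T by simp
    have "\<bar>s * cc M x y\<bar> \<le> 3/2 * max T 1"
      unfolding abs_mult[of s] by (rule mult_mono[OF _ ac]) (use s in \<open>auto simp: reg_def\<close>)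
    then have "\<bar>k0 (s * cc M x y)\<bar> \<le> B / sqrt (qq M (s * cc M x y))" by (intro B(2) qq_reg(1)[OF s(1) x y])
    also have "\<dots> \<le> B / sqrt (qq M (cc M x y))" using qq_reg(2)[OF s(1) x y] q B(1) by (intro divide_left_mono) auto
    also have "\<dots> = B * (1 / sqrt (qq M (cc M x y)))" by simp
    also have "\<dots> \<le> B * (1 + 1 / qq M (cc M x y))" using inverse_sqrt_le[OF q] B(1) by (intro mult_left_mono)
    finally show "\<bar>k0 (s * cc M x y) * 1\<bar> \<le> B * (1 + 1 / qq M (cc M x y))" by simp
  qed
qed

lemma dom_k1:
  assumes y: "y \<in> points M" and h: "C \<ge> 0" "\<And>x. x \<in> points M \<Longrightarrow> \<bar>h x\<bar> \<le> C * sqrt (qq M (cc M x y))"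
  shows "\<exists>B. \<forall>x\<in>points M. \<forall>s. reg M s \<longrightarrow> s \<le> 3/2 \<longrightarrow> cc M x y \<le> T \<longrightarrow> qq M (cc M x y) > 0 \<longrightarrow>
         \<bar>k1 (s * cc M x y) * h x\<bar> \<le> B * (1 + 1 / qq M (cc M x y))"
proof -
  obtain B where B: "B \<ge> 0" "\<And>t. qq M t > 0 \<Longrightarrow> \<bar>t\<bar> \<le> 3/2 * max T 1 \<Longrightarrow> \<bar>k1 t\<bar> \<le> B / sqrt (qq M t) ^ 3" using b1 by metis
  show ?thesis
  proof (intro exI[of _ "B * C"] ballI allI impI)
    fix x s assume x: "x \<in> points M" and s: "reg M s" "s \<le> 3/2" and T: "cc M x y \<le> T" and q: "qq M (cc M x y) > 0"
    have ac: "\<bar>cc M x y\<bar> \<le> max T 1" using abs_cc_le[OF x y, of "max T 1"] T by simp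
    have "\<bar>s * cc M x y\<bar> \<le> 3/2 * max T 1"
      unfolding abs_mult[of s] by (rule mult_mono[OF _ ac]) (use s in \<open>auto simp: reg_def\<close>)
    then have "\<bar>k1 (s * cc M x y)\<bar> \<le> B / sqrt (qq M (s * cc M x y)) ^ 3" by (intro B(2) qq_reg(1)[OF s(1) x y])
    also have "\<dots> \<le> B / sqrt (qq M (cc M x y)) ^ 3"
      using qq_reg(2)[OF s(1) x y] q B(1) by (intro divide_left_mono power_mono) auto
    finally have "\<bar>k1 (s * cc M x y) * h x\<bar> \<le> (B / sqrt (qq M (cc M x y)) ^ 3) * (C * sqrt (qq M (cc M x y)))"
      unfolding abs_mult using h(2)[OF x] B(1) q by (intro mult_mono) auto
    also have "\<dots> = B * C * (1 / qq M (cc M x y))" using q by (simp add: power3_eq_cube)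
    also have "\<dots> \<le> B * C * (1 + 1 / qq M (cc M x y))" using B(1) h(1) by (intro mult_left_mono) auto
    finally show "\<bar>k1 (s * cc M x y) * h x\<bar> \<le> B * C * (1 + 1 / qq M (cc M x y))" .
  qed
qed

lemma limit_k0:
  fixes F :: "real^4 \<Rightarrow> 'b::euclidean_space"
  assumes "y \<in> points M" "continuous_on (points M) F" "bsupp M F"
  shows "(\<lambda>n. \<integral>x. k0 (sreg M n * cc M x y) *\<^sub>R F x \<partial>vol M) \<longlonglongrightarrow> pot M k0 F y"
  using regularised_limit(1)[OF assms isCont_k(1) continuous_on_const[of _ 1] dom_k0[OF assms(1)]] by (simp add: pot_def)

lemma continuous_form_tpart: "continuous_on A (\<lambda>x. form M w (tpart M y x))"
  unfolding tpart_def by (intro form.continuous_on continuous_intros)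

text \<open>The derivative may be put back on the kernel, which then has the singularity of an inverse square.\<close>

theorem pot_lie:
  fixes F :: "real^4 \<Rightarrow> 'b::euclidean_space"
  assumes y: "y \<in> points M" and F: "Cn M 2 F" and b: "bsupp M F"
  shows "pot M k0 (lie M y w F) y = (\<integral>x. (k1 (cc M x y) * form M w (tpart M y x)) *\<^sub>R F x \<partial>vol M)"
    "integrable (vol M) (\<lambda>x. (k1 (cc M x y) * form M w (tpart M y x)) *\<^sub>R F x)"
proof -
  have F': "Cn M (Suc (Suc 0)) F" using F by (simp add: numeral_2_eq_2)
  have cF: "continuous_on (points M) F" using F by (rule Cn_continuous)
  obtain C where C: "C \<ge> 0" "\<And>x. x \<in> points M \<Longrightarrow> \<bar>form M w (tpart M y x)\<bar> \<le> C * sqrt (qq M (cc M x y))"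
    using form_tpart_bound[OF y] by blast
  note L = regularised_limit[OF y cF b isCont_k(2) continuous_form_tpart dom_k1[OF y C]]
  have lim: "(\<lambda>n. \<integral>x. k0 (sreg M n * cc M x y) *\<^sub>R lie M y w F x \<partial>vol M) \<longlonglongrightarrow> pot M k0 (lie M y w F) y"
    by (rule limit_k0[OF y Cn_continuous[OF Cn_lie[OF F']] bsupp_lie[OF b]])
  have "(\<lambda>n. sreg M n *\<^sub>R (\<integral>x. (k1 (sreg M n * cc M x y) * form M w (tpart M y x)) *\<^sub>R F x \<partial>vol M)) \<longlonglongrightarrow>
     1 *\<^sub>R (\<integral>x. (k1 (cc M x y) * form M w (tpart M y x)) *\<^sub>R F x \<partial>vol M)"
    by (rule tendsto_scaleR[OF sreg_limit L(1)])
  moreover have "sreg M n *\<^sub>R (\<integral>x. (k1 (sreg M n * cc M x y) * form M w (tpart M y x)) *\<^sub>R F x \<partial>vol M) =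
     (\<integral>x. k0 (sreg M n * cc M x y) *\<^sub>R lie M y w F x \<partial>vol M)" for n
    unfolding regularised_by_parts[OF sreg(1) y F b] kil_coefficient[OF y]
    by (simp add: mult.assoc flip: integral_scaleR_right scaleR_scaleR)
  ultimately have "(\<lambda>n. \<integral>x. k0 (sreg M n * cc M x y) *\<^sub>R lie M y w F x \<partial>vol M) \<longlonglongrightarrow>
     1 *\<^sub>R (\<integral>x. (k1 (cc M x y) * form M w (tpart M y x)) *\<^sub>R F x \<partial>vol M)" by (simp only:)
  from LIMSEQ_unique[OF lim this]
  show "pot M k0 (lie M y w F) y = (\<integral>x. (k1 (cc M x y) * form M w (tpart M y x)) *\<^sub>R F x \<partial>vol M)" by simp
  show "integrable (vol M) (\<lambda>x. (k1 (cc M x y) * form M w (tpart M y x)) *\<^sub>R F x)" by (rule L(2))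
qed

lemma limit_k1:
  fixes F :: "real^4 \<Rightarrow> 'b::euclidean_space"
  assumes y: "y \<in> points M" and F: "Cn M 2 F" and b: "bsupp M F"
  shows "(\<lambda>n. \<integral>x. (k1 (sreg M n * cc M x y) * form M w (tpart M y x)) *\<^sub>R F x \<partial>vol M) \<longlonglongrightarrow> pot M k0 (lie M y w F) y"
proof -
  obtain C where C: "C \<ge> 0" "\<And>x. x \<in> points M \<Longrightarrow> \<bar>form M w (tpart M y x)\<bar> \<le> C * sqrt (qq M (cc M x y))"
    using form_tpart_bound[OF y] by blast
  show ?thesis unfolding pot_lie(1)[OF y F b]
    by (rule regularised_limit(1)[OF y Cn_continuous[OF F] b isCont_k(2) continuous_form_tpart dom_k1[OF y C]])
qed

text \<open>Rotations about \<open>y\<close> leave the kernel invariant.\<close>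

lemma pot_lie_stabiliser:
  fixes F :: "real^4 \<Rightarrow> 'b::euclidean_space"
  assumes y: "y \<in> points M" and F: "Cn M 2 F" and b: "bsupp M F" and u: "u \<in> tangent M y" and w: "w \<in> tangent M y"
  shows "pot M k0 (lie M u w F) y = 0"
proof -
  have F': "Cn M (Suc (Suc 0)) F" using F by (simp add: numeral_2_eq_2)
  have "(\<integral>x. k0 (sreg M n * cc M x y) *\<^sub>R lie M u w F x \<partial>vol M) = 0" for n
    unfolding regularised_by_parts[OF sreg(1) y F b] using tangentD(2)[OF u] tangentD(2)[OF w] by simp
  moreover have "(\<lambda>n. \<integral>x. k0 (sreg M n * cc M x y) *\<^sub>R lie M u w F x \<partial>vol M) \<longlonglongrightarrow> pot M k0 (lie M u w F) y"
    by (rule limit_k0[OF y Cn_continuous[OF Cn_lie[OF F']] bsupp_lie[OF b]])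
  ultimately have "(\<lambda>n. 0) \<longlonglongrightarrow> pot M k0 (lie M u w F) y" by (simp only:)
  then show ?thesis by (simp add: LIMSEQ_const_iff)
qed

text \<open>
  Two integrations by parts. The integrand on the right is the Hessian of the regularised kernel in the
  directions \<open>u\<close> and \<open>w\<close>.
\<close>

lemma regularised_second:
  fixes F :: "real^4 \<Rightarrow> 'b::euclidean_space"
  assumes s: "reg M s" and y: "y \<in> points M" and F: "Cn M 3 F" and b: "bsupp M F"
    and u: "u \<in> tangent M y" and w: "w \<in> tangent M y"
  shows "(\<integral>x. k0 (s * cc M x y) *\<^sub>R lie M y u (lie M y w F) x \<partial>vol M) =
     (\<integral>x. (s\<^sup>2 * k2 (s * cc M x y) * (form M u x * form M w x) - s * k1 (s * cc M x y) * (cc M x y * (curv M * form M u w))) *\<^sub>R F x \<partial>vol M)"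
proof -
  have F': "Cn M (Suc 2) F" using F by (simp add: numeral_3_eq_3 numeral_2_eq_2)
  have L: "Cn M 2 (lie M y w F)" by (rule Cn_lie[OF F'])
  have tp: "form M v (tpart M y x) = form M v x" if "v \<in> tangent M y" for v x
    using tangentD[OF that] by (simp add: tpart_def form_lin)
  define h where "h x = k1 (s * cc M x y) * form M u x" for x
  have h: "Cn M 2 h" unfolding h_def[abs_def] by (intro Cn_mult Cn_k(2)[OF s y] Cn_form)
  have hl: "lie M y w h x = - (s * k2 (s * cc M x y) * (form M u x * form M w x)) + k1 (s * cc M x y) * (cc M x y * (curv M * form M u w))"
    if x: "x \<in> points M" for x
  proof -
    have d: "(\<lambda>x. k1 (s * cc M x y)) differentiable (at x within points M)" "form M u differentiable (at x within points M)"
      using Cn_k(2)[OF s y] Cn_form[of M "Suc 0" u] x by (simp_all add: numeral_2_eq_2)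
    have "lie M y w h x = k1 (s * cc M x y) * lie M y w (form M u) x + lie M y w (\<lambda>x. k1 (s * cc M x y)) x * form M u x"
      unfolding h_def[abs_def] using lie_scaleR[OF d x] by simp
    also have "lie M y w (form M u) x = form M y x * form M u w"
      using lie_form[OF x, of y w u] tangentD[OF u] by (simp add: kil_def form_lin)
    also have "lie M y w (\<lambda>x. k1 (s * cc M x y)) x = - (s * k2 (s * cc M x y) * form M w x)"
      unfolding lie_k(2)[OF s y x] kil_coefficient[OF y] tp[OF w] by simp
    finally show ?thesis by (simp add: form_sym[of M y x] algebra_simps)
  qed
  have "(\<integral>x. k0 (s * cc M x y) *\<^sub>R lie M y u (lie M y w F) x \<partial>vol M) = (\<integral>x. s *\<^sub>R (h x *\<^sub>R lie M y w F x) \<partial>vol M)"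
    unfolding regularised_by_parts[OF s y L bsupp_lie[OF b]] kil_coefficient[OF y] tp[OF u]
    by (simp add: h_def mult.assoc)
  also have "\<dots> = s *\<^sub>R (\<integral>x. h x *\<^sub>R lie M y w F x \<partial>vol M)" by (rule integral_scaleR_right)
  also have "\<dots> = - (s *\<^sub>R (\<integral>x. lie M y w h x *\<^sub>R F x \<partial>vol M))"
    using integral_by_parts[OF h Cn_le[OF F'] b, of y w] by simp
  also have "\<dots> = - (\<integral>x. s *\<^sub>R (lie M y w h x *\<^sub>R F x) \<partial>vol M)" by (simp only: integral_scaleR_right)
  also have "\<dots> = (\<integral>x. - (s *\<^sub>R (lie M y w h x *\<^sub>R F x)) \<partial>vol M)" by (simp only: Bochner_Integration.integral_minus)
  also have "\<dots> = (\<integral>x. (s\<^sup>2 * k2 (s * cc M x y) * (form M u x * form M w x) - s * k1 (s * cc M x y) * (cc M x y * (curv M * form M u w))) *\<^sub>R F x \<partial>vol M)"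
    by (intro Bochner_Integration.integral_cong refl) (subst hl, simp, simp add: algebra_simps power2_eq_square)
  finally show ?thesis .
qed

text \<open>
  The Hessian of the regularised kernel in \<open>regularised_second\<close> is symmetric in \<open>u\<close> and \<open>w\<close>.
\<close>

lemma pot_lie_commute:
  fixes F :: "real^4 \<Rightarrow> 'b::euclidean_space"
  assumes y: "y \<in> points M" and F: "Cn M 3 F" and b: "bsupp M F" and u: "u \<in> tangent M y" and w: "w \<in> tangent M y"
  shows "pot M k0 (lie M y u (lie M y w F)) y = pot M k0 (lie M y w (lie M y u F)) y"
proof -
  have F': "Cn M (Suc (Suc 1)) F" using F by (simp add: numeral_3_eq_3)
  have l: "(\<lambda>n. \<integral>x. k0 (sreg M n * cc M x y) *\<^sub>R lie M y u (lie M y w F) x \<partial>vol M) \<longlonglongrightarrow> pot M k0 (lie M y u (lie M y w F)) y" for u w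
    by (rule limit_k0[OF y Cn_continuous[OF Cn_lie[OF Cn_lie[OF F']]] bsupp_lie[OF bsupp_lie[OF b]]])
  have "(\<integral>x. k0 (sreg M n * cc M x y) *\<^sub>R lie M y u (lie M y w F) x \<partial>vol M) = (\<integral>x. k0 (sreg M n * cc M x y) *\<^sub>R lie M y w (lie M y u F) x \<partial>vol M)" for n
    unfolding regularised_second[OF sreg(1) y F b u w] regularised_second[OF sreg(1) y F b w u]
    by (simp add: form_sym[of M u w] mult.commute)
  then have "(\<lambda>n. \<integral>x. k0 (sreg M n * cc M x y) *\<^sub>R lie M y u (lie M y w F) x \<partial>vol M) \<longlonglongrightarrow> pot M k0 (lie M y w (lie M y u F)) y"
    using l[of w u] by (simp only:)
  with l[of u w] show ?thesis by (rule LIMSEQ_unique)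
qed

end

section \<open>The Dirac limit and the Laplace equation\<close>

lemma lipschitz_at_point:
  fixes F :: "real^4 \<Rightarrow> 'b::real_normed_vector"
  assumes D: "(F has_derivative D) (at y within points M)" and y: "y \<in> points M"
    and A: "\<And>x. x \<in> points M \<Longrightarrow> norm (F x) \<le> A"
  obtains L where "L \<ge> 0" "\<And>x. x \<in> points M \<Longrightarrow> norm (F x - F y) \<le> L * norm (x - y)"
proof -
  obtain d where d: "d > 0" "\<And>x. x \<in> points M \<Longrightarrow> norm (x - y) < d \<Longrightarrow> norm (F x - F y - D (x - y)) \<le> 1 * norm (x - y)"
    using D unfolding has_derivative_within_alt by (metis zero_less_one)
  obtain K where K: "K > 0" "\<And>x. norm (D x) \<le> norm x * K"
    using bounded_linear.pos_bounded[OF has_derivative_bounded_linear[OF D]] by blast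
  have A0: "A \<ge> 0" using A[OF y] norm_ge_zero order_trans by blast
  have "norm (F x - F y) \<le> (1 + K + 2 * A / d) * norm (x - y)" if x: "x \<in> points M" for x
  proof (cases "norm (x - y) < d")
    case True
    have "norm (F x - F y) \<le> norm (F x - F y - D (x - y)) + norm (D (x - y))" by norm
    also have "\<dots> \<le> (1 + K) * norm (x - y)" using d(2)[OF x True] K(2)[of "x - y"] by (simp add: algebra_simps)
    also have "\<dots> \<le> (1 + K + 2 * A / d) * norm (x - y)" using A0 d(1) by (intro mult_right_mono) auto
    finally show ?thesis .
  next
    case False
    have "norm (F x - F y) \<le> 2 * A" using A[OF x] A[OF y] norm_triangle_ineq4[of "F x" "F y"] by simp
    also have "\<dots> = 2 * A / d * d" using d(1) by simp
    also have "\<dots> \<le> (1 + K + 2 * A / d) * norm (x - y)" using False A0 K(1) d(1) by (intro mult_mono) auto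
    finally show ?thesis .
  qed
  moreover have "1 + K + 2 * A / d \<ge> 0" using K(1) A0 d(1) by simp
  ultimately show ?thesis using that by blast
qed

lemma near_estimates:
  assumes x: "x \<in> points M" and y: "y \<in> points M"
  shows "cc M x y \<in> near M \<Longrightarrow> 0 < cc M x y" "cc M x y \<in> near M \<Longrightarrow> cc M x y \<le> 5/3"
    "cc M x y \<in> near M \<Longrightarrow> \<bar>1 - cc M x y\<bar> \<le> 2 * sqrt (qq M (cc M x y))"
    "cc M x y \<notin> near M \<Longrightarrow> cc M x y > 0 \<Longrightarrow> 1 / sqrt (qq M (cc M x y)) \<le> 2"
proof -
  let ?c = "cc M x y" and ?q = "qq M (cc M x y)"
  have q0: "?q \<ge> 0" by (rule qq_nonneg[OF x y])
  consider "M = S3" "\<bar>?c\<bar> \<le> 1" | "M = H3" "?c \<ge> 1" using cc_S3_le1 cc_H3_ge1 x y by (cases M) metis+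
  then have a: "(?c \<in> near M \<longrightarrow> 0 < ?c \<and> ?c \<le> 5/3 \<and> \<bar>1 - ?c\<bar> \<le> ?q \<and> ?q \<le> 4) \<and> (?c \<notin> near M \<longrightarrow> ?c > 0 \<longrightarrow> ?q \<ge> 1/4)"
  proof cases
    case 1
    have n: "?c \<in> near M \<longleftrightarrow> ?c \<ge> 3/5" using 1(1) by (simp add: near_def t0_def)
    have q: "?q = (1 - ?c) * (1 + ?c)" using 1(1) by (simp add: qq_def power2_eq_square algebra_simps)
    have "1 - ?c \<le> ?q" if "?c \<ge> 3/5" unfolding q using that 1(2) by (simp add: mult_le_cancel_left1)
    moreover have "?q \<le> 4" unfolding q using 1(2) mult_mono[of "1 - ?c" 2 "1 + ?c" 2] by simp
    moreover have "?q \<ge> 1/4" if "?c < 3/5" "?c > 0"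
      unfolding q using that mult_mono[of "2/5" "1 - ?c" 1 "1 + ?c"] by simp
    ultimately show ?thesis using n 1(2) by auto
  next
    case 2
    have n: "?c \<in> near M \<longleftrightarrow> ?c \<le> 5/3" using 2(1) by (simp add: near_def t0_def)
    have q: "?q = (?c - 1) * (?c + 1)" using 2(1) by (simp add: qq_def power2_eq_square algebra_simps)
    have "?c - 1 \<le> ?q" unfolding q using 2(2) by (simp add: mult_le_cancel_left1)
    moreover have "?q \<le> 4" if "?c \<le> 5/3" unfolding q using that 2(2) mult_mono[of "?c - 1" "2/3" "?c + 1" "8/3"] by simp
    moreover have "?q \<ge> 1/4" if "?c > 5/3" unfolding q using that mult_mono[of "2/3" "?c - 1" 1 "?c + 1"] by simp
    ultimately show ?thesis using n 2(2) by auto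
  qed
  show "?c \<in> near M \<Longrightarrow> 0 < ?c" "?c \<in> near M \<Longrightarrow> ?c \<le> 5/3" using a by auto
  show "\<bar>1 - ?c\<bar> \<le> 2 * sqrt ?q" if "?c \<in> near M"
  proof -
    have "sqrt ?q \<le> sqrt 4" using a that by (intro real_sqrt_le_mono) auto
    then have "sqrt ?q * sqrt ?q \<le> 2 * sqrt ?q" using q0 by (intro mult_right_mono) auto
    then show ?thesis using a that q0 by simp
  qed
  show "1 / sqrt ?q \<le> 2" if "?c \<notin> near M" "?c > 0"
  proof -
    have "sqrt (1/4) \<le> sqrt ?q" using a that by (intro real_sqrt_le_mono) auto
    then have "1/2 \<le> sqrt ?q" by (simp add: real_sqrt_divide)
    moreover then have "sqrt ?q > 0" by linarith
    ultimately show ?thesis by (simp add: pos_divide_le_eq)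
  qed
qed

lemma near_dist:
  assumes y: "y \<in> points M"
  obtains C where "C \<ge> 0" "\<And>x. x \<in> points M \<Longrightarrow> cc M x y \<in> near M \<Longrightarrow> norm (x - y) \<le> C * sqrt (qq M (cc M x y))"
proof -
  obtain C where C: "C > 0" "\<And>v. v \<in> tangent M y \<Longrightarrow> norm v \<le> C * sqrt (form M v v)" using tangent_norm_le[OF y] by blast
  have "norm (x - y) \<le> (C + 2 * norm y) * sqrt (qq M (cc M x y))" if x: "x \<in> points M" and n: "cc M x y \<in> near M" for x
  proof -
    have "x - y = tpart M y x - (1 - cc M x y) *\<^sub>R y" by (simp add: tpart_def algebra_simps)
    then have "norm (x - y) \<le> norm (tpart M y x) + \<bar>1 - cc M x y\<bar> * norm y" by (metis norm_scaleR norm_triangle_ineq4)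
    also have "\<dots> \<le> C * sqrt (qq M (cc M x y)) + 2 * sqrt (qq M (cc M x y)) * norm y"
      using C(2)[OF tpart_tangent[OF y, of x]] form_tpart[OF x y] near_estimates(3)[OF x y n]
      by (intro add_mono mult_right_mono) auto
    finally show ?thesis by (simp add: algebra_simps)
  qed
  then show ?thesis using that[of "C + 2 * norm y"] C(1) by simp
qed

context fundamental_solution
begin

text \<open>
  The difference from the reference kernel \<open>refk\<close>, applied to the constant \<open>F y\<close>, is dominated by \<open>sing\<close>: the
  kernels agree to leading order, and \<open>F x - cc M x y *\<^sub>R F y\<close> vanishes to first order at \<open>y\<close>, which
  gains one power of the distance. The difference tends to zero pointwise, and the reference kernel has mass
  tending to 1.
\<close>

lemma dirac_limit:
  fixes F :: "real^4 \<Rightarrow> 'b::euclidean_space"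
  assumes y: "y \<in> points M" and F: "Cn M (Suc 0) F" and b: "bsupp M F"
  shows "(\<lambda>n. \<integral>x. (curv M * ((sreg M n)\<^sup>2 - 1) * k2 (sreg M n * cc M x y)) *\<^sub>R F x \<partial>vol M) \<longlonglongrightarrow> F y"
proof -
  define s where "s = sreg M"
  have s: "reg M (s n)" "1/2 \<le> s n" "s n \<le> 3/2" for n unfolding s_def by (rule sreg)+
  have cF: "continuous_on (points M) F" by (rule Cn_continuous[OF F])
  obtain T0 where T0: "T0 \<ge> 1" "\<And>x. x \<in> points M \<Longrightarrow> F x \<noteq> 0 \<Longrightarrow> cc M x y \<le> T0" using bsupp_cc[OF b y] by blast
  obtain A where A: "A > 0" "\<And>x. x \<in> points M \<Longrightarrow> norm (F x) \<le> A" using bsupp_bounded[OF cF b] by blast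
  obtain L1 where L1: "L1 \<ge> 0" "\<And>x. x \<in> points M \<Longrightarrow> norm (F x - F y) \<le> L1 * norm (x - y)"
    using lipschitz_at_point[OF Cn_derivative[OF F y] y A(2)] by blast
  obtain C where C: "C \<ge> 0" "\<And>x. x \<in> points M \<Longrightarrow> cc M x y \<in> near M \<Longrightarrow> norm (x - y) \<le> C * sqrt (qq M (cc M x y))"
    using near_dist[OF y] by blast
  define L where "L = L1 * C + 2 * A"
  have L: "norm (F x - cc M x y *\<^sub>R F y) \<le> L * sqrt (qq M (cc M x y))" if x: "x \<in> points M" and n: "cc M x y \<in> near M" for x
  proof -
    have "F x - cc M x y *\<^sub>R F y = (F x - F y) + (1 - cc M x y) *\<^sub>R F y" by (simp add: algebra_simps)
    then have "norm (F x - cc M x y *\<^sub>R F y) \<le> norm (F x - F y) + \<bar>1 - cc M x y\<bar> * norm (F y)" by (metis norm_scaleR norm_triangle_ineq)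
    also have "\<dots> \<le> L1 * (C * sqrt (qq M (cc M x y))) + (2 * sqrt (qq M (cc M x y))) * A"
      using order_trans[OF L1(2)[OF x] mult_left_mono[OF C(2)[OF x n] L1(1)]] near_estimates(3)[OF x y n] A(2)[OF y] qq_nonneg[OF x y]
      by (intro add_mono mult_mono) auto
    finally show ?thesis by (simp add: L_def algebra_simps)
  qed
  have L0: "L \<ge> 0" using L1(1) C(1) A(1) by (simp add: L_def)
  define T where "T = max T0 (5/3)"
  obtain B1 where B1: "B1 \<ge> 0" "\<And>t. qq M t > 0 \<Longrightarrow> \<bar>t\<bar> \<le> 3/2 * T \<Longrightarrow> t > 0 \<Longrightarrow>
        \<bar>k2 t + 3 / (4 * pi) * (1 / sqrt (qq M t) ^ 5)\<bar> \<le> B1 / sqrt (qq M t) ^ 4" using b2[of "3/2 * T"] by metis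
  obtain B2 where B2: "B2 \<ge> 0" "\<And>t. qq M t > 0 \<Longrightarrow> \<bar>t\<bar> \<le> 3/2 * T \<Longrightarrow> t \<le> 0 \<Longrightarrow> M = S3 \<Longrightarrow> \<bar>k2 t\<bar> \<le> B2 / sqrt (qq M t) ^ 4"
    using b2'[of "3/2 * T"] by metis
  let ?\<kappa> = "3 / (4 * pi)"
  \<comment> \<open>The difference of the two integrands, with the weight \<open>cc\<close> under which the mass of \<open>refk\<close> is known.\<close>
  define I where "I n x = (curv M * ((s n)\<^sup>2 - 1) * k2 (s n * cc M x y)) *\<^sub>R F x
      - (indicator (near M) (cc M x y) * (cc M x y * refk M (s n) (cc M x y))) *\<^sub>R F y" for n x
  define W where "W = A * (B1 + B2) + ?\<kappa> * L + 2 * ?\<kappa> * A"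
  have W0: "W \<ge> 0" using A(1) B1(1) B2(1) L0 by (simp add: W_def)
  have bound: "norm (I n x) \<le> W * sing M y T x" if x: "x \<in> points M" and q: "qq M (cc M x y) > 0" for n x
  proof (cases "cc M x y \<le> T")
    case False
    then have "F x = 0" using T0(2)[OF x] by (force simp: T_def)
    moreover have "cc M x y \<notin> near M" using False near_estimates(2)[OF x y] by (auto simp: T_def)
    ultimately show ?thesis using False by (simp add: I_def sing_def)
  next
    case True
    define c where "c = cc M x y"
    define \<delta> where "\<delta> = curv M * (1 - (s n)\<^sup>2)"
    define r where "r = sqrt (qq M (s n * c))"
    define w where "w = sqrt (qq M c)"
    have \<delta>: "\<delta> > 0" "\<delta> \<le> r * r" using reg_sq[OF s(1)] qq_reg[OF s(1)[of n] x y] by (simp_all add: \<delta>_def r_def c_def)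
    have w: "w > 0" "w * w = qq M c" "w \<le> r" using q qq_reg(2)[OF s(1)[of n] x y] by (simp_all add: w_def r_def c_def)
    have r: "r > 0" using w by linarith
    have rw: "1 / r \<le> 1 / w" using w r by (intro divide_left_mono) auto
    have "0 < (r * r) * (w * w)" using w(1) r by simp
    moreover have "w * w \<le> r * r" using w(1,3) by (intro mult_mono) auto
    ultimately have rw2: "1 / (r * r) \<le> 1 / (w * w)" by (intro divide_left_mono) auto
    have d4: "\<delta> / r ^ 4 \<le> 1 / (w * w)"
    proof -
      have "\<delta> / r ^ 4 \<le> (r * r) / r ^ 4" using \<delta> r by (intro divide_right_mono) auto
      also have "\<dots> = 1 / (r * r)" using r by (simp add: power4_eq_xxxx)
      finally show ?thesis using rw2 by linarith
    qed
    have d5: "\<delta> / r ^ 5 \<le> 1 / (w * w) * (1 / w)"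
    proof -
      have "\<delta> / r ^ 5 = \<delta> / r ^ 4 * (1 / r)" by (simp add: eval_nat_numeral)
      also have "\<dots> \<le> 1 / (w * w) * (1 / w)" using d4 rw \<delta>(1) r w(1) by (intro mult_mono) auto
      finally show ?thesis .
    qed
    have t: "qq M (s n * c) > 0" "\<bar>s n * c\<bar> \<le> 3/2 * T"
    proof -
      show "qq M (s n * c) > 0" unfolding c_def by (rule qq_reg(1)[OF s(1) x y])
      have ac: "\<bar>c\<bar> \<le> T" using abs_cc_le[OF x y True] T0(1) by (simp add: c_def T_def)
      show "\<bar>s n * c\<bar> \<le> 3/2 * T"
        unfolding abs_mult[of "s n"] by (rule mult_mono[OF _ ac]) (use s(2,3)[of n] in auto)
    qed
    have sp: "s n > 0" using s(2)[of n] by simp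
    have W1: "A * B1 \<le> W" "A * B2 \<le> W" "A * B1 + ?\<kappa> * L \<le> W" "A * B1 + 2 * ?\<kappa> * A \<le> W"
      using A(1) B1(1) B2(1) L0 by (simp_all add: W_def algebra_simps)
    have main: "norm (I n x) \<le> W * (1 / (w * w))"
    proof (cases "c \<in> near M")
      case True
      then have c0: "c > 0" using near_estimates(1)[OF x y] by (simp add: c_def)
      then have tp: "s n * c > 0" using sp by simp
      let ?E = "k2 (s n * c) + ?\<kappa> * (1 / r ^ 5)"
      have "I n x = (- \<delta> * k2 (s n * c)) *\<^sub>R F x - (c * (\<delta> * ?\<kappa> * (1 / r ^ 5))) *\<^sub>R F y"
        using True by (simp add: I_def refk_def c_def[symmetric] \<delta>_def r_def algebra_simps)
      also have "\<dots> = (- (\<delta> * ?E)) *\<^sub>R F x + (\<delta> / r ^ 5 * ?\<kappa>) *\<^sub>R (F x - c *\<^sub>R F y)"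
        by (simp add: algebra_simps)
      finally have "norm (I n x) \<le> (\<delta> * \<bar>?E\<bar>) * norm (F x) + (\<delta> / r ^ 5 * ?\<kappa>) * norm (F x - c *\<^sub>R F y)"
        using \<delta>(1) r norm_triangle_ineq[of "(- (\<delta> * ?E)) *\<^sub>R F x" "(\<delta> / r ^ 5 * ?\<kappa>) *\<^sub>R (F x - c *\<^sub>R F y)"]
        by (simp add: abs_mult)
      also have "\<dots> \<le> (\<delta> * (B1 / r ^ 4)) * A + (1 / (w * w) * (1 / w) * ?\<kappa>) * (L * w)"
        using B1(2)[OF t tp] A(2)[OF x] \<delta>(1) d5 L[OF x True[unfolded c_def]] w r B1(1) L0
        by (intro add_mono mult_mono mult_left_mono) (auto simp: r_def c_def w_def)
      also have "\<dots> = (A * B1) * (\<delta> / r ^ 4) + (?\<kappa> * L) * (1 / (w * w))" using w(1) by (simp add: field_simps)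
      also have "\<dots> \<le> (A * B1) * (1 / (w * w)) + (?\<kappa> * L) * (1 / (w * w))"
        using d4 A(1) B1(1) by (intro add_right_mono mult_left_mono) auto
      also have "\<dots> = (A * B1 + ?\<kappa> * L) * (1 / (w * w))" by (simp only: distrib_right)
      also have "\<dots> \<le> W * (1 / (w * w))" using W1 w(1) by (intro mult_right_mono) auto
      finally show ?thesis .
    next
      case False
      then have "I n x = (- \<delta> * k2 (s n * c)) *\<^sub>R F x"
        by (simp add: I_def c_def[symmetric] \<delta>_def algebra_simps)
      then have Ie: "norm (I n x) = \<delta> * \<bar>k2 (s n * c)\<bar> * norm (F x)" using \<delta>(1) by (simp add: abs_mult)
      show ?thesis
      proof (cases "s n * c > 0")
        case tp: True
        then have c0: "c > 0" using sp by (simp add: zero_less_mult_iff)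
        have w2: "1 / w \<le> 2" using near_estimates(4)[OF x y] False c0 by (simp add: c_def w_def)
        have "\<bar>k2 (s n * c)\<bar> \<le> \<bar>k2 (s n * c) + ?\<kappa> * (1 / r ^ 5)\<bar> + \<bar>?\<kappa> * (1 / r ^ 5)\<bar>" by linarith
        also have "\<dots> \<le> B1 / r ^ 4 + ?\<kappa> * (1 / r ^ 5)" using B1(2)[OF t tp] r by (simp add: r_def)
        finally have "\<delta> * \<bar>k2 (s n * c)\<bar> * norm (F x) \<le> \<delta> * (B1 / r ^ 4 + ?\<kappa> * (1 / r ^ 5)) * A"
          using \<delta>(1) A B1(1) r x by (intro mult_mono mult_left_mono) auto
        also have "\<dots> = (A * B1) * (\<delta> / r ^ 4) + (?\<kappa> * A) * (\<delta> / r ^ 5)" by (simp add: algebra_simps)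
        also have "\<dots> \<le> (A * B1) * (1 / (w * w)) + (?\<kappa> * A) * (1 / (w * w) * 2)"
          using d4 order_trans[OF d5 mult_left_mono[OF w2, of "1 / (w * w)"]] A(1) B1(1) w(1) by (intro add_mono mult_left_mono) auto
        also have "\<dots> = (A * B1 + 2 * ?\<kappa> * A) * (1 / (w * w))" by (simp add: algebra_simps)
        also have "\<dots> \<le> W * (1 / (w * w))" using W1 w(1) by (intro mult_right_mono) auto
        finally show ?thesis unfolding Ie .
      next
        case tn: False
        have "\<not> c > 0" using tn sp by auto
        then have S3: "M = S3" using cc_H3_ge1[of x y] x y by (cases M) (auto simp: c_def)
        have "\<delta> * \<bar>k2 (s n * c)\<bar> * norm (F x) \<le> \<delta> * (B2 / r ^ 4) * A"
          using \<delta>(1) A B2(2)[OF t _ S3] tn B2(1) r x by (intro mult_mono mult_left_mono) (auto simp: r_def)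
        also have "\<dots> = (A * B2) * (\<delta> / r ^ 4)" by simp
        also have "\<dots> \<le> (A * B2) * (1 / (w * w))" using d4 A(1) B2(1) by (intro mult_left_mono) auto
        also have "\<dots> \<le> W * (1 / (w * w))" using W1 w(1) by (intro mult_right_mono) auto
        finally show ?thesis unfolding Ie .
      qed
    qed
    also have "\<dots> \<le> W * (1 + 1 / qq M c)" using W0 w(1) by (intro mult_left_mono) (auto simp: w(2)[symmetric])
    finally show ?thesis using True by (simp add: sing_def c_def)
  qed
  have s1: "s \<longlonglongrightarrow> 1" unfolding s_def by (rule sreg_limit)
  have lim: "(\<lambda>n. I n x) \<longlonglongrightarrow> 0" if q: "qq M (cc M x y) > 0" for x
  proof -
    have st: "(\<lambda>n. s n * cc M x y) \<longlonglongrightarrow> cc M x y" using tendsto_mult[OF s1 tendsto_const, of "cc M x y"] by simp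
    have s2: "(\<lambda>n. (s n)\<^sup>2) \<longlonglongrightarrow> 1" using tendsto_power[OF s1, of 2] by simp
    have k: "(\<lambda>n. k2 (s n * cc M x y)) \<longlonglongrightarrow> k2 (cc M x y)" by (rule isCont_tendsto_compose[OF isCont_k(3)[OF q] st])
    have "(\<lambda>n. (curv M * ((s n)\<^sup>2 - 1) * k2 (s n * cc M x y)) *\<^sub>R F x) \<longlonglongrightarrow> (curv M * (1 - 1) * k2 (cc M x y)) *\<^sub>R F x"
      by (intro tendsto_scaleR tendsto_mult tendsto_diff tendsto_const s2 k)
    moreover have "(\<lambda>n. refk M (s n) (cc M x y)) \<longlonglongrightarrow> curv M * (1 - 1) * ?\<kappa> * (1 / sqrt (qq M (cc M x y)) ^ 5)"
    proof -
      have "(\<lambda>n. qq M (s n * cc M x y)) \<longlonglongrightarrow> qq M (cc M x y)"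
        unfolding qq_def by (intro tendsto_mult tendsto_diff tendsto_const tendsto_power st)
      then show ?thesis unfolding refk_def using q
        by (intro tendsto_mult tendsto_diff tendsto_const s2 tendsto_divide tendsto_power tendsto_real_sqrt) auto
    qed
    then have "(\<lambda>n. (indicator (near M) (cc M x y) * (cc M x y * refk M (s n) (cc M x y))) *\<^sub>R F y) \<longlonglongrightarrow>
        (indicator (near M) (cc M x y) * (cc M x y * (curv M * (1 - 1) * ?\<kappa> * (1 / sqrt (qq M (cc M x y)) ^ 5)))) *\<^sub>R F y"
      by (intro tendsto_scaleR tendsto_mult tendsto_const)
    ultimately have "(\<lambda>n. I n x) \<longlonglongrightarrow> (curv M * (1 - 1) * k2 (cc M x y)) *\<^sub>R F x -
        (indicator (near M) (cc M x y) * (cc M x y * (curv M * (1 - 1) * ?\<kappa> * (1 / sqrt (qq M (cc M x y)) ^ 5)))) *\<^sub>R F y"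
      unfolding I_def by (rule tendsto_diff)
    then show ?thesis by simp
  qed
  have i1: "integrable (vol M) (\<lambda>x. (curv M * ((s n)\<^sup>2 - 1) * k2 (s n * cc M x y)) *\<^sub>R F x)" for n
  proof (rule bsupp_integrable[OF continuous_on_scaleR[OF _ cF] bsupp_image[OF b]])
    show "continuous_on (points M) (\<lambda>x. curv M * ((s n)\<^sup>2 - 1) * k2 (s n * cc M x y))"
      using Cn_continuous[OF Cn_k(3)[OF s(1) y]] by (intro continuous_on_mult_left)
  qed simp
  note ms = mass_integral[OF s(1) y]
  have i2: "integrable (vol M) (\<lambda>x. (indicator (near M) (cc M x y) * (cc M x y * refk M (s n) (cc M x y))) *\<^sub>R F y)" for n
    using ms[of n] by (intro integrable_scaleR_left) (auto simp: has_bochner_integral_iff)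
  have i12: "integrable (vol M) (I n)" for n unfolding I_def by (intro Bochner_Integration.integrable_diff i1 i2)
  have m2: "(\<integral>x. (indicator (near M) (cc M x y) * (cc M x y * refk M (s n) (cc M x y))) *\<^sub>R F y \<partial>vol M) = mass M (s n) *\<^sub>R F y" for n
    using ms[of n] by (subst integral_scaleR_left) (auto simp: has_bochner_integral_iff)
  have "(\<lambda>n. integral\<^sup>L (vol M) (I n)) \<longlonglongrightarrow> integral\<^sup>L (vol M) (\<lambda>x. 0)"
  proof (rule integral_dominated_convergence[where w = "\<lambda>x. W * sing M y T x"])
    show "I n \<in> borel_measurable (vol M)" for n using i12 by (rule borel_measurable_integrable)
    show "integrable (vol M) (\<lambda>x. W * sing M y T x)" using sing_integrable[OF y] by simp
    show "AE x in vol M. (\<lambda>n. I n x) \<longlonglongrightarrow> 0" using AE_qq_pos[OF y] lim by (auto elim!: eventually_mono)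
    show "AE x in vol M. norm (I n x) \<le> W * sing M y T x" for n
      using AE_conjI[OF AE_qq_pos[OF y] AE_points]
    proof eventually_elim
      case (elim x)
      then show ?case by (intro bound) auto
    qed
  qed simp
  moreover have "integral\<^sup>L (vol M) (I n) = (\<integral>x. (curv M * ((s n)\<^sup>2 - 1) * k2 (s n * cc M x y)) *\<^sub>R F x \<partial>vol M) - mass M (s n) *\<^sub>R F y" for n
    unfolding I_def Bochner_Integration.integral_diff[OF i1 i2] m2 ..
  ultimately have a: "(\<lambda>n. (\<integral>x. (curv M * ((s n)\<^sup>2 - 1) * k2 (s n * cc M x y)) *\<^sub>R F x \<partial>vol M) - mass M (s n) *\<^sub>R F y) \<longlonglongrightarrow> 0" by simp
  have "(\<lambda>n. mass M (s n)) \<longlonglongrightarrow> 1"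
  proof (rule filterlim_compose[OF mass_limit])
    have "s n \<noteq> 1" for n using s(1)[of n] by (auto simp: reg_def)
    then show "filterlim s (at 1) sequentially" using s1 by (simp add: filterlim_at)
  qed
  then have "(\<lambda>n. mass M (s n) *\<^sub>R F y) \<longlonglongrightarrow> 1 *\<^sub>R F y" by (intro tendsto_scaleR tendsto_const)
  from tendsto_add[OF a this] show ?thesis by (simp add: s_def)
qed

text \<open>
  The trace of the regularised Hessian is the differential equation at \<open>t = s c\<close> plus the error \<open>curv M *
  (s\<^sup>2 - 1) * k2 t\<close>, because the sum of the squares of \<open>s * form M (e i) x\<close> is \<open>curv M * (s\<^sup>2 -
  t\<^sup>2)\<close> and not \<open>curv M * (1 - t\<^sup>2)\<close>.  The error tends to the Dirac mass by \<open>dirac_limit\<close>.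
\<close>

theorem laplace_pot:
  fixes F :: "real^4 \<Rightarrow> 'b::euclidean_space"
  assumes y: "y \<in> points M" and F: "Cn M 3 F" and b: "bsupp M F"
  shows "(\<Sum>i\<in>UNIV. pot M k0 (lie M y (frame M y i) (lie M y (frame M y i) F)) y) =
     curv M *\<^sub>R (al *\<^sub>R pot M k0 F y + be *\<^sub>R (\<integral>x. F x \<partial>vol M)) + F y"
proof -
  let ?e = "frame M y"
  have F': "Cn M (Suc (Suc 1)) F" using F by (simp add: numeral_3_eq_3)
  have cF: "continuous_on (points M) F" by (rule Cn_continuous[OF F])
  have int: "integrable (vol M) (\<lambda>x. h x *\<^sub>R F x)" if "continuous_on (points M) h" for h
    by (rule bsupp_integrable[OF continuous_on_scaleR[OF that cF] bsupp_image[OF b]]) simp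
  define s where "s = sreg M"
  have s: "reg M (s n)" for n unfolding s_def by (rule sreg)
  have c0: "continuous_on (points M) (\<lambda>x. k0 (s n * cc M x y))" "continuous_on (points M) (\<lambda>x. k1 (s n * cc M x y))"
     "continuous_on (points M) (\<lambda>x. k2 (s n * cc M x y))" for n
    using Cn_k[OF s y, THEN Cn_continuous] by blast+
  have eq: "(\<Sum>i\<in>UNIV. \<integral>x. k0 (s n * cc M x y) *\<^sub>R lie M y (?e i) (lie M y (?e i) F) x \<partial>vol M) =
     (curv M * al) *\<^sub>R (\<integral>x. k0 (s n * cc M x y) *\<^sub>R F x \<partial>vol M) + (curv M * be) *\<^sub>R (\<integral>x. F x \<partial>vol M)
       + (\<integral>x. (curv M * ((s n)\<^sup>2 - 1) * k2 (s n * cc M x y)) *\<^sub>R F x \<partial>vol M)" for n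
  proof -
    let ?g = "\<lambda>i x. (s n)\<^sup>2 * k2 (s n * cc M x y) * (form M (?e i) x * form M (?e i) x) - s n * k1 (s n * cc M x y) * (cc M x y * (curv M * form M (?e i) (?e i)))"
    have cg: "continuous_on (points M) (?g i)" for i
      by (intro continuous_on_diff continuous_on_mult continuous_on_const c0 continuous_cc form.continuous_on continuous_on_id)
    have "(\<Sum>i\<in>UNIV. \<integral>x. k0 (s n * cc M x y) *\<^sub>R lie M y (?e i) (lie M y (?e i) F) x \<partial>vol M) = (\<Sum>i\<in>UNIV. \<integral>x. ?g i x *\<^sub>R F x \<partial>vol M)"
      by (intro sum.cong refl regularised_second[OF s y F b] frameD(1)[OF y])
    also have "\<dots> = (\<integral>x. (\<Sum>i\<in>UNIV. ?g i x *\<^sub>R F x) \<partial>vol M)"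
      by (rule Bochner_Integration.integral_sum[symmetric]) (rule int[OF cg])
    also have "\<dots> = (\<integral>x. (curv M * al) *\<^sub>R (k0 (s n * cc M x y) *\<^sub>R F x) + (curv M * be) *\<^sub>R F x
        + (curv M * ((s n)\<^sup>2 - 1) * k2 (s n * cc M x y)) *\<^sub>R F x \<partial>vol M)"
    proof (rule Bochner_Integration.integral_cong[OF refl])
      fix x assume "x \<in> space (vol M)"
      then have x: "x \<in> points M" by simp
      define c t where "c = cc M x y" and "t = s n * c"
      have q: "qq M t > 0" unfolding t_def c_def by (rule qq_reg(1)[OF s x y])
      have tr: "(\<Sum>i\<in>UNIV. form M (?e i) x * form M (?e i) x) = curv M * (1 - c\<^sup>2)"
      proof -
        have "x = cc M x y *\<^sub>R y + (\<Sum>i\<in>UNIV. form M (?e i) x *\<^sub>R ?e i)" by (rule frame_expand[OF y frame_exists[OF y]])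
        from trans[OF this add.commute] have tx: "tpart M y x = (\<Sum>i\<in>UNIV. form M (?e i) x *\<^sub>R ?e i)"
          unfolding tpart_def by (rule iffD2[OF diff_eq_eq])
        have "form M (tpart M y x) x = (\<Sum>i\<in>UNIV. form M (?e i) x * form M (?e i) x)"
          unfolding tx form.sum_left form.scaleR_left by simp
        moreover have "form M (tpart M y x) x = form M (tpart M y x) (tpart M y x)"
          using tangentD[OF tpart_tangent[OF y, of x]] by (simp add: tpart_def[of M y x] form_lin)
        ultimately show ?thesis using form_tpart[OF x y] by (simp add: qq_def c_def)
      qed
      have "(\<Sum>i\<in>UNIV. ?g i x) = (s n)\<^sup>2 * k2 t * (\<Sum>i\<in>UNIV. form M (?e i) x * form M (?e i) x) - 3 * (s n * k1 t * (c * curv M))"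
        unfolding c_def t_def using frameD(2)[OF y] by (simp add: sum_subtractf sum_distrib_left)
      also have "\<dots> = curv M * ((1 - t\<^sup>2) * k2 t - 3 * t * k1 t) + curv M * ((s n)\<^sup>2 - 1) * k2 t"
        unfolding tr by (simp add: t_def algebra_simps power_mult_distrib)
      also have "\<dots> = curv M * al * k0 t + curv M * be + curv M * ((s n)\<^sup>2 - 1) * k2 t"
        unfolding ode[OF q] by (simp add: algebra_simps)
      finally show "(\<Sum>i\<in>UNIV. ?g i x *\<^sub>R F x) = (curv M * al) *\<^sub>R (k0 (s n * cc M x y) *\<^sub>R F x) + (curv M * be) *\<^sub>R F x
        + (curv M * ((s n)\<^sup>2 - 1) * k2 (s n * cc M x y)) *\<^sub>R F x"
        unfolding scaleR_sum_left[symmetric] by (simp add: scaleR_add_left t_def c_def)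
    qed
    also have "\<dots> = (\<integral>x. (curv M * al) *\<^sub>R (k0 (s n * cc M x y) *\<^sub>R F x) \<partial>vol M) + (\<integral>x. (curv M * be) *\<^sub>R F x \<partial>vol M)
       + (\<integral>x. (curv M * ((s n)\<^sup>2 - 1) * k2 (s n * cc M x y)) *\<^sub>R F x \<partial>vol M)"
    proof -
      have a: "integrable (vol M) (\<lambda>x. (curv M * al) *\<^sub>R (k0 (s n * cc M x y) *\<^sub>R F x))" by (intro integrable_scaleR_right int c0)
      have b: "integrable (vol M) (\<lambda>x. (curv M * be) *\<^sub>R F x)" by (intro int continuous_on_const)
      have c: "integrable (vol M) (\<lambda>x. (curv M * ((s n)\<^sup>2 - 1) * k2 (s n * cc M x y)) *\<^sub>R F x)" by (intro int continuous_on_mult_left c0)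
      show ?thesis
        unfolding Bochner_Integration.integral_add[OF Bochner_Integration.integrable_add[OF a b] c] Bochner_Integration.integral_add[OF a b] ..
    qed
    also have "\<dots> = (curv M * al) *\<^sub>R (\<integral>x. k0 (s n * cc M x y) *\<^sub>R F x \<partial>vol M) + (curv M * be) *\<^sub>R (\<integral>x. F x \<partial>vol M)
       + (\<integral>x. (curv M * ((s n)\<^sup>2 - 1) * k2 (s n * cc M x y)) *\<^sub>R F x \<partial>vol M)"
      by (simp only: integral_scaleR_right)
    finally show ?thesis .
  qed
  have "(\<lambda>n. \<Sum>i\<in>UNIV. \<integral>x. k0 (s n * cc M x y) *\<^sub>R lie M y (?e i) (lie M y (?e i) F) x \<partial>vol M) \<longlonglongrightarrow>
     (\<Sum>i\<in>UNIV. pot M k0 (lie M y (?e i) (lie M y (?e i) F)) y)"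
    unfolding s_def
    by (intro tendsto_sum limit_k0 y Cn_continuous[OF Cn_lie[OF Cn_lie[OF F']]] bsupp_lie[OF bsupp_lie[OF b]])
  moreover have "(\<lambda>n. \<Sum>i\<in>UNIV. \<integral>x. k0 (s n * cc M x y) *\<^sub>R lie M y (?e i) (lie M y (?e i) F) x \<partial>vol M) \<longlonglongrightarrow>
     (curv M * al) *\<^sub>R pot M k0 F y + (curv M * be) *\<^sub>R (\<integral>x. F x \<partial>vol M) + F y"
    unfolding eq unfolding s_def
    by (intro tendsto_add tendsto_scaleR tendsto_const limit_k0[OF y cF b] dirac_limit[OF y Cn_le[OF F] b]) simp
  ultimately have "(\<Sum>i\<in>UNIV. pot M k0 (lie M y (?e i) (lie M y (?e i) F)) y) =
     (curv M * al) *\<^sub>R pot M k0 F y + (curv M * be) *\<^sub>R (\<integral>x. F x \<partial>vol M) + F y"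
    by (rule LIMSEQ_unique)
  then show ?thesis by (simp add: scaleR_add_right)
qed

end

section \<open>The two fundamental solutions\<close>

text \<open>
  \<open>ker\<close> is the kernel of the parallel transport formulas as a function of \<open>cc x y\<close>, the cosine or hyperbolic
  cosine of the distance.  Off the poles \<open>qq t = 0\<close> its derivatives are obtained from the first-order
  equation \<open>(1 - t\<^sup>2) k' = t k - bcon\<close>.
\<close>

definition bcon :: "space_form \<Rightarrow> real" where
  "bcon M = (case M of S3 \<Rightarrow> 1 / (4 * pi\<^sup>2) | H3 \<Rightarrow> 0)"

definition ker :: "space_form \<Rightarrow> real \<Rightarrow> real" where
  "ker M t = (case M of S3 \<Rightarrow> - (1 / (4 * pi\<^sup>2)) * ((pi - arccos t) / sqrt (1 - t\<^sup>2)) | H3 \<Rightarrow> - (1 / (4 * pi)) * (1 / sqrt (t\<^sup>2 - 1)))"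

definition dker :: "space_form \<Rightarrow> real \<Rightarrow> real" where
  "dker M t = (t * ker M t - bcon M) / (1 - t\<^sup>2)"

definition ddker :: "space_form \<Rightarrow> real \<Rightarrow> real" where
  "ddker M t = (3 * t * dker M t + ker M t) / (1 - t\<^sup>2)"

definition dddker :: "space_form \<Rightarrow> real \<Rightarrow> real" where
  "dddker M t = (5 * t * ddker M t + 4 * dker M t) / (1 - t\<^sup>2)"

lemma bcon_bounds: "0 \<le> bcon M" "bcon M \<le> 1"
proof -
  have "1 \<le> pi" using pi_gt3 by simp
  then have "1 * 1 \<le> pi * pi" by (intro mult_mono) auto
  then have "1 \<le> 4 * pi\<^sup>2" by (simp add: power2_eq_square)
  then show "0 \<le> bcon M" "bcon M \<le> 1" by (auto simp: bcon_def divide_le_eq_1 split: space_form.split)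
qed

lemma qq_nz: "qq M t > 0 \<Longrightarrow> 1 - t\<^sup>2 \<noteq> 0"
  by (auto simp: qq_def)

lemma ker_derivative:
  assumes q: "qq M t > 0" shows "(ker M has_real_derivative dker M t) (at t)"
proof (cases M)
  case S3
  then have t: "1 - t\<^sup>2 > 0" using q by (simp add: qq_def)
  then have a: "\<bar>t\<bar> < 1" by (simp add: abs_square_less_1)
  define w where "w = sqrt (1 - t\<^sup>2)"
  have w: "w > 0" "w * w = 1 - t\<^sup>2" using t by (simp_all add: w_def)
  have ds: "((\<lambda>t. sqrt (1 - t\<^sup>2)) has_real_derivative - t / w) (at t)"
    using t by (auto intro!: derivative_eq_intros simp: w_def field_simps)
  have da: "(arccos has_real_derivative - (1 / w)) (at t)"
    using DERIV_arccos[of t] a by (simp add: w_def abs_less_iff divide_inverse)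
  have "((\<lambda>t. (pi - arccos t) / sqrt (1 - t\<^sup>2)) has_real_derivative
      ((0 - (- (1 / w))) * sqrt (1 - t\<^sup>2) - (pi - arccos t) * (- t / w)) / (sqrt (1 - t\<^sup>2) * sqrt (1 - t\<^sup>2))) (at t)"
    by (intro DERIV_divide DERIV_diff DERIV_const ds da) (use w in \<open>simp add: w_def[symmetric]\<close>)
  from DERIV_cmult[OF this, of "- (1 / (4 * pi\<^sup>2))"]
  have "(ker M has_real_derivative - (1 / (4 * pi\<^sup>2)) * ((1 / w * w + (pi - arccos t) * t / w) / (w * w))) (at t)"
    using S3 by (simp add: ker_def[abs_def] w_def[symmetric])
  moreover have "- (1 / (4 * pi\<^sup>2)) * ((1 / w * w + (pi - arccos t) * t / w) / (w * w)) = dker M t"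
    unfolding dker_def ker_def bcon_def w(2)[symmetric] using S3 w(1) by (simp add: w_def[symmetric] field_simps)
  ultimately show ?thesis by simp
next
  case H3
  then have t: "t\<^sup>2 - 1 > 0" using q by (simp add: qq_def)
  define w where "w = sqrt (t\<^sup>2 - 1)"
  have w: "w > 0" "w * w = t\<^sup>2 - 1" using t by (simp_all add: w_def)
  have ds: "((\<lambda>t. sqrt (t\<^sup>2 - 1)) has_real_derivative t / w) (at t)"
    using t by (auto intro!: derivative_eq_intros simp: w_def field_simps)
  have "((\<lambda>t. 1 / sqrt (t\<^sup>2 - 1)) has_real_derivative (0 * sqrt (t\<^sup>2 - 1) - 1 * (t / w)) / (sqrt (t\<^sup>2 - 1) * sqrt (t\<^sup>2 - 1))) (at t)"
    by (intro DERIV_divide DERIV_const ds) (use w in \<open>simp add: w_def[symmetric]\<close>)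
  from DERIV_cmult[OF this, of "- (1 / (4 * pi))"]
  have "(ker M has_real_derivative - (1 / (4 * pi)) * (- (t / w) / (w * w))) (at t)"
    using H3 by (simp add: ker_def[abs_def] w_def[symmetric])
  moreover have "- (1 / (4 * pi)) * (- (t / w) / (w * w)) = dker M t"
  proof -
    have e: "1 - t\<^sup>2 = - (w * w)" using w(2) by simp
    have k: "ker M t = - (1 / (4 * pi)) * (1 / w)" using H3 by (simp add: ker_def w_def)
    have "bcon M = 0" using H3 by (simp add: bcon_def)
    then have d: "dker M t = (t * (- (1 / (4 * pi)) * (1 / w)) - 0) / (- (w * w))" unfolding dker_def k e by simp
    show ?thesis unfolding d by simp
  qed
  ultimately show ?thesis by simp
qed

lemma quotient_cancel: "D \<noteq> 0 \<Longrightarrow> (a * D - b * D * e) / (D * D) = (a - b * e) / (D :: real)"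
  by (simp add: field_simps)

lemma dker_derivative:
  assumes q: "qq M t > 0" shows "(dker M has_real_derivative ddker M t) (at t)"
proof -
  note n = qq_nz[OF q]
  have "((\<lambda>t. (t * ker M t - bcon M) / (1 - t\<^sup>2)) has_real_derivative
     ((1 * ker M t + dker M t * t - 0) * (1 - t\<^sup>2) - (t * ker M t - bcon M) * (0 - 2 * t)) / ((1 - t\<^sup>2) * (1 - t\<^sup>2))) (at t)"
    by (intro DERIV_divide DERIV_diff DERIV_mult DERIV_const DERIV_ident ker_derivative[OF q] n)
      (auto intro!: derivative_eq_intros)
  moreover have "t * ker M t - bcon M = dker M t * (1 - t\<^sup>2)" using n by (simp add: dker_def)
  then have "((1 * ker M t + dker M t * t - 0) * (1 - t\<^sup>2) - (t * ker M t - bcon M) * (0 - 2 * t)) / ((1 - t\<^sup>2) * (1 - t\<^sup>2)) = ddker M t"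
    unfolding ddker_def by (simp only: quotient_cancel[OF n]) (simp add: algebra_simps)
  ultimately show ?thesis by (simp add: dker_def[abs_def])
qed

lemma ddker_derivative:
  assumes q: "qq M t > 0" shows "(ddker M has_real_derivative dddker M t) (at t)"
proof -
  note n = qq_nz[OF q]
  have "((\<lambda>t. (3 * t * dker M t + ker M t) / (1 - t\<^sup>2)) has_real_derivative
     ((3 * 1 * dker M t + ddker M t * (3 * t) + dker M t) * (1 - t\<^sup>2) - (3 * t * dker M t + ker M t) * (0 - 2 * t)) / ((1 - t\<^sup>2) * (1 - t\<^sup>2))) (at t)"
    by (intro DERIV_divide DERIV_add DERIV_diff DERIV_mult DERIV_cmult DERIV_const DERIV_ident ker_derivative[OF q] dker_derivative[OF q] n)
      (auto intro!: derivative_eq_intros)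
  moreover have "3 * t * dker M t + ker M t = ddker M t * (1 - t\<^sup>2)" using n by (simp add: ddker_def)
  then have "((3 * 1 * dker M t + ddker M t * (3 * t) + dker M t) * (1 - t\<^sup>2) - (3 * t * dker M t + ker M t) * (0 - 2 * t)) / ((1 - t\<^sup>2) * (1 - t\<^sup>2)) = dddker M t"
    unfolding dddker_def by (simp only: quotient_cancel[OF n]) (simp add: algebra_simps)
  ultimately show ?thesis by (simp add: ddker_def[abs_def])
qed

lemma dddker_continuous: "qq M t > 0 \<Longrightarrow> isCont (dddker M) t"
  unfolding dddker_def[abs_def] using DERIV_isCont[OF dker_derivative] DERIV_isCont[OF ddker_derivative] qq_nz
  by (intro continuous_intros) auto

lemma qq_le: "\<bar>t\<bar> \<le> T \<Longrightarrow> qq M t \<le> (1 + T)\<^sup>2"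
proof -
  assume t: "\<bar>t\<bar> \<le> T"
  then have "t\<^sup>2 \<le> T\<^sup>2" using power_mono[of "\<bar>t\<bar>" T 2] by simp
  moreover have "(1 + T)\<^sup>2 \<ge> 1 + T\<^sup>2" using t by (simp add: power2_eq_square algebra_simps)
  ultimately show ?thesis using curv_cases[of M] by (auto simp: qq_def) (smt (verit) zero_le_power2)+
qed

text \<open>
  Near \<open>t = 1\<close> the kernel is the Newton kernel up to a bounded term, on \<open>S3\<close> a multiple of \<open>arccos t / sin
  (arccos t)\<close>.
\<close>

lemma ker_bounds:
  assumes q: "qq M t > 0"
  shows "\<bar>ker M t\<bar> \<le> 1 / sqrt (qq M t)"
    "t > 0 \<Longrightarrow> \<bar>ker M t + 1 / (4 * pi) * (1 / sqrt (qq M t))\<bar> \<le> 1"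
    "M = S3 \<Longrightarrow> t \<le> 0 \<Longrightarrow> \<bar>ker M t\<bar> \<le> 1"
proof -
  have pi1: "pi \<ge> 1" using pi_gt3 by simp
  have p4: "1 / (4 * pi) \<le> 1" using pi1 by simp
  have "\<bar>ker M t\<bar> \<le> 1 / sqrt (qq M t) \<and> (t > 0 \<longrightarrow> \<bar>ker M t + 1 / (4 * pi) * (1 / sqrt (qq M t))\<bar> \<le> 1) \<and> (M = S3 \<longrightarrow> t \<le> 0 \<longrightarrow> \<bar>ker M t\<bar> \<le> 1)"
  proof (cases M)
    case S3
    then have t: "1 - t\<^sup>2 > 0" "qq M t = 1 - t\<^sup>2" using q by (simp_all add: qq_def)
    then have a: "-1 \<le> t" "t \<le> 1" using abs_square_less_1[of t] by auto
    define w where "w = sqrt (1 - t\<^sup>2)"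
    have w: "w > 0" "sqrt (qq M t) = w" "sin (arccos t) = w" using t a by (simp_all add: w_def sin_arccos)
    define \<beta> where "\<beta> = pi - arccos t"
    have \<beta>: "0 \<le> \<beta>" "\<beta> \<le> pi" "sin \<beta> = w" using arccos_bounded[OF a] w(3) by (simp_all add: \<beta>_def)
    have k: "ker M t = - (1 / (4 * pi\<^sup>2)) * (\<beta> / w)" using S3 by (simp add: ker_def w_def \<beta>_def)
    have c: "1 / (4 * pi\<^sup>2) \<le> 1 / 4" "1 / (4 * pi\<^sup>2) > 0"
    proof -
      have "1 * 1 \<le> pi * pi" using pi1 by (intro mult_mono) auto
      then show "1 / (4 * pi\<^sup>2) \<le> 1 / 4" by (simp add: power2_eq_square divide_le_eq)
    qed simp
    have "\<bar>ker M t\<bar> = 1 / (4 * pi\<^sup>2) * (\<beta> / w)" unfolding k using \<beta> w by (simp add: abs_mult)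
    also have "\<dots> \<le> 1 / (4 * pi\<^sup>2) * (pi / w)" using \<beta> w by (intro mult_left_mono divide_right_mono) auto
    also have "\<dots> = 1 / (4 * pi) * (1 / w)" by (simp add: power2_eq_square)
    also have "\<dots> \<le> 1 * (1 / w)" using p4 w by (intro mult_right_mono) auto
    finally have 1: "\<bar>ker M t\<bar> \<le> 1 / sqrt (qq M t)" using w by simp
    have 2: "\<bar>ker M t + 1 / (4 * pi) * (1 / sqrt (qq M t))\<bar> \<le> 1" if "t > 0"
    proof -
      have e: "ker M t + 1 / (4 * pi) * (1 / sqrt (qq M t)) = 1 / (4 * pi\<^sup>2) * (arccos t / w)"
        unfolding k w(2) \<beta>_def using w(1) by (simp add: field_simps power2_eq_square)
      have a2: "arccos t / w \<le> 2"
        using sin_ge_half[of "arccos t"] arccos_le_pi2[of t] a that arccos_lbound[OF a] w by (simp add: divide_le_eq)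
      have a0: "0 \<le> arccos t / w" using arccos_lbound[OF a] w by simp
      have "1 / (4 * pi\<^sup>2) * (arccos t / w) \<le> 1 / 4 * 2" using c a0 a2 by (intro mult_mono) auto
      moreover have "0 \<le> 1 / (4 * pi\<^sup>2) * (arccos t / w)" using c a0 by (intro mult_nonneg_nonneg) auto
      ultimately show ?thesis unfolding e by linarith
    qed
    have 3: "\<bar>ker M t\<bar> \<le> 1" if "t \<le> 0"
    proof -
      have "\<beta> = arccos (- t)" unfolding \<beta>_def using arccos_minus[OF a] by simp
      then have "\<beta> \<le> pi / 2" using arccos_le_pi2[of "- t"] that a by simp
      then have "\<beta> / w \<le> 2" using sin_ge_half[of \<beta>] \<beta> w by (simp add: divide_le_eq)
      moreover have b0: "0 \<le> \<beta> / w" using \<beta> w by simp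
      ultimately have "1 / (4 * pi\<^sup>2) * (\<beta> / w) \<le> 1 / 4 * 2" using c by (intro mult_mono) auto
      moreover have "0 \<le> 1 / (4 * pi\<^sup>2) * (\<beta> / w)" using c b0 by (intro mult_nonneg_nonneg) auto
      moreover have "ker M t = - (1 / (4 * pi\<^sup>2) * (\<beta> / w))" unfolding k by (rule mult_minus_left)
      ultimately show ?thesis by linarith
    qed
    show ?thesis using 1 2 3 by blast
  next
    case H3
    then have q': "qq M t = t\<^sup>2 - 1" by (simp add: qq_def)
    have k: "ker M t = - (1 / (4 * pi)) * (1 / sqrt (qq M t))" unfolding q' using H3 by (simp add: ker_def)
    have "\<bar>ker M t\<bar> = 1 / (4 * pi) * (1 / sqrt (qq M t))" unfolding k using q by (simp add: abs_mult)
    also have "\<dots> \<le> 1 * (1 / sqrt (qq M t))" using p4 q by (intro mult_right_mono) auto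
    finally show ?thesis using H3 k by simp
  qed
  then show "\<bar>ker M t\<bar> \<le> 1 / sqrt (qq M t)"
    "t > 0 \<Longrightarrow> \<bar>ker M t + 1 / (4 * pi) * (1 / sqrt (qq M t))\<bar> \<le> 1"
    "M = S3 \<Longrightarrow> t \<le> 0 \<Longrightarrow> \<bar>ker M t\<bar> \<le> 1" by auto
qed

lemma abs_one_minus_sq: "\<bar>1 - t\<^sup>2\<bar> = \<bar>qq M t\<bar>"
  by (simp add: qq_def abs_mult)

text \<open>With \<open>r = sqrt (qq t)\<close> bounded by \<open>R\<close>, lower powers of \<open>1 / r\<close> are absorbed in higher ones.\<close>

lemma absorb:
  fixes r R :: real assumes "0 < r" "r \<le> R" "m \<le> n"
  shows "1 / r ^ m \<le> (1 + R) ^ n / r ^ n"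
proof -
  have "r ^ (n - m) \<le> (1 + R) ^ (n - m)" using assms by (intro power_mono) auto
  also have "\<dots> \<le> (1 + R) ^ n" using assms by (intro power_increasing) auto
  finally have "r ^ (n - m) * r ^ m \<le> (1 + R) ^ n * r ^ m" using assms by (intro mult_right_mono) auto
  then have "r ^ n \<le> (1 + R) ^ n * r ^ m" using assms(3) by (simp flip: power_add)
  then show ?thesis using assms(1) by (simp add: field_simps)
qed

lemma dker_bounds:
  assumes q: "qq M t > 0" and T: "\<bar>t\<bar> \<le> T"
  defines "r \<equiv> sqrt (qq M t)"
  shows "\<bar>dker M t\<bar> \<le> (2 + 2 * T) / r ^ 3"
    "t \<le> 0 \<Longrightarrow> M = S3 \<Longrightarrow> \<bar>dker M t\<bar> \<le> (1 + T) / r\<^sup>2"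
proof -
  have r: "r > 0" "r * r = qq M t" "r \<le> 1 + T"
  proof -
    show "r > 0" "r * r = qq M t" using q by (simp_all add: r_def)
    have "sqrt (qq M t) \<le> sqrt ((1 + T)\<^sup>2)" using qq_le[OF T] by (rule real_sqrt_le_mono)
    then show "r \<le> 1 + T" using T by (simp add: r_def)
  qed
  have d: "\<bar>dker M t\<bar> \<le> (T * \<bar>ker M t\<bar> + 1) / (r * r)"
  proof -
    have "\<bar>dker M t\<bar> = \<bar>t * ker M t - bcon M\<bar> / (r * r)" using q by (simp add: dker_def abs_divide abs_one_minus_sq[of t M] r(2))
    also have "\<dots> \<le> (T * \<bar>ker M t\<bar> + 1) / (r * r)"
    proof (rule divide_right_mono)
      have "\<bar>t * ker M t - bcon M\<bar> \<le> \<bar>t * ker M t\<bar> + \<bar>bcon M\<bar>" by linarith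
      also have "\<dots> \<le> T * \<bar>ker M t\<bar> + 1" using T bcon_bounds[of M] by (simp add: abs_mult add_mono mult_right_mono)
      finally show "\<bar>t * ker M t - bcon M\<bar> \<le> T * \<bar>ker M t\<bar> + 1" .
    qed simp
    finally show ?thesis .
  qed
  have k: "\<bar>ker M t\<bar> \<le> 1 / r" using ker_bounds(1)[OF q] by (simp add: r_def)
  have "T * \<bar>ker M t\<bar> + 1 \<le> T * (1 / r) + (1 + T) * (1 / r) + 1 * (1 / r)"
  proof -
    have "1 \<le> (1 + T) * (1 / r)" using r by (simp add: field_simps)
    moreover have "T * \<bar>ker M t\<bar> \<le> T * (1 / r)" using k T by (intro mult_left_mono) auto
    moreover have "0 \<le> 1 / r" using r by simp
    ultimately show ?thesis by linarith
  qed
  then have "(T * \<bar>ker M t\<bar> + 1) / (r * r) \<le> (T * (1 / r) + (1 + T) * (1 / r) + 1 * (1 / r)) / (r * r)"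
    by (intro divide_right_mono) auto
  also have "\<dots> = (2 + 2 * T) / r ^ 3" using r(1) by (simp add: field_simps power3_eq_cube)
  finally show "\<bar>dker M t\<bar> \<le> (2 + 2 * T) / r ^ 3" using d by linarith
  show "\<bar>dker M t\<bar> \<le> (1 + T) / r\<^sup>2" if "t \<le> 0" "M = S3"
  proof -
    have "T * \<bar>ker M t\<bar> \<le> T * 1" using ker_bounds(3)[OF q that(2,1)] T by (intro mult_left_mono) auto
    then have "(T * \<bar>ker M t\<bar> + 1) / (r * r) \<le> (1 + T) / (r * r)" by (intro divide_right_mono) auto
    then show ?thesis using d by (simp add: power2_eq_square)
  qed
qed

lemma ddker_bounds:
  assumes q: "qq M t > 0" and T: "\<bar>t\<bar> \<le> T"
  defines "r \<equiv> sqrt (qq M t)"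
  shows "t > 0 \<Longrightarrow> \<bar>ddker M t + 3 / (4 * pi) * (1 / r ^ 5)\<bar> \<le> (2 + 6 * T + 2 * T\<^sup>2) / r ^ 4"
    "t \<le> 0 \<Longrightarrow> M = S3 \<Longrightarrow> \<bar>ddker M t\<bar> \<le> (3 * T * (1 + T) + (1 + T)\<^sup>2) / r ^ 4"
proof -
  have r: "r > 0" "r * r = qq M t" "r \<le> 1 + T" "r * r \<le> (1 + T)\<^sup>2"
  proof -
    show "r > 0" "r * r = qq M t" using q by (simp_all add: r_def)
    have "sqrt (qq M t) \<le> sqrt ((1 + T)\<^sup>2)" using qq_le[OF T] by (rule real_sqrt_le_mono)
    then show "r \<le> 1 + T" using T by (simp add: r_def)
    show "r * r \<le> (1 + T)\<^sup>2" using qq_le[OF T, of M] q by (simp add: r_def)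
  qed
  have T0: "T \<ge> 0" using T by linarith
  have t2: "t\<^sup>2 \<le> T\<^sup>2" using power_mono[OF T, of 2] by simp
  have u: "1 - t\<^sup>2 = curv M * (r * r)" unfolding r(2) by (simp add: qq_def)
  show "\<bar>ddker M t + 3 / (4 * pi) * (1 / r ^ 5)\<bar> \<le> (2 + 6 * T + 2 * T\<^sup>2) / r ^ 4" if t: "t > 0"
  proof -
    define \<epsilon> where "\<epsilon> = ker M t + 1 / (4 * pi) * (1 / r)"
    have \<epsilon>: "\<bar>\<epsilon>\<bar> \<le> 1" "ker M t = \<epsilon> - 1 / (4 * pi) * (1 / r)" using ker_bounds(2)[OF q t] by (simp_all add: \<epsilon>_def r_def)
    have "ddker M t = (ker M t * (1 + 2 * t\<^sup>2) - 3 * t * bcon M) / ((1 - t\<^sup>2) * (1 - t\<^sup>2))"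
    proof -
      have "(3 * t * (N / D) + k) / D = (3 * t * N + k * D) / (D * D)" if "D \<noteq> 0" for N D k :: real
        using that by (simp add: field_simps)
      note quot = this[OF qq_nz[OF q]]
      show ?thesis unfolding ddker_def dker_def quot
        by (rule arg_cong[where f = "\<lambda>z. z / _"]) (simp add: algebra_simps power2_eq_square)
    qed
    also have "(1 - t\<^sup>2) * (1 - t\<^sup>2) = r ^ 4" unfolding u by (cases M) (simp_all add: power4_eq_xxxx)
    finally have d: "ddker M t = (ker M t * (1 + 2 * t\<^sup>2) - 3 * t * bcon M) / r ^ 4" .
    have "ker M t * (1 + 2 * t\<^sup>2) + 3 / (4 * pi) * (1 / r) = \<epsilon> * (1 + 2 * t\<^sup>2) + 1 / (2 * pi) * ((1 - t\<^sup>2) / r)"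
      unfolding \<epsilon>(2) using r(1) by (simp add: field_simps)
    also have "(1 - t\<^sup>2) / r = curv M * r" unfolding u using r(1) by simp
    finally have k: "ker M t * (1 + 2 * t\<^sup>2) + 3 / (4 * pi) * (1 / r) = \<epsilon> * (1 + 2 * t\<^sup>2) + 1 / (2 * pi) * (curv M * r)" .
    have "ddker M t + 3 / (4 * pi) * (1 / r ^ 5) = (ker M t * (1 + 2 * t\<^sup>2) + 3 / (4 * pi) * (1 / r) - 3 * t * bcon M) / r ^ 4"
      unfolding d using r(1) by (simp add: field_simps eval_nat_numeral)
    then have "\<bar>ddker M t + 3 / (4 * pi) * (1 / r ^ 5)\<bar> = \<bar>\<epsilon> * (1 + 2 * t\<^sup>2) + 1 / (2 * pi) * (curv M * r) - 3 * t * bcon M\<bar> / r ^ 4"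
      unfolding k using r(1) by (simp add: abs_divide)
    also have "\<dots> \<le> (2 + 6 * T + 2 * T\<^sup>2) / r ^ 4"
    proof (rule divide_right_mono)
      have "\<bar>\<epsilon> * (1 + 2 * t\<^sup>2)\<bar> \<le> 1 * (1 + 2 * T\<^sup>2)" unfolding abs_mult using \<epsilon>(1) t2 by (intro mult_mono) auto
      moreover have "\<bar>1 / (2 * pi) * (curv M * r)\<bar> \<le> 1 * (1 + T)"
        unfolding abs_mult using r(1,3) pi_gt3 by (intro mult_mono) (auto simp: divide_le_eq)
      moreover have "\<bar>t * bcon M\<bar> \<le> T * 1" unfolding abs_mult using T bcon_bounds[of M] by (intro mult_mono) auto
      moreover have "\<bar>a + b - 3 * c\<bar> \<le> 2 + 6 * T + 2 * T\<^sup>2"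
        if "\<bar>a\<bar> \<le> 1 * (1 + 2 * T\<^sup>2)" "\<bar>b\<bar> \<le> 1 * (1 + T)" "\<bar>c\<bar> \<le> T * 1" for a b c :: real
        using that T0 zero_le_power2[of T] unfolding abs_le_iff mult_1 mult_1_right by (intro conjI; linarith)
      ultimately show "\<bar>\<epsilon> * (1 + 2 * t\<^sup>2) + 1 / (2 * pi) * (curv M * r) - 3 * t * bcon M\<bar> \<le> 2 + 6 * T + 2 * T\<^sup>2"
        unfolding mult.assoc[of 3 t] by blast
    qed (use r in simp)
    finally show ?thesis .
  qed
  show "\<bar>ddker M t\<bar> \<le> (3 * T * (1 + T) + (1 + T)\<^sup>2) / r ^ 4" if t: "t \<le> 0" "M = S3"
  proof -
    have "\<bar>1 - t\<^sup>2\<bar> = r\<^sup>2" unfolding abs_one_minus_sq[of t M] power2_eq_square[of r] r(2) using q by simp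
    then have "\<bar>ddker M t\<bar> = \<bar>3 * t * dker M t + ker M t\<bar> / r\<^sup>2"
      unfolding ddker_def abs_divide by simp
    also have "\<dots> \<le> ((3 * T * (1 + T) + (1 + T)\<^sup>2) / r\<^sup>2) / r\<^sup>2"
    proof (rule divide_right_mono)
      have "\<bar>3 * t * dker M t\<bar> \<le> (3 * T) * ((1 + T) / r\<^sup>2)"
        unfolding abs_mult using dker_bounds(2)[OF q T t] T by (intro mult_mono) (auto simp: r_def)
      moreover have "\<bar>ker M t\<bar> \<le> (1 + T)\<^sup>2 / r\<^sup>2"
      proof -
        have "1 \<le> (1 + T)\<^sup>2 / r\<^sup>2"
          unfolding power2_eq_square[of r] using r(4) by (subst le_divide_eq_1_pos) (use r(1) in simp, simp)
        then show ?thesis using ker_bounds(3)[OF q t(2,1)] by linarith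
      qed
      ultimately have "\<bar>3 * t * dker M t + ker M t\<bar> \<le> (3 * T) * ((1 + T) / r\<^sup>2) + (1 + T)\<^sup>2 / r\<^sup>2" by linarith
      then show "\<bar>3 * t * dker M t + ker M t\<bar> \<le> (3 * T * (1 + T) + (1 + T)\<^sup>2) / r\<^sup>2"
        by (simp only: add_divide_distrib[of "3 * T * (1 + T)"] times_divide_eq_right)
    qed simp
    also have "\<dots> = (3 * T * (1 + T) + (1 + T)\<^sup>2) / r ^ 4" by (simp add: power4_eq_xxxx power2_eq_square)
    finally show ?thesis .
  qed
qed

lemma ker_ode: "qq M t > 0 \<Longrightarrow> (1 - t\<^sup>2) * ddker M t - 3 * t * dker M t = 1 * ker M t + 0"
  using qq_nz by (simp add: ddker_def)

interpretation ker: fundamental_solution M "ker M" "dker M" "ddker M" "dddker M" 1 0 for M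
proof
  fix t assume q: "qq M t > 0"
  show "(ker M has_real_derivative dker M t) (at t)" "(dker M has_real_derivative ddker M t) (at t)"
    "(ddker M has_real_derivative dddker M t) (at t)" "isCont (dddker M) t"
    "(1 - t\<^sup>2) * ddker M t - 3 * t * dker M t = 1 * ker M t + 0"
    by (rule ker_derivative dker_derivative ddker_derivative dddker_continuous ker_ode q)+
next
  fix T :: real
  define T' where "T' = \<bar>T\<bar>"
  have T': "T' \<ge> 0" "\<And>t. \<bar>t\<bar> \<le> T \<Longrightarrow> \<bar>t\<bar> \<le> T'" by (auto simp: T'_def)
  show "\<exists>B\<ge>0. \<forall>t. qq M t > 0 \<longrightarrow> \<bar>t\<bar> \<le> T \<longrightarrow> \<bar>ker M t\<bar> \<le> B / sqrt (qq M t)"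
    using ker_bounds(1) by (intro exI[of _ 1]) auto
  show "\<exists>B\<ge>0. \<forall>t. qq M t > 0 \<longrightarrow> \<bar>t\<bar> \<le> T \<longrightarrow> \<bar>dker M t\<bar> \<le> B / sqrt (qq M t) ^ 3"
    using dker_bounds(1) T' by (intro exI[of _ "2 + 2 * T'"]) auto
  show "\<exists>B\<ge>0. \<forall>t. qq M t > 0 \<longrightarrow> \<bar>t\<bar> \<le> T \<longrightarrow> t > 0 \<longrightarrow>
        \<bar>ddker M t + 3 / (4 * pi) * (1 / sqrt (qq M t) ^ 5)\<bar> \<le> B / sqrt (qq M t) ^ 4"
    by (intro exI[of _ "2 + 6 * T' + 2 * T'\<^sup>2"] conjI allI impI ddker_bounds(1) T'(2)) (use T'(1) in auto)
  show "\<exists>B\<ge>0. \<forall>t. qq M t > 0 \<longrightarrow> \<bar>t\<bar> \<le> T \<longrightarrow> t \<le> 0 \<longrightarrow> M = S3 \<longrightarrow> \<bar>ddker M t\<bar> \<le> B / sqrt (qq M t) ^ 4"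
    by (intro exI[of _ "3 * T' * (1 + T') + (1 + T')\<^sup>2"] conjI allI impI ddker_bounds(2) T'(2)) (use T'(1) in auto)
qed

text \<open>
  \<open>phi0\<close> differs by a constant from \<open>t * ker t\<close>; this relation between the kernels of the electric and the
  magnetic field is what produces the displacement current.
\<close>

definition ccon :: "space_form \<Rightarrow> real" where
  "ccon M = (case M of S3 \<Rightarrow> 0 | H3 \<Rightarrow> 1 / (4 * pi))"

definition ker0 :: "space_form \<Rightarrow> real \<Rightarrow> real" where "ker0 M t = t * ker M t + ccon M"
definition dker0 :: "space_form \<Rightarrow> real \<Rightarrow> real" where "dker0 M t = ker M t + t * dker M t"
definition ddker0 :: "space_form \<Rightarrow> real \<Rightarrow> real" where "ddker0 M t = 2 * dker M t + t * ddker M t"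
definition dddker0 :: "space_form \<Rightarrow> real \<Rightarrow> real" where "dddker0 M t = 3 * ddker M t + t * dddker M t"

interpretation ker0: fundamental_solution M "ker0 M" "dker0 M" "ddker0 M" "dddker0 M" 0 "- 2 * bcon M" for M
proof
  fix t assume q: "qq M t > 0"
  note D = ker_derivative[OF q] dker_derivative[OF q] ddker_derivative[OF q]
  show "(ker0 M has_real_derivative dker0 M t) (at t)"
    unfolding ker0_def[abs_def] dker0_def by (auto intro!: derivative_eq_intros D)
  show "(dker0 M has_real_derivative ddker0 M t) (at t)"
    unfolding dker0_def[abs_def] ddker0_def by (auto intro!: derivative_eq_intros D)
  show "(ddker0 M has_real_derivative dddker0 M t) (at t)"
    unfolding ddker0_def[abs_def] dddker0_def by (auto intro!: derivative_eq_intros D)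
  show "isCont (dddker0 M) t"
    unfolding dddker0_def[abs_def] by (intro continuous_intros dddker_continuous[OF q] DERIV_isCont[OF D(3)])
  have "(1 - t\<^sup>2) * ddker0 M t - 3 * t * dker0 M t = t * ((1 - t\<^sup>2) * ddker M t - 3 * t * dker M t) + 2 * ((1 - t\<^sup>2) * dker M t) - 3 * t * ker M t"
    by (simp add: ddker0_def dker0_def algebra_simps power2_eq_square)
  also have "(1 - t\<^sup>2) * dker M t = t * ker M t - bcon M" using qq_nz[OF q] by (simp add: dker_def)
  finally show "(1 - t\<^sup>2) * ddker0 M t - 3 * t * dker0 M t = 0 * ker0 M t + - 2 * bcon M"
    unfolding ker_ode[OF q] by simp
next
  fix T :: real
  define T' where "T' = \<bar>T\<bar>"
  have T': "T' \<ge> 0" "\<And>t. \<bar>t\<bar> \<le> T \<Longrightarrow> \<bar>t\<bar> \<le> T'" by (auto simp: T'_def)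
  have r: "0 < sqrt (qq M t)" "sqrt (qq M t) \<le> 1 + T'" if "qq M t > 0" "\<bar>t\<bar> \<le> T" for t
  proof -
    show "0 < sqrt (qq M t)" using that by simp
    have "sqrt (qq M t) \<le> sqrt ((1 + T')\<^sup>2)" using qq_le[OF T'(2)[OF that(2)]] by (rule real_sqrt_le_mono)
    then show "sqrt (qq M t) \<le> 1 + T'" using T' by simp
  qed
  let ?R = "1 + (1 + T')"
  have cc: "\<bar>ccon M\<bar> \<le> 1" using pi_gt3 by (auto simp: ccon_def divide_le_eq split: space_form.split)
  show "\<exists>B\<ge>0. \<forall>t. qq M t > 0 \<longrightarrow> \<bar>t\<bar> \<le> T \<longrightarrow> \<bar>ker0 M t\<bar> \<le> B / sqrt (qq M t)"
  proof (intro exI[of _ "T' + ?R"] conjI allI impI)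
    fix t assume q: "qq M t > 0" and t: "\<bar>t\<bar> \<le> T"
    have "\<bar>t * ker M t\<bar> \<le> T' * (1 / sqrt (qq M t))" unfolding abs_mult using ker_bounds(1)[OF q] T'(2)[OF t] T' by (intro mult_mono) auto
    moreover have "1 \<le> ?R / sqrt (qq M t)" using absorb[OF r[OF q t], of 0 1] by simp
    ultimately show "\<bar>ker0 M t\<bar> \<le> (T' + ?R) / sqrt (qq M t)" unfolding ker0_def add_divide_distrib[of T'] using cc by simp
  qed (use T' in simp)
  show "\<exists>B\<ge>0. \<forall>t. qq M t > 0 \<longrightarrow> \<bar>t\<bar> \<le> T \<longrightarrow> \<bar>dker0 M t\<bar> \<le> B / sqrt (qq M t) ^ 3"
  proof (intro exI[of _ "?R ^ 3 + T' * (2 + 2 * T')"] conjI allI impI)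
    fix t assume q: "qq M t > 0" and t: "\<bar>t\<bar> \<le> T"
    have "\<bar>t * dker M t\<bar> \<le> T' * ((2 + 2 * T') / sqrt (qq M t) ^ 3)"
      unfolding abs_mult using dker_bounds(1)[OF q T'(2)[OF t]] T'(2)[OF t] T' by (intro mult_mono) auto
    moreover have "\<bar>ker M t\<bar> \<le> ?R ^ 3 / sqrt (qq M t) ^ 3" using ker_bounds(1)[OF q] absorb[OF r[OF q t], of 1 3] by simp
    ultimately show "\<bar>dker0 M t\<bar> \<le> (?R ^ 3 + T' * (2 + 2 * T')) / sqrt (qq M t) ^ 3"
      unfolding dker0_def add_divide_distrib[of "?R ^ 3"] by simp
  qed (use T' in simp)
  show "\<exists>B\<ge>0. \<forall>t. qq M t > 0 \<longrightarrow> \<bar>t\<bar> \<le> T \<longrightarrow> t > 0 \<longrightarrow>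
        \<bar>ddker0 M t + 3 / (4 * pi) * (1 / sqrt (qq M t) ^ 5)\<bar> \<le> B / sqrt (qq M t) ^ 4"
  proof (intro exI[of _ "T' * (2 + 6 * T' + 2 * T'\<^sup>2) + ?R ^ 4 + 2 * (2 + 2 * T') * ?R ^ 4"] conjI allI impI)
    fix t assume q: "qq M t > 0" and t: "\<bar>t\<bar> \<le> T" and tp: "t > 0"
    define r where "r = sqrt (qq M t)"
    have rr: "0 < r" "r \<le> 1 + T'" using r[OF q t] by (simp_all add: r_def)
    have "ddker0 M t + a * b = t * (ddker M t + a * b) + a * ((1 - t) * b) + 2 * dker M t" for a b
      by (simp add: ddker0_def algebra_simps)
    note e = this[of "3 / (4 * pi)" "1 / r ^ 5"]
    have 1: "\<bar>t * (ddker M t + 3 / (4 * pi) * (1 / r ^ 5))\<bar> \<le> T' * ((2 + 6 * T' + 2 * T'\<^sup>2) / r ^ 4)"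
      unfolding abs_mult[of t] using ddker_bounds(1)[OF q T'(2)[OF t] tp] T'(2)[OF t] T' by (intro mult_mono) (auto simp: r_def)
    have 2: "\<bar>3 / (4 * pi) * ((1 - t) * (1 / r ^ 5))\<bar> \<le> ?R ^ 4 / r ^ 4"
    proof -
      have "\<bar>1 - t\<bar> * 1 \<le> \<bar>1 - t\<bar> * (1 + t)" using tp by (intro mult_left_mono) auto
      also have "\<dots> = \<bar>1 - t\<^sup>2\<bar>"
      proof -
        have "1 - t\<^sup>2 = (1 - t) * (1 + t)" by (simp add: power2_eq_square algebra_simps)
        then have "\<bar>1 - t\<^sup>2\<bar> = \<bar>1 - t\<bar> * \<bar>1 + t\<bar>" by (simp only: abs_mult)
        then show ?thesis using tp by simp
      qed
      also have "\<dots> = r * r" using q by (simp add: abs_one_minus_sq[of t M] r_def)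
      finally have "\<bar>1 - t\<bar> * (1 / r ^ 5) \<le> r * r * (1 / r ^ 5)" using rr by (intro mult_right_mono) auto
      also have "\<dots> = 1 / r ^ 3" using rr by (simp add: eval_nat_numeral)
      also have "\<dots> \<le> ?R ^ 4 / r ^ 4" by (rule absorb[OF rr]) simp
      finally have a: "\<bar>(1 - t) * (1 / r ^ 5)\<bar> \<le> ?R ^ 4 / r ^ 4" using rr by (simp add: abs_mult)
      have "\<bar>3 / (4 * pi)\<bar> * \<bar>(1 - t) * (1 / r ^ 5)\<bar> \<le> 1 * (?R ^ 4 / r ^ 4)"
        using a pi_gt3 by (intro mult_mono) (auto simp: divide_le_eq)
      then show ?thesis by (simp only: abs_mult[of "3 / (4 * pi)"] mult_1)
    qed
    have 3: "\<bar>2 * dker M t\<bar> \<le> 2 * (2 + 2 * T') * ?R ^ 4 / r ^ 4"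
    proof -
      have "\<bar>dker M t\<bar> \<le> (2 + 2 * T') * (1 / r ^ 3)" using dker_bounds(1)[OF q T'(2)[OF t]] by (simp add: r_def)
      also have "\<dots> \<le> (2 + 2 * T') * (?R ^ 4 / r ^ 4)" using T' by (intro mult_left_mono absorb[OF rr]) auto
      finally have "\<bar>dker M t\<bar> \<le> (2 + 2 * T') * (?R ^ 4 / r ^ 4)" .
      then have "\<bar>2 * dker M t\<bar> \<le> 2 * ((2 + 2 * T') * (?R ^ 4 / r ^ 4))" unfolding abs_mult by (intro mult_mono) auto
      then show ?thesis by (simp only: times_divide_eq_right mult.assoc)
    qed
    show "\<bar>ddker0 M t + 3 / (4 * pi) * (1 / sqrt (qq M t) ^ 5)\<bar> \<le> (T' * (2 + 6 * T' + 2 * T'\<^sup>2) + ?R ^ 4 + 2 * (2 + 2 * T') * ?R ^ 4) / sqrt (qq M t) ^ 4"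
      unfolding r_def[symmetric] e add_divide_distrib[of "_ + _" "2 * (2 + 2 * T') * ?R ^ 4"] add_divide_distrib[of "_ * _" "?R ^ 4"]
      using 1 2 3 by (simp only: times_divide_eq_right)
  qed (use T' in simp)
  show "\<exists>B\<ge>0. \<forall>t. qq M t > 0 \<longrightarrow> \<bar>t\<bar> \<le> T \<longrightarrow> t \<le> 0 \<longrightarrow> M = S3 \<longrightarrow> \<bar>ddker0 M t\<bar> \<le> B / sqrt (qq M t) ^ 4"
  proof (intro exI[of _ "2 * (1 + T') * ?R ^ 4 + T' * (3 * T' * (1 + T') + (1 + T')\<^sup>2)"] conjI allI impI)
    fix t assume q: "qq M t > 0" and t: "\<bar>t\<bar> \<le> T" and tn: "t \<le> 0" "M = S3"
    define r where "r = sqrt (qq M t)"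
    have rr: "0 < r" "r \<le> 1 + T'" using r[OF q t] by (simp_all add: r_def)
    have "\<bar>dker M t\<bar> \<le> (1 + T') * (1 / r\<^sup>2)" using dker_bounds(2)[OF q T'(2)[OF t] tn] by (simp add: r_def)
    also have "\<dots> \<le> (1 + T') * (?R ^ 4 / r ^ 4)" using T' by (intro mult_left_mono absorb[OF rr]) auto
    finally have "\<bar>dker M t\<bar> \<le> (1 + T') * (?R ^ 4 / r ^ 4)" .
    then have "\<bar>2 * dker M t\<bar> \<le> 2 * ((1 + T') * (?R ^ 4 / r ^ 4))" unfolding abs_mult by (intro mult_mono) auto
    then have 1: "\<bar>2 * dker M t\<bar> \<le> 2 * (1 + T') * ?R ^ 4 / r ^ 4" by (simp only: times_divide_eq_right mult.assoc)
    have 2: "\<bar>t * ddker M t\<bar> \<le> T' * ((3 * T' * (1 + T') + (1 + T')\<^sup>2) / r ^ 4)"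
      unfolding abs_mult[of t] using ddker_bounds(2)[OF q T'(2)[OF t] tn] T'(2)[OF t] T' by (intro mult_mono) (auto simp: r_def)
    show "\<bar>ddker0 M t\<bar> \<le> (2 * (1 + T') * ?R ^ 4 + T' * (3 * T' * (1 + T') + (1 + T')\<^sup>2)) / sqrt (qq M t) ^ 4"
      unfolding ddker0_def r_def[symmetric] add_divide_distrib[of "2 * (1 + T') * ?R ^ 4"]
      using 1 2 by (simp only: times_divide_eq_right)
  qed (use T' in simp)
qed

section \<open>The distance\<close>

lemma curve_tangent:
  assumes "C1_curve M c c'" "t \<in> {0..1}"
  shows "c t \<in> points M" "c' t \<in> tangent M (c t)" "(c has_vector_derivative c' t) (at t within {0..1})"
proof -
  show p: "c t \<in> points M" and d: "(c has_vector_derivative c' t) (at t within {0..1})" using assms by (auto simp: C1_curve_def)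
  have "((\<lambda>t. form M (c t) (c t)) has_vector_derivative (form M (c t) (c' t) + form M (c' t) (c t))) (at t within {0..1})"
    by (rule form.has_vector_derivative[OF d d])
  moreover have "((\<lambda>t. form M (c t) (c t)) has_vector_derivative 0) (at t within {0..1})"
  proof (rule has_vector_derivative_transform[OF assms(2)])
    show "form M (c s) (c s) = curv M" if "s \<in> {0..1}" for s using that assms(1) by (auto simp: C1_curve_def intro: form_point)
  qed simp
  ultimately have "form M (c t) (c' t) + form M (c' t) (c t) = 0"
    using vector_derivative_unique_within_closed_interval[of 0 1 t] assms(2) by force
  then show "c' t \<in> tangent M (c t)" by (simp add: tangent_def form_sym)
qed

lemma angle_derivative:
  assumes q: "qq M t > 0" "M = H3 \<Longrightarrow> t > 0"
  shows "(angle M has_real_derivative - (curv M / sqrt (qq M t))) (at t)"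
proof (cases M)
  case S3
  then have "\<bar>t\<bar> < 1" using q by (simp add: qq_def abs_square_less_1)
  then show ?thesis using DERIV_arccos[of t] S3 by (simp add: angle_def[abs_def] qq_def abs_less_iff divide_inverse)
next
  case H3
  then have "1 < t\<^sup>2" "t > 0" using q by (simp_all add: qq_def)
  then have "1 < t" using power_le_one[of t 2] by (meson less_imp_le not_less)
  then show ?thesis using arcosh_real_has_field_derivative[of t] H3 by (simp add: angle_def[abs_def] qq_def)
qed

text \<open>
  The speed of a curve is at least the rate of change of the angle to \<open>x\<close>, by the Cauchy-Schwarz inequality on
  the tangent space. The angle is not differentiable at \<open>x\<close> and at its antipode; it is replaced by \<open>angle (s
  c)\<close> with \<open>s\<close> tending to 1.
\<close>

lemma length_ge_angle:
  assumes c: "C1_curve M c c'"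
  shows "angle M (cc M (c 0) (c 1)) \<le> curve_length M c'"
proof -
  define x where "x = c 0"
  have x: "x \<in> points M" using curve_tangent(1)[OF c, of 0] by (simp add: x_def)
  have y: "c 1 \<in> points M" using curve_tangent(1)[OF c, of 1] by simp
  define sp where "sp t = sqrt (form M (c' t) (c' t))" for t
  have cc': "continuous_on {0..1} c'" using c by (simp add: C1_curve_def)
  have "continuous_on {0..1} sp"
    unfolding sp_def by (intro continuous_on_real_sqrt form.continuous_on cc')
  then have "sp integrable_on {0..1}" by (rule integrable_continuous_real)
  moreover have "curve_length M c' = integral {0..1} sp" by (simp add: curve_length_def sp_def[abs_def])
  ultimately have L: "(sp has_integral curve_length M c') {0..1}" by (simp add: integrable_integral)
  have key: "angle M (s * cc M (c 1) x) - angle M (s * cc M x x) \<le> curve_length M c'" if s: "reg M s" for s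
  proof -
    let ?f = "\<lambda>t. angle M (s * cc M (c t) x)"
    define f' where "f' t = - (curv M / sqrt (qq M (s * cc M (c t) x))) * (s * (curv M * form M (c' t) x))" for t
    have d: "(?f has_vector_derivative f' t) (at t within {0..1})" if t: "t \<in> {0..1}" for t
    proof -
      note C = curve_tangent[OF c t]
      have "((\<lambda>t. form M (c t) x) has_vector_derivative form M (c' t) x) (at t within {0..1})"
        using bounded_linear.has_vector_derivative[OF form.bounded_linear_left C(3)] .
      then have "((\<lambda>t. s * (curv M * form M (c t) x)) has_real_derivative s * (curv M * form M (c' t) x)) (at t within {0..1})"
        unfolding has_real_derivative_iff_has_vector_derivative[symmetric] by (intro DERIV_cmult)
      moreover have "s * cc M (c t) x > 0" if "M = H3"
      proof (rule mult_pos_pos)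
        show "cc M (c t) x > 0" using cc_H3_ge1[of "c t" x] C(1) x that by simp
      qed (use s in \<open>simp add: reg_def\<close>)
      then have "(angle M has_real_derivative - (curv M / sqrt (qq M (s * cc M (c t) x)))) (at (s * cc M (c t) x))"
        by (intro angle_derivative qq_reg(1)[OF s C(1) x])
      ultimately show ?thesis
        unfolding has_real_derivative_iff_has_vector_derivative[symmetric] f'_def by (rule DERIV_chain2[rotated])
    qed
    have "(f' has_integral ?f 1 - ?f 0) {0..1}" by (rule fundamental_theorem_of_calculus) (use d in auto)
    moreover have "f' t \<le> sp t" if t: "t \<in> {0..1}" for t
    proof -
      note C = curve_tangent[OF c t]
      let ?q = "qq M (s * cc M (c t) x)"
      have q: "?q > 0" by (rule qq_reg(1)[OF s C(1) x])
      have s0: "s > 0" using s by (simp add: reg_def)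
      have "\<bar>form M (c' t) x\<bar> = \<bar>form M (c' t) (tpart M (c t) x)\<bar>"
        using tangentD[OF C(2)] by (simp add: tpart_def form_lin)
      also have "\<dots> \<le> sp t * sqrt (qq M (cc M x (c t)))"
        using tangent_cauchy_schwarz[OF C(1,2) tpart_tangent[OF C(1)], of x] form_tpart[OF x C(1)] by (simp add: sp_def)
      finally have f: "\<bar>form M (c' t) x\<bar> \<le> sp t * sqrt (qq M (cc M (c t) x))" by (simp add: form_sym[of M x])
      have sqq: "s * sqrt (qq M (cc M (c t) x)) \<le> sqrt ?q"
      proof -
        have "?q = curv M * (1 - s\<^sup>2) + s\<^sup>2 * qq M (cc M (c t) x)" by (simp add: qq_def algebra_simps power_mult_distrib)
        then have "s\<^sup>2 * qq M (cc M (c t) x) \<le> ?q" using reg_sq[OF s] by simp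
        then have "sqrt (s\<^sup>2 * qq M (cc M (c t) x)) \<le> sqrt ?q" by (rule real_sqrt_le_mono)
        then show ?thesis using s0 by (simp add: real_sqrt_mult)
      qed
      have sp0: "sp t \<ge> 0" using tangent_pos(1)[OF C(1,2)] by (simp add: sp_def)
      have "f' t \<le> \<bar>f' t\<bar>" by simp
      also have "\<bar>f' t\<bar> = (1 / sqrt ?q) * (s * \<bar>form M (c' t) x\<bar>)" unfolding f'_def using s0 q by (simp add: abs_mult)
      also have "\<dots> \<le> (1 / sqrt ?q) * (s * (sp t * sqrt (qq M (cc M (c t) x))))"
        using f s0 q by (intro mult_left_mono) auto
      also have "\<dots> = (1 / sqrt ?q) * (s * sqrt (qq M (cc M (c t) x))) * sp t" by simp
      also have "\<dots> \<le> (1 / sqrt ?q) * sqrt ?q * sp t" using sqq sp0 q by (intro mult_right_mono mult_left_mono) auto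
      also have "\<dots> = sp t" using q by simp
      finally show ?thesis .
    qed
    ultimately have "?f 1 - ?f 0 \<le> curve_length M c'" by (rule has_integral_le[OF _ L])
    then show ?thesis by (simp add: x_def)
  qed
  have lim: "(\<lambda>n. angle M (sreg M n * cc M z x)) \<longlonglongrightarrow> angle M (cc M z x)" if z: "z \<in> points M" for z
  proof -
    have l: "(\<lambda>n. sreg M n * cc M z x) \<longlonglongrightarrow> cc M z x" using tendsto_mult[OF sreg_limit[of M] tendsto_const, of "cc M z x"] by simp
    show ?thesis
    proof (cases M)
      case S3
      have "continuous_on {-1..1} arccos" by (rule continuous_on_arccos')
      moreover have "sreg M n * cc M z x \<in> {-1..1}" for n
      proof -
        have "qq M (sreg M n * cc M z x) > 0" by (rule qq_reg(1)[OF sreg(1) z x])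
        then have "\<bar>sreg M n * cc M z x\<bar> < 1" using S3 by (simp add: qq_def abs_square_less_1)
        then show ?thesis by (simp add: abs_less_iff)
      qed
      moreover have "cc M z x \<in> {-1..1}" using cc_S3_le1[of z x] z x S3 by (simp add: abs_le_iff)
      ultimately show ?thesis using S3 l
        unfolding angle_def by (simp del: atLeastAtMost_iff) (rule continuous_on_tendsto_compose[where s = "{-1..1}"], auto simp del: atLeastAtMost_iff)
    next
      case H3
      have c1: "cc M z x \<ge> 1" using cc_H3_ge1[of z x] z x H3 by simp
      have "continuous_on {1..} (arcosh :: real \<Rightarrow> real)" by (intro continuous_intros) auto
      moreover have "sreg M n * cc M z x \<in> {1..}" for n
      proof -
        have "1 * 1 \<le> sreg M n * cc M z x" using c1 sreg(1)[of M n] H3 by (intro mult_mono) (auto simp: reg_def)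
        then show ?thesis by simp
      qed
      moreover have "cc M z x \<in> {1..}" using c1 by simp
      ultimately show ?thesis using H3 l
        unfolding angle_def by (simp del: atLeast_iff) (rule continuous_on_tendsto_compose[where s = "{1..}"], auto simp del: atLeast_iff)
    qed
  qed
  have "angle M (cc M (c 1) x) - angle M (cc M x x) \<le> curve_length M c'"
    by (rule LIMSEQ_le_const2[OF tendsto_diff[OF lim[OF y] lim[OF x]]]) (use key[OF sreg(1)] in auto)
  moreover have "angle M (cc M x x) = 0" unfolding cc_self[OF x] by (cases M) (auto simp: angle_def)
  ultimately show ?thesis by (simp add: x_def cc_sym)
qed

lemma geodesic_facts:
  assumes e: "unit_tangent M x e" and l: "l \<ge> 0"
  defines "c \<equiv> \<lambda>t. geo M x e (l * t)" and "c' \<equiv> \<lambda>t. l *\<^sub>R (cs M (l * t) *\<^sub>R e - (curv M * sn M (l * t)) *\<^sub>R x)"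
  shows "C1_curve M c c'" "parallel_along M c c'" "curve_length M c' = l" "c 0 = x" "c 1 = geo M x e l"
proof -
  note U = unit_tangentD[OF e]
  have dcs: "((\<lambda>t. cs M (l * t)) has_real_derivative - (curv M * sn M (l * t)) * l) (at t within A)" for t A
    by (rule DERIV_chain2[OF cs_derivative]) (auto intro!: derivative_eq_intros)
  have dsn: "((\<lambda>t. sn M (l * t)) has_real_derivative cs M (l * t) * l) (at t within A)" for t A
    by (rule DERIV_chain2[OF sn_derivative]) (auto intro!: derivative_eq_intros)
  have d: "(c has_vector_derivative c' t) (at t within A)" for t A
  proof -
    have "(c has_vector_derivative (- (curv M * sn M (l * t)) * l) *\<^sub>R x + (cs M (l * t) * l) *\<^sub>R e) (at t within A)"
      unfolding c_def geo_def by (intro has_vector_derivative_add scaleR_const_derivative dcs dsn)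
    then show ?thesis by (simp add: c'_def algebra_simps)
  qed
  have d': "(c' has_vector_derivative (- (curv M * l\<^sup>2)) *\<^sub>R c t) (at t within A)" for t A
  proof -
    have "((\<lambda>t. cs M (l * t) *\<^sub>R e - (curv M * sn M (l * t)) *\<^sub>R x) has_vector_derivative
       (- (curv M * sn M (l * t)) * l) *\<^sub>R e - (curv M * (cs M (l * t) * l)) *\<^sub>R x) (at t within A)"
      by (intro has_vector_derivative_diff scaleR_const_derivative dcs DERIV_cmult dsn)
    then have "(c' has_vector_derivative l *\<^sub>R ((- (curv M * sn M (l * t)) * l) *\<^sub>R e - (curv M * (cs M (l * t) * l)) *\<^sub>R x)) (at t within A)"
      unfolding c'_def by (rule bounded_linear.has_vector_derivative[OF bounded_linear_scaleR_right])
    moreover have "l *\<^sub>R ((- (curv M * sn M (l * t)) * l) *\<^sub>R e - (curv M * (cs M (l * t) * l)) *\<^sub>R x) = (- (curv M * l\<^sup>2)) *\<^sub>R c t"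
      by (simp add: c_def geo_def tri_ext algebra_simps power2_eq_square)
    ultimately show ?thesis by simp
  qed
  have p: "c t \<in> points M" for t unfolding c_def by (rule geo_point[OF e])
  have n: "form M (c' t) (c' t) = l\<^sup>2" for t
  proof -
    have "form M (c' t) (c' t) = l\<^sup>2 * (cs M (l * t) * cs M (l * t) + curv M * (sn M (l * t) * sn M (l * t)))"
      by (simp add: c'_def form_lin U power2_eq_square algebra_simps)
    then show ?thesis by (simp add: cs_sn_sq)
  qed
  have ct: "c' t \<in> tangent M (c t)" for t
    by (simp add: c'_def c_def geo_def tangent_def form_lin U algebra_simps)
  show "C1_curve M c c'"
    unfolding C1_curve_def using p d d' by (auto intro!: continuous_on_vector_derivative)
  have tz: "tproj M z (r *\<^sub>R z) = 0" if "z \<in> points M" for z r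
    using that by (simp add: tproj_eq tpart_def form_lin form_point)
  show "parallel_along M c c'"
    unfolding parallel_along_def using ct d' tz[OF p] by blast
  show "curve_length M c' = l" unfolding curve_length_def n using l by simp
  show "c 0 = x" "c 1 = geo M x e l" by (simp_all add: c_def geo_def)
qed

theorem rdist_eq:
  assumes x: "x \<in> points M" and y: "y \<in> points M"
  shows "rdist M x y = angle M (cc M x y)"
  unfolding rdist_def
proof (rule cInf_eq_minimum)
  obtain e where e: "unit_tangent M x e" "y = geo M x e (angle M (cc M x y))" using polar[OF x y] .
  note G = geodesic_facts[OF e(1) angle_facts(3)[OF x y]]
  have "\<exists>c c'. C1_curve M c c' \<and> curve_length M c' = angle M (cc M x y) \<and> c 0 = x \<and> c 1 = y"
    by (rule exI, rule exI, intro conjI, rule G(1), rule G(3), rule G(4), rule trans[OF G(5) e(2)[symmetric]])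
  then obtain c c' where "C1_curve M c c'" "curve_length M c' = angle M (cc M x y)" "c 0 = x" "c 1 = y" by blast
  then show "angle M (cc M x y) \<in> {curve_length M c' |c c'. C1_curve M c c' \<and> c 0 = x \<and> c 1 = y}"
    by (intro CollectI exI[of _ c] exI[of _ c'] conjI) simp_all
next
  fix l assume "l \<in> {curve_length M c' |c c'. C1_curve M c c' \<and> c 0 = x \<and> c 1 = y}"
  then show "angle M (cc M x y) \<le> l" using length_ge_angle by blast
qed

section \<open>Parallel transport\<close>

lemma normal_derivative:
  assumes z: "z \<in> points M" and n: "tproj M z X' = 0"
  shows "X' = cc M X' z *\<^sub>R z"
  using n unfolding tproj_eq[OF z] tpart_def by simp

lemma constant_on_unit_interval:
  fixes f :: "real \<Rightarrow> 'a::real_normed_vector"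
  assumes "\<And>t. t \<in> {0..1} \<Longrightarrow> (f has_vector_derivative 0) (at t within {0..1})" "t \<in> {0..1}"
  shows "f t = f 0"
  using has_vector_derivative_zero_constant[of "{0..1}" f] assms by (metis atLeastAtMost_iff convex_real_interval(5) order_refl zero_le_one)

text \<open>
  Along a geodesic \<open>c\<close> of speed \<open>l\<close> one has \<open>c'' = - curv l\<^sup>2 c\<close>, so that \<open>c\<close> is determined by its endpoints when
  \<open>sn l \<noteq> 0\<close>, and a parallel field \<open>X\<close> satisfies \<open>X' = - curv (X \<bullet> c') c\<close> with constant \<open>X \<bullet> c'\<close>.
\<close>

lemma parallel_transport_value:
  assumes sg: "shortest_geodesic M x y c" and par: "parallel_along M c X"
    and x: "x \<in> points M" and y: "y \<in> points M" and ny: "y \<noteq> - x"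
  shows "X 1 = X 0 - (curv M * form M (X 0) y / (1 + cc M x y)) *\<^sub>R (x + y)"
proof -
  obtain c' where c: "C1_curve M c c'" "parallel_along M c c'" "curve_length M c' = rdist M x y" "c 0 = x" "c 1 = y"
    using sg by (auto simp: shortest_geodesic_def)
  let ?I = "{0..1::real}"
  note C = curve_tangent[OF c(1)]
  obtain c'' where c'': "\<And>t. t \<in> ?I \<Longrightarrow> (c' has_vector_derivative c'' t) (at t within ?I)" "\<And>t. t \<in> ?I \<Longrightarrow> c'' t = cc M (c'' t) (c t) *\<^sub>R c t"
    using c(2) normal_derivative[OF C(1)] unfolding parallel_along_def by metis
  obtain X' where X': "\<And>t. t \<in> ?I \<Longrightarrow> (X has_vector_derivative X' t) (at t within ?I)" "\<And>t. t \<in> ?I \<Longrightarrow> X' t = cc M (X' t) (c t) *\<^sub>R c t"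
    and Xt: "\<And>t. t \<in> ?I \<Longrightarrow> X t \<in> tangent M (c t)"
    using par normal_derivative[OF C(1)] unfolding parallel_along_def by metis
  have zero: "form M (X t) (c t) = 0" "form M (c' t) (c t) = 0" if "t \<in> ?I" for t
    using Xt[OF that] C(2)[OF that] by (auto simp: tangentD)
  \<comment> \<open>Differentiating the orthogonality relations determines the normal components.\<close>
  have uniq: "u = 0" if "(f has_vector_derivative u) (at t within ?I)" "\<And>s. s \<in> ?I \<Longrightarrow> f s = 0" "t \<in> ?I" for f :: "real \<Rightarrow> real" and u t
  proof -
    have "(f has_vector_derivative 0) (at t within ?I)"
      by (rule has_vector_derivative_transform[OF that(3)]) (use that(2) in auto)
    then show ?thesis using that(1,3) vector_derivative_unique_within_closed_interval[of 0 1 t f] by auto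
  qed
  have Xn: "form M (X' t) (c t) = - form M (X t) (c' t)" and cn: "form M (c'' t) (c t) = - form M (c' t) (c' t)" if t: "t \<in> ?I" for t
  proof -
    have "form M (X t) (c' t) + form M (X' t) (c t) = 0"
      by (rule uniq[OF form.has_vector_derivative[OF X'(1)[OF t] C(3)[OF t]] zero(1) t])
    then show "form M (X' t) (c t) = - form M (X t) (c' t)" by simp
    have "form M (c' t) (c' t) + form M (c'' t) (c t) = 0"
      by (rule uniq[OF form.has_vector_derivative[OF c''(1)[OF t] C(3)[OF t]] zero(2) t])
    then show "form M (c'' t) (c t) = - form M (c' t) (c' t)" by simp
  qed
  define a where "a = form M (X 0) (c' 0)"
  define L where "L = form M (c' 0) (c' 0)"
  have orth: "form M (X t) (c'' t) = 0" "form M (X' t) (c' t) = 0" "form M (c'' t) (c' t) = 0" if t: "t \<in> ?I" for t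
  proof -
    have "form M (X t) (c'' t) = form M (X t) (cc M (c'' t) (c t) *\<^sub>R c t)" by (rule arg_cong[OF c''(2)[OF t]])
    then show "form M (X t) (c'' t) = 0" by (simp add: form.scaleR_right zero[OF t])
    have "form M (X' t) (c' t) = form M (cc M (X' t) (c t) *\<^sub>R c t) (c' t)" by (rule arg_cong[OF X'(2)[OF t]])
    then show "form M (X' t) (c' t) = 0" by (simp add: form.scaleR_left form_sym[of M "c t"] zero[OF t])
    have "form M (c'' t) (c' t) = form M (cc M (c'' t) (c t) *\<^sub>R c t) (c' t)" by (rule arg_cong[OF c''(2)[OF t]])
    then show "form M (c'' t) (c' t) = 0" by (simp add: form.scaleR_left form_sym[of M "c t"] zero[OF t])
  qed
  have ca: "form M (X t) (c' t) = a" if t: "t \<in> ?I" for t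
    unfolding a_def
  proof (rule constant_on_unit_interval[OF _ t])
    fix t assume t: "t \<in> ?I"
    show "((\<lambda>t. form M (X t) (c' t)) has_vector_derivative 0) (at t within ?I)"
      using form.has_vector_derivative[where M = M, OF X'(1)[OF t] c''(1)[OF t]] orth[OF t] by simp
  qed
  have cL: "form M (c' t) (c' t) = L" if t: "t \<in> ?I" for t
    unfolding L_def
  proof (rule constant_on_unit_interval[OF _ t])
    fix t assume t: "t \<in> ?I"
    show "((\<lambda>t. form M (c' t) (c' t)) has_vector_derivative 0) (at t within ?I)"
      using form.has_vector_derivative[where M = M, OF c''(1)[OF t] c''(1)[OF t]] orth[OF t] by (simp add: form_sym[of M _ "c'' t"])
  qed
  have c2: "c'' t = (- (curv M * L)) *\<^sub>R c t" and X2: "X' t = (- (curv M * a)) *\<^sub>R c t" if t: "t \<in> ?I" for t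
    using c''(2)[OF t] X'(2)[OF t] Xn[OF t] cn[OF t] ca[OF t] cL[OF t] by simp_all
  define l where "l = angle M (cc M x y)"
  have l0: "l \<ge> 0" unfolding l_def by (rule angle_facts(3)[OF x y])
  have L0: "L \<ge> 0" unfolding L_def using tangent_pos(1)[OF C(1,2)] by simp
  have "curve_length M c' = integral ?I (\<lambda>t. sqrt L)" unfolding curve_length_def using cL by (intro integral_cong) simp
  then have "sqrt L = l" using c(3) rdist_eq[OF x y] by (simp add: l_def)
  then have Ll: "L = l\<^sup>2" using L0 by (metis real_sqrt_pow2)
  have i: "0 \<in> ?I" "1 \<in> ?I" by auto
  show ?thesis
  proof (cases "l = 0")
    case True
    then have "form M (c' t) (c' t) = 0" if "t \<in> ?I" for t using cL[OF that] Ll by simp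
    then have c0: "c' t = 0" if "t \<in> ?I" for t using tangent_pos(2)[OF C(1,2)] that by blast
    have "c 1 = c 0"
      by (rule constant_on_unit_interval) (use C(3) c0 in auto)
    then have xy: "y = x" using c by simp
    have "X 1 = X 0"
    proof (rule constant_on_unit_interval)
      fix t assume t: "t \<in> ?I"
      have "a = 0" unfolding a_def using c0 by (simp add: form_lin)
      then show "(X has_vector_derivative 0) (at t within ?I)" using X'(1)[OF t] X2[OF t] by simp
    qed simp
    moreover have "form M (X 0) y = 0" using zero(1)[of 0] c xy by simp
    ultimately show ?thesis by simp
  next
    case False
    then have lp: "l > 0" using l0 by simp
    \<comment> \<open>Two first integrals of the geodesic equation; they express \<open>c' 0\<close> and \<open>c' 1\<close> by the endpoints.\<close>
    define K where "K t = cs M (l * t) *\<^sub>R c t - (sn M (l * t) / l) *\<^sub>R c' t" for t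
    define J where "J t = (curv M * l * sn M (l * t)) *\<^sub>R c t + cs M (l * t) *\<^sub>R c' t" for t
    have dcs: "((\<lambda>t. cs M (l * t)) has_real_derivative - (curv M * sn M (l * t)) * l) (at t within A)" for t A
      by (rule DERIV_chain2[OF cs_derivative]) (auto intro!: derivative_eq_intros)
    have dsn: "((\<lambda>t. sn M (l * t)) has_real_derivative cs M (l * t) * l) (at t within A)" for t A
      by (rule DERIV_chain2[OF sn_derivative]) (auto intro!: derivative_eq_intros)
    have "K 1 = K 0"
    proof (rule constant_on_unit_interval)
      fix t assume t: "t \<in> ?I"
      have "(K has_vector_derivative (cs M (l * t) *\<^sub>R c' t + (- (curv M * sn M (l * t)) * l) *\<^sub>R c t)
        - ((sn M (l * t) / l) *\<^sub>R c'' t + (cs M (l * t) * l / l) *\<^sub>R c' t)) (at t within ?I)"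
        unfolding K_def by (intro has_vector_derivative_diff has_vector_derivative_scaleR DERIV_cdivide dcs dsn C(3)[OF t] c''(1)[OF t])
      then show "(K has_vector_derivative 0) (at t within ?I)"
        unfolding c2[OF t] Ll using lp by (simp add: power2_eq_square mult_ac)
    qed simp
    then have Ke: "cs M l *\<^sub>R y - (sn M l / l) *\<^sub>R c' 1 = x" using c by (simp add: K_def)
    have "J 1 = J 0"
    proof (rule constant_on_unit_interval)
      fix t assume t: "t \<in> ?I"
      have "(J has_vector_derivative ((curv M * l * sn M (l * t)) *\<^sub>R c' t + (curv M * l * (cs M (l * t) * l)) *\<^sub>R c t)
        + (cs M (l * t) *\<^sub>R c'' t + (- (curv M * sn M (l * t)) * l) *\<^sub>R c' t)) (at t within ?I)"
        unfolding J_def by (intro has_vector_derivative_add has_vector_derivative_scaleR DERIV_cmult dcs dsn C(3)[OF t] c''(1)[OF t])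
      then show "(J has_vector_derivative 0) (at t within ?I)"
        unfolding c2[OF t] Ll by (simp add: power2_eq_square mult_ac)
    qed simp
    then have Je: "(curv M * l * sn M l) *\<^sub>R y + cs M l *\<^sub>R c' 1 = c' 0" using c by (simp add: J_def)
    have XC: "X 1 - (a / L) *\<^sub>R c' 1 = X 0 - (a / L) *\<^sub>R c' 0"
    proof -
      have "(\<lambda>t. X t - (a / L) *\<^sub>R c' t) 1 = (\<lambda>t. X t - (a / L) *\<^sub>R c' t) 0"
      proof (rule constant_on_unit_interval)
        fix t assume t: "t \<in> ?I"
        have "((\<lambda>t. X t - (a / L) *\<^sub>R c' t) has_vector_derivative X' t - (a / L) *\<^sub>R c'' t) (at t within ?I)"
          by (intro has_vector_derivative_diff X'(1)[OF t] bounded_linear.has_vector_derivative[OF bounded_linear_scaleR_right c''(1)[OF t]])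
        then show "((\<lambda>t. X t - (a / L) *\<^sub>R c' t) has_vector_derivative 0) (at t within ?I)"
          unfolding c2[OF t] X2[OF t] using lp by (simp add: Ll mult.commute)
      qed simp
      then show ?thesis by simp
    qed
    have csl: "cs M l = cc M x y" "sn M l = sqrt (qq M (cc M x y))" unfolding l_def by (rule angle_facts[OF x y])+
    have xny: "x \<noteq> y"
    proof
      assume "x = y"
      then have "l = angle M 1" using cc_self[OF y] by (simp add: l_def)
      then show False using lp by (cases M) (auto simp: angle_def)
    qed
    have q: "qq M (cc M x y) > 0" using xny ny by (intro qq_pos x y) auto
    then have sp: "sn M l > 0" by (simp add: csl)
    define m where "m = l / sn M l"
    have c1: "c' 1 = m *\<^sub>R (cs M l *\<^sub>R y - x)"
    proof -
      have "(sn M l / l) *\<^sub>R c' 1 = cs M l *\<^sub>R y - x" by (subst Ke[symmetric]) simp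
      then have "m *\<^sub>R ((sn M l / l) *\<^sub>R c' 1) = m *\<^sub>R (cs M l *\<^sub>R y - x)" by simp
      then show ?thesis using sp lp by (simp add: m_def)
    qed
    have c0: "c' 0 = m *\<^sub>R (y - cs M l *\<^sub>R x)"
    proof -
      have lm: "curv M * l * sn M l = m * (1 - cs M l * cs M l)"
      proof -
        have "1 - cs M l * cs M l = curv M * (sn M l * sn M l)" using cs_sn_sq[of M l] by linarith
        then show ?thesis unfolding m_def using sp by simp
      qed
      show ?thesis unfolding Je[symmetric] c1 lm by (simp add: algebra_simps)
    qed
    have a: "a = m * form M (X 0) y" unfolding a_def c0 using zero(1)[of 0] c by (simp add: form_lin)
    have "X 1 = X 0 + (a / L) *\<^sub>R (c' 1 - c' 0)" using XC by (simp add: algebra_simps)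
    also have "c' 1 - c' 0 = (- (m * (1 - cs M l))) *\<^sub>R (x + y)" unfolding c1 c0 by (simp add: algebra_simps)
    also have "X 0 + (a / L) *\<^sub>R ((- (m * (1 - cs M l))) *\<^sub>R (x + y)) = X 0 - (a / L * (m * (1 - cs M l))) *\<^sub>R (x + y)" by simp
    also have "a / L * (m * (1 - cs M l)) = curv M * form M (X 0) y / (1 + cc M x y)"
    proof -
      have s2: "sn M l * sn M l = curv M * ((1 - cs M l) * (1 + cs M l))"
        using cs_sn_sq[of M l] curv_cases[of M] by (auto simp: algebra_simps)
      have n: "1 - cs M l \<noteq> 0" "1 + cs M l \<noteq> 0" using s2 sp by auto
      have "a / L * (m * (1 - cs M l)) = form M (X 0) y * (1 - cs M l) / (sn M l * sn M l)"
        unfolding a Ll m_def using lp sp by (simp add: power2_eq_square)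
      also have "\<dots> = curv M * form M (X 0) y / (1 + cs M l)" unfolding s2
      proof -
        have "f * u / (curv M * (u * w)) = curv M * f / w" if "u \<noteq> 0" "w \<noteq> 0" for f u w
          using that curv_sq(2)[of M] by (simp add: field_simps)
        from this[OF n] show "form M (X 0) y * (1 - cs M l) / (curv M * ((1 - cs M l) * (1 + cs M l))) = curv M * form M (X 0) y / (1 + cs M l)" .
      qed
      finally show ?thesis by (simp add: csl)
    qed
    finally show ?thesis .
  qed
qed

lemma ptransport_eq:
  assumes x: "x \<in> points M" and y: "y \<in> points M" and ny: "y \<noteq> - x" and v: "v \<in> tangent M x"
  shows "ptransport M y x v = v - (curv M * form M v y / (1 + cc M x y)) *\<^sub>R (x + y)"
  unfolding ptransport_def
proof (rule the_equality)
  let ?w = "v - (curv M * form M v y / (1 + cc M x y)) *\<^sub>R (x + y)"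
  obtain e where e: "unit_tangent M x e" "y = geo M x e (angle M (cc M x y))" using polar[OF x y] .
  define l where "l = angle M (cc M x y)"
  have l: "l \<ge> 0" unfolding l_def by (rule angle_facts(3)[OF x y])
  note G = geodesic_facts[OF e(1) l]
  note U = unit_tangentD[OF e(1)]
  let ?c = "\<lambda>t. geo M x e (l * t)"
  have sg: "shortest_geodesic M x y ?c"
    unfolding shortest_geodesic_def using G rdist_eq[OF x y] e(2) by (auto simp: l_def)
  define X where "X t = v + form M e v *\<^sub>R (cs M (l * t) *\<^sub>R e - (curv M * sn M (l * t)) *\<^sub>R x - e)" for t
  have xv: "form M x v = 0" "form M v x = 0" using v by (auto simp: tangentD)
  have par: "parallel_along M ?c X"
    unfolding parallel_along_def
  proof (intro ballI conjI exI)
    fix t :: real assume t: "t \<in> {0..1}"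
    show "X t \<in> tangent M (?c t)"
      by (simp add: X_def tangent_def geo_def form_lin U xv algebra_simps)
    have dcs: "((\<lambda>t. cs M (l * t)) has_real_derivative - (curv M * sn M (l * t)) * l) (at t within {0..1})"
      by (rule DERIV_chain2[OF cs_derivative]) (auto intro!: derivative_eq_intros)
    have dsn: "((\<lambda>t. sn M (l * t)) has_real_derivative cs M (l * t) * l) (at t within {0..1})"
      by (rule DERIV_chain2[OF sn_derivative]) (auto intro!: derivative_eq_intros)
    have "(X has_vector_derivative 0 + form M e v *\<^sub>R ((- (curv M * sn M (l * t)) * l) *\<^sub>R e - (curv M * (cs M (l * t) * l)) *\<^sub>R x - 0)) (at t within {0..1})"
      unfolding X_def
      by (intro has_vector_derivative_add has_vector_derivative_diff has_vector_derivative_const scaleR_const_derivative dcs DERIV_cmult dsn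
        bounded_linear.has_vector_derivative[OF bounded_linear_scaleR_right])
    moreover have "0 + form M e v *\<^sub>R ((- (curv M * sn M (l * t)) * l) *\<^sub>R e - (curv M * (cs M (l * t) * l)) *\<^sub>R x - 0)
        = (- (curv M * l * form M e v)) *\<^sub>R ?c t"
      by (simp add: geo_def tri_ext algebra_simps)
    ultimately show "(X has_vector_derivative (- (curv M * l * form M e v)) *\<^sub>R ?c t) (at t within {0..1})" by simp
    show "tproj M (?c t) ((- (curv M * l * form M e v)) *\<^sub>R ?c t) = 0"
      using geo_point[OF e(1), of "l * t"] by (simp add: tproj_eq tpart_def form_lin form_point)
  qed
  have X0: "X 0 = v" by (simp add: X_def)
  have "X 1 = ?w" using parallel_transport_value[OF sg par x y ny] by (simp add: X0)
  then show "\<exists>c X. shortest_geodesic M x y c \<and> parallel_along M c X \<and> X 0 = v \<and> X 1 = ?w"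
    using sg par X0 by blast
  fix w assume "\<exists>c X. shortest_geodesic M x y c \<and> parallel_along M c X \<and> X 0 = v \<and> X 1 = w"
  then show "w = ?w" using parallel_transport_value[OF _ _ x y ny] by blast
qed

section \<open>Derivatives of potentials along Killing fields at a moving point\<close>

lemma pot_cong: "(\<And>x. x \<in> points M \<Longrightarrow> F x = G x) \<Longrightarrow> pot M K F y = pot M K G y"
  unfolding pot_def by (rule Bochner_Integration.integral_cong) auto

lemma pot_sum:
  fixes F :: "'i \<Rightarrow> real^4 \<Rightarrow> 'b::euclidean_space"
  assumes "kernel M K" "y \<in> points M" "\<And>i. i \<in> I \<Longrightarrow> continuous_on (points M) (F i)" "\<And>i. i \<in> I \<Longrightarrow> bsupp M (F i)"
  shows "pot M K (\<lambda>x. \<Sum>i\<in>I. c i *\<^sub>R F i x) y = (\<Sum>i\<in>I. c i *\<^sub>R pot M K (F i) y)"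
proof -
  have i: "integrable (vol M) (\<lambda>x. K (cc M x y) *\<^sub>R F i x)" if "i \<in> I" for i
    using pot_integrable[OF assms(1) assms(3)[OF that] assms(4)[OF that] assms(2)] .
  have "pot M K (\<lambda>x. \<Sum>i\<in>I. c i *\<^sub>R F i x) y = (\<integral>x. (\<Sum>i\<in>I. c i *\<^sub>R (K (cc M x y) *\<^sub>R F i x)) \<partial>vol M)"
    unfolding pot_def by (rule Bochner_Integration.integral_cong) (simp_all add: scaleR_sum_right mult.commute)
  also have "\<dots> = (\<Sum>i\<in>I. \<integral>x. c i *\<^sub>R (K (cc M x y) *\<^sub>R F i x) \<partial>vol M)"
    using i by (intro Bochner_Integration.integral_sum integrable_scaleR_right) auto
  also have "\<dots> = (\<Sum>i\<in>I. c i *\<^sub>R pot M K (F i) y)"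
    unfolding pot_def by (intro sum.cong refl integral_scaleR_right)
  finally show ?thesis .
qed

lemma linear_components: "linear (\<lambda>a::real^4. \<Sum>b\<in>UNIV. (a $ b) *\<^sub>R (C b :: 'b::real_vector))"
  by (rule linearI) (simp_all add: algebra_simps sum.distrib scaleR_sum_right)

lemma linear_ext: "linear g \<Longrightarrow> (\<And>a. f a = g a) \<Longrightarrow> linear f"
  by (simp add: linear_iff)

lemma lie_skew: "F differentiable (at x within points M) \<Longrightarrow> lie M a b F x = - lie M b a F x"
proof -
  assume F: "F differentiable (at x within points M)"
  have "kil M a b x = - kil M b a x" by (simp add: kil_def)
  then show ?thesis unfolding lie_def using linear_frechet_derivative[OF F] by (simp add: linear_neg)
qed

lemma lie_expand:
  assumes F: "F differentiable (at x within points M)"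
  shows "lie M a w F x = (\<Sum>b\<in>UNIV. (a $ b) *\<^sub>R lie M (ax b) w F x)" "lie M w a F x = (\<Sum>b\<in>UNIV. (a $ b) *\<^sub>R lie M w (ax b) F x)"
proof -
  show r: "lie M w a F x = (\<Sum>b\<in>UNIV. (a $ b) *\<^sub>R lie M w (ax b) F x)" for w a
    using lie_sum_right[OF finite F, of w "\<lambda>b. a $ b" ax UNIV] by (simp add: sum_ax)
  show "lie M a w F x = (\<Sum>b\<in>UNIV. (a $ b) *\<^sub>R lie M (ax b) w F x)"
    using r[of w a] by (simp add: lie_skew[OF F, of _ w] sum_negf)
qed

context
  fixes M K and y :: "real^4" and F :: "real^4 \<Rightarrow> 'b::euclidean_space"
  assumes K: "kernel M K" and y: "y \<in> points M" and b: "bsupp M F"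
begin

lemma pot_lie_expand:
  assumes F: "Cn M 1 F"
  shows "pot M K (lie M a w F) y = (\<Sum>b\<in>UNIV. (a $ b) *\<^sub>R pot M K (lie M (ax b) w F) y)"
    "pot M K (lie M w a F) y = (\<Sum>b\<in>UNIV. (a $ b) *\<^sub>R pot M K (lie M w (ax b) F) y)"
proof -
  have d: "F differentiable (at x within points M)" if "x \<in> points M" for x using F that by simp
  have c: "continuous_on (points M) (lie M a w F)" for a w using F by simp
  show "pot M K (lie M a w F) y = (\<Sum>b\<in>UNIV. (a $ b) *\<^sub>R pot M K (lie M (ax b) w F) y)"
    by (rule trans[OF pot_cong[OF lie_expand(1)[OF d]] pot_sum[OF K y c bsupp_lie[OF b]]])
  show "pot M K (lie M w a F) y = (\<Sum>b\<in>UNIV. (a $ b) *\<^sub>R pot M K (lie M w (ax b) F) y)"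
    by (rule trans[OF pot_cong[OF lie_expand(2)[OF d]] pot_sum[OF K y c bsupp_lie[OF b]]])
qed

lemma linear_pot_lie:
  assumes F: "Cn M 1 F"
  shows "linear (\<lambda>a. pot M K (lie M a w F) y)" "linear (\<lambda>a. pot M K (lie M w a F) y)"
  by (rule linear_components[THEN linear_ext], rule pot_lie_expand[OF F])+

lemma pot_lie_lie_expand:
  assumes F: "Cn M 2 F"
  shows "pot M K (lie M u v (lie M a w F)) y = (\<Sum>b\<in>UNIV. (a $ b) *\<^sub>R pot M K (lie M u v (lie M (ax b) w F)) y)"
    "pot M K (lie M u v (lie M w a F)) y = (\<Sum>b\<in>UNIV. (a $ b) *\<^sub>R pot M K (lie M u v (lie M w (ax b) F)) y)"
proof -
  have F2: "Cn M (Suc (Suc 0)) F" using F by (simp add: numeral_2_eq_2)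
  have d: "F differentiable (at x within points M)" if "x \<in> points M" for x using F2 that by simp
  have d2: "lie M a w F differentiable (at x within points M)" if "x \<in> points M" for x a w using F2 that by simp
  have c: "continuous_on (points M) (lie M u v (lie M a w F))" for a w using F2 by simp
  note bb = bsupp_lie[OF bsupp_lie[OF b]]
  have "lie M u v (lie M a w F) x = (\<Sum>b\<in>UNIV. (a $ b) *\<^sub>R lie M u v (lie M (ax b) w F) x)" if x: "x \<in> points M" for x
    by (rule trans[OF lie_cong[OF lie_expand(1)[OF d] x] lie_linear_sum[OF finite d2[OF x] x]])
  then show "pot M K (lie M u v (lie M a w F)) y = (\<Sum>b\<in>UNIV. (a $ b) *\<^sub>R pot M K (lie M u v (lie M (ax b) w F)) y)"
    by (intro trans[OF pot_cong pot_sum[OF K y c bb]])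
  have "lie M u v (lie M w a F) x = (\<Sum>b\<in>UNIV. (a $ b) *\<^sub>R lie M u v (lie M w (ax b) F) x)" if x: "x \<in> points M" for x
    by (rule trans[OF lie_cong[OF lie_expand(2)[OF d] x] lie_linear_sum[OF finite d2[OF x] x]])
  then show "pot M K (lie M u v (lie M w a F)) y = (\<Sum>b\<in>UNIV. (a $ b) *\<^sub>R pot M K (lie M u v (lie M w (ax b) F)) y)"
    by (intro trans[OF pot_cong pot_sum[OF K y c bb]])
qed

lemma linear_pot_lie_lie:
  assumes F: "Cn M 2 F"
  shows "linear (\<lambda>a. pot M K (lie M u v (lie M w a F)) y)"
  by (rule linear_components[THEN linear_ext], rule pot_lie_lie_expand[OF F])

end

text \<open>The product rule, applied to the occurrence of the point in the Killing field and to the parameter of the potential.\<close>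

lemma pot_lie_derivative:
  fixes F :: "real^4 \<Rightarrow> 'b::euclidean_space"
  assumes K: "kernel M K" and F: "Cn M 3 F" and b: "bsupp M F" and y: "y \<in> points M"
  shows "((\<lambda>z. pot M K (lie M z w F) z) has_derivative
     (\<lambda>v. pot M K (lie M v w F) y + curv M *\<^sub>R pot M K (lie M y v (lie M y w F)) y)) (at y within points M)"
proof -
  have F3: "Cn M (Suc 2) F" and F1: "Cn M 1 F" and F2: "Cn M 2 F"
    using F Cn_le[OF F, of 1] Cn_le[OF F, of 2] by (simp_all add: eval_nat_numeral)
  let ?G = "\<lambda>b. lie M (ax b) w F"
  have "((\<lambda>z. \<Sum>b\<in>UNIV. (z $ b) *\<^sub>R pot M K (?G b) z) has_derivative
     (\<lambda>v. \<Sum>b\<in>UNIV. (y $ b) *\<^sub>R (curv M *\<^sub>R pot M K (lie M y v (?G b)) y) + (v $ b) *\<^sub>R pot M K (?G b) y)) (at y within points M)"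
    by (intro has_derivative_sum has_derivative_scaleR pot_derivative[OF K Cn_lie[OF F3] bsupp_lie[OF b] y]
        bounded_linear_imp_has_derivative bounded_linear_vec_nth)
  also have "(\<lambda>v. \<Sum>b\<in>UNIV. (y $ b) *\<^sub>R (curv M *\<^sub>R pot M K (lie M y v (?G b)) y) + (v $ b) *\<^sub>R pot M K (?G b) y) =
     (\<lambda>v. pot M K (lie M v w F) y + curv M *\<^sub>R pot M K (lie M y v (lie M y w F)) y)"
  proof
    fix v
    show "(\<Sum>b\<in>UNIV. (y $ b) *\<^sub>R (curv M *\<^sub>R pot M K (lie M y v (?G b)) y) + (v $ b) *\<^sub>R pot M K (?G b) y) =
      pot M K (lie M v w F) y + curv M *\<^sub>R pot M K (lie M y v (lie M y w F)) y"
      unfolding pot_lie_expand(1)[OF K y b F1, of v w] pot_lie_lie_expand(1)[OF K y b F2, of y v y w]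
      by (simp add: sum.distrib scaleR_sum_right mult.commute)
  qed
  finally show ?thesis
    by (subst has_derivative_within_cong[OF pot_lie_expand(1)[OF K _ b F1]]) (use y in auto)
qed

section \<open>Gradient, divergence and curl from ambient derivatives\<close>

text \<open>Written in the standard basis so that it depends differentiably on the functional.\<close>

definition dual :: "space_form \<Rightarrow> (real^4 \<Rightarrow> real) \<Rightarrow> real^4" where
  "dual M D = (\<Sum>a\<in>UNIV. (eps M a * D (ax a)) *\<^sub>R ax a)"

lemma form_dual: assumes "linear D" shows "form M (dual M D) v = D v"
proof -
  have "form M (dual M D) v = (\<Sum>a\<in>UNIV. (eps M a * form M (ax a) v) * D (ax a))"
    unfolding dual_def form.sum_left by (simp add: form_lin mult_ac)
  also have "\<dots> = (\<Sum>a\<in>UNIV. v $ a *\<^sub>R D (ax a))" by (simp add: form_ax flip: mult.assoc)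
  also have "\<dots> = D (\<Sum>a\<in>UNIV. v $ a *\<^sub>R ax a)" by (simp add: linear_sum[OF assms] linear_cmul[OF assms])
  finally show ?thesis by (simp add: sum_ax)
qed

lemma gradient_dual:
  assumes f: "(f has_derivative D) (at y within points M)" and y: "y \<in> points M" and D: "D y = 0"
  shows "gradient M f y = dual M D"
  using gradient_eq[OF f y, of "dual M D"] form_dual[OF has_derivative_linear[OF f], of M]
  by (simp add: tangent_def form_sym[of M y] D)

lemma divergence_eq:
  assumes X: "(X has_derivative D) (at y within points M)" and y: "y \<in> points M"
  shows "divergence M X y = (\<Sum>i\<in>UNIV. form M (frame M y i) (D (frame M y i)))"
  unfolding divergence_def cov_deriv_def
  by (simp add: fd_tangent[OF X y] frameD[OF y] tproj_eq[OF y] tpart_def form_lin)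

lemma curl_eq:
  assumes X: "(X has_derivative D) (at y within points M)" and y: "y \<in> points M"
  shows "curl M X y = (\<Sum>i\<in>UNIV. tri M y (frame M y i) (D (frame M y i)))"
  unfolding curl_def cov_deriv_def
  by (simp add: fd_tangent[OF X y] frameD[OF y] tproj_eq[OF y] tpart_def cross_eq_tri[OF y] tri_lin)

lemma antisymmetric_sum:
  fixes g :: "3 \<Rightarrow> 3 \<Rightarrow> 'a::real_vector"
  assumes "\<And>i j. g j i = - g i j"
  shows "(\<Sum>i\<in>UNIV. \<Sum>j\<in>UNIV. g i j) = 0"
proof -
  have "g i i = 0" for i using assms[of i i] by (metis eq_neg_iff_add_eq_0 scaleR_2 scaleR_eq_0_iff zero_neq_numeral)
  then show ?thesis using assms[of 1 2] assms[of 1 3] assms[of 2 3] by (simp add: sum_3)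
qed

section \<open>The electric field\<close>

lemma rdist_sn:
  assumes "x \<in> points M" "z \<in> points M"
  shows "sn M (rdist M x z) = sqrt (qq M (cc M x z))" "cs M (rdist M x z) = cc M x z"
  unfolding rdist_eq[OF assms] by (rule angle_facts[OF assms])+

lemma phi_ker:
  assumes x: "x \<in> points M" and z: "z \<in> points M"
  shows "phi M (rdist M x z) = ker M (cc M x z)" "phi0 M (rdist M x z) = ker0 M (cc M x z)"
proof -
  have "phi M (rdist M x z) = ker M (cc M x z) \<and> phi0 M (rdist M x z) = ker0 M (cc M x z)"
  proof (cases M)
    case S3
    have a: "rdist M x z = arccos (cc M x z)" using rdist_eq[OF x z] S3 by (simp add: angle_def)
    have s: "sin (rdist M x z) = sqrt (1 - (cc M x z)\<^sup>2)" "cos (rdist M x z) = cc M x z"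
      using rdist_sn[OF x z] S3 by (simp_all add: qq_def)
    have p: "phi M r = - (1 / (4 * pi\<^sup>2)) * ((pi - r) / sin r)" "phi0 M r = - (1 / (4 * pi\<^sup>2)) * ((pi - r) * (cos r / sin r))" for r
      using S3 by (simp_all add: cot_def)
    have k: "ker M t = - (1 / (4 * pi\<^sup>2)) * ((pi - arccos t) / sqrt (1 - t\<^sup>2))" "ccon M = 0" for t
      using S3 by (simp_all add: ker_def ccon_def)
    show ?thesis unfolding p s ker0_def k unfolding a by simp
  next
    case H3
    have s: "sinh (rdist M x z) = sqrt ((cc M x z)\<^sup>2 - 1)" "cosh (rdist M x z) = cc M x z"
      using rdist_sn[OF x z] H3 by (simp_all add: qq_def)
    have p: "phi M r = - (1 / (4 * pi)) * (1 / sinh r)" "phi0 M r = - (1 / (4 * pi)) * (cosh r / sinh r - 1)" for r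
      using H3 by simp_all
    have k: "ker M t = - (1 / (4 * pi)) * (1 / sqrt (t\<^sup>2 - 1))" "ccon M = 1 / (4 * pi)" for t
      using H3 by (simp_all add: ker_def ccon_def)
    show ?thesis unfolding p s ker0_def k by (simp add: diff_divide_distrib right_diff_distrib)
  qed
  then show "phi M (rdist M x z) = ker M (cc M x z)" "phi0 M (rdist M x z) = ker0 M (cc M x z)" by auto
qed

lemma E_field_potential:
  assumes z: "z \<in> points M"
  shows "(\<integral>x. \<rho> x * phi0 M (rdist M x z) \<partial>vol M) = pot M (ker0 M) \<rho> z"
  unfolding pot_def by (rule Bochner_Integration.integral_cong) (use z in \<open>auto simp: phi_ker\<close>)

lemma E_field_eq:
  assumes r: "Cn M 2 \<rho>" and b: "bsupp M \<rho>" and y: "y \<in> points M"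
  shows "E_field M \<rho> y = dual M (\<lambda>w. curv M * pot M (ker0 M) (lie M y w \<rho>) y)"
proof -
  have r1: "Cn M 1 \<rho>" using Cn_le[OF r, of 1] by simp
  have "((\<lambda>z. \<integral>x. \<rho> x * phi0 M (rdist M x z) \<partial>vol M) has_derivative
      (\<lambda>w. curv M *\<^sub>R pot M (ker0 M) (lie M y w \<rho>) y)) (at y within points M)"
    using pot_derivative[OF ker0.kernel_k0 r b y]
    by (subst has_derivative_within_cong[of "points M", OF E_field_potential]) (use y in auto)
  then have "gradient M (\<lambda>z. \<integral>x. \<rho> x * phi0 M (rdist M x z) \<partial>vol M) y = dual M (\<lambda>w. curv M *\<^sub>R pot M (ker0 M) (lie M y w \<rho>) y)"
  proof (rule gradient_dual[OF _ y])
    have "pot M (ker0 M) (lie M y y \<rho>) y = pot M (ker0 M) (\<lambda>_. 0) y"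
      using r1 by (intro pot_cong lie_bilinear(5)) auto
    then show "curv M *\<^sub>R pot M (ker0 M) (lie M y y \<rho>) y = 0" by (simp add: pot_def)
  qed
  then show ?thesis by (simp add: E_field_def)
qed

text \<open>
  On tangent vectors the first-order term that comes from moving the point in the Killing field vanishes by
  \<open>pot_lie_stabiliser\<close>, and the Hessian of the potential remains.
\<close>

lemma E_field_derivative:
  assumes r: "Cn M 3 \<rho>" and b: "bsupp M \<rho>" and y: "y \<in> points M"
  obtains D where "(E_field M \<rho> has_derivative D) (at y within points M)"
    "\<And>v w. v \<in> tangent M y \<Longrightarrow> w \<in> tangent M y \<Longrightarrow> form M w (D v) = pot M (ker0 M) (lie M y v (lie M y w \<rho>)) y"
proof -
  have r1: "Cn M 1 \<rho>" and r2: "Cn M 2 \<rho>" using Cn_le[OF r, of 1] Cn_le[OF r, of 2] by simp_all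
  define Z where "Z v w = curv M * (pot M (ker0 M) (lie M v w \<rho>) y + curv M *\<^sub>R pot M (ker0 M) (lie M y v (lie M y w \<rho>)) y)" for v w
  let ?D = "\<lambda>v. dual M (Z v)"
  have "((\<lambda>z. dual M (\<lambda>w. curv M * pot M (ker0 M) (lie M z w \<rho>) z)) has_derivative ?D) (at y within points M)"
    unfolding dual_def Z_def
    by (intro has_derivative_sum has_derivative_scaleR_left has_derivative_mult_right pot_lie_derivative ker0.kernel_k0 r b y)
  then have "(E_field M \<rho> has_derivative ?D) (at y within points M)"
    by (subst has_derivative_within_cong[of "points M", OF E_field_eq[OF r2 b]]) (use y in auto)
  moreover have "form M w (?D v) = pot M (ker0 M) (lie M y v (lie M y w \<rho>)) y" if "v \<in> tangent M y" "w \<in> tangent M y" for v w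
  proof -
    have "linear (Z v)"
      using linear_pot_lie(2)[OF ker0.kernel_k0 y b r1, of v] linear_pot_lie_lie[OF ker0.kernel_k0 y b r2, of y v y]
      unfolding Z_def linear_iff by (simp add: algebra_simps)
    then show ?thesis
      unfolding form_sym[of M w] by (simp add: form_dual Z_def ker0.pot_lie_stabiliser[OF y r2 b that])
  qed
  ultimately show ?thesis by (rule that)
qed

text \<open>
  The divergence is the trace of the Hessian, given by \<open>laplace_pot\<close>; on \<open>S3\<close> the constant term vanishes since
  the total charge does. The curl is the antisymmetric part of the Hessian.
\<close>

theorem electric_field:
  assumes r: "Cn M 3 \<rho>" and b: "bsupp M \<rho>" and y: "y \<in> points M" and t: "M = S3 \<Longrightarrow> (\<integral>x. \<rho> x \<partial>vol M) = 0"
  shows "E_field M \<rho> differentiable (at y within points M)" "divergence M (E_field M \<rho>) y = \<rho> y" "curl M (E_field M \<rho>) y = 0"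
proof -
  let ?e = "frame M y"
  obtain D where D: "(E_field M \<rho> has_derivative D) (at y within points M)"
    "\<And>v w. v \<in> tangent M y \<Longrightarrow> w \<in> tangent M y \<Longrightarrow> form M w (D v) = pot M (ker0 M) (lie M y v (lie M y w \<rho>)) y"
    using E_field_derivative[OF r b y] by blast
  show "E_field M \<rho> differentiable (at y within points M)" using D(1) by (auto simp: differentiable_def)
  have bc: "bcon M * (\<integral>x. \<rho> x \<partial>vol M) = 0" using t by (cases M) (auto simp: bcon_def)
  have "divergence M (E_field M \<rho>) y = (\<Sum>i\<in>UNIV. pot M (ker0 M) (lie M y (?e i) (lie M y (?e i) \<rho>)) y)"
    unfolding divergence_eq[OF D(1) y] by (simp add: D(2) frameD[OF y])
  also have "\<dots> = \<rho> y" unfolding ker0.laplace_pot[OF y r b] using bc by simp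
  finally show "divergence M (E_field M \<rho>) y = \<rho> y" .
  define Q where "Q i j = pot M (ker0 M) (lie M y (?e i) (lie M y (?e j) \<rho>)) y" for i j
  have "tri M y (?e i) (D (?e i)) = (\<Sum>j\<in>UNIV. Q i j *\<^sub>R tri M y (?e i) (?e j))" for i
  proof -
    have "D (?e i) = cc M (D (?e i)) y *\<^sub>R y + (\<Sum>j\<in>UNIV. form M (?e j) (D (?e i)) *\<^sub>R ?e j)"
      by (rule frame_expand[OF y frame_exists[OF y]])
    also have "\<dots> = cc M (D (?e i)) y *\<^sub>R y + (\<Sum>j\<in>UNIV. Q i j *\<^sub>R ?e j)" by (simp add: D(2) frameD[OF y] Q_def)
    finally have "tri M y (?e i) (D (?e i)) = tri M y (?e i) (cc M (D (?e i)) y *\<^sub>R y + (\<Sum>j\<in>UNIV. Q i j *\<^sub>R ?e j))" by simp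
    then show ?thesis by (simp add: tri_lin sum_3)
  qed
  then have "curl M (E_field M \<rho>) y = (\<Sum>i\<in>UNIV. \<Sum>j\<in>UNIV. Q i j *\<^sub>R tri M y (?e i) (?e j))"
    unfolding curl_eq[OF D(1) y] by simp
  also have "\<dots> = 0"
  proof (rule antisymmetric_sum)
    fix i j
    have "Q j i = Q i j" unfolding Q_def by (rule ker0.pot_lie_commute[OF y r b]) (simp_all add: frameD[OF y])
    then show "Q j i *\<^sub>R tri M y (?e j) (?e i) = - (Q i j *\<^sub>R tri M y (?e i) (?e j))"
      using tri_skew(2)[of M y "?e j" "?e i"] by simp
  qed
  finally show "curl M (E_field M \<rho>) y = 0" .
qed

section \<open>The magnetic field by parallel transport\<close>

text \<open>
  Gradients of kernels and parallel transport are computed only for \<open>x\<close> different from \<open>y\<close> and its antipode,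
  which suffices for integrals.
\<close>

lemma vol_integral_cong:
  fixes f g :: "real^4 \<Rightarrow> 'b::euclidean_space"
  assumes "\<And>x. x \<in> points M \<Longrightarrow> x \<noteq> y \<Longrightarrow> x \<noteq> - y \<Longrightarrow> f x = g x"
  shows "(\<integral>x. f x \<partial>vol M) = (\<integral>x. g x \<partial>vol M)"
proof (rule integral_discrete_difference[where X = "{y, - y} \<inter> points M"])
  show "countable ({y, - y} \<inter> points M)" by (rule countable_finite) simp
  show "emeasure (vol M) {x} = 0" for x by (rule vol_singleton)
  show "{x} \<in> sets (vol M)" if "x \<in> {y, - y} \<inter> points M" for x using that by (simp add: sets_vol sets_restrict_space_iff)
qed (use assms in auto)

lemma gradient_ker:
  assumes x: "x \<in> points M" and y: "y \<in> points M" and k: "(K has_real_derivative k') (at (cc M x y))"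
    and f: "\<And>z. z \<in> points M \<Longrightarrow> f z = K (cc M x z)"
  shows "gradient M f y = (curv M * k') *\<^sub>R tpart M y x"
proof (rule gradient_eq[OF _ y])
  have "((\<lambda>z. K (cc M z x)) has_derivative (\<lambda>h. k' * (curv M * form M h x))) (at y within points M)"
    by (rule radial_derivative) (use k in \<open>simp add: form_sym\<close>)
  then show "(f has_derivative (\<lambda>h. k' * (curv M * form M h x))) (at y within points M)"
    by (subst has_derivative_within_cong[of "points M" f]) (use f y in \<open>auto simp: form_sym\<close>)
  show "(curv M * k') *\<^sub>R tpart M y x \<in> tangent M y" by (simp add: tangent_lin tpart_tangent y)
  show "form M ((curv M * k') *\<^sub>R tpart M y x) v = k' * (curv M * form M v x)" if "v \<in> tangent M y" for v
    using that by (simp add: tpart_def form_lin tangentD form_sym[of M x])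
qed

text \<open>Parallel transport changes \<open>V x\<close> only by multiples of \<open>x\<close> and \<open>y\<close>, which the cross product with the gradient annihilates.\<close>

lemma BS_integrand:
  assumes x: "x \<in> points M" and y: "y \<in> points M" and v: "v \<in> tangent M x" and n: "x \<noteq> y" "x \<noteq> - y"
  shows "cross M y (ptransport M y x v) (gradient M (\<lambda>z. phi M (rdist M x z)) y) = (curv M * dker M (cc M x y)) *\<^sub>R tri M y v x"
proof -
  have g: "gradient M (\<lambda>z. phi M (rdist M x z)) y = (curv M * dker M (cc M x y)) *\<^sub>R tpart M y x"
    by (rule gradient_ker[OF x y ker_derivative[OF qq_pos[OF x y n]] phi_ker(1)[OF x]])
  have n': "y \<noteq> - x" using n by auto
  have "tri M y (v - r *\<^sub>R (x + y)) (s *\<^sub>R (x - c *\<^sub>R y)) = s *\<^sub>R tri M y v x" for r s c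
    by (simp add: tri_ext tri_components algebra_simps)
  then show ?thesis unfolding cross_eq_tri[OF y] ptransport_eq[OF x y n' v] g tpart_def by blast
qed

lemma BS_parallel_integral:
  assumes y: "y \<in> points M" and V: "\<And>x. x \<in> points M \<Longrightarrow> V x \<in> tangent M x"
  shows "BS_parallel M V y = (\<integral>x. (curv M * dker M (cc M x y)) *\<^sub>R tri M y (V x) x \<partial>vol M)"
  unfolding BS_parallel_def by (rule vol_integral_cong[where y = y]) (use BS_integrand y V in auto)

lemma linear_tri: "linear (\<lambda>p. tri M p u v)" "linear (\<lambda>p. tri M u p v)" "linear (\<lambda>p. tri M u v p)"
  by (rule linearI; simp add: tri_lin)+

lemma bounded_linear_tri: "bounded_linear (\<lambda>p. tri M p u v)" "bounded_linear (\<lambda>p. tri M u p v)" "bounded_linear (\<lambda>p. tri M u v p)"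
  using linear_tri by (simp_all add: linear_conv_bounded_linear)

text \<open>
  Expansion of \<open>x\<close> in the standard basis turns the integral into potentials of Killing derivatives of \<open>V\<close>,
  which \<open>pot_lie_derivative\<close> can differentiate.
\<close>

lemma tri_integral_sum:
  assumes y: "y \<in> points M" and V: "Cn M 2 V" and b: "bsupp M V"
  shows "(\<integral>x. (curv M * dker M (cc M x y)) *\<^sub>R tri M y (V x) x \<partial>vol M) =
      curv M *\<^sub>R (\<Sum>a\<in>UNIV. eps M a *\<^sub>R tri M y (pot M (ker M) (lie M y (ax a) V) y) (ax a))"
    "integrable (vol M) (\<lambda>x. (curv M * dker M (cc M x y)) *\<^sub>R tri M y (V x) x)"
proof -
  let ?f = "\<lambda>a x. (dker M (cc M x y) * form M (ax a) (tpart M y x)) *\<^sub>R V x"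
  have i: "integrable (vol M) (?f a)" for a by (rule ker.pot_lie(2)[OF y V b])
  have e: "(curv M * dker M (cc M x y)) *\<^sub>R tri M y (V x) x = (\<Sum>a\<in>UNIV. (curv M * eps M a) *\<^sub>R tri M y (?f a x) (ax a))" for x
  proof -
    have "tri M y (V x) x = tri M y (V x) (tpart M y x)" by (simp add: tpart_def tri_lin)
    also have "\<dots> = tri M y (V x) (\<Sum>a\<in>UNIV. (eps M a * form M (ax a) (tpart M y x)) *\<^sub>R ax a)" by (simp only: sum_ax_form)
    also have "\<dots> = (\<Sum>a\<in>UNIV. (eps M a * form M (ax a) (tpart M y x)) *\<^sub>R tri M y (V x) (ax a))"
      by (simp only: linear_sum[OF linear_tri(3)] linear_cmul[OF linear_tri(3)])
    finally have "tri M y (V x) x = (\<Sum>a\<in>UNIV. (eps M a * form M (ax a) (tpart M y x)) *\<^sub>R tri M y (V x) (ax a))" .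
    then show ?thesis by (simp add: scaleR_sum_right tri_lin mult_ac)
  qed
  have it: "integrable (vol M) (\<lambda>x. (curv M * eps M a) *\<^sub>R tri M y (?f a x) (ax a))" for a
    by (intro integrable_scaleR_right integrable_bounded_linear[OF bounded_linear_tri(2)] i)
  have p: "(\<integral>x. tri M y (?f a x) (ax a) \<partial>vol M) = tri M y (pot M (ker M) (lie M y (ax a) V) y) (ax a)" for a
    unfolding ker.pot_lie(1)[OF y V b] by (rule integral_bounded_linear[OF bounded_linear_tri(2) i])
  show "integrable (vol M) (\<lambda>x. (curv M * dker M (cc M x y)) *\<^sub>R tri M y (V x) x)"
    unfolding e by (intro Bochner_Integration.integrable_sum it)
  have "(\<integral>x. (curv M * dker M (cc M x y)) *\<^sub>R tri M y (V x) x \<partial>vol M) =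
      (\<Sum>a\<in>UNIV. \<integral>x. (curv M * eps M a) *\<^sub>R tri M y (?f a x) (ax a) \<partial>vol M)"
    unfolding e by (intro Bochner_Integration.integral_sum it)
  also have "\<dots> = (\<Sum>a\<in>UNIV. (curv M * eps M a) *\<^sub>R tri M y (pot M (ker M) (lie M y (ax a) V) y) (ax a))"
    unfolding integral_scaleR_right p ..
  finally show "(\<integral>x. (curv M * dker M (cc M x y)) *\<^sub>R tri M y (V x) x \<partial>vol M) =
      curv M *\<^sub>R (\<Sum>a\<in>UNIV. eps M a *\<^sub>R tri M y (pot M (ker M) (lie M y (ax a) V) y) (ax a))"
    by (simp add: scaleR_sum_right)
qed

text \<open>
  The two kinds of terms in the curl. Both follow from \<open>tri_tri\<close>, the second one with the roles of \<open>y\<close> and \<open>e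
  i\<close> exchanged.
\<close>

lemma double_cross:
  assumes y: "y \<in> points M"
  defines "e \<equiv> frame M y"
  shows "tri M y (e i) (tri M y q (e j)) = (if i = j then tpart M y q else 0) - form M (e i) q *\<^sub>R e j"
    "tri M y (e i) (tri M (e i) u (e j)) = (curv M * form M y u) *\<^sub>R (if i = j then 0 else e j)"
proof -
  note E = frameD[OF y, folded e_def]
  show "tri M y (e i) (tri M y q (e j)) = (if i = j then tpart M y q else 0) - form M (e i) q *\<^sub>R e j"
    unfolding tri_tri by (simp add: E form_point[OF y] tpart_def form_sym[of M q] algebra_simps)
  show "tri M y (e i) (tri M (e i) u (e j)) = (curv M * form M y u) *\<^sub>R (if i = j then 0 else e j)"
    unfolding tri_skew(1)[of M y "e i" "tri M (e i) u (e j)"] tri_tri[of M "e i" y u "e j"] by (simp add: E algebra_simps)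
qed

context
  fixes M and V :: "real^4 \<Rightarrow> real^4" and y :: "real^4"
  assumes V: "Cn M 3 V" and b: "bsupp M V" and y: "y \<in> points M" and t: "\<And>x. x \<in> points M \<Longrightarrow> V x \<in> tangent M x"
begin

lemma field_Cn1: "Cn M 1 V" and field_Cn2: "Cn M 2 V"
  using Cn_le[OF V, of 1] Cn_le[OF V, of 2] by simp_all

definition "dpot w = pot M (ker M) (lie M y w V) y"
definition "ddpot u w = pot M (ker M) (lie M y u (lie M y w V)) y"

lemma linear_dpot: "linear dpot"
  unfolding dpot_def[abs_def] by (rule linear_pot_lie(2)[OF ker.kernel_k0 y b field_Cn1])

lemma linear_ddpot: "linear (ddpot u)"
  unfolding ddpot_def[abs_def] by (rule linear_pot_lie_lie[OF ker.kernel_k0 y b field_Cn2])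

lemma dpot_point: "dpot y = 0"
proof -
  have "pot M (ker M) (lie M y y V) y = pot M (ker M) (\<lambda>_. 0) y" using field_Cn1 by (intro pot_cong lie_bilinear(5)) auto
  then show ?thesis by (simp add: dpot_def pot_def)
qed

lemma ddpot_point: "ddpot u y = 0"
proof -
  have z: "lie M y y V x = 0" if "x \<in> points M" for x using field_Cn1 that by (intro lie_bilinear(5)) auto
  have "lie M y u (lie M y y V) x = lie M y u (\<lambda>_. 0) x" if "x \<in> points M" for x by (rule lie_cong[OF z that])
  also have "\<And>x. x \<in> points M \<Longrightarrow> lie M y u (\<lambda>_. 0) x = 0" by (rule lie_eq[OF has_derivative_const])
  finally have "ddpot u y = pot M (ker M) (\<lambda>_. 0) y" unfolding ddpot_def by (rule pot_cong)
  then show ?thesis by (simp add: pot_def)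
qed

lemma ddpot_sym: "ddpot (frame M y i) (frame M y j) = ddpot (frame M y j) (frame M y i)"
  unfolding ddpot_def by (rule ker.pot_lie_commute[OF y V b]) (simp_all add: frameD[OF y])

lemma ddpot_trace: "(\<Sum>i\<in>UNIV. ddpot (frame M y i) (frame M y i)) = curv M *\<^sub>R pot M (ker M) V y + V y"
  unfolding ddpot_def ker.laplace_pot[OF y V b] by simp

text \<open>
  The terms with \<open>ddpot\<close> come from moving the parameter of the potentials, those with \<open>dpot\<close> from moving the
  point in the triple product.
\<close>

lemma BS_parallel_derivative:
  obtains D where "(BS_parallel M V has_derivative D) (at y within points M)"
    "\<And>i. D (frame M y i) = (\<Sum>j\<in>UNIV. curv M *\<^sub>R tri M (frame M y i) (dpot (frame M y j)) (frame M y j)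
       + tri M y (ddpot (frame M y i) (frame M y j)) (frame M y j))"
proof -
  define P' where "P' v w = pot M (ker M) (lie M v w V) y + curv M *\<^sub>R ddpot v w" for v w
  define D where "D v = curv M *\<^sub>R (\<Sum>a\<in>UNIV. eps M a *\<^sub>R (tri M v (dpot (ax a)) (ax a) + tri M y (P' v (ax a)) (ax a)))" for v
  have d: "((\<lambda>z. pot M (ker M) (lie M z w V) z) has_derivative (\<lambda>v. P' v w)) (at y within points M)" for w
    unfolding P'_def ddpot_def by (rule pot_lie_derivative[OF ker.kernel_k0 V b y])
  have tr: "((\<lambda>z. tri M z (f z) c) has_derivative (\<lambda>v. tri M v (f y) c + tri M y (f' v) c)) (at y within points M)"
    if "(f has_derivative f') (at y within points M)" for f f' c
  proof -
    have B: "bounded_bilinear (\<lambda>p q. tri M p q c)"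
      unfolding bilinear_conv_bounded_bilinear[symmetric] bilinear_def using linear_tri by blast
    show ?thesis using bounded_bilinear.FDERIV[OF B has_derivative_ident that] by (simp add: add.commute)
  qed
  have "((\<lambda>z. curv M *\<^sub>R (\<Sum>a\<in>UNIV. eps M a *\<^sub>R tri M z (pot M (ker M) (lie M z (ax a) V) z) (ax a))) has_derivative D) (at y within points M)"
    unfolding D_def dpot_def by (intro has_derivative_scaleR_right has_derivative_sum tr d)
  then have 1: "(BS_parallel M V has_derivative D) (at y within points M)"
    by (subst has_derivative_within_cong[where G = "\<lambda>z. curv M *\<^sub>R (\<Sum>a\<in>UNIV. eps M a *\<^sub>R tri M z (pot M (ker M) (lie M z (ax a) V) z) (ax a))"])
      (use BS_parallel_integral[OF _ t] tri_integral_sum(1)[OF _ field_Cn2 b] y in auto)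
  have 2: "D (frame M y i) = (\<Sum>j\<in>UNIV. curv M *\<^sub>R tri M (frame M y i) (dpot (frame M y j)) (frame M y j)
       + tri M y (ddpot (frame M y i) (frame M y j)) (frame M y j))" for i
  proof -
    let ?e = "frame M y"
    define \<beta> where "\<beta> p q = tri M (?e i) (dpot p) q + tri M y (P' (?e i) p) q" for p q
    have lP: "linear (P' (?e i))"
      using linear_pot_lie(2)[OF ker.kernel_k0 y b field_Cn1, of "?e i"] linear_ddpot[of "?e i"]
      unfolding P'_def linear_iff by (simp add: algebra_simps)
    have l: "linear (\<beta> p)" for p by (rule linearI) (simp_all add: \<beta>_def tri_lin algebra_simps)
    have r: "linear (\<lambda>p. \<beta> p q)" for q
      using linear_dpot lP unfolding \<beta>_def linear_iff by (simp add: tri_lin algebra_simps)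
    have P'e: "P' (?e i) (?e j) = curv M *\<^sub>R ddpot (?e i) (?e j)" for j
      unfolding P'_def by (simp add: ker.pot_lie_stabiliser[OF y field_Cn2 b] frameD[OF y])
    have "\<beta> y y = 0" by (simp add: \<beta>_def dpot_point)
    then have "D (?e i) = curv M *\<^sub>R (\<Sum>j\<in>UNIV. \<beta> (?e j) (?e j))"
      unfolding D_def \<beta>_def[symmetric] trace_frame[OF y frame_exists[OF y] l r] by simp
    also have "\<dots> = (\<Sum>j\<in>UNIV. curv M *\<^sub>R tri M (?e i) (dpot (?e j)) (?e j) + tri M y (ddpot (?e i) (?e j)) (?e j))"
      unfolding \<beta>_def P'e by (simp add: scaleR_sum_right scaleR_add_right tri_lin)
    finally show ?thesis .
  qed
  show ?thesis by (rule that[OF 1 2])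
qed

text \<open>
  The first group of terms is orthogonal to the direction of differentiation, and the second is antisymmetric
  since \<open>ddpot\<close> is symmetric.
\<close>

theorem BS_parallel_divergence: "divergence M (BS_parallel M V) y = 0"
proof -
  let ?e = "frame M y"
  obtain D where D: "(BS_parallel M V has_derivative D) (at y within points M)"
    "\<And>i. D (?e i) = (\<Sum>j\<in>UNIV. curv M *\<^sub>R tri M (?e i) (dpot (?e j)) (?e j) + tri M y (ddpot (?e i) (?e j)) (?e j))"
    using BS_parallel_derivative by blast
  have z: "form M (?e i) (tri M (?e i) u w) = 0" for i u w by (simp add: form_sym[of M "?e i"])
  have "divergence M (BS_parallel M V) y = (\<Sum>i\<in>UNIV. \<Sum>j\<in>UNIV. form M (?e i) (tri M y (ddpot (?e i) (?e j)) (?e j)))"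
    unfolding divergence_eq[OF D(1) y] D(2) form.sum_right by (simp add: form_lin z)
  also have "\<dots> = 0"
  proof (rule antisymmetric_sum)
    fix i j
    have s: "form M a (tri M y q c) = - form M c (tri M y q a)" for a c q
      unfolding form_sym[of M _ "tri M y q _"] form_tri det_4 by (simp add: algebra_simps)
    show "form M (?e j) (tri M y (ddpot (?e j) (?e i)) (?e i)) = - form M (?e i) (tri M y (ddpot (?e i) (?e j)) (?e j))"
      unfolding ddpot_sym[of j i] by (rule s)
  qed
  finally show ?thesis .
qed

text \<open>
  The trace of \<open>ddpot\<close> produces \<open>V y\<close> by the Laplace equation for \<open>ker\<close>; all other terms are tangential and
  will be identified with the displacement current.
\<close>

theorem BS_parallel_curl:
  "curl M (BS_parallel M V) y = V y + (\<Sum>j\<in>UNIV. (curv M * form M (frame M y j) (pot M (ker M) V y) + 2 * form M y (dpot (frame M y j))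
     - (\<Sum>i\<in>UNIV. form M (frame M y i) (ddpot (frame M y i) (frame M y j)))) *\<^sub>R frame M y j)"
proof -
  let ?e = "frame M y"
  obtain D where D: "(BS_parallel M V has_derivative D) (at y within points M)"
    "\<And>i. D (?e i) = (\<Sum>j\<in>UNIV. curv M *\<^sub>R tri M (?e i) (dpot (?e j)) (?e j) + tri M y (ddpot (?e i) (?e j)) (?e j))"
    using BS_parallel_derivative by blast
  define W where "W = pot M (ker M) V y"
  have "curl M (BS_parallel M V) y = (\<Sum>i\<in>UNIV. \<Sum>j\<in>UNIV. form M y (dpot (?e j)) *\<^sub>R (if i = j then 0 else ?e j)
      + ((if i = j then tpart M y (ddpot (?e i) (?e j)) else 0) - form M (?e i) (ddpot (?e i) (?e j)) *\<^sub>R ?e j))"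
    unfolding curl_eq[OF D(1) y] D(2) linear_sum[OF linear_tri(3)]
    by (simp add: tri_lin double_cross[OF y])
  also have "\<dots> = (\<Sum>i\<in>UNIV. tpart M y (ddpot (?e i) (?e i)))
      + (\<Sum>j\<in>UNIV. (2 * form M y (dpot (?e j)) - (\<Sum>i\<in>UNIV. form M (?e i) (ddpot (?e i) (?e j)))) *\<^sub>R ?e j)"
    by (simp add: sum_3 tri_ext algebra_simps)
  also have "(\<Sum>i\<in>UNIV. tpart M y (ddpot (?e i) (?e i))) = tpart M y (\<Sum>i\<in>UNIV. ddpot (?e i) (?e i))"
    by (simp add: sum_3 tpart_def form_lin algebra_simps)
  also have "\<dots> = V y + curv M *\<^sub>R tpart M y W"
    unfolding ddpot_trace W_def[symmetric] using t[OF y] by (simp add: tpart_def form_lin tangentD algebra_simps)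
  also have "tpart M y W = (\<Sum>j\<in>UNIV. form M (?e j) W *\<^sub>R ?e j)"
  proof -
    have "W - cc M W y *\<^sub>R y = (\<Sum>j\<in>UNIV. form M (?e j) W *\<^sub>R ?e j)"
      unfolding diff_eq_eq add.commute[of "sum _ _"] by (rule frame_expand[OF y frame_exists[OF y]])
    then show ?thesis by (simp add: tpart_def)
  qed
  finally show ?thesis unfolding W_def[symmetric]
    by (simp add: scaleR_sum_right scaleR_add_left scaleR_diff_left sum.distrib sum_subtractf add_diff_eq)
qed

end

section \<open>The divergence theorem\<close>

lemma lie_compose_linear:
  assumes L: "bounded_linear L" and F: "F differentiable (at x within points M)" and x: "x \<in> points M"
  shows "lie M a b (\<lambda>x. L (F x)) x = L (lie M a b F x)"
  using lie_eq[OF bounded_linear.has_derivative[OF L, of F "frechet_derivative F (at x within points M)"] x] F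
  by (simp add: lie_def frechet_derivative_works)

lemma pot_bounded_linear:
  fixes F :: "real^4 \<Rightarrow> 'b::euclidean_space" and L :: "'b \<Rightarrow> 'c::euclidean_space"
  assumes L: "bounded_linear L" and K: "kernel M K" and F: "continuous_on (points M) F" "bsupp M F" and y: "y \<in> points M"
  shows "pot M K (\<lambda>x. L (F x)) y = L (pot M K F y)"
  using integral_bounded_linear[OF L pot_integrable[OF K F y]] linear_cmul[OF bounded_linear.linear[OF L]] by (simp add: pot_def)

text \<open>At \<open>x\<close> the Killing fields of the rotations in the planes through \<open>x\<close> form a frame of the tangent space.\<close>

lemma divergence_lie:
  assumes V: "V differentiable (at x within points M)" and x: "x \<in> points M"
  shows "divergence M V x = (\<Sum>a\<in>UNIV. \<Sum>b\<in>UNIV. (curv M * eps M a) * (x $ b * lie M (ax b) (ax a) (\<lambda>x. form M (ax a) (V x)) x))"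
proof -
  let ?D = "frechet_derivative V (at x within points M)"
  have D: "(V has_derivative ?D) (at x within points M)" using V by (simp add: frechet_derivative_works)
  have lD: "linear ?D" using D by (rule has_derivative_linear)
  define \<beta> where "\<beta> p q = form M p (lie M x q V x)" for p q
  have l: "linear (\<beta> p)" for p
    by (rule linearI) (simp_all add: \<beta>_def lie_bilinear[OF V] form_lin)
  have r: "linear (\<lambda>p. \<beta> p q)" for q by (rule linearI) (simp_all add: \<beta>_def form_lin)
  have "kil M x (frame M x i) x = curv M *\<^sub>R frame M x i" for i using x by (simp add: kil_def frameD form_point)
  then have "lie M x (frame M x i) V x = curv M *\<^sub>R ?D (frame M x i)" for i by (simp add: lie_def linear_cmul[OF lD])
  then have "curv M * \<beta> (frame M x i) (frame M x i) = form M (frame M x i) (?D (frame M x i))" for i by (simp add: \<beta>_def form_lin)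
  moreover have \<beta>: "\<beta> (ax a) (ax a) = (\<Sum>b\<in>UNIV. x $ b * lie M (ax b) (ax a) (\<lambda>x. form M (ax a) (V x)) x)" for a
    unfolding \<beta>_def lie_compose_linear[OF form.bounded_linear_right V x] lie_expand(1)[OF V, of x "ax a"] form.sum_right
    by (simp add: form_lin)
  ultimately have "divergence M V x = curv M * (\<Sum>i\<in>UNIV. \<beta> (frame M x i) (frame M x i))"
    unfolding divergence_eq[OF D x] by (simp add: sum_distrib_left)
  also have "\<dots> = curv M * (\<Sum>a\<in>UNIV. eps M a *\<^sub>R \<beta> (ax a) (ax a))"
    unfolding trace_frame[OF x frame_exists[OF x] l r] by (simp add: \<beta>_def lie_bilinear(5)[OF V] form_lin)
  finally show ?thesis unfolding \<beta> by (simp add: sum_distrib_left mult.assoc)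
qed

lemma Cn_component: "Cn M n V \<Longrightarrow> Cn M n (\<lambda>x. form M c (V x))"
  by (rule Cn_bounded_linear[OF form.bounded_linear_right])

lemma bsupp_component: "bsupp M V \<Longrightarrow> bsupp M (\<lambda>x. form M c (V x))"
  by (erule bsupp_image) (simp add: form_lin)

lemma Cn_divergence:
  assumes V: "Cn M (Suc n) V" shows "Cn M n (divergence M V)"
proof -
  have d: "V differentiable (at x within points M)" if "x \<in> points M" for x using V that by simp
  let ?G = "\<lambda>x. \<Sum>a\<in>UNIV. \<Sum>b\<in>UNIV. (curv M * eps M a) * (x $ b * lie M (ax b) (ax a) (\<lambda>x. form M (ax a) (V x)) x)"
  have "Cn M n ?G"
    by (intro Cn_sum finite Cn_mult Cn_const Cn_nth Cn_lie Cn_component V)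
  then show ?thesis by (subst Cn_cong[where G = ?G, OF divergence_lie[OF d]])
qed

lemma bsupp_divergence:
  assumes V: "Cn M 1 V" and b: "bsupp M V" shows "bsupp M (divergence M V)"
proof -
  have d: "V differentiable (at x within points M)" if "x \<in> points M" for x using V that by simp
  obtain C where C: "\<And>x. x \<in> points M \<Longrightarrow> V x \<noteq> 0 \<Longrightarrow> norm x \<le> C" using b by (auto simp: bsupp_def)
  have "norm x \<le> C" if x: "x \<in> points M" and n: "divergence M V x \<noteq> 0" for x
  proof (rule ccontr)
    assume "\<not> ?thesis"
    then have "lie M (ax b) (ax a) V x = 0" for a b using supp_lie[of M V C x "ax b" "ax a", OF C] x by blast
    then have "divergence M V x = 0"
      unfolding divergence_lie[OF d[OF x] x] lie_compose_linear[OF form.bounded_linear_right d[OF x] x] by (simp add: form_lin)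
    then show False using n by simp
  qed
  then show ?thesis unfolding bsupp_def by blast
qed

lemma lie_nth: "x \<in> points M \<Longrightarrow> lie M a b (\<lambda>x. x $ c) x = kil M a b x $ c"
  by (rule lie_eq) (intro bounded_linear_imp_has_derivative bounded_linear_vec_nth)

text \<open>The right-hand side is the integral of the derivative of \<open>h\<close> in direction \<open>V\<close>, since \<open>kil M x (V x) x = curv M *\<^sub>R V x\<close>.\<close>

theorem divergence_theorem:
  assumes h: "Cn M 2 h" and V: "Cn M 2 V" and b: "bsupp M V" and t: "\<And>x. x \<in> points M \<Longrightarrow> V x \<in> tangent M x"
  shows "(\<integral>x. h x * divergence M V x \<partial>vol M) = - (\<integral>x. curv M * lie M x (V x) h x \<partial>vol M)"
proof -
  have V': "Cn M (Suc (Suc 0)) V" and h': "Cn M (Suc (Suc 0)) h" using V h by (simp_all add: numeral_2_eq_2)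
  have dV: "V differentiable (at x within points M)" and dh: "h differentiable (at x within points M)" if "x \<in> points M" for x
    using V' h' that by simp_all
  define f where "f a x = form M (ax a) (V x)" for a x
  define H where "H c x = h x *\<^sub>R x $ c" for c x
  have f: "Cn M 2 (f a)" "bsupp M (f a)" for a unfolding f_def using Cn_component[OF V] bsupp_component[OF b] by auto
  have H: "Cn M 2 (H c)" for c unfolding H_def by (rule Cn_scaleR[OF h Cn_nth])
  have f1: "continuous_on (points M) (lie M p q (f a))" and H1: "continuous_on (points M) (lie M p q (H c))" for p q a c
    using Cn_continuous[OF Cn_lie[of M 1]] f(1)[of a] H[of c] by (simp_all add: numeral_2_eq_2 del: Cn.simps)
  have i1: "integrable (vol M) (\<lambda>x. H c x *\<^sub>R lie M p q (f a) x)" for c p q a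
    by (rule bsupp_integrable[OF continuous_on_scaleR[OF Cn_continuous[OF H] f1] bsupp_image[OF bsupp_lie[OF f(2)[of a], of p q]]]) simp
  have i2: "integrable (vol M) (\<lambda>x. lie M p q (H c) x *\<^sub>R f a x)" for c p q a
    by (rule bsupp_integrable[OF continuous_on_scaleR[OF H1 Cn_continuous[OF f(1)]] bsupp_image[OF f(2)[of a]]]) simp
  have "(\<integral>x. h x * divergence M V x \<partial>vol M) = (\<integral>x. (\<Sum>a\<in>UNIV. \<Sum>c\<in>UNIV. (curv M * eps M a) * (H c x *\<^sub>R lie M (ax c) (ax a) (f a) x)) \<partial>vol M)"
    by (rule Bochner_Integration.integral_cong) (simp_all add: divergence_lie[OF dV] f_def[abs_def] H_def sum_distrib_left mult_ac)
  also have "\<dots> = (\<Sum>a\<in>UNIV. \<Sum>c\<in>UNIV. (curv M * eps M a) * (\<integral>x. H c x *\<^sub>R lie M (ax c) (ax a) (f a) x \<partial>vol M))"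
    using i1 by simp
  also have "\<dots> = (\<Sum>a\<in>UNIV. \<Sum>c\<in>UNIV. (curv M * eps M a) * - (\<integral>x. lie M (ax c) (ax a) (H c) x *\<^sub>R f a x \<partial>vol M))"
    using integral_by_parts[OF H f(1) f(2)] by simp
  also have "\<dots> = - (\<integral>x. (\<Sum>a\<in>UNIV. \<Sum>c\<in>UNIV. (curv M * eps M a) * (lie M (ax c) (ax a) (H c) x *\<^sub>R f a x)) \<partial>vol M)"
    using i2 by (simp add: sum_negf)
  also have "(\<integral>x. (\<Sum>a\<in>UNIV. \<Sum>c\<in>UNIV. (curv M * eps M a) * (lie M (ax c) (ax a) (H c) x *\<^sub>R f a x)) \<partial>vol M) =
      (\<integral>x. curv M * lie M x (V x) h x \<partial>vol M)"
  proof (rule Bochner_Integration.integral_cong[OF refl])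
    fix x assume "x \<in> space (vol M)"
    then have x: "x \<in> points M" by simp
    have n: "(\<lambda>x. x $ c) differentiable (at x within points M)" for c :: 4
      by (intro bounded_linear_imp_differentiable bounded_linear_vec_nth)
    have lH: "lie M (ax c) (ax a) (H c) x = h x * kil M (ax c) (ax a) x $ c + x $ c * lie M (ax c) (ax a) h x" for c a
      unfolding H_def using lie_scaleR[OF dh[OF x] n x] lie_nth[OF x] by simp
    have s: "(\<Sum>c\<in>UNIV. lie M (ax c) (ax a) (H c) x) = - 3 * h x * (eps M a * x $ a) + lie M x (ax a) h x" for a
    proof -
      have "(\<Sum>c\<in>UNIV. kil M (ax c) (ax a) x $ c) = - 3 * (eps M a * x $ a)"
        unfolding kil_def form_ax(1) using exhaust_4[of a] by (auto simp: sum_4 axis_def)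
      then have "(\<Sum>c\<in>UNIV. h x * kil M (ax c) (ax a) x $ c) = h x * (- 3 * (eps M a * x $ a))" by (simp only: sum_distrib_left[symmetric])
      moreover have "(\<Sum>c\<in>UNIV. x $ c * lie M (ax c) (ax a) h x) = lie M x (ax a) h x"
        using lie_expand(1)[OF dh[OF x], of x "ax a"] by simp
      ultimately show ?thesis unfolding lH sum.distrib by simp
    qed
    have "(\<Sum>a\<in>UNIV. eps M a * ((\<Sum>c\<in>UNIV. lie M (ax c) (ax a) (H c) x) * f a x)) =
       - 3 * h x * (\<Sum>a\<in>UNIV. eps M a * (form M (ax a) x * form M (ax a) (V x))) + (\<Sum>a\<in>UNIV. (eps M a * f a x) *\<^sub>R lie M x (ax a) h x)"
      unfolding s f_def form_ax(1)[of M _ x] by (simp add: sum_distrib_left algebra_simps sum.distrib sum_subtractf sum_negf)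
    also have "(\<Sum>a\<in>UNIV. eps M a * (form M (ax a) x * form M (ax a) (V x))) = 0"
      unfolding form_expand using t[OF x] by (simp add: tangentD)
    also have "(\<Sum>a\<in>UNIV. (eps M a * f a x) *\<^sub>R lie M x (ax a) h x) = lie M x (V x) h x"
      using lie_sum_right[OF finite dh[OF x], of x "\<lambda>a. eps M a * f a x" ax UNIV] by (simp add: f_def sum_ax_form)
    finally have e: "(\<Sum>a\<in>UNIV. eps M a * ((\<Sum>c\<in>UNIV. lie M (ax c) (ax a) (H c) x) * f a x)) = lie M x (V x) h x" by simp
    show "(\<Sum>a\<in>UNIV. \<Sum>c\<in>UNIV. (curv M * eps M a) * (lie M (ax c) (ax a) (H c) x *\<^sub>R f a x)) = curv M * lie M x (V x) h x"
      unfolding e[symmetric] by (simp add: sum_distrib_left sum_distrib_right mult.assoc)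
  qed
  finally show ?thesis .
qed

section \<open>The displacement current\<close>

text \<open>
  The divergence theorem against the regularised kernel of the electric field, whose derivative splits by
  \<open>dker0 t = ker t + t * dker t\<close>.  This expresses the potential by the quantities that occur in the magnetic
  field.
\<close>

lemma pot_divergence:
  assumes V: "Cn M 3 V" and b: "bsupp M V" and t: "\<And>x. x \<in> points M \<Longrightarrow> V x \<in> tangent M x" and y: "y \<in> points M"
  shows "pot M (ker0 M) (divergence M V) y =
    - (curv M * (form M (pot M (ker M) V y) y - (\<Sum>a\<in>UNIV. eps M a * form M (ax a) (pot M (ker M) (lie M y (ax a) V) y))))"
proof -
  have V3: "Cn M (Suc 2) V" using V by (simp add: eval_nat_numeral)
  have V2: "Cn M 2 V" and V1: "Cn M 1 V" using Cn_le[OF V, of 2] Cn_le[OF V, of 1] by simp_all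
  have cV: "continuous_on (points M) V" using V by (rule Cn_continuous)
  define f where "f a x = form M (ax a) (V x)" for a x
  have f: "Cn M 2 (f a)" "bsupp M (f a)" for a unfolding f_def using Cn_component[OF V2] bsupp_component[OF b] by auto
  have g: "continuous_on (points M) (\<lambda>x. form M (V x) y)" "bsupp M (\<lambda>x. form M (V x) y)"
    using Cn_continuous[OF Cn_component[OF V, of y]] bsupp_component[OF b, of y] by (simp_all add: form_sym)
  define J where "J s = (\<integral>x. ker M (s * cc M x y) *\<^sub>R form M (V x) y \<partial>vol M)" for s
  define L where "L a s = (\<integral>x. (dker M (s * cc M x y) * form M (ax a) (tpart M y x)) *\<^sub>R f a x \<partial>vol M)" for a s
  have eq: "(\<integral>x. ker0 M (s * cc M x y) *\<^sub>R divergence M V x \<partial>vol M) = - (curv M * (s * (J s - s * (\<Sum>a\<in>UNIV. eps M a * L a s))))"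
    if s: "reg M s" for s
  proof -
    have iJ: "integrable (vol M) (\<lambda>x. ker M (s * cc M x y) *\<^sub>R form M (V x) y)"
      by (rule bsupp_integrable[OF continuous_on_scaleR[OF Cn_continuous[OF ker.Cn_k(1)[OF s y]] g(1)] bsupp_image[OF g(2)]]) simp
    have iL: "integrable (vol M) (\<lambda>x. (dker M (s * cc M x y) * form M (ax a) (tpart M y x)) *\<^sub>R f a x)" for a
      by (rule bsupp_integrable[OF continuous_on_scaleR[OF continuous_on_mult[OF Cn_continuous[OF ker.Cn_k(2)[OF s y]] ker.continuous_form_tpart]
            Cn_continuous[OF f(1)]] bsupp_image[OF f(2)[of a]]]) simp
    have "(\<integral>x. ker0 M (s * cc M x y) *\<^sub>R divergence M V x \<partial>vol M) = - (\<integral>x. curv M * lie M x (V x) (\<lambda>x. ker0 M (s * cc M x y)) x \<partial>vol M)"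
      using divergence_theorem[OF Cn_le[OF ker0.Cn_k(1)[OF s y], of 2] V2 b t] by simp
    also have "(\<integral>x. curv M * lie M x (V x) (\<lambda>x. ker0 M (s * cc M x y)) x \<partial>vol M) =
        (\<integral>x. (curv M * s) * (ker M (s * cc M x y) *\<^sub>R form M (V x) y
          - s * (\<Sum>a\<in>UNIV. eps M a * ((dker M (s * cc M x y) * form M (ax a) (tpart M y x)) *\<^sub>R f a x))) \<partial>vol M)"
    proof (rule Bochner_Integration.integral_cong[OF refl])
      fix x assume "x \<in> space (vol M)"
      then have x: "x \<in> points M" by simp
      let ?s = "s * cc M x y"
      have "lie M x (V x) (\<lambda>x. ker0 M (s * cc M x y)) x = s * dker0 M ?s * form M (V x) y"
        unfolding ker0.lie_k(1)[OF s y x] using t[OF x] by (simp add: form_point[OF x] tangentD)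
      also have "\<dots> = s * (ker M ?s * form M (V x) y + s * dker M ?s * (cc M x y * form M (V x) y))" by (simp add: dker0_def algebra_simps)
      also have "cc M x y * form M (V x) y = - form M (tpart M y x) (V x)"
        using t[OF x] by (simp add: tpart_def form_lin tangentD form_sym[of M y "V x"])
      also have "form M (tpart M y x) (V x) = (\<Sum>a\<in>UNIV. eps M a * (form M (ax a) (tpart M y x) * f a x))"
        unfolding f_def by (rule form_expand[symmetric])
      finally show "curv M * lie M x (V x) (\<lambda>x. ker0 M (s * cc M x y)) x = (curv M * s) * (ker M ?s *\<^sub>R form M (V x) y
          - s * (\<Sum>a\<in>UNIV. eps M a * ((dker M ?s * form M (ax a) (tpart M y x)) *\<^sub>R f a x)))"
        by (simp add: sum_distrib_left mult_ac)
    qed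
    also have "\<dots> = curv M * (s * (J s - s * (\<Sum>a\<in>UNIV. eps M a * L a s)))"
      unfolding J_def L_def using iJ iL by simp
    finally show ?thesis by simp
  qed
  have lf: "pot M (ker M) (lie M y (ax a) (f a)) y = form M (ax a) (pot M (ker M) (lie M y (ax a) V) y)" for a
  proof -
    have "pot M (ker M) (lie M y (ax a) (f a)) y = pot M (ker M) (\<lambda>x. form M (ax a) (lie M y (ax a) V x)) y"
      unfolding f_def[abs_def] using V1 by (intro pot_cong lie_compose_linear form.bounded_linear_right) auto
    also have "\<dots> = form M (ax a) (pot M (ker M) (lie M y (ax a) V) y)"
      using V1 by (intro pot_bounded_linear form.bounded_linear_right ker.kernel_k0 bsupp_lie b y) auto
    finally show ?thesis .
  qed
  have "(\<lambda>n. \<integral>x. ker0 M (sreg M n * cc M x y) *\<^sub>R divergence M V x \<partial>vol M) \<longlonglongrightarrow> pot M (ker0 M) (divergence M V) y"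
    by (rule ker0.limit_k0[OF y Cn_continuous[OF Cn_divergence[OF V3]] bsupp_divergence[OF V1 b]])
  moreover have "(\<lambda>n. J (sreg M n)) \<longlonglongrightarrow> pot M (ker M) (\<lambda>x. form M (V x) y) y"
    unfolding J_def by (rule ker.limit_k0[OF y g])
  then have "(\<lambda>n. - (curv M * (sreg M n * (J (sreg M n) - sreg M n * (\<Sum>a\<in>UNIV. eps M a * L a (sreg M n)))))) \<longlonglongrightarrow>
     - (curv M * (1 * (pot M (ker M) (\<lambda>x. form M (V x) y) y - 1 * (\<Sum>a\<in>UNIV. eps M a * pot M (ker M) (lie M y (ax a) (f a)) y))))"
    unfolding L_def
    by (intro tendsto_minus tendsto_mult tendsto_diff tendsto_sum tendsto_const sreg_limit ker.limit_k1[OF y f])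
  ultimately have "pot M (ker0 M) (divergence M V) y =
     - (curv M * (1 * (pot M (ker M) (\<lambda>x. form M (V x) y) y - 1 * (\<Sum>a\<in>UNIV. eps M a * pot M (ker M) (lie M y (ax a) (f a)) y))))"
    unfolding eq[OF sreg(1)] by (rule LIMSEQ_unique)
  also have "pot M (ker M) (\<lambda>x. form M (V x) y) y = form M (pot M (ker M) V y) y"
    by (rule pot_bounded_linear[OF form.bounded_linear_left ker.kernel_k0 cV b y])
  finally show ?thesis unfolding lf by simp
qed

text \<open>
  Both sides are computed from \<open>dpot\<close> and \<open>ddpot\<close> in a frame at \<open>y\<close>; differentiating the formula of
  \<open>pot_divergence\<close> gives the terms of \<open>BS_parallel_curl\<close> other than \<open>V y\<close>.
\<close>

theorem displacement_current:
  assumes V: "Cn M 3 V" and b: "bsupp M V" and y: "y \<in> points M" and t: "\<And>x. x \<in> points M \<Longrightarrow> V x \<in> tangent M x"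
  shows "curl M (BS_parallel M V) y = V y + dE_dt M V y"
proof -
  note C = V b y t
  have V2: "Cn M 2 V" and V1: "Cn M 1 V" using Cn_le[OF V, of 2] Cn_le[OF V, of 1] by simp_all
  let ?e = "frame M y"
  let ?U = "dpot M V y" and ?Q = "ddpot M V y" and ?W = "pot M (ker M) V"
  define S where "S = (\<Sum>j\<in>UNIV. (curv M * form M (?e j) (?W y) + 2 * form M y (?U (?e j))
     - (\<Sum>i\<in>UNIV. form M (?e i) (?Q (?e i) (?e j)))) *\<^sub>R ?e j)"
  define P' where "P' v w = pot M (ker M) (lie M v w V) y + curv M *\<^sub>R ?Q v w" for v w
  define D where "D v = curv M * ((form M (?W y) v + form M (curv M *\<^sub>R pot M (ker M) (lie M y v V) y) y)
     - (\<Sum>a\<in>UNIV. eps M a * form M (ax a) (P' v (ax a))))" for v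
  let ?f = "\<lambda>z. curv M * (form M (?W z) z - (\<Sum>a\<in>UNIV. eps M a * form M (ax a) (pot M (ker M) (lie M z (ax a) V) z)))"
  have Q: "?Q u w = pot M (ker M) (lie M y u (lie M y w V)) y" for u w by (rule ddpot_def[OF C])
  have U: "?U w = pot M (ker M) (lie M y w V) y" for w by (rule dpot_def[OF C])
  have dP: "((\<lambda>z. pot M (ker M) (lie M z w V) z) has_derivative (\<lambda>v. P' v w)) (at y within points M)" for w
    unfolding P'_def Q by (rule pot_lie_derivative[OF ker.kernel_k0 V b y])
  have fd: "(?f has_derivative D) (at y within points M)"
    unfolding D_def
    by (intro has_derivative_mult_right has_derivative_diff has_derivative_sum form.FDERIV bounded_linear.has_derivative[OF form.bounded_linear_right]
        pot_derivative[OF ker.kernel_k0 V2 b y] has_derivative_ident dP)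
  have f: "(\<integral>x. - divergence M V x * phi0 M (rdist M x z) \<partial>vol M) = ?f z" if z: "z \<in> points M" for z
    unfolding E_field_potential[OF z] using pot_divergence[OF V b t z] by (simp add: pot_def)
  have fd': "((\<lambda>z. \<integral>x. - divergence M V x * phi0 M (rdist M x z) \<partial>vol M) has_derivative D) (at y within points M)"
    by (subst has_derivative_within_cong[OF f]) (use fd y in auto)
  have De: "D (?e j) = form M S (?e j)" for j
  proof -
    define \<beta> where "\<beta> p q = form M p (P' (?e j) q)" for p q
    have lP: "linear (P' (?e j))"
      using linear_pot_lie(2)[OF ker.kernel_k0 y b V1, of "?e j"] linear_ddpot[OF C, of "?e j"]
      unfolding P'_def linear_iff by (simp add: algebra_simps)
    have l: "linear (\<beta> p)" for p using lP unfolding \<beta>_def linear_iff by (simp add: form_lin)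
    have r: "linear (\<lambda>p. \<beta> p q)" for q by (rule linearI) (simp_all add: \<beta>_def form_lin)
    have Pe: "P' (?e j) (?e i) = curv M *\<^sub>R ?Q (?e j) (?e i)" for i
      unfolding P'_def by (simp add: ker.pot_lie_stabiliser[OF y V2 b] frameD[OF y])
    have "lie M (?e j) y V x = (-1) *\<^sub>R lie M y (?e j) V x" if "x \<in> points M" for x
      using lie_skew[of V x M "?e j" y] V1 that by simp
    then have "pot M (ker M) (lie M (?e j) y V) y = pot M (ker M) (\<lambda>x. (-1) *\<^sub>R lie M y (?e j) V x) y" by (rule pot_cong)
    also have "\<dots> = (-1) *\<^sub>R ?U (?e j)"
      unfolding U using V1 by (intro pot_bounded_linear bounded_linear_scaleR_right ker.kernel_k0 bsupp_lie b y) auto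
    finally have Py: "P' (?e j) y = - ?U (?e j)" unfolding P'_def by (simp add: ddpot_point[OF C])
    have "(\<Sum>a\<in>UNIV. eps M a * \<beta> (ax a) (ax a)) = curv M * \<beta> y y + (\<Sum>i\<in>UNIV. \<beta> (?e i) (?e i))"
      using trace_frame[OF y frame_exists[OF y] l r] by simp
    also have "\<dots> = - (curv M * form M y (?U (?e j))) + curv M * (\<Sum>i\<in>UNIV. form M (?e i) (?Q (?e i) (?e j)))"
      unfolding \<beta>_def Py Pe using ddpot_sym[OF C] by (simp add: form_lin sum_distrib_left)
    finally have tr: "(\<Sum>a\<in>UNIV. eps M a * \<beta> (ax a) (ax a)) =
       - (curv M * form M y (?U (?e j))) + curv M * (\<Sum>i\<in>UNIV. form M (?e i) (?Q (?e i) (?e j)))" .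
    have "D (?e j) = curv M * form M (?e j) (?W y) + 2 * form M y (?U (?e j)) - (\<Sum>i\<in>UNIV. form M (?e i) (?Q (?e i) (?e j)))"
      unfolding D_def \<beta>_def[symmetric] tr U[symmetric] by (simp add: form_lin form_sym[of M _ y] form_sym[of M "?W y"] algebra_simps)
    also have "\<dots> = form M S (?e j)"
      unfolding S_def form.sum_left by (simp add: form_lin frameD[OF y] if_distrib[of "\<lambda>x. _ * x"] cong: if_cong)
    finally show ?thesis .
  qed
  have "gradient M (\<lambda>z. \<integral>x. - divergence M V x * phi0 M (rdist M x z) \<partial>vol M) y = S"
  proof (rule gradient_eq[OF fd' y])
    show "S \<in> tangent M y" unfolding S_def tangent_def by (simp add: form.sum_right form_lin frameD[OF y])
    fix v assume v: "v \<in> tangent M y"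
    have lD: "linear D" using fd by (rule has_derivative_linear)
    have v: "v = (\<Sum>i\<in>UNIV. form M (?e i) v *\<^sub>R ?e i)"
      using frame_expand[OF y frame_exists[OF y], of v] v by (simp add: tangentD)
    show "form M S v = D v"
      by (subst (1 2) v) (simp add: linear_sum[OF lD] linear_cmul[OF lD] form.sum_right form_lin De)
  qed
  then have "dE_dt M V y = S" by (simp add: dE_dt_def E_field_def)
  moreover have "curl M (BS_parallel M V) y = V y + S" unfolding S_def by (rule BS_parallel_curl[OF C])
  ultimately show ?thesis by simp
qed

section \<open>The magnetic field by left translation\<close>

lemma linear_qmult: "linear (qmult p)"
  by (rule linearI) (simp_all add: qmult_def tri_ext algebra_simps)

lemma qmult_qinverse:
  assumes "x \<in> points S3"
  shows "qmult (qmult y (qinverse x)) v = tri S3 y v x + form S3 x y *\<^sub>R v - form S3 v y *\<^sub>R x + form S3 v x *\<^sub>R y"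
  using assms by (simp add: points_S3_norm qinverse_def qmult_def tri_ext tri_components form_def algebra_simps)

text \<open>
  Left translation in terms of the triple product, from which the comparison with parallel transport becomes linear algebra.
\<close>

lemma ltranslate_eq:
  assumes "x \<in> points S3" "v \<in> tangent S3 x"
  shows "ltranslate y x v = tri S3 y v x + form S3 x y *\<^sub>R v - form S3 v y *\<^sub>R x"
proof -
  let ?L = "qmult (qmult y (qinverse x))"
  have "(?L has_derivative ?L) (at x)"
    using linear_qmult by (intro bounded_linear_imp_has_derivative) (simp add: linear_conv_bounded_linear)
  then have "ltranslate y x = ?L" unfolding ltranslate_def by (rule frechet_derivative_at[symmetric])
  then show ?thesis using qmult_qinverse[OF assms(1), of y v] tangentD(2)[OF assms(2)] by simp
qed

lemma form_ltranslate:
  assumes "x \<in> points S3" "z \<in> points S3" "v \<in> tangent S3 x"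
  shows "form S3 (ltranslate z x v) (tpart S3 z x) = - form S3 v z"
  unfolding ltranslate_eq[OF assms(1,3)] tpart_def
  using assms by (simp add: form_lin tangentD form_point algebra_simps)

lemma tri_ltranslate:
  assumes "x \<in> points S3" "y \<in> points S3" "v \<in> tangent S3 x"
  defines "c \<equiv> form S3 x y" and "w \<equiv> form S3 v y"
  shows "tri S3 y (ltranslate y x v) (tpart S3 y x) = c *\<^sub>R tri S3 y v x + (c\<^sup>2 - 1) *\<^sub>R v - (c * w) *\<^sub>R x + w *\<^sub>R y"
proof -
  have "tri S3 y (tri S3 y v x) x = - tri S3 y x (tri S3 y v x)" by (rule tri_skew)
  also have "\<dots> = (c\<^sup>2 - 1) *\<^sub>R v - (c * w) *\<^sub>R x + w *\<^sub>R y"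
  proof -
    have f: "form S3 y y = 1" "form S3 x x = 1" "form S3 x v = 0" "form S3 x y = c" "form S3 y x = c" "form S3 y v = w"
      using assms(1-3) by (simp_all add: form_point tangentD c_def w_def form_sym[of S3 y x] form_sym[of S3 y v])
    show ?thesis unfolding tri_tri f by (simp add: tri_ext power2_eq_square algebra_simps)
  qed
  finally have "tri S3 y (tri S3 y v x) x = (c\<^sup>2 - 1) *\<^sub>R v - (c * w) *\<^sub>R x + w *\<^sub>R y" .
  then show ?thesis
    unfolding ltranslate_eq[OF assms(1,3)] tpart_def c_def[symmetric] w_def[symmetric]
    by (simp add: tri_lin linear_diff[OF linear_tri(2)])
qed

lemma phi1_derivative:
  assumes "qq S3 t > 0" shows "((\<lambda>t. phi1 (angle S3 t)) has_real_derivative - (ker S3 t / 2)) (at t)"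
proof -
  have "((\<lambda>t. - (1 / (16 * pi\<^sup>2)) * (angle S3 t * (2 * pi - angle S3 t))) has_real_derivative
     - (1 / (16 * pi\<^sup>2)) * (- (curv S3 / sqrt (qq S3 t)) * (2 * pi - angle S3 t) + (0 - - (curv S3 / sqrt (qq S3 t))) * angle S3 t)) (at t)"
    by (intro DERIV_cmult DERIV_mult DERIV_diff DERIV_const angle_derivative assms) simp_all
  moreover have "- (1 / (16 * pi\<^sup>2)) * (- (curv S3 / sqrt (qq S3 t)) * (2 * pi - angle S3 t) + (0 - - (curv S3 / sqrt (qq S3 t))) * angle S3 t)
     = - (ker S3 t / 2)"
    using assms by (simp add: ker_def angle_def qq_def field_simps)
  ultimately show ?thesis unfolding phi1_def by (simp only:)
qed

context
  fixes V :: "real^4 \<Rightarrow> real^4" and y :: "real^4"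
  assumes V: "Cn S3 2 V" and t: "\<And>x. x \<in> points S3 \<Longrightarrow> V x \<in> tangent S3 x" and y: "y \<in> points S3"
begin

lemma left_potential:
  assumes z: "z \<in> points S3"
  shows "(\<integral>x. form S3 (ltranslate z x (V x)) (gradient S3 (\<lambda>w. phi1 (rdist S3 x w)) z) \<partial>vol S3) = form S3 (pot S3 (ker S3) V z) z / 2"
proof -
  have "(\<integral>x. form S3 (ltranslate z x (V x)) (gradient S3 (\<lambda>w. phi1 (rdist S3 x w)) z) \<partial>vol S3) =
     (\<integral>x. (1/2) *\<^sub>R (ker S3 (cc S3 x z) *\<^sub>R form S3 (V x) z) \<partial>vol S3)"
  proof (rule vol_integral_cong[where y = z])
    fix x assume x: "x \<in> points S3" "x \<noteq> z" "x \<noteq> - z"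
    have g: "gradient S3 (\<lambda>w. phi1 (rdist S3 x w)) z = (curv S3 * - (ker S3 (cc S3 x z) / 2)) *\<^sub>R tpart S3 z x"
      by (rule gradient_ker[OF x(1) z phi1_derivative[OF qq_pos[OF x(1) z x(2,3)]]]) (simp only: rdist_eq[OF x(1)])
    show "form S3 (ltranslate z x (V x)) (gradient S3 (\<lambda>w. phi1 (rdist S3 x w)) z) = (1/2) *\<^sub>R (ker S3 (cc S3 x z) *\<^sub>R form S3 (V x) z)"
      unfolding g form.scaleR_right form_ltranslate[OF x(1) z t[OF x(1)]] by simp
  qed
  also have "\<dots> = (1/2) *\<^sub>R pot S3 (ker S3) (\<lambda>x. form S3 (V x) z) z" unfolding pot_def by (rule integral_scaleR_right)
  also have "pot S3 (ker S3) (\<lambda>x. form S3 (V x) z) z = form S3 (pot S3 (ker S3) V z) z"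
    by (rule pot_bounded_linear[OF form.bounded_linear_left ker.kernel_k0 Cn_continuous[OF V] bsupp_S3 z])
  finally show ?thesis by simp
qed

text \<open>
  By \<open>left_potential\<close> the function under the gradient is a derivative-free potential; its derivative is put
  back on the kernel by \<open>ker.pot_lie\<close> in order to compare integrands.
\<close>

lemma left_gradient:
  "2 *\<^sub>R gradient S3 (\<lambda>z. \<integral>x. form S3 (ltranslate z x (V x)) (gradient S3 (\<lambda>w. phi1 (rdist S3 x w)) z) \<partial>vol S3) y =
     (\<integral>x. ker S3 (cc S3 x y) *\<^sub>R tpart S3 y (V x) \<partial>vol S3) + (\<integral>x. (dker S3 (cc S3 x y) * form S3 (V x) y) *\<^sub>R tpart S3 y x \<partial>vol S3)"
  "integrable (vol S3) (\<lambda>x. ker S3 (cc S3 x y) *\<^sub>R tpart S3 y (V x))"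
  "integrable (vol S3) (\<lambda>x. (dker S3 (cc S3 x y) * form S3 (V x) y) *\<^sub>R tpart S3 y x)"
proof -
  let ?f = "\<lambda>z. \<integral>x. form S3 (ltranslate z x (V x)) (gradient S3 (\<lambda>w. phi1 (rdist S3 x w)) z) \<partial>vol S3"
  let ?W = "pot S3 (ker S3) V" and ?R = "\<lambda>x. (dker S3 (cc S3 x y) * form S3 (V x) y) *\<^sub>R tpart S3 y x"
  have L: "bounded_linear (tpart S3 y)"
    unfolding tpart_def[abs_def] by (intro bounded_linear_sub bounded_linear_ident bounded_linear_scaleR_const bounded_linear_const_mult form.bounded_linear_left)
  note iW = pot_integrable[OF ker.kernel_k0 Cn_continuous[OF V] bsupp_S3 y]
  have kW: "ker S3 (cc S3 x y) *\<^sub>R tpart S3 y (V x) = tpart S3 y (ker S3 (cc S3 x y) *\<^sub>R V x)" for x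
    by (simp add: linear_cmul[OF bounded_linear.linear[OF L]])
  show 1: "integrable (vol S3) (\<lambda>x. ker S3 (cc S3 x y) *\<^sub>R tpart S3 y (V x))"
    unfolding kW by (rule integrable_bounded_linear[OF L iW])
  have tW: "(\<integral>x. ker S3 (cc S3 x y) *\<^sub>R tpart S3 y (V x) \<partial>vol S3) = tpart S3 y (?W y)"
    unfolding kW pot_def by (rule integral_bounded_linear[OF L iW])
  have iw: "integrable (vol S3) (\<lambda>x. form S3 ((dker S3 (cc S3 x y) * form S3 w (tpart S3 y x)) *\<^sub>R V x) y)" for w
    by (rule integrable_bounded_linear[OF form.bounded_linear_left ker.pot_lie(2)[OF y V bsupp_S3]])
  have Rw: "?R x = (\<Sum>a\<in>UNIV. (eps S3 a * form S3 ((dker S3 (cc S3 x y) * form S3 (ax a) (tpart S3 y x)) *\<^sub>R V x) y) *\<^sub>R ax a)" for x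
  proof -
    have "?R x = (dker S3 (cc S3 x y) * form S3 (V x) y) *\<^sub>R (\<Sum>a\<in>UNIV. (eps S3 a * form S3 (ax a) (tpart S3 y x)) *\<^sub>R ax a)"
      by (simp only: sum_ax_form)
    then show ?thesis by (simp only: scaleR_sum_right form.scaleR_left scaleR_scaleR real_scaleR_def mult.assoc mult.commute mult.left_commute)
  qed
  show 2: "integrable (vol S3) ?R"
    unfolding Rw by (intro Bochner_Integration.integrable_sum integrable_scaleR_left integrable_mult_right iw)
  have R: "form S3 (integral\<^sup>L (vol S3) ?R) w = form S3 (pot S3 (ker S3) (lie S3 y w V) y) y" for w
  proof -
    have "form S3 (integral\<^sup>L (vol S3) ?R) w = (\<integral>x. form S3 (?R x) w \<partial>vol S3)"
      by (rule integral_bounded_linear[OF form.bounded_linear_left 2, symmetric])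
    also have "\<dots> = (\<integral>x. form S3 ((dker S3 (cc S3 x y) * form S3 w (tpart S3 y x)) *\<^sub>R V x) y \<partial>vol S3)"
      by (rule Bochner_Integration.integral_cong) (simp_all add: form_lin form_sym[of S3 w] mult_ac)
    also have "\<dots> = form S3 (pot S3 (ker S3) (lie S3 y w V) y) y"
      unfolding ker.pot_lie(1)[OF y V bsupp_S3] by (rule integral_bounded_linear[OF form.bounded_linear_left ker.pot_lie(2)[OF y V bsupp_S3]])
    finally show ?thesis .
  qed
  let ?D = "\<lambda>v. (form S3 (?W y) v + form S3 (curv S3 *\<^sub>R pot S3 (ker S3) (lie S3 y v V) y) y) / 2"
  have "((\<lambda>z. (1/2) * form S3 (?W z) z) has_derivative
      (\<lambda>v. (1/2) * (form S3 (?W y) v + form S3 (curv S3 *\<^sub>R pot S3 (ker S3) (lie S3 y v V) y) y))) (at y within points S3)"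
    by (intro has_derivative_mult_right form.FDERIV pot_derivative[OF ker.kernel_k0 V bsupp_S3 y] has_derivative_ident)
  then have d: "(?f has_derivative ?D) (at y within points S3)"
    by (subst has_derivative_within_cong[OF left_potential]) (use y in auto)
  have "gradient S3 ?f y = (1/2) *\<^sub>R (tpart S3 y (?W y) + integral\<^sup>L (vol S3) ?R)"
  proof (rule gradient_eq[OF d y])
    have "form S3 (integral\<^sup>L (vol S3) ?R) y = (\<integral>x. form S3 (?R x) y \<partial>vol S3)"
      by (rule integral_bounded_linear[OF form.bounded_linear_left 2, symmetric])
    also have "\<dots> = 0" using tpart_tangent[OF y] by (simp add: form_lin tangentD)
    finally have "integral\<^sup>L (vol S3) ?R \<in> tangent S3 y" by (simp add: tangent_def form_sym)
    then show "(1/2) *\<^sub>R (tpart S3 y (?W y) + integral\<^sup>L (vol S3) ?R) \<in> tangent S3 y"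
      by (intro tangent_lin tpart_tangent[OF y])
    fix v assume v: "v \<in> tangent S3 y"
    have "form S3 (tpart S3 y (?W y)) v = form S3 (?W y) v" using v by (simp add: tpart_def form_lin tangentD)
    then show "form S3 ((1/2) *\<^sub>R (tpart S3 y (?W y) + integral\<^sup>L (vol S3) ?R)) v = ?D v"
      unfolding form.scaleR_left form.add_left R by simp
  qed
  then show "2 *\<^sub>R gradient S3 ?f y = (\<integral>x. ker S3 (cc S3 x y) *\<^sub>R tpart S3 y (V x) \<partial>vol S3) + integral\<^sup>L (vol S3) ?R"
    unfolding tW by simp
qed

text \<open>
  The integrands differ by terms along \<open>V x\<close>, \<open>x\<close> and \<open>y\<close>, whose coefficients vanish because of
  \<open>(1 - c\<^sup>2) * dker c = c * ker c - bcon\<close>.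
\<close>

theorem BS_left_eq_parallel: "BS_left V y = BS_parallel S3 V y"
proof -
  let ?L = "\<lambda>x. tri S3 y (V x) x + form S3 x y *\<^sub>R V x - form S3 (V x) y *\<^sub>R x"
  let ?T = "\<lambda>x. (curv S3 * dker S3 (cc S3 x y)) *\<^sub>R tri S3 y (V x) x"
  let ?A = "\<lambda>x. ker S3 (cc S3 x y) *\<^sub>R tpart S3 y (V x)"
  let ?R = "\<lambda>x. (dker S3 (cc S3 x y) * form S3 (V x) y) *\<^sub>R tpart S3 y x"
  have cV: "continuous_on (points S3) V" using V by (rule Cn_continuous)
  have L: "ltranslate y x (V x) = ?L x" if "x \<in> points S3" for x by (rule ltranslate_eq[OF that t[OF that]])
  have "continuous_on (points S3) ?L"
  proof (intro continuous_intros cV form.continuous_on)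
    have B: "bounded_bilinear (\<lambda>p q. tri S3 y p q)"
      unfolding bilinear_conv_bounded_bilinear[symmetric] bilinear_def using linear_tri by blast
    show "continuous_on (points S3) (\<lambda>x. tri S3 y (V x) x)"
      by (rule bounded_bilinear.continuous_on[OF B cV continuous_on_id])
  qed
  then have iL: "integrable (vol S3) ?L" using bsupp_S3 by (rule bsupp_integrable)
  note iT = tri_integral_sum(2)[OF y V bsupp_S3] and iA = left_gradient(2) and iR = left_gradient(3)
  have "(\<integral>x. cross S3 y (ltranslate y x (V x)) (gradient S3 (\<lambda>z. phi0 S3 (rdist S3 x z)) y) \<partial>vol S3) =
      (\<integral>x. ?T x + bcon S3 *\<^sub>R ?L x - ?A x - ?R x \<partial>vol S3)"
  proof (rule vol_integral_cong[where y = y])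
    fix x assume x: "x \<in> points S3" "x \<noteq> y" "x \<noteq> - y"
    define c w where "c = form S3 x y" and "w = form S3 (V x) y"
    define k d b where "k = ker S3 c" and "d = dker S3 c" and "b = bcon S3"
    have q: "qq S3 c > 0" using qq_pos[OF x(1) y x(2,3)] by (simp add: c_def)
    have kd: "b = c * k - (1 - c\<^sup>2) * d" using qq_nz[OF q] by (simp add: b_def d_def dker_def k_def)
    have g: "gradient S3 (\<lambda>z. phi0 S3 (rdist S3 x z)) y = (curv S3 * dker0 S3 (cc S3 x y)) *\<^sub>R tpart S3 y x"
      by (rule gradient_ker[OF x(1) y ker0.k0[OF qq_pos[OF x(1) y x(2,3)]] phi_ker(2)[OF x(1)]])
    have "cross S3 y (ltranslate y x (V x)) (gradient S3 (\<lambda>z. phi0 S3 (rdist S3 x z)) y) =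
        (k + c * d) *\<^sub>R (c *\<^sub>R tri S3 y (V x) x + (c\<^sup>2 - 1) *\<^sub>R V x - (c * w) *\<^sub>R x + w *\<^sub>R y)"
      unfolding g cross_eq_tri[OF y] tri_lin tri_ltranslate[OF x(1) y t[OF x(1)]] by (simp add: dker0_def k_def d_def c_def w_def)
    also have "\<dots> = d *\<^sub>R tri S3 y (V x) x + b *\<^sub>R (tri S3 y (V x) x + c *\<^sub>R V x - w *\<^sub>R x)
        - k *\<^sub>R (V x - w *\<^sub>R y) - (d * w) *\<^sub>R (x - c *\<^sub>R y)"
      unfolding kd tri_ext by (simp add: algebra_simps power2_eq_square)
    finally show "cross S3 y (ltranslate y x (V x)) (gradient S3 (\<lambda>z. phi0 S3 (rdist S3 x z)) y) = ?T x + bcon S3 *\<^sub>R ?L x - ?A x - ?R x"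
      by (simp add: tpart_def k_def d_def c_def w_def b_def)
  qed
  also have "\<dots> = integral\<^sup>L (vol S3) ?T + bcon S3 *\<^sub>R integral\<^sup>L (vol S3) ?L - integral\<^sup>L (vol S3) ?A - integral\<^sup>L (vol S3) ?R"
    by (simp only: Bochner_Integration.integral_diff Bochner_Integration.integral_add integral_scaleR_right Bochner_Integration.integrable_diff
        Bochner_Integration.integrable_add integrable_scaleR_right iT iL iA iR)
  finally have 1: "(\<integral>x. cross S3 y (ltranslate y x (V x)) (gradient S3 (\<lambda>z. phi0 S3 (rdist S3 x z)) y) \<partial>vol S3) =
     integral\<^sup>L (vol S3) ?T + bcon S3 *\<^sub>R integral\<^sup>L (vol S3) ?L - integral\<^sup>L (vol S3) ?A - integral\<^sup>L (vol S3) ?R" .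
  have 2: "(\<integral>x. ltranslate y x (V x) \<partial>vol S3) = integral\<^sup>L (vol S3) ?L"
    by (rule Bochner_Integration.integral_cong) (auto simp: L)
  have 3: "BS_parallel S3 V y = integral\<^sup>L (vol S3) ?T" by (rule BS_parallel_integral[OF y t])
  have b: "1 / (4 * pi\<^sup>2) = bcon S3" by (simp add: bcon_def)
  show ?thesis unfolding BS_left_def 1 2 3 left_gradient(1) b by simp
qed

end

section \<open>Maxwell's equations\<close>

lemma divergence_curl_cong:
  assumes "\<And>x. x \<in> points M \<Longrightarrow> X x = Y x" "y \<in> points M"
  shows "divergence M X y = divergence M Y y" "curl M X y = curl M Y y"
    "X differentiable (at y within points M) \<longleftrightarrow> Y differentiable (at y within points M)"
proof -
  have d: "(X has_derivative D) (at y within points M) \<longleftrightarrow> (Y has_derivative D) (at y within points M)" for D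
    by (rule has_derivative_within_cong[OF assms])
  then have "frechet_derivative X (at y within points M) = frechet_derivative Y (at y within points M)"
    by (simp add: frechet_derivative_def)
  then show "divergence M X y = divergence M Y y" "curl M X y = curl M Y y"
    by (simp_all add: divergence_def curl_def cov_deriv_def)
  show "X differentiable (at y within points M) \<longleftrightarrow> Y differentiable (at y within points M)"
    by (simp add: differentiable_def d)
qed

lemma compact_support_bsupp:
  assumes "M = H3 \<Longrightarrow> compact_support M F" shows "bsupp M F"
proof (cases M)
  case S3 then show ?thesis by (simp add: bsupp_S3)
next
  case H3
  then have "bounded (closure {x \<in> points M. F x \<noteq> 0})" using assms by (simp add: compact_support_def compact_imp_bounded)
  then have "bounded {x \<in> points M. F x \<noteq> 0}" by (rule bounded_subset) (rule closure_subset)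
  then show ?thesis unfolding bsupp_def bounded_iff by blast
qed

text \<open>
  Division by zero yields zero, so the case of volume zero has to be considered; then every bounded function
  has integral zero.
\<close>

lemma average_zero:
  assumes c: "continuous_on (points S3) \<rho>" and a: "(\<integral>x. \<rho> x \<partial>vol S3) / measure (vol S3) (points S3) = 0"
  shows "(\<integral>x. \<rho> x \<partial>vol S3) = (0::real)"
proof (cases "measure (vol S3) (points S3) = 0")
  case True
  obtain B where B: "B > 0" "\<And>x. x \<in> points S3 \<Longrightarrow> norm (\<rho> x) \<le> B" using bsupp_bounded[OF c bsupp_S3] by blast
  have i: "integrable (vol S3) (\<lambda>x. B)" by (intro bsupp_integrable continuous_on_const bsupp_S3)
  have "norm (\<integral>x. \<rho> x \<partial>vol S3) \<le> (\<integral>x. norm (\<rho> x) \<partial>vol S3)" by (rule integral_norm_bound)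
  also have "\<dots> \<le> (\<integral>x. B \<partial>vol S3)"
    using B(2) by (intro integral_mono integrable_norm bsupp_integrable c bsupp_S3 i) auto
  also have "\<dots> = 0" using True by simp
  finally show ?thesis by simp
qed (use a in simp)

theorem theorem4:
  fixes M :: space_form
    and \<rho> :: "real^4 \<Rightarrow> real"
    and V E B :: "real^4 \<Rightarrow> real^4"
  assumes "smooth M \<rho>"
    and "M = S3 \<Longrightarrow> (\<integral>x. \<rho> x \<partial>vol M) / measure (vol M) (points M) = 0"
    and "M = H3 \<Longrightarrow> compact_support M \<rho>"
    and "smooth_vector_field M V"
    and "M = H3 \<Longrightarrow> compact_support M V"
    and "E = E_field M \<rho>"
    and "is_BS M V B"
  shows "\<forall>y\<in>points M.
    E differentiable (at y within points M) \<and>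
    B differentiable (at y within points M) \<and>
    divergence M E y = \<rho> y \<and>
    curl M E y = 0 \<and>
    divergence M B y = 0 \<and>
    curl M B y = V y + dE_dt M V y"
proof
  fix y assume y: "y \<in> points M"
  have r: "Cn M 3 \<rho>" and br: "bsupp M \<rho>" using smooth_Cn[OF assms(1)] compact_support_bsupp[OF assms(3)] by auto
  have V: "Cn M n V" and bV: "bsupp M V" and t: "\<And>x. x \<in> points M \<Longrightarrow> V x \<in> tangent M x" for n
    using assms(4) compact_support_bsupp[OF assms(5)] by (auto simp: smooth_vector_field_def intro: smooth_Cn)
  have av: "(\<integral>x. \<rho> x \<partial>vol M) = 0" if "M = S3"
    using average_zero[of \<rho>] Cn_continuous[OF r] assms(2)[OF that] unfolding that by blast
  have B: "B z = BS_parallel M V z" if z: "z \<in> points M" for z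
  proof (cases M)
    case S3
    then show ?thesis using assms(7) BS_left_eq_parallel[of V z] V[of 2] t z by auto
  next
    case H3
    then show ?thesis using assms(7) by simp
  qed
  have c: "divergence M B y = divergence M (BS_parallel M V) y" "curl M B y = curl M (BS_parallel M V) y"
    "B differentiable (at y within points M) \<longleftrightarrow> BS_parallel M V differentiable (at y within points M)"
    by (rule divergence_curl_cong[OF B y]; assumption)+
  have "BS_parallel M V differentiable (at y within points M)"
    using BS_parallel_derivative[OF V bV y t] by (metis differentiable_def)
  moreover have "E differentiable (at y within points M)" "divergence M E y = \<rho> y" "curl M E y = 0"
    unfolding assms(6) by (rule electric_field[OF r br y av]; assumption)+
  moreover have "divergence M (BS_parallel M V) y = 0" by (rule BS_parallel_divergence[OF V bV y t])
  moreover have "curl M (BS_parallel M V) y = V y + dE_dt M V y" by (rule displacement_current[OF V bV y t])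
  ultimately show "E differentiable (at y within points M) \<and> B differentiable (at y within points M) \<and>
    divergence M E y = \<rho> y \<and> curl M E y = 0 \<and> divergence M B y = 0 \<and> curl M B y = V y + dE_dt M V y"
    unfolding c by blast
qed

end
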